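(* Let $n\ge 2$, let $M,M'\subset\mathbb{C}^n$ be small connected pieces of real analytic hypersurfaces, let $h\colon M\to M'$ be a $\mathcal{C}^\infty$-smooth CR diffeomorphism, let $p\in M$ and $p'=h(p)$. Assume that $M$ is minimal at $p$. Then the reflection function $\mathcal{R}'_h$ extends holomorphically to a neighborhood of $p\times\overline{p'}$. Equivalently: there exist a neighborhood $U$ of $p$ in $\mathbb{C}^n$ and a constant $C>0$ such that for every $\beta\in\mathbb{N}^{n-1}$ the function $t\mapsto\Theta'_\beta(h(t))$, $t\in M\cap U$, extends to a holomorphic function $\varphi'_\beta$ on $U$ with $|\varphi'_\beta(t)|\le C^{|\beta|+1}$ for all $t\in U$.
   Context: Choose holomorphic coordinates $t'=(w',z')\in\mathbb{C}^{n-1}\times\mathbb{C}$ vanishing at $p'$ in which $M'$ is given near $p'$ by $\bar z'=\Theta'(\bar w',t')=\sum_{\beta\in\mathbb{N}^{n-1}}(\bar w')^\beta\,\Theta'_\beta(t')$, where the power series $\Theta'$ vanishes at $0$ and converges normally in a small polydisc $\Delta_{2n-1}(0,4r')$, $r'>0$. The reflection function associated with $h$ and this defining function is $\mathcal{R}'_h(t,\bar\nu')=\bar\mu'-\sum_{\beta\in\mathbb{N}^{n-1}}(\bar\lambda')^\beta\,\Theta'_\beta(h(t))$, for $t\in M$ near $p$ and $\bar\nu'=(\bar\lambda',\bar\mu')\in\mathbb{C}^{n-1}\times\mathbb{C}$ near $\overline{p'}=0$; it is CR in $t$ and holomorphic in $\bar\nu'$. The hypersurface $M$ is minimal at $p$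 (in the sense of Tumanov) if there is no germ at $p$ of a complex hypersurface contained in $M$. *)

theory Defs
  imports "HOL-Analysis.Analysis"
begin

text \<open>Ambient space C^n is modelled as (complex^'m) \<times> complex, with n = CARD('m) + 1;
  the first factor holds the w-coordinates (C^(n-1)), the second the z-coordinate.
  Since every type is nonempty, CARD('m) \<ge> 1, i.e. n \<ge> 2 automatically.\<close>

type_synonym 'm cn = "(complex^'m) \<times> complex"

definition cmul :: "complex \<Rightarrow> 'm::finite cn \<Rightarrow> 'm cn" where
  "cmul c x = (c *s fst x, c * snd x)"

definition Jc :: "'m::finite cn \<Rightarrow> 'm cn" where
  "Jc v = cmul \<i> v"

definition holo_fun :: "'m::finite cn set \<Rightarrow> ('m cn \<Rightarrow> complex) \<Rightarrow> bool" where
  "holo_fun U f \<longleftrightarrow> open U \<and> (\<forall>x\<in>U. \<exists>L. (f has_derivative L) (at x) \<and>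
       (\<forall>c v. L (cmul c v) = c * L v))"

definition holo_map :: "'m::finite cn set \<Rightarrow> ('m cn \<Rightarrow> 'm cn) \<Rightarrow> bool" where
  "holo_map U F \<longleftrightarrow> (\<forall>i. holo_fun U (\<lambda>x. fst (F x) $ i)) \<and> holo_fun U (\<lambda>x. snd (F x))"

definition biholo :: "'m::finite cn set \<Rightarrow> ('m cn \<Rightarrow> 'm cn) \<Rightarrow> bool" where
  "biholo V F \<longleftrightarrow> open V \<and> holo_map V F \<and> inj_on F V \<and> open (F ` V) \<and>
      holo_map (F ` V) (inv_into V F)"

fun Ck :: "nat \<Rightarrow> 'a::real_normed_vector set \<Rightarrow> ('a \<Rightarrow> 'b::real_normed_vector) \<Rightarrow> bool" where
  "Ck 0 U f = continuous_on U f"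
| "Ck (Suc k) U f = ((\<forall>x\<in>U. f differentiable (at x)) \<and>
       (\<forall>v. Ck k U (\<lambda>x. frechet_derivative f (at x) v)))"

definition smooth_on :: "'a::real_normed_vector set \<Rightarrow> ('a \<Rightarrow> 'b::real_normed_vector) \<Rightarrow> bool" where
  "smooth_on U f \<longleftrightarrow> open U \<and> (\<forall>k. Ck k U f)"

definition smooth_on_set :: "'a::real_normed_vector set \<Rightarrow> ('a \<Rightarrow> 'b::real_normed_vector) \<Rightarrow> bool" where
  "smooth_on_set M h \<longleftrightarrow> (\<forall>q\<in>M. \<exists>W H. open W \<and> q \<in> W \<and> smooth_on W H \<and> (\<forall>x\<in>M \<inter> W. H x = h x))"

definition real_analytic_on :: "'a::euclidean_space set \<Rightarrow> ('a \<Rightarrow> real) \<Rightarrow> bool" where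
  "real_analytic_on U f \<longleftrightarrow> open U \<and> (\<forall>a\<in>U. \<exists>r>0. \<exists>c::('a \<Rightarrow> nat) \<Rightarrow> real.
      \<forall>x\<in>ball a r. ((\<lambda>\<alpha>. c \<alpha> * (\<Prod>b\<in>Basis. ((x - a) \<bullet> b) ^ (\<alpha> b))) has_sum f x)
                     {\<alpha>. \<forall>b. b \<notin> Basis \<longrightarrow> \<alpha> b = 0})"

definition real_analytic_hypersurface :: "'a::euclidean_space set \<Rightarrow> bool" where
  "real_analytic_hypersurface M \<longleftrightarrow> (\<forall>q\<in>M. \<exists>V \<rho>. open V \<and> q \<in> V \<and> real_analytic_on V \<rho> \<and>
      M \<inter> V = {x\<in>V. \<rho> x = 0} \<and>
      (\<forall>x\<in>V. \<exists>D. (\<rho> has_derivative D) (at x) \<and> D \<noteq> (\<lambda>_. 0)))"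

definition tangent_space :: "'a::real_normed_vector set \<Rightarrow> 'a \<Rightarrow> 'a set" where
  "tangent_space M q = {v. \<exists>\<gamma> e. e > 0 \<and> (\<forall>s\<in>{-e<..<e}. \<gamma> s \<in> M) \<and> \<gamma> 0 = q \<and>
       (\<gamma> has_vector_derivative v) (at 0)}"

definition CR_map :: "'m::finite cn set \<Rightarrow> ('m cn \<Rightarrow> 'm cn) \<Rightarrow> bool" where
  "CR_map M h \<longleftrightarrow> smooth_on_set M h \<and>
     (\<forall>q\<in>M. \<forall>W H. open W \<and> q \<in> W \<and> smooth_on W H \<and> (\<forall>x\<in>M \<inter> W. H x = h x) \<longrightarrow>
        (\<forall>v. v \<in> tangent_space M q \<and> Jc v \<in> tangent_space M q \<longrightarrow>
             frechet_derivative H (at q) (Jc v) = Jc (frechet_derivative H (at q) v)))"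

definition CR_diffeo :: "'m::finite cn set \<Rightarrow> 'm cn set \<Rightarrow> ('m cn \<Rightarrow> 'm cn) \<Rightarrow> bool" where
  "CR_diffeo M M' h \<longleftrightarrow> bij_betw h M M' \<and> CR_map M h \<and> smooth_on_set M' (inv_into M h)"

text \<open>Minimality in the sense of Tumanov: no germ at p of a complex hypersurface
  (complex submanifold of codimension one, given by a holomorphic function with
  nonzero differential) contained in M.\<close>
definition minimal_at :: "'m::finite cn set \<Rightarrow> 'm cn \<Rightarrow> bool" where
  "minimal_at M p \<longleftrightarrow> \<not> (\<exists>V g. open V \<and> p \<in> V \<and> holo_fun V g \<and> g p = 0 \<and>
       frechet_derivative g (at p) \<noteq> (\<lambda>_. 0) \<and> {x\<in>V. g x = 0} \<subseteq> M)"

definition polydisc :: "real \<Rightarrow> 'm::finite cn set" where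
  "polydisc r = {x. (\<forall>i. cmod (fst x $ i) < r) \<and> cmod (snd x) < r}"

definition cpolydisc :: "real \<Rightarrow> 'm::finite cn set" where
  "cpolydisc r = {x. (\<forall>i. cmod (fst x $ i) \<le> r) \<and> cmod (snd x) \<le> r}"

definition mlen :: "('m::finite \<Rightarrow> nat) \<Rightarrow> nat" where
  "mlen \<beta> = (\<Sum>i\<in>UNIV. \<beta> i)"

definition mpow :: "complex^'m \<Rightarrow> ('m::finite \<Rightarrow> nat) \<Rightarrow> complex" where
  "mpow w \<beta> = (\<Prod>i\<in>UNIV. (w $ i) ^ (\<beta> i))"

end

theory Submission
  imports Defs "HOL-Complex_Analysis.Complex_Analysis"
begin

text \<open>
  Minimality yields an analytic disc whose boundary lies strictly on one side of \<open>M\<close>. In a chart adapted to it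
  the components of \<open>h\<close> extend holomorphically to one side (a Cauchy transform along the disc direction solves
  the dbar problem), with all derivatives continuous up to \<open>M\<close>. In coordinates \<open>(w, (chi, z))\<close> on the complexified
  hypersurface the reflected map \<open>a\<close> is holomorphic on the opposite side. Differentiating the equation of \<open>M'\<close> in
  \<open>chi\<close> and using Cramer's rule expresses the derivatives of \<open>Theta'\<close> in its first argument at \<open>(a, h)\<close> by those of \<open>a\<close>.
  Nested Cauchy estimates and the maximum principle for \<open>(x^2 - s^2)^k * f\<close> on half discs bound them by
  \<open>C * K^k * k!\<close>, so the Taylor expansion from \<open>a\<close> to \<open>0\<close> continues \<open>Theta'_beta o h\<close> across \<open>M\<close> in slices, and a
  Hartogs argument makes the continuation jointly holomorphic.
\<close>

text \<open>The target \<open>M'\<close> may be so degenerate that no finite number of derivatives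
  of its equation determines \<open>h\<close>, so no extension of \<open>h\<close> itself is sought.
  Only the Taylor coefficients of the defining function at the origin of its first argument are
  wanted, and these are recovered from its full jet at \<open>(a, h)\<close>. Hence derivatives of
  every order enter, and each estimate must be geometric in the order up to a factorial. The
  obstacle is the edge: off \<open>M\<close> the discs available for Cauchy estimates have radius
  comparable to \<open>abs (Im x)\<close>, which costs a power of \<open>abs (Im x)\<close>; on
  \<open>M\<close> itself the convergence of the series gives a bound without loss. The multiplier
  on half discs combines the two bounds. The recursion also differentiates \<open>a\<close>
  repeatedly at points of \<open>M\<close>, which is why the one-sided extension has to be smooth up
  to the boundary to all orders. The Jacobian inverted by Cramer's rule is nonzero because the
  differential of a diffeomorphism is injective on tangent vectors. Minimality enters through the
  Segre variety of \<open>p\<close>: if it lay in \<open>M\<close>, it would be a forbidden complex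
  hypersurface.\<close>

notation scaleR (infixr "*R" 75)

text \<open>One class for \<open>complex\<close>, \<open>complex^'m\<close>, \<open>'m cn\<close>
  and their products, so that a single notion of holomorphy serves the ambient space, its
  complexification and all parameter spaces. Building on \<open>euclidean_space\<close> keeps real
  derivatives, compactness and integration at hand; \<open>norm_cs\<close> makes scalar
  multiplication bounded bilinear.\<close>

class cvec = euclidean_space +
 fixes cs :: "complex => 'a => 'a"
 assumes cs_add_right: "cs c (x+y) = cs c x+cs c y"
  and cs_add_left: "cs (c+d) x = cs c x+cs d x"
  and cs_cs [simp]: "cs c (cs d x) = cs (c * d) x"
  and cs_of_real [simp]: "cs (complex_of_real r) x = r *R x"
  and norm_cs [simp]: "norm (cs c x) = cmod c * norm x"

lemma bounded_bilinear_cs: "bounded_bilinear (cs :: complex => 'a::cvec => 'a)"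
proof
 fix r :: real and a :: complex and b :: 'a
 show "cs (r *R a) b = r *R cs a b"
  by (simp add: scaleR_conv_of_real flip: cs_cs)
 have "cs a (r *R b) = cs (a * of_real r) b"
  by (simp flip: cs_cs)
 also have "... = r *R cs a b"
  by (metis cs_cs cs_of_real mult.commute)
 finally show "cs a (r *R b) = r *R cs a b" .
qed (auto simp: cs_add_left cs_add_right intro!: exI[of _ 1])

interpretation cs: bounded_bilinear "cs :: complex => 'a::cvec => 'a"
 by (rule bounded_bilinear_cs)

lemma cs_one [simp]: "cs 1 x = x"
 using cs_of_real[of 1 x] by simp

instantiation complex :: cvec
begin
definition cs_complex :: "complex => complex => complex" where
 [simp]: "cs_complex c x = c * x"
instance
 by standard (auto simp: algebra_simps norm_mult scaleR_conv_of_real)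
end

instantiation prod :: (cvec, cvec) cvec
begin
definition cs_prod :: "complex => 'a \<times> 'b => 'a \<times> 'b" where
 "cs_prod c x = (cs c (fst x),cs c (snd x))"
instance
proof
 fix c :: complex and x :: "'a \<times> 'b"
 show "norm (cs c x) = cmod c * norm x"
  by (auto simp: cs_prod_def norm_prod_def power_mult_distrib real_sqrt_mult simp flip: distrib_left)
qed (auto simp: cs_prod_def cs_add_left cs_add_right)
end

instantiation vec :: (cvec, finite) cvec
begin
definition cs_vec :: "complex => 'a^'b => 'a^'b" where
 "cs_vec c x = (\<chi> i. cs c (x $ i))"
instance
proof
 fix c :: complex and x :: "'a^'b"
 show "norm (cs c x) = cmod c * norm x"
  by (auto simp: cs_vec_def norm_vec_def L2_set_def power_mult_distrib real_sqrt_mult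
    simp flip: sum_distrib_left)
qed (auto simp: cs_vec_def cs_add_left cs_add_right vec_eq_iff)
end

lemma fst_cs [simp]: "fst (cs c x) = cs c (fst x)"
 and snd_cs [simp]: "snd (cs c x) = cs c (snd x)"
 by (simp_all add: cs_prod_def)

lemma vec_nth_cs [simp]: "cs c x $ i = cs c (x $ i)"
 by (simp add: cs_vec_def)

lemma cs_Pair [simp]: "cs c (x,y) = (cs c x,cs c y)"
 by (simp add: cs_prod_def)

lemma cmul_eq_cs: "cmul c x = cs c x"
 by (simp add: cmul_def prod_eq_iff vec_eq_iff)

lemma cs_minus_left [simp]: "cs (- c) x = - cs c x"
 by (rule cs.minus_left)

section \<open>Holomorphic maps between complex vector spaces\<close>

definition clin :: "('a::cvec => 'b::cvec) => bool" where
 "clin L \<longleftrightarrow> (ALL c v. L (cs c v) = cs c (L v))"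

definition hol :: "'a::cvec set => ('a => 'b::cvec) => bool" where
 "hol S f \<longleftrightarrow> open S & (ALL x:S. EX L. (f has_derivative L) (at x) & clin L)"

lemma holo_fun_iff_hol: "holo_fun U f \<longleftrightarrow> hol U f"
 by (simp add: holo_fun_def hol_def clin_def cmul_eq_cs)

lemma clinD: "clin L ==> L (cs c v) = cs c (L v)"
 by (simp add: clin_def)

lemma hol_open: "hol S f ==> open S"
 by (simp add: hol_def)

lemma hol_deriv:
 assumes "hol S f" "x : S"
 shows "(f has_derivative frechet_derivative f (at x)) (at x)"
  and "clin (frechet_derivative f (at x))"
proof -
 obtain L where L: "(f has_derivative L) (at x)" "clin L"
  using assms by (auto simp: hol_def)
 then show "(f has_derivative frechet_derivative f (at x)) (at x)"
  and "clin (frechet_derivative f (at x))"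
  using frechet_derivative_at[OF L(1)] by simp_all
qed

lemma hol_continuous_on: "hol S f ==> continuous_on S f"
 by (metis continuous_at_imp_continuous_on has_derivative_continuous hol_deriv(1))

lemma hol_subset: "hol S f ==> open T ==> T <= S ==> hol T f"
 by (auto simp: hol_def)

lemma hol_cong: "hol S f ==> (!!x. x : S ==> f x = g x) ==> hol S g"
 unfolding hol_def
 by (metis has_derivative_transform_within_open)

lemma hol_const [intro, simp]: "open S ==> hol S (%_. c)"
 by (auto simp: hol_def clin_def intro!: exI[of _ "%_. 0"] simp: cs.zero_right)

lemma hol_linear: "bounded_linear f ==> clin f ==> open S ==> hol S f"
 unfolding hol_def by (metis bounded_linear_imp_has_derivative)

lemma hol_id [intro, simp]: "open S ==> hol S (%x. x)"
 by (rule hol_linear) (auto simp: clin_def)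

lemma clin_compose: "clin f ==> clin g ==> clin (%x. g (f x))"
 by (simp add: clin_def)

lemma hol_compose:
 assumes "hol T g" "hol S f" "!!x. x : S ==> f x : T"
 shows "hol S (%x. g (f x))"
 unfolding hol_def
proof (intro conjI ballI)
 show "open S" using assms(2) by (rule hol_open)
 fix x assume x: "x : S"
 have "((%x. g (f x)) has_derivative (%v. frechet_derivative g (at (f x)) (frechet_derivative f (at x) v))) (at x)"
  using has_derivative_compose[OF hol_deriv(1)[OF assms(2) x] hol_deriv(1)[OF assms(1) assms(3)[OF x]]] .
 then show "EX L. ((%x. g (f x)) has_derivative L) (at x) & clin L"
  using clin_compose[OF hol_deriv(2)[OF assms(2) x] hol_deriv(2)[OF assms(1) assms(3)[OF x]]] by blast
qed

lemma hol_bilinear: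
 assumes "bounded_bilinear B" "!!c x y. B (cs c x) y = cs c (B x y)" "!!c x y. B x (cs c y) = cs c (B x y)"
  and f: "hol S f" and g: "hol S g"
 shows "hol S (%x. B (f x) (g x))"
 unfolding hol_def
proof (intro conjI ballI)
 show "open S" using f by (rule hol_open)
 fix x assume x: "x : S"
 have "((%x. B (f x) (g x)) has_derivative (%v. B (f x) (frechet_derivative g (at x) v)+B (frechet_derivative f (at x) v) (g x))) (at x)"
  using bounded_bilinear.FDERIV[OF assms(1) hol_deriv(1)[OF f x] hol_deriv(1)[OF g x]] .
 moreover have "clin (%v. B (f x) (frechet_derivative g (at x) v)+B (frechet_derivative f (at x) v) (g x))"
  using clinD[OF hol_deriv(2)[OF f x]] clinD[OF hol_deriv(2)[OF g x]]
  by (auto simp: clin_def assms(2,3) cs_add_right)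
 ultimately show "EX L. ((%x. B (f x) (g x)) has_derivative L) (at x) & clin L" by blast
qed

lemma hol_linear_compose:
 assumes "bounded_linear h" "clin h" "hol S f"
 shows "hol S (%x. h (f x))"
 by (rule hol_compose[OF hol_linear[OF assms(1,2) open_UNIV] assms(3)]) simp

lemma hol_mult [intro]:
 fixes f g :: "'a::cvec => complex"
 shows "hol S f ==> hol S g ==> hol S (%x. f x * g x)"
 by (rule hol_bilinear[OF bounded_bilinear_mult]) auto

lemma hol_cs [intro]: "hol S f ==> hol S g ==> hol S (%x. cs (f x) (g x))"
 by (rule hol_bilinear[OF bounded_bilinear_cs]) (auto simp: mult.commute)

lemma hol_Pair [intro]:
 assumes f: "hol S f" and g: "hol S g"
 shows "hol S (%x. (f x,g x))"
 unfolding hol_def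
proof (intro conjI ballI)
 show "open S" using f by (rule hol_open)
 fix x assume x: "x : S"
 show "EX L. ((%x. (f x,g x)) has_derivative L) (at x) & clin L"
  using has_derivative_Pair[OF hol_deriv(1)[OF f x] hol_deriv(1)[OF g x]]
   clinD[OF hol_deriv(2)[OF f x]] clinD[OF hol_deriv(2)[OF g x]]
  by (intro exI conjI) (auto simp: clin_def)
qed

lemma hol_fst [intro]: "hol S f ==> hol S (%x. fst (f x))"
 by (rule hol_linear_compose[OF bounded_linear_fst]) (auto simp: clin_def)

lemma hol_snd [intro]: "hol S f ==> hol S (%x. snd (f x))"
 by (rule hol_linear_compose[OF bounded_linear_snd]) (auto simp: clin_def)

lemma hol_nth [intro]: "hol S f ==> hol S (%x. f x $ i)"
 by (rule hol_linear_compose[OF bounded_linear_vec_nth]) (auto simp: clin_def)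

lemma hol_add [intro]:
 assumes f: "hol S f" and g: "hol S g"
 shows "hol S (%x. f x+g x)"
 by (rule hol_linear_compose[OF _ _ hol_Pair[OF f g], of "%p. fst p+snd p", simplified])
  (auto simp: clin_def cs_add_right intro!: bounded_linear_intros)

lemma hol_diff [intro]:
 assumes f: "hol S f" and g: "hol S g"
 shows "hol S (%x. f x-g x)"
 by (rule hol_linear_compose[OF _ _ hol_Pair[OF f g], of "%p. fst p-snd p", simplified])
  (auto simp: clin_def cs.diff_right intro!: bounded_linear_intros)

lemma hol_uminus [intro]: "hol S f ==> hol S (%x. - f x)"
 using hol_diff[of S "%_. 0" f] hol_open[of S f] by simp

lemma hol_sum [intro]:
 "open S ==> (!!i. i : I ==> hol S (f i)) ==> hol S (%x. \<Sum>i\<in>I. f i x)"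
 by (induction I rule: infinite_finite_induct) auto

lemma hol_prod [intro]:
 fixes f :: "'i => 'a::cvec => complex"
 shows "open S ==> (!!i. i : I ==> hol S (f i)) ==> hol S (%x. \<Prod>i\<in>I. f i x)"
 by (induction I rule: infinite_finite_induct) auto

lemma hol_power [intro]:
 fixes f :: "'a::cvec => complex"
 shows "hol S f ==> hol S (%x. f x^n)"
 by (induction n) (auto intro: hol_open)

lemma vec_eq_sum_axis: "x = (\<Sum>i\<in>UNIV. axis i (x $ i))"
 by (simp add: vec_eq_iff axis_def sum.delta)

lemma bounded_linear_axis: "bounded_linear (axis i :: 'a::euclidean_space => 'a^'n::finite)"
 by (rule linear_conv_bounded_linear[THEN iffD1], rule linearI) (auto simp: axis_def vec_eq_iff)

lemma hol_vec:
 fixes f :: "'a::cvec => 'b::cvec^'n::finite"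
 assumes "open S" "!!i. hol S (%x. f x $ i)"
 shows "hol S f"
proof -
 have "hol S (%x. \<Sum>i\<in>UNIV. axis i (f x $ i))"
  by (intro hol_sum assms(1) hol_linear_compose[OF bounded_linear_axis _ assms(2)])
   (auto simp: clin_def axis_def vec_eq_iff cs.zero_right)
 then show ?thesis
  by (simp flip: vec_eq_sum_axis)
qed

lemma clin_complex_iff_mult:
 assumes "clin (L :: complex => complex)" shows "L = (%v. L 1 * v)"
proof
 fix v show "L v = L 1 * v" using clinD[OF assms, of v 1] by (simp add: mult.commute)
qed

lemma hol_iff_holomorphic_on:
 "open S ==> hol S (f :: complex => complex) \<longleftrightarrow> f holomorphic_on S"
proof -
 assume S: "open S"
 have "clin ((*) c)" for c :: complex by (simp add: clin_def)
 then show ?thesis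
  unfolding hol_def holomorphic_on_open[OF S] has_field_derivative_def
  using S clin_complex_iff_mult by metis
qed

lemma hol_compose_1:
 fixes g :: "complex => complex"
 assumes "g holomorphic_on T" "open T" "hol S f" "!!x. x : S ==> f x : T"
 shows "hol S (%x. g (f x))"
 using hol_compose[of T g S f] assms hol_iff_holomorphic_on by blast

lemma hol_inverse [intro]:
 fixes f :: "'a::cvec => complex"
 assumes "hol S f" "!!x. x : S ==> f x ~= 0"
 shows "hol S (%x. inverse (f x))"
 by (rule hol_compose_1[where T="- {0}"]) (insert assms, auto intro!: holomorphic_intros)

lemma hol_line:
 assumes "hol S f"
 shows "hol {zt. x+cs zt v : S} (%zt. f (x+cs zt v))"
proof (rule hol_compose[OF assms])
 have "open ((%zt. x+cs zt v) -` S)"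
  by (rule open_vimage[OF hol_open[OF assms]]) (intro continuous_intros cs.continuous_on)
 then show "hol {zt. x+cs zt v : S} (%zt. x+cs zt v)"
  by (intro hol_add hol_cs hol_id hol_const) (auto simp: vimage_def)
qed simp

subsection \<open>Holomorphy along complex lines\<close>

text \<open>Discs of radius \<open>r/2\<close> about points of the half disc stay inside the full
  one, so Cauchy bounds the second derivative by \<open>2 * B/(r/2)^2\<close>, which is
  \<open>8 * B/r^2\<close>; Taylor's formula of order one does the rest.\<close>

lemma quadratic_remainder_bound:
 assumes "g holomorphic_on ball 0 r" "continuous_on (cball 0 r) g" "0 < r" 
  and B: "!!z. cmod z <= r ==> cmod (g z) <= B"
 shows "cmod z <= r/2 ==> cmod (g z-g 0-deriv g 0 * z) <= 8 * B/r^2*(cmod z)^2"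
  and "cmod (deriv g 0) <= B/r"
proof -
 have "cmod ((deriv ^^ 1) g 0) <= fact 1 * B/r^1"
  using Cauchy_inequality[of g 0 r B 1] assms by auto
 then show "cmod (deriv g 0) <= B/r" by simp
next
 assume z: "cmod z <= r/2"
 have d2: "cmod ((deriv ^^ 2) g w) <= 8 * B/r^2" if w: "cmod w <= r/2" for w
 proof -
  have sub: "cball w (r/2) <= cball 0 r"
  proof
   fix y assume "y : cball w (r/2)"
   then show "y : cball 0 r" using w norm_triangle_sub[of y w] by (simp add: dist_norm norm_minus_commute)
  qed
  have sub2: "ball w (r/2) <= ball 0 r"
   using interior_mono[OF sub] by simp
  have "cmod ((deriv ^^ 2) g w) <= fact 2 * B/(r/2)^2"
  proof (rule Cauchy_inequality)
   show "g holomorphic_on ball w (r/2)" using assms(1) sub2 by (rule holomorphic_on_subset)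
   show "continuous_on (cball w (r/2)) g" using assms(2) sub by (rule continuous_on_subset)
   show "cmod (g x) <= B" if "cmod (w-x) = r/2" for x
   proof -
    have "x : cball w (r/2)" using that by (simp add: dist_norm)
    then show ?thesis using sub by (intro B) auto
   qed
  qed (use \<open>0 < r\<close> in auto)
  then show ?thesis by (simp add: power2_eq_square)
 qed
 define f where "f i = (deriv ^^ i) g" for i
 have "cmod (f 0 z-(\<Sum>i\<le>1. f i 0*(z-0)^i/fact i)) <= 8 * B/r^2 * cmod (z-0)^Suc 1/fact 1"
 proof (rule complex_Taylor)
  show "convex (cball (0::complex) (r/2))" by simp
  fix i x assume *: "x : cball (0::complex) (r/2)" and "i <= (1::nat)"
  have "x : ball 0 r" using * \<open>0<r\<close> by auto
  then have "(f i has_field_derivative f (Suc i) x) (at x)"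
   unfolding f_def funpow.simps(2) o_def
   by (intro holomorphic_derivI[OF holomorphic_higher_deriv[OF assms(1)]]) auto
  then show "(f i has_field_derivative f (Suc i) x) (at x within cball 0 (r/2))"
   by (rule has_field_derivative_at_within)
 next
  fix x assume "x : cball (0::complex) (r/2)"
  then show "cmod (f (Suc 1) x) <= 8 * B/r^2" using d2[of x] by (simp add: f_def numeral_2_eq_2)
 qed (use z \<open>0 < r\<close> in auto)
 then show "cmod (g z-g 0-deriv g 0 * z) <= 8 * B/r^2*(cmod z)^2"
  by (simp add: f_def power2_eq_square algebra_simps)
qed

text \<open>Gateaux holomorphy together with continuity. In this form the one-variable theory
  applies line by line, in particular to uniform limits; \<open>ghol_iff_hol\<close> identifies it
  with \<open>hol\<close>.\<close>

definition ghol :: "'a::cvec set => ('a => complex) => bool" where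
 "ghol S f \<longleftrightarrow> open S & continuous_on S f &
  (ALL x v. (%zt. f (x+cs zt v)) holomorphic_on {zt. x+cs zt v : S})"

definition ldv :: "('a::cvec => complex) => 'a => 'a => complex" where
 "ldv f x v = deriv (%zt. f (x+cs zt v)) 0"

lemma open_line: "open S ==> open {zt. x+cs zt v : S}"
 using open_vimage[of S "%zt. x+cs zt v"]
 by (simp add: vimage_def continuous_intros cs.continuous_on)

lemma hol_imp_ghol: "hol S f ==> ghol S f"
 unfolding ghol_def
 using hol_line hol_open hol_continuous_on hol_iff_holomorphic_on open_line by metis

lemma ldv_cs:
 assumes "ghol S f" "x : S"
 shows "ldv f x (cs c v) = c * ldv f x v"
proof -
 have h: "(%zt. f (x+cs zt v)) holomorphic_on {zt. x+cs zt v : S}" and o: "open {zt. x+cs zt v : S}"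
  using assms open_line by (auto simp: ghol_def)
 have d: "((%zt. f (x+cs zt v)) has_field_derivative ldv f x v) (at (0 * c))"
  unfolding ldv_def using holomorphic_derivI[OF h o, of 0] assms(2) by (simp add: cs.zero_left)
 have "((%zt. zt * c) has_field_derivative c) (at 0)"
  by (auto intro!: derivative_eq_intros)
 from DERIV_chain2[OF d this]
 have "((%zt. f (x+cs (zt * c) v)) has_field_derivative ldv f x v * c) (at 0)" .
 then show ?thesis
  using DERIV_imp_deriv unfolding ldv_def by (metis (no_types, lifting) cs_cs mult.commute ext)
qed

text \<open>The one-variable estimates are used along the normalised direction \<open>u\<close>.
  Discs of radius \<open>r\<close> about \<open>x\<close> stay in \<open>cball x0 (2*r)\<close>, so
  the constants depend neither on \<open>x\<close> nor on \<open>v\<close>. For \<open>v = 0\<close>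
  the quotient defining \<open>u\<close> is \<open>0\<close>, hence only \<open>norm u <= 1\<close>
  is claimed.\<close>

lemma ghol_local_bounds:
 assumes g: "ghol S f" and "0 < r" and sub: "cball x0 (2*r) <= S"
  and B: "!!y. y : cball x0 (2*r) ==> cmod (f y) <= B" and x: "x : cball x0 r"
 shows "norm v <= r/2 ==> cmod (f (x+v)-f x-ldv f x v) <= 8 * B/r^2*(norm v)^2"
  and "cmod (ldv f x v) <= B/r * norm v"
proof -
 define u where "u = v /\<^sub>R norm v"
 have nu: "norm u <= 1" by (cases "v = 0") (simp_all add: u_def)
 have v: "v = cs (of_real (norm v)) u" by (cases "v = 0") (simp_all add: u_def cs.zero_right)
 have inc: "x+cs zt u : cball x0 (2*r)" if "cmod zt <= r" for zt
 proof -
  have "dist x0 (x+cs zt u) <= dist x0 x+norm (cs zt u)"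
   by (metis dist_norm dist_triangle diff_add_cancel add.commute norm_minus_commute add_diff_cancel_left')
  also have "... <= r+r * 1"
   using x that mult_mono[OF that nu] \<open>0<r\<close> by (intro add_mono) auto
  finally show ?thesis by simp
 qed
 have h: "(%zt. f (x+cs zt u)) holomorphic_on {zt. x+cs zt u : S}"
  using g by (auto simp: ghol_def)
 have h1: "(%zt. f (x+cs zt u)) holomorphic_on cball 0 r"
  using h by (rule holomorphic_on_subset) (use inc sub in auto)
 note Q = quadratic_remainder_bound[of "%zt. f (x+cs zt u)" r B]
 have xS: "x : S" using inc[of 0] sub \<open>0<r\<close> by (auto simp: cs.zero_left)
 have l: "ldv f x v = norm v * ldv f x u"
  using ldv_cs[OF g xS, of "of_real (norm v)" u] v by simp
 have pre: "(%zt. f (x+cs zt u)) holomorphic_on ball 0 r" 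
  "continuous_on (cball 0 r) (%zt. f (x+cs zt u))" "0 < r" "!!z. cmod z <= r ==> cmod (f (x+cs z u)) <= B"
  using holomorphic_on_subset[OF h1 ball_subset_cball] holomorphic_on_imp_continuous_on[OF h1] \<open>0<r\<close> B inc by auto
 show "cmod (f (x+v)-f x-ldv f x v) <= 8 * B/r^2*(norm v)^2" if "norm v <= r/2"
  using Q(1)[OF pre, of "of_real (norm v)"] that v[symmetric] l
  by (simp add: cs.zero_left ldv_def mult.commute)
 have "cmod (ldv f x u) <= B/r"
  using Q(2)[OF pre] by (simp add: ldv_def)
 then show "cmod (ldv f x v) <= B/r * norm v"
  using mult_right_mono[of "cmod (ldv f x u)" "B/r" "norm v"] by (simp add: l norm_mult mult.commute)
qed

lemma ghol_subset:
 assumes "ghol S f" "open T" "T <= S" shows "ghol T f"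
proof -
 have "(%zt. f (x+cs zt v)) holomorphic_on {zt. x+cs zt v : T}" for x v
  by (rule holomorphic_on_subset[where s="{zt. x+cs zt v : S}"]) (insert assms(1,3), auto simp: ghol_def)
 then show ?thesis
  using assms continuous_on_subset unfolding ghol_def by blast
qed

lemma ghol_diff: 
 assumes "ghol S f" "ghol S g" shows "ghol S (%x. f x-g x)"
 using assms by (auto simp: ghol_def intro!: continuous_intros holomorphic_intros)

lemma ghol_translate:
 assumes "ghol S f" shows "ghol ((+) (- a) ` S) (%x. f (a+x))"
proof -
 have eq: "(+) (- a) ` S = {x. a+x : S}"
 proof (intro set_eqI iffI)
  fix x assume "x : {x. a+x : S}"
  then show "x : (+) (- a) ` S" by (intro image_eqI[of _ _ "a+x"]) auto
 qed auto
 have "open ((+) (- a) ` S)"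
  using assms open_translation unfolding ghol_def by blast
 moreover have "continuous_on {x. a+x : S} (%x. f (a+x))"
  by (rule continuous_on_compose2[of S f]) (insert assms, auto simp: ghol_def intro!: continuous_intros)
 moreover have "(%zt. f (a+(x+cs zt v))) holomorphic_on {zt. a+(x+cs zt v) : S}" for x v
  using assms unfolding ghol_def add.assoc[symmetric] by blast
 ultimately show ?thesis
  unfolding ghol_def eq by simp
qed

text \<open>The difference of \<open>f\<close> and its translate by \<open>x - x0\<close> is again
  holomorphic along lines and is uniformly small near \<open>x0\<close> by uniform continuity.
  Cauchy's estimate for its derivative at \<open>x0\<close> bounds
  \<open>ldv f x v - ldv f x0 v\<close>.\<close>

lemma ghol_ldv_continuous:
 assumes g: "ghol S f" shows "continuous_on S (%x. ldv f x v)"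
proof -
 have "isCont (%x. ldv f x v) x0" if "x0 : S" for x0
 proof -
  have oS: "open S" using g by (simp add: ghol_def)
  obtain e where "e > 0" and e: "cball x0 e <= S" using \<open>x0 \<in> S\<close> oS open_contains_cball by blast
  define r where "r = e/3"
  have "r > 0" using \<open>e>0\<close> by (simp add: r_def)
  have sub: "cball x0 (3*r) <= S" using e by (simp add: r_def)
  have uc: "uniformly_continuous_on (cball x0 (3*r)) f"
   using g sub by (intro compact_uniformly_continuous) (auto simp: ghol_def intro: continuous_on_subset)
  show ?thesis
   unfolding continuous_at_eps_delta
  proof (intro allI impI)
   fix ep :: real assume "ep > 0"
   define ep' where "ep' = ep * r/(norm v+1)"
   have "norm v+1 > 0" by (smt (verit) norm_ge_zero)
   then have "ep' > 0" using \<open>ep>0\<close> \<open>r>0\<close> by (simp add: ep'_def)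
   then obtain d where "d > 0" and d: "!!x y. x : cball x0 (3*r) ==> y : cball x0 (3*r) ==> dist y x < d ==> dist (f y) (f x) < ep'"
    using uc unfolding uniformly_continuous_on_def by metis
   have "dist (ldv f x v) (ldv f x0 v) < ep" if x: "dist x x0 < min d r" for x
   proof -
    define h where "h = (%y. f ((x-x0)+y)-f y)"
    define T where "T = (+) (- (x-x0)) ` S Int S"
    have gh: "ghol T h"
     unfolding h_def T_def
     by (intro ghol_diff ghol_subset[OF ghol_translate[OF g]] ghol_subset[OF g])
      (auto intro!: open_Int open_translation oS)
    have inb: "y : cball x0 (3*r)" "(x-x0)+y : cball x0 (3*r)" if "y : cball x0 (2*r)" for y
    proof -
     show "y : cball x0 (3*r)" using that \<open>r>0\<close> by auto
     have "dist x0 ((x-x0)+y) <= dist x0 y+dist y ((x-x0)+y)" by (rule dist_triangle)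
     also have "dist y ((x-x0)+y) = dist x x0" by (simp add: dist_norm norm_minus_commute)
     finally show "(x-x0)+y : cball x0 (3*r)" using that x by auto
    qed
    have sT: "cball x0 (2*r) <= T"
    proof
     fix y assume y: "y : cball x0 (2*r)"
     have "y = - (x-x0)+((x-x0)+y)" by simp
     then show "y : T" unfolding T_def using inb[OF y] sub by blast
    qed
    have hb: "cmod (h y) <= ep'" if "y : cball x0 (2*r)" for y
     using d[OF inb(1) inb(2), OF that that] x by (simp add: h_def dist_norm)
    have "cmod (ldv h x0 v) <= ep'/r * norm v"
     using ghol_local_bounds(2)[OF gh \<open>r>0\<close> sT hb, of x0 v] \<open>r>0\<close> by simp
    also have "... < ep"
     using \<open>ep>0\<close> \<open>r>0\<close> \<open>norm v + 1 > 0\<close> by (simp add: ep'_def divide_less_eq distrib_left)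
    also have "ldv h x0 v = ldv f x v-ldv f x0 v"
    proof -
     have d: "(%zt. f (y+cs zt v)) field_differentiable (at 0)" if "y : S" for y
      using g that holomorphic_on_imp_differentiable_at[OF _ open_line[OF oS]]
      unfolding ghol_def by (metis (mono_tags, lifting) add.right_neutral cs.zero_left mem_Collect_eq)
     have "x : S" using inb(2)[of x0] sub \<open>r>0\<close> by auto
     have "deriv (%zt. f (x+cs zt v)-f (x0+cs zt v)) 0 = ldv f x v-ldv f x0 v"
      unfolding ldv_def using d[OF \<open>x\<in>S\<close>] d[OF \<open>x0\<in>S\<close>] by (rule deriv_diff)
     then show ?thesis unfolding ldv_def h_def by (simp add: algebra_simps)
    qed
    finally show ?thesis by (simp add: dist_norm)
   qed
   then show "EX d>0. ALL x. dist x x0 < d --> dist (ldv f x v) (ldv f x0 v) < ep"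
    using \<open>d>0\<close> \<open>r>0\<close> by (intro exI[of _ "min d r"]) auto
  qed
 qed
 then show ?thesis by (simp add: continuous_at_imp_continuous_on)
qed

text \<open>Goursat-Osgood: additivity of the directional derivatives comes from comparing second
 order remainders along the two paths \<open>x \<rightarrow> x + s v \<rightarrow> x + s (v + u)\<close> and \<open>x \<rightarrow> x + s (v + u)\<close>.\<close>

lemma ghol_has_derivative:
 assumes g: "ghol S f" and x0: "x0 : S"
 shows "(f has_derivative ldv f x0) (at x0)" "clin (ldv f x0)"
proof -
 have oS: "open S" using g by (simp add: ghol_def)
 obtain e where "e > 0" and e: "cball x0 e <= S" using x0 oS open_contains_cball by blast
 define r where "r = e/2"
 have "r > 0" and sub: "cball x0 (2*r) <= S" using \<open>e>0\<close> e by (simp_all add: r_def)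
 have "continuous_on (cball x0 (2*r)) f"
  using g sub by (auto simp: ghol_def intro: continuous_on_subset)
 from continuous_on_compact_bound[OF compact_cball this]
 obtain B where B: "!!y. y : cball x0 (2*r) ==> cmod (f y) <= B" and "0 <= B" by blast
 define C where "C = 8 * B/r^2"
 have "C >= 0" using \<open>0\<le>B\<close> by (simp add: C_def)
 note Q = ghol_local_bounds(1)[OF g \<open>r>0\<close> sub B, folded C_def]
 have sc: "ldv f x (s *R v) = s * ldv f x v" if "x : S" for s x v
  using ldv_cs[OF g that, of "of_real s" v] by simp
 have add: "ldv f x0 (v+u) = ldv f x0 v+ldv f x0 u" for u v
 proof -
  define m where "m = norm u+norm v+1"
  have m: "m > 0" "norm u <= m" "norm v <= m" "norm (v+u) <= m"
   unfolding m_def by (smt (verit) norm_ge_zero norm_triangle_ineq)+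
  \<comment> \<open>Each of the three remainders is at most \<open>C * (s*m)^2\<close>, so an error
    linear in \<open>s\<close> survives the division by \<open>s\<close>. The last derivative is
    taken at the moved point \<open>x0+s *R v\<close>; continuity of \<open>ldv\<close> in the base
    point brings it back to \<open>x0\<close>.\<close>
  have key: "cmod (ldv f x0 (v+u)-ldv f x0 v-ldv f (x0+s *R v) u) <= 3 * C * m^2 * s"
   if s: "0 < s" "s < r/2/m" for s
  proof -
   have sm: "s * m <= r/2" using s m by (simp add: field_simps)
   have n: "norm (s *R w) <= r/2" if "norm w <= m" for w
   proof -
    have "norm (s *R w) <= s * m" using that s by (simp add: mult_left_mono)
    with sm show ?thesis by simp
   qed
   have x1: "x0+s *R v : cball x0 r" using n[OF m(3)] \<open>r>0\<close> by (simp add: dist_norm)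
   then have x1S: "x0+s *R v : S" using sub \<open>r>0\<close> by auto
   have b: "cmod (f (x+s *R w)-f x-s * ldv f x w) <= C * (s*m)^2" if "norm w <= m" "x : cball x0 r" "x : S" for x w
   proof -
    have "cmod (f (x+s *R w)-f x-ldv f x (s *R w)) <= C * (norm (s *R w))^2"
     by (rule Q) (use that n in auto)
    also have "... <= C * (s*m)^2"
     using that s \<open>C\<ge>0\<close> by (intro mult_left_mono power_mono) (auto intro: mult_left_mono)
    finally show ?thesis using sc that by simp
   qed
   have x0b: "x0 : cball x0 r" using \<open>r>0\<close> by simp
   define a where "a = f (x0+s *R (v+u))-f x0-s * ldv f x0 (v+u)"
   define b' where "b' = f (x0+s *R v)-f x0-s * ldv f x0 v"
   define c where "c = f (x0+s *R v+s *R u)-f (x0+s *R v)-s * ldv f (x0+s *R v) u"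
   have "s * (ldv f x0 (v+u)-ldv f x0 v-ldv f (x0+s *R v) u) = b'+c-a"
    by (simp add: a_def b'_def c_def algebra_simps scaleR_add_right)
   then have "s * cmod (ldv f x0 (v+u)-ldv f x0 v-ldv f (x0+s *R v) u) = cmod (b'+c-a)"
    using s by (metis norm_mult norm_of_real abs_of_pos)
   also have "... <= cmod b'+cmod c+cmod a"
    by (meson norm_triangle_ineq norm_triangle_ineq4 order_trans add_right_mono)
   also have "... <= C * (s*m)^2+C * (s*m)^2+C * (s*m)^2"
    unfolding a_def b'_def c_def using b[OF m(4) x0b x0] b[OF m(3) x0b x0] b[OF m(2) x1 x1S] by linarith
   also have "... = s * (3 * C * m^2 * s)" by (simp add: power2_eq_square)
   finally show ?thesis using s by simp
  qed
  have t1: "((%s. x0+s *R v) \<longlongrightarrow> x0) (at_right 0)"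
   by (auto intro!: tendsto_eq_intros)
  have "isCont (%x. ldv f x u) x0"
   using ghol_ldv_continuous[OF g] oS x0 by (simp add: continuous_on_eq_continuous_at)
  then have t2: "((%s. ldv f (x0+s *R v) u) \<longlongrightarrow> ldv f x0 u) (at_right 0)"
   using isCont_tendsto_compose[OF _ t1] by blast
  have "((%s. cmod (ldv f x0 (v+u)-ldv f x0 v-ldv f (x0+s *R v) u)) \<longlongrightarrow>
   cmod (ldv f x0 (v+u)-ldv f x0 v-ldv f x0 u)) (at_right 0)"
   by (intro tendsto_intros t2)
  moreover have "((%s. 3 * C * m^2 * s) \<longlongrightarrow> 0) (at_right (0::real))"
   by (auto intro!: tendsto_eq_intros)
  moreover have "\<forall>\<^sub>F s in at_right 0. cmod (ldv f x0 (v+u)-ldv f x0 v-ldv f (x0+s *R v) u) <= 3 * C * m^2 * s"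
   using eventually_at_right_less[of 0] eventually_at_right[of 0 "r/2/m"] key \<open>r>0\<close> m(1)
   unfolding eventually_at_right[OF zero_less_one]
   by (metis divide_pos_pos eventually_at_right half_gt_zero)
  ultimately have "cmod (ldv f x0 (v+u)-ldv f x0 v-ldv f x0 u) <= 0"
   by (intro tendsto_le[of "at_right (0::real)"]) auto
  then show ?thesis by (simp add: algebra_simps)
 qed
 have lin: "linear (ldv f x0)"
  by (rule linearI) (insert add sc[OF x0], auto simp: scaleR_conv_of_real)
 show "(f has_derivative ldv f x0) (at x0)"
 proof (rule has_derivativeI_sandwich[where e="r/2" and H="%y. C * norm (y-x0)"])
  show "bounded_linear (ldv f x0)" using lin by (simp add: linear_conv_bounded_linear)
  show "((%y. C * norm (y-x0)) \<longlongrightarrow> 0) (at x0)"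
   by (auto intro!: tendsto_eq_intros)
  fix y assume y: "y ~= x0" "dist y x0 < r/2"
  have "cmod (f (x0+(y-x0))-f x0-ldv f x0 (y-x0)) <= C * (norm (y-x0))^2"
   by (rule Q) (insert y \<open>r>0\<close>, auto simp: dist_norm)
  then show "norm (f y-f x0-ldv f x0 (y-x0))/norm (y-x0) <= C * norm (y-x0)"
   using y by (simp add: field_simps power2_eq_square)
 qed (use \<open>r>0\<close> in auto)
 show "clin (ldv f x0)"
  using ldv_cs[OF g x0] by (simp add: clin_def)
qed

lemma ghol_iff_hol: "ghol S f \<longleftrightarrow> hol S f"
 using ghol_has_derivative hol_imp_ghol unfolding hol_def ghol_def by metis

lemma hol_frechet_eq_ldv:
 fixes f :: "'a::cvec => complex"
 shows "hol S f ==> x : S ==> frechet_derivative f (at x) = ldv f x"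
 using ghol_has_derivative(1) frechet_derivative_at ghol_iff_hol by metis

lemma hol_local:
 assumes "!!x. x : S ==> EX T. x : T & T <= S & hol T f"
 shows "hol S f"
 unfolding hol_def
proof
 show "open S" using assms hol_open openI open_subopen by metis
 show "ALL x:S. EX L. (f has_derivative L) (at x) & clin L"
  using assms unfolding hol_def by blast
qed

text \<open>Restricted to a complex line this is the Weierstrass theorem of one variable, and
  continuity is inherited from the uniform limit; the equivalence of \<open>ghol\<close> and
  \<open>hol\<close> turns this into joint holomorphy. A general filter is allowed because
  multi-index series are summed along \<open>finite_subsets_at_top\<close>.\<close>

lemma hol_uniform_limit:
 fixes f :: "'i => 'a::cvec => complex"
 assumes F: "F ~= bot"
  and loc: "!!x. x : S ==> EX T. x : T & T <= S & open T & (\<forall>\<^sub>F n in F. hol T (f n)) & uniform_limit T f g F"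
 shows "hol S g"
proof (rule hol_local)
 fix x assume "x : S"
 then obtain T where T: "x : T" "T <= S" "open T" "\<forall>\<^sub>F n in F. hol T (f n)" "uniform_limit T f g F"
  using loc by blast
 have "ghol T g"
  unfolding ghol_def
 proof (intro conjI allI)
  show "open T" by fact
  show "continuous_on T g"
   by (rule uniform_limit_theorem[OF eventually_mono[OF T(4) hol_continuous_on] T(5) F])
  fix y v
  show "(%zt. g (y+cs zt v)) holomorphic_on {zt. y+cs zt v : T}" (is "?g holomorphic_on ?A")
  proof -
   have oA: "open ?A" by (rule open_line[OF T(3)])
   have "?g field_differentiable (at z)" if zA: "z : ?A" for z
   proof -
    obtain d where d: "d > 0" "cball z d <= ?A"
     using open_contains_cball_eq[OF oA, rule_format, THEN iffD1, OF zA] by metis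
    have ul: "uniform_limit (cball z d) (%n zt. f n (y+cs zt v)) ?g F"
     unfolding uniform_limit_iff
    proof (intro allI impI)
     fix ep :: real assume "ep > 0"
     then have "\<forall>\<^sub>F n in F. ALL x:T. dist (f n x) (g x) < ep" using T(5) by (simp add: uniform_limit_iff)
     then show "\<forall>\<^sub>F n in F. ALL x:cball z d. dist (f n (y+cs x v)) (g (y+cs x v)) < ep"
      by (rule eventually_mono) (use d(2) in blast)
    qed
    have ev: "\<forall>\<^sub>F n in F. continuous_on (cball z d) (%zt. f n (y+cs zt v)) & (%zt. f n (y+cs zt v)) holomorphic_on ball z d"
     using T(4)
    proof eventually_elim
     case (elim n)
     then have h: "(%zt. f n (y+cs zt v)) holomorphic_on ?A"
      using hol_line hol_iff_holomorphic_on[OF oA] by blast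
     show ?case
      using holomorphic_on_subset[OF h] holomorphic_on_imp_continuous_on d(2) ball_subset_cball[of z d]
      by (meson order_trans)
    qed
    have "?g holomorphic_on ball z d"
     using holomorphic_uniform_limit[OF ev ul] F by auto
    then show ?thesis
     using d(1) holomorphic_on_imp_differentiable_at[OF _ open_ball] by auto
   qed
   then show ?thesis by (simp add: holomorphic_on_def field_differentiable_at_within)
  qed
 qed
 then show "EX T. x : T & T <= S & hol T g" using T ghol_iff_hol by blast
qed

text \<open>The derivative is a locally uniform limit of the difference quotients with step
  \<open>1/(n+1)\<close>: these are holomorphic, and the quadratic remainder makes their error at
  most \<open>C * (norm u)^2/(n+1)\<close>.\<close>

lemma hol_ldv:
 assumes h: "hol S (f :: 'a::cvec => complex)" shows "hol S (%x. ldv f x u)"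
proof (rule hol_uniform_limit[where F=sequentially and f="%n x. of_nat (Suc n)*(f (x+u /\<^sub>R (Suc n))-f x)"])
 have g: "ghol S f" using h ghol_iff_hol by blast
 fix x0 assume x0: "x0 : S"
 have oS: "open S" using h by (rule hol_open)
 obtain e where "e > 0" and e: "cball x0 e <= S" using x0 oS open_contains_cball by blast
 define r where "r = e/2"
 have "r > 0" and sub: "cball x0 (2*r) <= S" using \<open>e>0\<close> e by (simp_all add: r_def)
 have "continuous_on (cball x0 (2*r)) f"
  using g sub by (auto simp: ghol_def intro: continuous_on_subset)
 from continuous_on_compact_bound[OF compact_cball this]
 obtain B where B: "!!y. y : cball x0 (2*r) ==> cmod (f y) <= B" and "0 <= B" by blast
 define C where "C = 8 * B/r^2"
 note Q = ghol_local_bounds(1)[OF g \<open>r>0\<close> sub B, folded C_def]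
 have ev: "\<forall>\<^sub>F n in sequentially. norm (u /\<^sub>R Suc n) < r/2"
 proof -
  have "(%n. norm (u /\<^sub>R Suc n)) \<longlonglongrightarrow> norm (0 *R u)"
   by (intro tendsto_intros LIMSEQ_inverse_real_of_nat)
  then show ?thesis using \<open>r>0\<close> by (intro order_tendstoD) auto
 qed
 show "EX T. x0 : T & T <= S & open T & (\<forall>\<^sub>F n in sequentially. hol T (%x. of_nat (Suc n)*(f (x+u /\<^sub>R (Suc n))-f x))) &
  uniform_limit T (%n x. of_nat (Suc n)*(f (x+u /\<^sub>R (Suc n))-f x)) (%x. ldv f x u) sequentially"
 proof (intro exI[of _ "ball x0 r"] conjI)
  show "x0 : ball x0 r" "ball x0 r <= S" using \<open>r>0\<close> sub by auto
  show "\<forall>\<^sub>F n in sequentially. hol (ball x0 r) (%x. of_nat (Suc n)*(f (x+u /\<^sub>R (Suc n))-f x))"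
   using ev
  proof eventually_elim
   case (elim n)
   have "x+u /\<^sub>R Suc n : S" if "x : ball x0 r" for x
   proof -
    have "dist x0 (x+u /\<^sub>R Suc n) <= dist x0 x+dist x (x+u /\<^sub>R Suc n)" by (rule dist_triangle)
    also have "dist x (x+u /\<^sub>R Suc n) = norm (u /\<^sub>R Suc n)" by (simp add: dist_norm)
    finally have "x+u /\<^sub>R Suc n : cball x0 (2*r)" using elim that \<open>r>0\<close> by auto
    then show ?thesis using sub by blast
   qed
   then have "hol (ball x0 r) (%x. f (x+u /\<^sub>R Suc n))"
    by (intro hol_compose[OF h] hol_add hol_id hol_const) auto
   then show ?case
    by (intro hol_mult hol_diff hol_const hol_subset[OF h]) (use sub \<open>r>0\<close> in auto)
  qed
  show "uniform_limit (ball x0 r) (%n x. of_nat (Suc n)*(f (x+u /\<^sub>R (Suc n))-f x)) (%x. ldv f x u) sequentially"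
  proof (rule uniform_limitI)
   fix ep :: real assume "ep > 0"
   have "(%n. C * (norm u)^2 * inverse (real (Suc n))) \<longlonglongrightarrow> C * (norm u)^2*0"
    by (intro tendsto_intros LIMSEQ_inverse_real_of_nat)
   then have "\<forall>\<^sub>F n in sequentially. C * (norm u)^2 * inverse (real (Suc n)) < ep"
    using \<open>ep>0\<close> by (intro order_tendstoD) auto
   then show "\<forall>\<^sub>F n in sequentially. ALL x:ball x0 r. dist (of_nat (Suc n)*(f (x+u /\<^sub>R (Suc n))-f x)) (ldv f x u) < ep"
    using ev
   proof eventually_elim
    case (elim n)
    show ?case
    proof
     fix x assume x: "x : ball x0 r"
     then have xS: "x : S" using sub \<open>r>0\<close> by auto
     have l: "ldv f x (u /\<^sub>R Suc n) = inverse (of_nat (Suc n)) * ldv f x u"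
      using ldv_cs[OF g xS, of "of_real (inverse (real (Suc n)))" u]
      unfolding cs_of_real by (simp only: of_real_inverse of_real_of_nat_eq)
     have "cmod (f (x+u /\<^sub>R Suc n)-f x-ldv f x (u /\<^sub>R Suc n)) <= C * (norm (u /\<^sub>R Suc n))^2"
      by (rule Q) (use x elim in auto)
     then have "Suc n * cmod (f (x+u /\<^sub>R Suc n)-f x-ldv f x (u /\<^sub>R Suc n)) <= Suc n * (C * (norm (u /\<^sub>R Suc n))^2)"
      by (rule mult_left_mono) auto
     also have "Suc n * (C * (norm (u /\<^sub>R Suc n))^2) = C * (norm u)^2 * inverse (real (Suc n))"
     proof -
      have "k * (C * (inverse k * a)^2) = C * a^2 * inverse k" if "k > 0" for a k :: real
       using that by (simp add: power2_eq_square field_simps)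
      from this[of "real (Suc n)" "norm u"] show ?thesis by simp
     qed
     also have "Suc n * cmod (f (x+u /\<^sub>R Suc n)-f x-ldv f x (u /\<^sub>R Suc n)) =
       cmod (of_nat (Suc n)*(f (x+u /\<^sub>R Suc n)-f x-ldv f x (u /\<^sub>R Suc n)))"
      by (simp add: norm_mult del: of_nat_Suc)
     also have "of_nat (Suc n)*(f (x+u /\<^sub>R Suc n)-f x-ldv f x (u /\<^sub>R Suc n)) = of_nat (Suc n)*(f (x+u /\<^sub>R Suc n)-f x)-ldv f x u"
      unfolding l by (simp add: right_diff_distrib del: of_nat_Suc)
     finally show "dist (of_nat (Suc n)*(f (x+u /\<^sub>R (Suc n))-f x)) (ldv f x u) < ep"
      using elim by (simp add: dist_norm del: of_nat_Suc)
    qed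
   qed
  qed
 qed auto
qed simp

subsection \<open>The holomorphic implicit function theorem\<close>

lemma norm_Pair_le_add: "norm (x,y) <= norm x+norm y"
 by (simp add: norm_Pair) (metis norm_ge_zero sqrt_sum_squares_le_sum)

text \<open>Simplified Newton iteration: \<open>N u\<close> moves \<open>y\<close> by
  \<open>G (u,y)\<close> times the fixed inverse slope \<open>c\<close>, hence contracts with factor
  \<open>1/2\<close> near \<open>(u0,y0)\<close>. The bound \<open>e0\<close> lets the caller limit
  the size of the solution.\<close>

lemma hol_implicit_function:
 fixes G :: "'a::cvec \<times> complex => complex"
 assumes G: "hol S G" and S: "(u0,y0) : S" and G0: "G (u0,y0) = 0"
  and d: "ldv G (u0,y0) (0,1) ~= 0" and e0: "e0 > 0"
 obtains U e g where "open U" "u0 : U" "0 < e" "e <= e0" "hol U g" "g u0 = y0"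
  "ALL u:U. g u : ball y0 e"
  "ALL u:U. ALL y:ball y0 e. (u,y) : S & (G (u,y) = 0 \<longleftrightarrow> y = g u)"
proof -
 define c where "c = inverse (ldv G (u0,y0) (0,1))"
 have c0: "c ~= 0" using d by (simp add: c_def)
 define N where "N u y = y-c * G (u,y)" for u y
 have oS: "open S" using G by (rule hol_open)
 have "isCont (%p. ldv G p (0,1)) (u0,y0)"
  using hol_continuous_on[OF hol_ldv[OF G]] oS S by (simp add: continuous_on_eq_continuous_at)
 then have "isCont (%p. cmod (1-c * ldv G p (0,1))) (u0,y0)"
  by (intro continuous_intros)
 then have "((%p. cmod (1-c * ldv G p (0,1))) \<longlongrightarrow> cmod (1-c * ldv G (u0,y0) (0,1))) (nhds (u0,y0))"
  by (simp add: continuous_at tendsto_nhds_iff)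
 moreover have "cmod (1-c * ldv G (u0,y0) (0,1)) < 1/2" using d by (simp add: c_def)
 ultimately have "\<forall>\<^sub>F p in nhds (u0,y0). cmod (1-c * ldv G p (0,1)) < 1/2"
  by (rule order_tendstoD)
 moreover have "\<forall>\<^sub>F p in nhds (u0,y0). p : S" using oS S eventually_nhds by blast
 ultimately have "\<forall>\<^sub>F p in nhds (u0,y0). cmod (1-c * ldv G p (0,1)) < 1/2 & p : S"
  by (rule eventually_conj)
 then obtain e1 where e1: "e1 > 0" "!!p. dist p (u0,y0) < e1 ==> cmod (1-c * ldv G p (0,1)) < 1/2 & p : S"
  unfolding eventually_nhds_metric by blast
 define e where "e = min e0 (e1/3)"
 have e: "e > 0" "e <= e0" "e <= e1/3" using e0 e1(1) by (auto simp: e_def)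
 have in1: "dist (u,y) (u0,y0) < e1" if "u : ball u0 (e1/3)" "y : cball y0 e" for u y
 proof -
  have "dist (u,y) (u0,y0) <= norm (u-u0)+norm (y-y0)"
   unfolding dist_norm using norm_Pair_le_add[of "u-u0" "y-y0"] by simp
  then show ?thesis using that e e1 by (simp add: dist_norm norm_minus_commute)
 qed
 have contr: "cmod (N u y-N u y') <= 1/2 * cmod (y-y')"
  if u: "u : ball u0 (e1/3)" and y: "y : cball y0 e" "y' : cball y0 e" for u y y'
 proof (rule field_differentiable_bound[where S="cball y0 e" and f'="%y. 1-c * ldv G (u,y) (0,1)"])
  fix z assume z: "z : cball y0 e"
  have uz: "(u,z) : S" using e1(2)[OF in1[OF u z]] by simp
  have D: "(G has_derivative ldv G (u,z)) (at (u,z))"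
   using hol_deriv(1)[OF G uz] hol_frechet_eq_ldv[OF G uz] by simp
  have "((%z. (u,z)) has_derivative (%v. (0,v))) (at z)" by (auto intro!: derivative_eq_intros)
  from has_derivative_compose[OF this D]
  have "((%z. G (u,z)) has_derivative (%v. ldv G (u,z) (0,v))) (at z)" .
  moreover have "(%v. ldv G (u,z) (0,v)) = (*) (ldv G (u,z) (0,1))"
  proof
   fix v show "ldv G (u,z) (0,v) = ldv G (u,z) (0,1) * v"
    using ldv_cs[OF hol_imp_ghol[OF G] uz, of v "(0,1)"] by (simp add: cs.zero_right mult.commute)
  qed
  ultimately have "((%z. G (u,z)) has_field_derivative ldv G (u,z) (0,1)) (at z)"
   by (simp add: has_field_derivative_def)
  then show "(N u has_field_derivative 1-c * ldv G (u,z) (0,1)) (at z within cball y0 e)"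
   unfolding N_def
   by (intro has_field_derivative_at_within[OF DERIV_diff[OF DERIV_ident DERIV_cmult]])
  show "cmod (1-c * ldv G (u,z) (0,1)) <= 1/2"
   using e1(2)[OF in1[OF u z]] by simp
 qed (use y in auto)
 have "isCont G (u0,y0)" using hol_continuous_on[OF G] oS S by (simp add: continuous_on_eq_continuous_at)
 then have "isCont (%u. G (u,y0)) u0"
  using isCont_o2[of u0 "%u. (u,y0)" G] by (simp add: continuous_intros)
 then have "isCont (%u. cmod (c * G (u,y0))) u0" by (intro continuous_intros)
 then have "((%u. cmod (c * G (u,y0))) \<longlongrightarrow> cmod (c * G (u0,y0))) (nhds u0)"
  by (simp add: continuous_at tendsto_nhds_iff)
 then have "\<forall>\<^sub>F u in nhds u0. cmod (c * G (u,y0)) < e/4"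
  using G0 e by (intro order_tendstoD(2)) auto
 then obtain dl' where dl': "dl' > 0" "!!u. dist u u0 < dl' ==> cmod (c * G (u,y0)) < e/4"
  unfolding eventually_nhds_metric by blast
 define dl where "dl = min dl' (e1/3)"
 define U where "U = ball u0 dl"
 have U: "open U" "u0 : U" using dl' e1 by (auto simp: U_def dl_def)
 have Ub: "u : ball u0 (e1/3)" "cmod (N u y0-y0) < e/4" if "u : U" for u
  using that dl'(2)[of u] by (auto simp: U_def dl_def N_def dist_commute norm_minus_commute)
 have y0c: "y0 : cball y0 e" using e by simp
 \<comment> \<open>The centre moves by less than \<open>e/4\<close> and the contraction contributes
   at most half of \<open>e/2\<close>, so the half-size ball is mapped into itself.\<close>
 have self: "N u y : cball y0 (e/2)" if u: "u : U" and y: "y : cball y0 (e/2)" for u y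
 proof -
  have "cmod (N u y-N u y0) <= 1/2 * cmod (y-y0)"
   using y e by (intro contr Ub(1)[OF u]) auto
  moreover have "cmod (y-y0) <= e/2" using y by (simp add: dist_norm norm_minus_commute)
  ultimately have "cmod (N u y-y0) <= e/2"
   using norm_triangle_sub[of "N u y-y0" "N u y0-y0"] Ub(2)[OF u] by (simp add: algebra_simps)
  then show ?thesis by (simp add: dist_norm norm_minus_commute)
 qed
 have half: "cball y0 (e/2) <= cball y0 e" using e by auto
 have "\<exists>!y\<in>cball y0 (e/2). N u y = y" if u: "u : U" for u
 proof (rule Banach_fix[where c="1/2"])
  show "complete (cball y0 (e/2))" by (simp add: complete_eq_closed)
  show "N u ` cball y0 (e/2) <= cball y0 (e/2)" using self[OF u] by blast
  show "dist (N u x) (N u y) <= 1/2 * dist x y" if "x : cball y0 (e/2)" "y : cball y0 (e/2)" for x y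
   using contr[OF Ub(1)[OF u]] half that unfolding dist_norm[of "N u x"] dist_norm[of x] by blast
 qed (use e in auto)
 then obtain g where g: "!!u. u : U ==> g u : cball y0 (e/2)" "!!u. u : U ==> N u (g u) = g u"
  by metis
 have sol: "y = g u \<longleftrightarrow> G (u,y) = 0" if u: "u : U" and y: "y : ball y0 e" for u y
 proof -
  have "G (u,y) = 0 \<longleftrightarrow> N u y = y" using c0 by (simp add: N_def)
  also have "... \<longleftrightarrow> y = g u"
  proof
   assume "N u y = y"
   then have "cmod (y-g u) <= 1/2 * cmod (y-g u)"
    using contr[OF Ub(1)[OF u], of y "g u"] g(1)[OF u] g(2)[OF u] y half by auto
   then show "y = g u" by simp
  qed (use g(2) u in auto)
  finally show ?thesis by simp
 qed
 \<comment> \<open>Banach's theorem gives \<open>g\<close> without any regularity in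
   \<open>u\<close>. Holomorphy comes from the iterates, which are holomorphic and converge
   uniformly.\<close>
 define ph where "ph n u = (N u ^^ n) y0" for n u
 have phS: "ph (Suc n) u = N u (ph n u)" for n u by (simp add: ph_def)
 have phin: "ph n u : cball y0 (e/2)" if "u : U" for n u
  by (induction n) (insert self[OF that] e, auto simp: ph_def)
 have inS: "(u,y) : S" if "u : U" "y : cball y0 e" for u y
  using e1(2)[OF in1[OF Ub(1)[OF that(1)] that(2)]] by simp
 have phhol: "hol U (ph n)" for n
 proof (induction n)
  case 0 then show ?case using U by (simp add: ph_def)
 next
  case (Suc n)
  have "hol U (%u. ph n u-c * G (u,ph n u))"
   by (intro hol_diff Suc hol_mult hol_const hol_compose[OF G] hol_Pair hol_id U)
    (use inS subsetD[OF half phin] in blast)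
  then show ?case by (simp add: phS[abs_def] N_def)
 qed
 have conv: "cmod (ph n u-g u) <= (1/2)^n * (2*e)" if u: "u : U" for n u
 proof (induction n)
  case 0 then show ?case using g(1)[OF u] e by (simp add: ph_def dist_norm)
 next
  case (Suc n)
  have "cmod (ph (Suc n) u-g u) = cmod (N u (ph n u)-N u (g u))" by (simp add: phS g(2)[OF u])
  also have "... <= 1/2 * cmod (ph n u-g u)"
   by (intro contr Ub(1)[OF u] subsetD[OF half] phin[OF u] g(1)[OF u])
  finally show ?case using Suc by simp
 qed
 have ul: "uniform_limit U ph g sequentially"
 proof (rule uniform_limitI)
  fix ep :: real assume "ep > 0"
  have "(%n. (1/2)^n * (2*e)) \<longlonglongrightarrow> 0*(2*e)"
   by (intro tendsto_intros) auto
  then have "\<forall>\<^sub>F n in sequentially. (1/2)^n * (2*e) < ep" using \<open>ep>0\<close> by (intro order_tendstoD) auto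
  then show "\<forall>\<^sub>F n in sequentially. ALL u:U. dist (ph n u) (g u) < ep"
  proof eventually_elim
   case (elim n)
   show ?case
   proof
    fix u assume "u : U"
    from conv[OF this, of n] elim show "dist (ph n u) (g u) < ep" unfolding dist_norm by linarith
   qed
  qed
 qed
 have holg: "hol U g"
  by (rule hol_uniform_limit[of sequentially _ ph]) (use U ul phhol in auto)
 have gb: "g u : ball y0 e" if "u : U" for u using g(1)[OF that] e by auto
 show ?thesis
 proof (rule that[of U e g])
  show "g u0 = y0" using sol[OF U(2), of y0] G0 e by simp
  show "ALL u:U. ALL y:ball y0 e. (u,y) : S & (G (u,y) = 0 \<longleftrightarrow> y = g u)"
  proof (intro ballI)
   fix u y assume uy: "u : U" "y : ball y0 e"
   show "(u,y) : S & (G (u,y) = 0 \<longleftrightarrow> y = g u)"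
    using sol[OF uy] inS[OF uy(1), of y] uy(2) by auto
  qed
 qed (use U e holg gb in auto)
qed

subsection \<open>Functions smooth up to the boundary\<close>

text \<open>With the flag \<open>cl\<close> set, all derivatives are complex linear. Derivatives within
 \<open>S\<close> need not be unique at boundary points, hence the coinductive definition by some choice
 of derivatives.\<close>

coinductive bsm :: "bool => 'a::cvec set => ('a => complex) => bool" for cl S where
 bsmI: "(!!y. y : S ==> (f has_derivative (%v. f' v y)) (at y within S)) ==>
  (!!y. cl ==> y : S ==> clin (%v. f' v y)) ==> (!!v. bsm cl S (f' v)) ==> bsm cl S f"

definition hasder :: "bool => 'a::cvec set => ('a => complex) => ('a => 'a => complex) => bool" where
 "hasder cl S f f' \<longleftrightarrow> (ALL y:S. (f has_derivative (%v. f' v y)) (at y within S) & (cl --> clin (%v. f' v y)))"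

lemma bsmE:
 assumes "bsm cl S f" and that: "!!f'. hasder cl S f f' ==> (!!v. bsm cl S (f' v)) ==> P"
 shows P
 using assms(1)
proof (cases rule: bsm.cases)
 case (bsmI f')
 then show ?thesis by (intro assms(2)[of f']) (auto simp: hasder_def)
qed

lemma bsm_coinduct_set:
 assumes "R f" "!!f. R f ==> EX f'. hasder cl S f f' & (ALL v. R (f' v) | bsm cl S (f' v))"
 shows "bsm cl S f"
 using assms(1)
proof (coinduction arbitrary: f rule: bsm.coinduct)
 case bsm
 then obtain f' where "hasder cl S f f'" "ALL v. R (f' v) | bsm cl S (f' v)" using assms(2) by blast
 then show ?case unfolding hasder_def by (intro exI[of _ f] exI[of _ f']) auto
qed

lemma hasder_subset: "hasder cl S f f' ==> T <= S ==> hasder cl T f f'"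
 unfolding hasder_def using has_derivative_subset by blast

lemma bsm_continuous_on: "bsm cl S f ==> continuous_on S f"
 by (erule bsmE) (auto simp: hasder_def continuous_on_eq_continuous_within intro: has_derivative_continuous)

lemma bsm_subset: 
 assumes "bsm cl S f" "T <= S" shows "bsm cl T f"
proof (rule bsm_coinduct_set[of "bsm cl S"])
 fix g assume "bsm cl S g"
 with assms(2) show "EX f'. hasder cl T g f' & (ALL v. bsm cl S (f' v) | bsm cl T (f' v))"
  by (metis bsmE hasder_subset)
qed (rule assms(1))

lemma bsm_cong:
 assumes "bsm cl S f" "!!x. x : S ==> f x = g x" shows "bsm cl S g"
proof -
 obtain f' where f': "hasder cl S f f'" "!!v. bsm cl S (f' v)" using assms(1) by (rule bsmE) blast
 then have "hasder cl S g f'"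
  unfolding hasder_def using has_derivative_transform[of _ S g f] assms(2) by metis
 then show ?thesis using f'(2) by (intro bsmI[of S g f']) (auto simp: hasder_def)
qed

lemma hol_hasder:
 fixes f :: "'a::cvec => complex"
 shows "hol S f ==> hasder cl S f (%v y. ldv f y v)"
 unfolding hasder_def
 using ghol_has_derivative[of S f] by (auto simp: ghol_iff_hol intro: has_derivative_at_withinI)

lemma hol_imp_bsm: "hol S f ==> bsm cl S f"
 by (rule bsm_coinduct_set[of "hol S"]) (use hol_hasder hol_ldv in blast)+

lemma bsm_const [intro, simp]: "bsm cl S (%_. c)"
 by (rule bsm_coinduct_set[of "%f. EX c. f = (%_. c)"])
  (auto simp: hasder_def clin_def intro!: exI[of _ "%_ _. 0"])

text \<open>The derivative of a product is a sum of products, and that of an inverse contains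
  inverses again. Closing under all operations at once gives a class stable under differentiation,
  as the coinduction needs.\<close>

inductive balg :: "bool => 'a::cvec set => ('a => complex) => bool" for cl S where
 balg_base: "bsm cl S f ==> balg cl S f"
| balg_add: "balg cl S f ==> balg cl S g ==> balg cl S (%x. f x+g x)"
| balg_mult: "balg cl S f ==> balg cl S g ==> balg cl S (%x. f x * g x)"
| balg_inverse: "balg cl S f ==> (ALL x:S. f x ~= 0) ==> balg cl S (%x. inverse (f x))"

lemma clin_add: "clin f ==> clin g ==> clin (%v. f v+g v)"
 and clin_mult_const: "clin h ==> clin (%v. (a::complex) * h v * b)"
 by (simp_all add: clin_def cs_add_right)

lemma hasder_add: "hasder cl S f f' ==> hasder cl S g g' ==> hasder cl S (%x. f x+g x) (%v x. f' v x+g' v x)"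
 by (auto simp: hasder_def intro!: has_derivative_add clin_add)

lemma hasder_mult: 
 assumes "hasder cl S f f'" "hasder cl S g g'"
 shows "hasder cl S (%x. f x * g x) (%v x. f x * g' v x+f' v x * g x)"
 unfolding hasder_def
proof (intro ballI conjI impI)
 fix y assume y: "y : S"
 then show "((%x. f x * g x) has_derivative (%v. f y * g' v y+f' v y * g y)) (at y within S)"
  using assms by (intro has_derivative_mult) (auto simp: hasder_def)
 show "clin (%v. f y * g' v y+f' v y * g y)" if cl
  using assms y that clin_mult_const[of "%v. g' v y" "f y" 1] clin_mult_const[of "%v. f' v y" 1 "g y"]
  by (intro clin_add) (auto simp: hasder_def)
qed

lemma hasder_inverse: 
 assumes "hasder cl S f f'" "ALL x:S. f x ~= 0"
 shows "hasder cl S (%x. inverse (f x)) (%v x. - 1*(inverse (f x) * f' v x * inverse (f x)))"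
 unfolding hasder_def
proof (intro ballI conjI impI)
 fix y assume y: "y : S"
 have "((%x. inverse (f x)) has_derivative (%v. - (inverse (f y) * f' v y * inverse (f y)))) (at y within S)"
  using assms y Deriv.has_derivative_inverse[of f y "%v. f' v y" S] by (auto simp: hasder_def)
 then show "((%x. inverse (f x)) has_derivative (%v. - 1*(inverse (f y) * f' v y * inverse (f y)))) (at y within S)"
  by simp
 show "clin (%v. - 1*(inverse (f y) * f' v y * inverse (f y)))" if cl
  using assms y that clin_mult_const[of "%v. f' v y" "- inverse (f y)" "inverse (f y)"]
  by (auto simp: hasder_def mult.assoc)
qed

lemma balg_hasder: "balg cl S f ==> EX f'. hasder cl S f f' & (ALL v. balg cl S (f' v))"
proof (induction rule: balg.induct)
 case (balg_base f) then show ?case by (metis bsmE balg.balg_base)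
next
 case (balg_add f g) then show ?case using hasder_add balg.balg_add by blast
next
 case (balg_mult f g)
 then obtain f' g' where "hasder cl S f f'" "ALL v. balg cl S (f' v)" "hasder cl S g g'" "ALL v. balg cl S (g' v)" by blast
 then show ?case using hasder_mult balg_mult(1,2)
  by (intro exI[of _ "%v x. f x * g' v x+f' v x * g x"]) (auto intro!: balg.balg_add balg.balg_mult)
next
 case (balg_inverse f)
 then obtain f' where f': "hasder cl S f f'" "ALL v. balg cl S (f' v)" by blast
 have "balg cl S (%x. - 1*(inverse (f x) * f' v x * inverse (f x)))" for v
  using balg_inverse(1,2) f'(2)
  by (intro balg.balg_mult balg.balg_inverse balg.balg_base[OF bsm_const]) auto
 then show ?case using hasder_inverse[OF f'(1) balg_inverse(2)] by blast
qed

lemma balg_imp_bsm: "balg cl S f ==> bsm cl S f"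
 by (rule bsm_coinduct_set[of "balg cl S"]) (use balg_hasder in blast)+

lemma bsm_add [intro]: "bsm cl S f ==> bsm cl S g ==> bsm cl S (%x. f x+g x)"
 by (rule balg_imp_bsm[OF balg_add[OF balg_base balg_base]])

lemma bsm_mult [intro]: "bsm cl S f ==> bsm cl S g ==> bsm cl S (%x. f x * g x)"
 by (rule balg_imp_bsm[OF balg_mult[OF balg_base balg_base]])

lemma bsm_inverse [intro]: "bsm cl S f ==> (!!x. x : S ==> f x ~= 0) ==> bsm cl S (%x. inverse (f x))"
 by (rule balg_imp_bsm[OF balg_inverse[OF balg_base]]) auto

lemma bsm_diff [intro]: "bsm cl S f ==> bsm cl S g ==> bsm cl S (%x. f x-g x)"
 using bsm_add[of cl S f "%x. - 1 * g x"] bsm_mult[of cl S "%_. - 1" g] by simp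

lemma bsm_uminus [intro]: "bsm cl S f ==> bsm cl S (%x. - f x)"
 using bsm_diff[of cl S "%_. 0" f] by simp

lemma bsm_sum [intro]: "(!!i. i : I ==> bsm cl S (f i)) ==> bsm cl S (%x. \<Sum>i\<in>I. f i x)"
 by (induction I rule: infinite_finite_induct) auto

lemma bsm_prod [intro]: "(!!i. i : I ==> bsm cl S (f i)) ==> bsm cl S (%x. \<Prod>i\<in>I. f i x)"
 by (induction I rule: infinite_finite_induct) auto

lemma bsm_power [intro]: "bsm cl S f ==> bsm cl S (%x. f x^n)"
 by (induction n) auto

lemma bsm_divide [intro]:
 "bsm cl S f ==> bsm cl S g ==> (!!x. x : S ==> g x ~= 0) ==> bsm cl S (%x. f x/g x)"
 unfolding divide_inverse by (intro bsm_mult bsm_inverse)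

text \<open>A class that the chain rule does not leave: differentiating \<open>g (q x)\<close>
  produces sums of products of coordinates of the derivative of \<open>q\<close> with derivatives of
  \<open>g\<close> composed with \<open>q\<close>.\<close>

inductive bcomp :: "bool => 'a::cvec set => 'b::cvec set => ('a => 'b) => ('a => complex) => bool" for cl A T q where
 bcomp_base: "bsm cl A f ==> bcomp cl A T q f"
| bcomp_comp: "bsm cl T g ==> bcomp cl A T q (%x. g (q x))"
| bcomp_add: "bcomp cl A T q f ==> bcomp cl A T q g ==> bcomp cl A T q (%x. f x+g x)"
| bcomp_mult: "bcomp cl A T q f ==> bcomp cl A T q g ==> bcomp cl A T q (%x. f x * g x)"

lemma bcomp_sum: "finite I ==> (!!i. i : I ==> bcomp cl A T q (f i)) ==> bcomp cl A T q (%x. \<Sum>i\<in>I. f i x)"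
 by (induction I rule: finite_induct) (auto intro: bcomp.intros)

text \<open>The functionals \<open>l i\<close> are coordinates with respect to the vectors \<open>e i\<close>: real ones if
 \<open>cl\<close> is false, complex ones otherwise.\<close>

lemma bsm_compose:
 fixes l :: "'i => 'b::cvec => complex" and e :: "'i => 'b" and q :: "'a::cvec => 'b"
 assumes I: "finite I"
  and rep: "!!L u. linear L ==> (cl ==> clin L) ==> L u = (\<Sum>i\<in>I. l i u * L (e i))"
  and q: "!!y. y : A ==> (q has_derivative (%v. q' v y)) (at y within A)"
  and qc: "!!y. cl ==> y : A ==> clin (%v. q' v y)"
  and l: "!!v i. i : I ==> bsm cl A (%y. l i (q' v y))"
  and qT: "!!y. y : A ==> q y : T" and g: "bsm cl T g"
 shows "bsm cl A (%y. g (q y))"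
proof (rule bsm_coinduct_set[of "bcomp cl A T q"])
 show "bcomp cl A T q (%y. g (q y))" using g by (rule bcomp_comp)
 fix f assume "bcomp cl A T q f"
 then have "EX f'. hasder cl A f f' & (ALL v. bcomp cl A T q (f' v))"
 proof (induction rule: bcomp.induct)
  case (bcomp_base f) then show ?case by (metis bsmE bcomp.bcomp_base)
 next
  case (bcomp_comp g)
  then obtain g' where g': "hasder cl T g g'" "!!v. bsm cl T (g' v)" by (rule bsmE) blast
  have "hasder cl A (%x. g (q x)) (%v y. \<Sum>i\<in>I. l i (q' v y) * g' (e i) (q y))"
   unfolding hasder_def
  proof (intro ballI conjI impI)
   fix y assume y: "y : A"
   have dg: "(g has_derivative (%v. g' v (q y))) (at (q y) within T)" and cg: "cl ==> clin (%v. g' v (q y))"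
    using g'(1) qT[OF y] by (auto simp: hasder_def)
   have "(g has_derivative (%v. g' v (q y))) (at (q y) within q ` A)"
    by (rule has_derivative_subset[OF dg]) (use qT in auto)
   from has_derivative_in_compose[OF q[OF y] this]
   have *: "((%x. g (q x)) has_derivative (%v. g' (q' v y) (q y))) (at y within A)" .
   have r: "g' u (q y) = (\<Sum>i\<in>I. l i u * g' (e i) (q y))" for u
    by (rule rep[of "%v. g' v (q y)"]) (insert dg cg, auto intro: has_derivative_linear)
   show "((%x. g (q x)) has_derivative (%v. \<Sum>i\<in>I. l i (q' v y) * g' (e i) (q y))) (at y within A)"
    using * unfolding r[of "q' _ y"] .
   show "clin (%v. \<Sum>i\<in>I. l i (q' v y) * g' (e i) (q y))" if cl
    using qc[OF that y] cg[OF that] unfolding clin_def r[of "q' _ y", symmetric] by simp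
  qed
  moreover have "bcomp cl A T q (%y. \<Sum>i\<in>I. l i (q' v y) * g' (e i) (q y))" for v
   by (intro bcomp_sum I bcomp_mult bcomp.bcomp_base bcomp.bcomp_comp l g')
  ultimately show ?case by blast
 next
  case (bcomp_add f g) then show ?case using hasder_add bcomp.bcomp_add by blast
 next
  case (bcomp_mult f g)
  then obtain f' g' where "hasder cl A f f'" "ALL v. bcomp cl A T q (f' v)" "hasder cl A g g'" "ALL v. bcomp cl A T q (g' v)" by blast
  then show ?case using hasder_mult bcomp_mult(1,2)
   by (intro exI[of _ "%v x. f x * g' v x+f' v x * g x"]) (auto intro!: bcomp.bcomp_add bcomp.bcomp_mult)
 qed
 then show "EX f'. hasder cl A f f' & (ALL v. bcomp cl A T q (f' v) | bsm cl A (f' v))" by blast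
qed

lemma bsm_cnj: "bsm False S f ==> bsm False S (%x. cnj (f x))"
proof (rule bsm_coinduct_set[of "%h. EX f. bsm False S f & h = (%x. cnj (f x))"])
 fix h assume "EX f. bsm False S f & h = (%x. cnj (f x))"
 then obtain f where f: "bsm False S f" "h = (%x. cnj (f x))" by blast
 from f(1) obtain f' where f': "hasder False S f f'" "!!v. bsm False S (f' v)" by (rule bsmE) blast
 then have "hasder False S h (%v x. cnj (f' v x))"
  using f by (auto simp: hasder_def intro!: has_derivative_cnj)
 then show "EX f'. hasder False S h f' & (ALL v. (EX f. bsm False S f & f' v = (%x. cnj (f x))) | bsm False S (f' v))"
  using f'(2) by blast
qed auto

text \<open>Two conjugations restore complex linearity of all derivatives. This is what makes the
  reflected map holomorphic rather than antiholomorphic.\<close>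

lemma bsm_conjugate:
 fixes cj :: "'a::cvec => 'a"
 assumes cj: "bounded_linear cj" "!!c x. cj (cs c x) = cs (cnj c) (cj x)"
  and "bsm True S f"
 shows "bsm True {x. cj x : S} (%x. cnj (f (cj x)))"
proof (rule bsm_coinduct_set[of "%h. EX f. bsm True S f & h = (%x. cnj (f (cj x)))"])
 fix h assume "EX f. bsm True S f & h = (%x. cnj (f (cj x)))"
 then obtain f where f: "bsm True S f" "h = (%x. cnj (f (cj x)))" by blast
 from f(1) obtain f' where f': "hasder True S f f'" "!!v. bsm True S (f' v)" by (rule bsmE) blast
 have "hasder True {x. cj x : S} h (%v x. cnj (f' (cj v) (cj x)))"
  unfolding hasder_def
 proof (intro ballI conjI impI)
  fix y assume y: "y : {x. cj x : S}"
  then have d: "(f has_derivative (%v. f' v (cj y))) (at (cj y) within S)" and c: "clin (%v. f' v (cj y))"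
   using f'(1) by (auto simp: hasder_def)
  have "(f has_derivative (%v. f' v (cj y))) (at (cj y) within cj ` {x. cj x : S})"
   by (rule has_derivative_subset[OF d]) auto
  from has_derivative_in_compose[OF bounded_linear_imp_has_derivative[OF cj(1)] this]
  show "(h has_derivative (%v. cnj (f' (cj v) (cj y)))) (at y within {x. cj x : S})"
   unfolding f(2) by (rule has_derivative_cnj)
  show "clin (%v. cnj (f' (cj v) (cj y)))"
   using c by (auto simp: clin_def cj(2))
 qed
 then show "EX f'. hasder True {x. cj x : S} h f' & (ALL v. (EX f. bsm True S f & f' v = (%x. cnj (f (cj x)))) | bsm True {x. cj x : S} (f' v))"
  using f'(2) by (intro exI[of _ "%v x. cnj (f' (cj v) (cj x))"]) auto
qed (use assms(3) in auto)

lemma smooth_on_imp_bsm: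
 fixes f :: "'a::cvec => 'b::real_normed_vector"
 assumes "smooth_on U f" "bounded_linear l"
 shows "bsm False U (%x. l (f x))"
proof (rule bsm_coinduct_set[of "%h. EX f. smooth_on U f & h = (%x. l (f x))"])
 fix h assume "EX f. smooth_on U f & h = (%x. l (f x))"
 then obtain f where f: "smooth_on U f" "h = (%x. l (f x))" by blast
 have C: "Ck (Suc k) U f" for k using f by (simp add: smooth_on_def del: Ck.simps)
 have d: "(f has_derivative frechet_derivative f (at x)) (at x)" if "x : U" for x
  using C[of 0] that by (simp add: frechet_derivative_works[symmetric])
 have "hasder False U h (%v x. l (frechet_derivative f (at x) v))"
  unfolding hasder_def f(2)
 proof (intro ballI conjI impI)
  fix y assume "y : U"
  show "((%x. l (f x)) has_derivative (%v. l (frechet_derivative f (at y) v))) (at y within U)"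
   by (rule has_derivative_at_withinI[OF bounded_linear.has_derivative[OF assms(2) d[OF \<open>y \<in> U\<close>]]])
 qed simp
 moreover have "smooth_on U (%x. frechet_derivative f (at x) v)" for v
  using C f(1) by (simp add: smooth_on_def)
 ultimately show "EX f'. hasder False U h f' & (ALL v. (EX f. smooth_on U f & f' v = (%x. l (f x))) | bsm False U (f' v))"
  by (intro exI[of _ "%v x. l (frechet_derivative f (at x) v)"]) blast
qed (use assms in auto)

lemma bsm_open:
 assumes "open S" "bsm cl S f"
 shows "!!x. x : S ==> (f has_derivative frechet_derivative f (at x)) (at x)"
  and "bsm cl S (%x. frechet_derivative f (at x) v)"
proof -
 from assms(2) obtain f' where f': "hasder cl S f f'" "!!v. bsm cl S (f' v)" by (rule bsmE) blast
 have d: "(f has_derivative (%v. f' v x)) (at x)" if "x : S" for x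
  using f'(1) that unfolding hasder_def at_within_open[OF that assms(1)] by (auto simp: at_within_open[OF that assms(1)])
 then have e: "frechet_derivative f (at x) = (%v. f' v x)" if "x : S" for x
  using frechet_derivative_at that by metis
 show "(f has_derivative frechet_derivative f (at x)) (at x)" if "x : S" for x
  using d[OF that] e[OF that] by simp
 show "bsm cl S (%x. frechet_derivative f (at x) v)"
  by (rule bsm_cong[OF f'(2)[of v]]) (simp add: e)
qed

subsection \<open>Wirtinger derivatives\<close>

abbreviation fd :: "('a::real_normed_vector => 'b::real_normed_vector) => 'a => 'a => 'b" where
 "fd f x v \<equiv> frechet_derivative f (at x) v"

text \<open>The derivative splits into its antilinear part \<open>wb\<close> and its complex linear
  part \<open>wd\<close> in the direction; \<open>wb u f\<close> is the form dbar \<open>f\<close>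
  evaluated on \<open>u\<close>.\<close>

definition wb :: "'a::cvec => ('a => complex) => 'a => complex" where
 "wb u f x = (fd f x u+\<i> * fd f x (cs \<i> u))/2"

definition wd :: "'a::cvec => ('a => complex) => 'a => complex" where
 "wd u f x = (fd f x u-\<i> * fd f x (cs \<i> u))/2"

lemma fd_eq_wd_wb: "fd f x u = wd u f x+wb u f x"
 by (simp add: wb_def wd_def field_simps)

lemma fd_eqI: "(f has_derivative f') (at x) ==> fd f x v = f' v"
 by (metis frechet_derivative_at)

lemma cs_split: "cs c v = Re c *R v+Im c *R cs \<i> v"
proof -
 have "cs c v = cs (of_real (Re c) + of_real (Im c) * \<i>) v"
  by (metis complex_eq mult.commute)
 then show ?thesis by (simp add: cs_add_left flip: cs_cs)
qed

lemma linear_cs: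
 fixes L :: "'a::cvec => 'b::real_vector"
 assumes "linear L" shows "L (cs c v) = Re c *R L v+Im c *R L (cs \<i> v)"
 unfolding cs_split[of c v] using assms by (simp add: linear_add linear_scale)

lemma cs_i_i [simp]: "cs \<i> (cs \<i> v) = - v"
 by (simp add: cs.minus_left)

lemma wb_form_cs:
 fixes L :: "'a::cvec => complex"
 assumes "linear L"
 shows "L (cs c v)+\<i> * L (cs \<i> (cs c v)) = cnj c * (L v+\<i> * L (cs \<i> v))"
proof -
 have 1: "L (cs c v) = Re c * L v+Im c * L (cs \<i> v)"
  using linear_cs[OF assms, of c v] by (simp add: scaleR_conv_of_real)
 have "L (cs \<i> (cs c v)) = L (cs c (cs \<i> v))" by (simp add: mult.commute)
 also have "... = Re c * L (cs \<i> v)-Im c * L v"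
  using linear_cs[OF assms, of c "cs \<i> v"] assms by (simp add: scaleR_conv_of_real linear_neg)
 finally have 2: "L (cs \<i> (cs c v)) = Re c * L (cs \<i> v)-Im c * L v" .
 have 3: "cnj c = Re c-Im c * \<i>" by (simp add: complex_eq_iff)
 show ?thesis unfolding 1 2 unfolding 3 by (simp add: algebra_simps)
qed

lemma clin_if_wb_zero:
 assumes "linear L" "!!u. L u+\<i> * L (cs \<i> u) = (0::complex)"
 shows "clin L"
 unfolding clin_def
proof (intro allI)
 fix c v
 have "L (cs \<i> v) = \<i> * L v"
 proof -
  have "\<i> * (L v+\<i> * L (cs \<i> v)) = 0" using assms(2)[of v] by simp
  then show ?thesis by (simp add: algebra_simps)
 qed
 then show "L (cs c v) = cs c (L v)"
  using linear_cs[OF assms(1), of c v]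
  by (simp add: scaleR_conv_of_real complex_eq_iff)
qed

lemma has_vector_derivative_line:
 assumes "(f has_derivative f') (at (x+s *R v))"
 shows "((%s. f (x+s *R v)) has_vector_derivative f' v) (at s)"
proof -
 have "((%s. x+s *R v) has_derivative (%h. h *R v)) (at s)"
  by (auto intro!: derivative_eq_intros)
 from has_derivative_compose[OF this assms]
 show ?thesis
  using linear_scale[OF has_derivative_linear[OF assms]] by (simp add: has_vector_derivative_def)
qed

lemma vector_derivative_bound_segment:
 fixes g :: "real => 'b::real_normed_vector"
 assumes "0 <= s" "!!t. t : {0..s} ==> (g has_vector_derivative g' t) (at t)" "!!t. t : {0..s} ==> norm (g' t) <= B"
 shows "norm (g s-g 0) <= B * s"
proof -
 have "norm (g s-g 0) <= B * norm (s-0)"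
 proof (rule differentiable_bound)
  show "(g has_derivative (%h. h *R g' t)) (at t within {0..s})" if "t : {0..s}" for t
   using assms(2)[OF that] by (simp add: has_vector_derivative_def has_derivative_at_withinI)
  show "onorm (%h. h *R g' t) <= B" if "t : {0..s}" for t
   by (rule onorm_bound)
    (use assms(3)[OF that] order_trans[OF norm_ge_zero assms(3)[OF that]] mult_left_mono[OF assms(3)[OF that], of "(abs _)"]
     in \<open>auto simp: mult.commute\<close>)
 qed (use assms in auto)
 then show ?thesis using assms(1) by simp
qed

text \<open>The second difference of \<open>f\<close> along \<open>s *R u\<close> and
  \<open>s *R v\<close> is symmetric in \<open>u\<close> and \<open>v\<close>. Two mean value
  estimates compare it with \<open>s * s\<close> times either mixed derivative, up to an arbitrarily
  small multiple of \<open>s * s\<close>.\<close>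

lemma fd_sym:
 fixes f :: "'a::cvec => complex"
 assumes N: "open N" and f: "bsm cl N f" and x: "x : N"
 shows "fd (%y. fd f y u) x v = fd (%y. fd f y v) x u"
proof -
 note D1 = bsm_open(1)[OF N f] and B1 = bsm_open(2)[OF N f]
 note D2 = bsm_open(1)[OF N B1] and B2 = bsm_open(2)[OF N B1]
 define m where "m = norm u+norm v+1"
 have m: "m > 0" unfolding m_def by (smt (verit) norm_ge_zero)
 have key: "EX d>0. ALL s. 0 < s --> s < d -->
   cmod (f (x+s *R u+s *R v)-f (x+s *R u)-f (x+s *R v)+f x-of_real (s * s) * fd (%y. fd f y u) x v) <= e * s * s"
  if e: "e > 0" and uv: "norm u+norm v+1 <= m" for e u v
 proof -
  define A where "A = fd (%y. fd f y u) x v"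
  have "isCont (%y. fd (%y. fd f y u) y v) x"
   using bsm_continuous_on[OF B2] N x by (simp add: continuous_on_eq_continuous_at)
  then obtain r1 where r1: "r1 > 0" "!!y. dist y x < r1 ==> dist (fd (%y. fd f y u) y v) A < e"
   unfolding continuous_at_eps_delta A_def using e by blast
  obtain r2 where r2: "r2 > 0" "ball x r2 <= N" using N x open_contains_ball by blast
  define d where "d = min r1 r2/m"
  have "d > 0" using r1 r2 m by (simp add: d_def)
  moreover have "cmod (f (x+s *R u+s *R v)-f (x+s *R u)-f (x+s *R v)+f x-of_real (s * s) * A) <= e * s * s"
   if s: "0 < s" "s < d" for s
  proof -
   have near: "dist (x+sx *R u+ta *R v) x < min r1 r2" if "sx : {0..s}" "ta : {0..s}" for sx ta
   proof -
    have "dist (x+sx *R u+ta *R v) x = norm (sx *R u+ta *R v)" by (simp add: dist_norm add.assoc)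
    also have "... <= sx * norm u+ta * norm v" using that norm_triangle_ineq[of "sx *R u" "ta *R v"] by simp
    also have "... <= s * norm u+s * norm v" using that by (intro add_mono mult_right_mono) auto
    also have "... <= s * m" using s uv by (simp flip: distrib_left)
    also have "... < min r1 r2" using s m by (simp add: d_def pos_less_divide_eq)
    finally show ?thesis .
   qed
   have inN: "x+sx *R u+ta *R v : N" if "sx : {0..s}" "ta : {0..s}" for sx ta
   proof -
    have "x+sx *R u+ta *R v : ball x r2" using near[OF that] by (simp add: dist_commute)
    then show ?thesis using r2(2) by blast
   qed
   have inner: "cmod (fd f (x+sx *R u+s *R v) u-fd f (x+sx *R u) u-of_real s * A) <= e * s" if sx: "sx : {0..s}" for sx
   proof -
    define g where "g ta = fd f (x+sx *R u+ta *R v) u-ta *R A" for ta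
    have "norm (g s-g 0) <= e * s"
    proof (rule vector_derivative_bound_segment)
     fix ta assume ta: "ta : {0..s}"
     show "(g has_vector_derivative fd (%y. fd f y u) (x+sx *R u+ta *R v) v-A) (at ta)"
      unfolding g_def using has_vector_derivative_line[OF D2[OF inN[OF sx ta]]]
      by (auto intro!: derivative_eq_intros)
     show "norm (fd (%y. fd f y u) (x+sx *R u+ta *R v) v-A) <= e"
      using r1(2)[of "x+sx *R u+ta *R v"] near[OF sx ta] by (simp add: dist_norm)
    qed (use s in auto)
    then show ?thesis by (simp add: g_def scaleR_conv_of_real algebra_simps)
   qed
   define h where "h sx = f (x+s *R v+sx *R u)-f (x+sx *R u)-sx *R (s *R A)" for sx
   have "norm (h s-h 0) <= e * s * s"
   proof (rule vector_derivative_bound_segment)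
    fix sx assume sx: "sx : {0..s}"
    have 1: "x+s *R v+sx *R u : N" using inN[OF sx, of s] s by (simp add: algebra_simps)
    have 2: "x+sx *R u : N" using inN[OF sx, of 0] s by simp
    show "(h has_vector_derivative fd f (x+s *R v+sx *R u) u-fd f (x+sx *R u) u-s *R A) (at sx)"
     unfolding h_def using has_vector_derivative_line[OF D1[OF 1]] has_vector_derivative_line[OF D1[OF 2]]
     by (auto intro!: derivative_eq_intros)
    show "norm (fd f (x+s *R v+sx *R u) u-fd f (x+sx *R u) u-s *R A) <= e * s"
     using inner[OF sx] by (simp add: scaleR_conv_of_real algebra_simps)
   qed (use s in auto)
   moreover have "h s-h 0 = f (x+s *R u+s *R v)-f (x+s *R u)-f (x+s *R v)+f x-of_real (s * s) * A"
    by (simp add: h_def scaleR_conv_of_real algebra_simps)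
   ultimately show ?thesis by simp
  qed
  ultimately show ?thesis unfolding A_def by blast
 qed
 have "cmod (fd (%y. fd f y u) x v-fd (%y. fd f y v) x u) <= e" if e: "e > 0" for e
 proof -
  have e2: "e/2 > 0" using e by simp
  obtain d1 where d1: "d1 > 0" "!!s. 0 < s ==> s < d1 ==> cmod (f (x+s *R u+s *R v)-f (x+s *R u)-f (x+s *R v)+f x-of_real (s * s) * fd (%y. fd f y u) x v) <= e/2 * s * s"
   using key[OF e2, of u v] unfolding m_def by auto
  obtain d2 where d2: "d2 > 0" "!!s. 0 < s ==> s < d2 ==> cmod (f (x+s *R v+s *R u)-f (x+s *R v)-f (x+s *R u)+f x-of_real (s * s) * fd (%y. fd f y v) x u) <= e/2 * s * s"
   using key[OF e2, of v u] unfolding m_def by auto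
  define s where "s = min d1 d2/2"
  have s: "0 < s" "s < d1" "s < d2" using d1 d2 by (auto simp: s_def)
  define \<Delta> where "\<Delta> = f (x+s *R u+s *R v)-f (x+s *R u)-f (x+s *R v)+f x"
  have "cmod (\<Delta> - of_real (s * s) * fd (%y. fd f y u) x v) <= e/2 * s * s"
   using d1(2)[OF s(1,2)] by (simp add: \<Delta>_def)
  moreover have "cmod (\<Delta> - of_real (s * s) * fd (%y. fd f y v) x u) <= e/2 * s * s"
   using d2(2)[OF s(1,3)] by (simp add: \<Delta>_def algebra_simps)
  ultimately have "cmod ((\<Delta> - of_real (s * s) * fd (%y. fd f y v) x u)-(\<Delta> - of_real (s * s) * fd (%y. fd f y u) x v)) <= e * s * s"
   using norm_triangle_ineq4 by (smt (verit) field_sum_of_halves distrib_right)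
  also have "(\<Delta> - of_real (s * s) * fd (%y. fd f y v) x u)-(\<Delta> - of_real (s * s) * fd (%y. fd f y u) x v)
    = of_real (s * s)*(fd (%y. fd f y u) x v-fd (%y. fd f y v) x u)" by (simp add: algebra_simps)
  finally have "(s * s) * cmod (fd (%y. fd f y u) x v-fd (%y. fd f y v) x u) <= (s * s) * e"
   using s by (simp add: norm_mult mult.commute mult.left_commute)
  then show ?thesis using s by simp
 qed
 then have "cmod (fd (%y. fd f y u) x v-fd (%y. fd f y v) x u) <= 0"
  by (metis dense_ge)
 then show ?thesis by simp
qed

context
 fixes N :: "'a::cvec set" assumes N: "open N"
begin

lemma fd_linear: "bsm cl N f ==> x : N ==> linear (frechet_derivative f (at x))"
 using bsm_open(1)[OF N] has_derivative_linear by blast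

lemma bsm_wb: "bsm False N f ==> bsm False N (wb u f)"
 unfolding wb_def[abs_def] by (intro bsm_divide bsm_add bsm_mult bsm_const bsm_open(2)[OF N]) auto

lemma bsm_wd: "bsm False N f ==> bsm False N (wd u f)"
 unfolding wd_def[abs_def] by (intro bsm_divide bsm_diff bsm_mult bsm_const bsm_open(2)[OF N]) auto

lemma fd_diff: "bsm False N f ==> bsm False N g ==> x : N ==> fd (%y. f y-g y) x v = fd f x v-fd g x v"
 by (rule fd_eqI) (intro has_derivative_diff bsm_open(1)[OF N])

lemma fd_mult: "bsm False N f ==> bsm False N g ==> x : N ==> fd (%y. f y * g y) x v = f x * fd g x v+fd f x v * g x"
 by (rule fd_eqI) (intro has_derivative_mult bsm_open(1)[OF N])

lemma wb_diff: "bsm False N f ==> bsm False N g ==> x : N ==> wb u (%y. f y-g y) x = wb u f x-wb u g x"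
 by (simp add: wb_def fd_diff field_simps)

lemma wb_mult: "bsm False N f ==> bsm False N g ==> x : N ==> wb u (%y. f y * g y) x = f x * wb u g x+wb u f x * g x"
 by (simp add: wb_def fd_mult field_simps)

lemma wb_cs: "bsm False N f ==> x : N ==> wb (cs c u) f x = cnj c * wb u f x"
 unfolding wb_def using wb_form_cs[OF fd_linear, of False f x c u] by simp

lemma fd_cong: 
 assumes "!!y. y : N ==> f y = g y" "x : N" shows "frechet_derivative f (at x) = frechet_derivative g (at x)"
proof -
 have "(f has_derivative D) (at x) \<longleftrightarrow> (g has_derivative D) (at x)" for D
  using has_derivative_transform_within_open[OF _ N assms(2)] assms(1) by metis
 then show ?thesis unfolding frechet_derivative_def by simp
qed

lemma fd_wb: "bsm False N f ==> x : N ==>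
  fd (wb u f) x v = (fd (%y. fd f y u) x v+\<i> * fd (%y. fd f y (cs \<i> u)) x v)/2"
 unfolding wb_def[abs_def]
 by (rule fd_eqI) (auto intro!: derivative_eq_intros bsm_open(1)[OF N bsm_open(2)[OF N]])

lemma fd_wd: "bsm False N f ==> x : N ==>
  fd (wd u f) x v = (fd (%y. fd f y u) x v-\<i> * fd (%y. fd f y (cs \<i> u)) x v)/2"
 unfolding wd_def[abs_def]
 by (rule fd_eqI) (auto intro!: derivative_eq_intros bsm_open(1)[OF N bsm_open(2)[OF N]])

lemma wb_wb_commute: "bsm False N f ==> x : N ==> wb u (wb v f) x = wb v (wb u f) x"
 unfolding wb_def[of _ "wb _ _"] fd_wb
 by (simp add: fd_sym[OF N, of False f x u] fd_sym[OF N, of False f x "cs \<i> u"] field_simps)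

lemma wb_wd_commute: "bsm False N f ==> x : N ==> wb u (wd v f) x = wd v (wb u f) x"
 unfolding wb_def[of _ "wd _ _"] wd_def[of _ "wb _ _"] fd_wb fd_wd
 by (simp add: fd_sym[OF N, of False f x u] fd_sym[OF N, of False f x "cs \<i> u"] field_simps)

end

subsection \<open>The Cauchy transform in polar coordinates\<close>

lemma continuous_on_linear_family:
 fixes D :: "'x::topological_space => complex => complex"
 assumes "!!x. x : S ==> linear (D x)" "!!v. continuous_on S (%x. D x v)" "continuous_on S h"
 shows "continuous_on S (%x. D x (h x))"
proof -
 have "D x (h x) = Re (h x) * D x 1+Im (h x) * D x \<i>" if "x : S" for x
  using linear_cs[OF assms(1)[OF that], of "h x" 1] by (simp add: scaleR_conv_of_real)
 moreover have "continuous_on S (%x. Re (h x) * D x 1+Im (h x) * D x \<i>)"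
  by (intro continuous_intros assms)
 ultimately show ?thesis by (simp cong: continuous_on_cong)
qed

text \<open>The Cauchy-Pompeiu formula at the origin. In polar coordinates the area element cancels
  the pole of the kernel, leaving the smooth weight \<open>cis (- th)\<close>; the weighted dbar
  derivative is half the radial derivative \<open>f1\<close> plus \<open>\<i>\<close> times half the
  angular one \<open>f2\<close>. The first integrates to the value at the centre, the second to
  \<open>0\<close> by periodicity.\<close>

lemma polar_cauchy_pompeiu:
 fixes ps :: "complex => complex"
 assumes d: "!!zt. (ps has_derivative ps' zt) (at zt)" and c: "!!v. continuous_on UNIV (%zt. ps' zt v)"
  and z: "!!zt. cmod zt >= B ==> ps zt = 0" and B: "B > 0"
 shows "integral (cbox (0,0) (B,2*pi)) (%p. (ps' (of_real (fst p) * cis (snd p)) 1+\<i> * ps' (of_real (fst p) * cis (snd p)) \<i>)/2 * cis (- snd p)) = - pi * ps 0"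
proof -
 have lin: "linear (ps' zt)" for zt using has_derivative_linear[OF d] .
 define f1 where "f1 = (%(r,th). ps' (of_real r * cis th) (cis th))"
 define f2 where "f2 = (%(r,th). ps' (of_real r * cis th) (\<i> * cis th))"
 have cc: "continuous_on S (%x. ps' (h x) v)" if "continuous_on S h" for S :: "(real \<times> real) set" and h v
  using continuous_on_compose2[OF c that] by simp
 have c1: "continuous_on S f1" for S
  unfolding f1_def case_prod_beta by (rule continuous_on_linear_family[OF lin]) (intro cc continuous_intros)+
 have c2: "continuous_on S f2" for S
  unfolding f2_def case_prod_beta by (rule continuous_on_linear_family[OF lin]) (intro cc continuous_intros)+
 have eq: "(ps' (of_real (fst p) * cis (snd p)) 1+\<i> * ps' (of_real (fst p) * cis (snd p)) \<i>)/2 * cis (- snd p) = (f1 p+\<i> * f2 p)/2" for p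
 proof -
  have "ps' zt (cs (cis th) 1)+\<i> * ps' zt (cs \<i> (cs (cis th) 1)) = cnj (cis th)*(ps' zt 1+\<i> * ps' zt (cs \<i> 1))" for zt th
   by (rule wb_form_cs[OF lin])
  then have "ps' zt (cis th)+\<i> * ps' zt (\<i> * cis th) = cis (-th)*(ps' zt 1+\<i> * ps' zt \<i>)" for zt th
   by (simp add: cis_cnj)
  then show ?thesis by (simp add: f1_def f2_def case_prod_beta)
 qed
 have I1: "integral (cbox (0,0) (B,2*pi)) f1 = - (2 * pi) * ps 0"
 proof -
  have inner: "integral (cbox 0 B) (%r. f1 (r,th)) = - ps 0" for th
  proof -
   have "((%r. f1 (r,th)) has_integral (ps (of_real B * cis th)-ps (of_real 0 * cis th))) {0..B}"
   proof (rule fundamental_theorem_of_calculus[where f="%r. ps (of_real r * cis th)"])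
    fix r
    have "((%r. ps (0+r *R cis th)) has_vector_derivative ps' (of_real r * cis th) (cis th)) (at r)"
     by (rule has_vector_derivative_line) (insert d[of "r * cis th"], simp add: scaleR_conv_of_real)
    then show "((%r. ps (of_real r * cis th)) has_vector_derivative f1 (r,th)) (at r within {0..B})"
     by (simp add: f1_def scaleR_conv_of_real has_vector_derivative_at_within)
   qed (use B in auto)
   moreover have "ps (B * cis th) = 0" using B by (intro z) (simp add: norm_mult)
   ultimately show ?thesis by (simp add: integral_unique)
  qed
  have "integral (cbox (0,0) (B,2*pi)) f1 = integral (cbox 0 B) (%r. integral (cbox 0 (2*pi)) (%th. f1 (r,th)))"
   by (rule integral_prod_continuous[OF c1])
  also have "... = integral (cbox 0 (2*pi)) (%th. integral (cbox 0 B) (%r. f1 (r,th)))"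
   using integral_swap_continuous[of 0 0 B "2*pi" "%r th. f1 (r,th)"] c1 by simp
  also have "... = integral (cbox 0 (2*pi)) (%th. - ps 0)" by (simp only: inner)
  also have "... = - (2 * pi) * ps 0" by (simp add: scaleR_conv_of_real)
  finally show ?thesis .
 qed
 have I2: "integral (cbox (0,0) (B,2*pi)) f2 = 0"
 proof -
  have eq2: "integral (cbox (0,0) (B,2*pi)) f2 = integral (cbox 0 B) (%r. integral (cbox 0 (2*pi)) (%th. f2 (r,th)))"
   by (rule integral_prod_continuous[OF c2])
  have "integral (cbox 0 (2*pi)) (%th. f2 (r,th)) = 0" if "r : cbox 0 B" for r
  proof -
   have dcis: "((%th. a * cis th) has_vector_derivative a * (\<i> * cis th)) (at th)" for a th
    unfolding cis_conv_exp
    by (rule has_vector_derivative_real_field[where f="%z. a * exp (\<i> * z)"]) (auto intro!: derivative_eq_intros)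
   have "((%th. f2 (r,th)) has_integral 0) {0..2*pi}"
   \<comment> \<open>The angular primitive is \<open>ps (r * cis th)/r\<close>; at the centre, where
     it makes no sense, the linear map \<open>ps' 0\<close> takes its place.\<close>
   proof (cases "r = 0")
    case True
    have "((%th. f2 (r,th)) has_integral (ps' 0 (1 * cis (2*pi))-ps' 0 (1 * cis 0))) {0..2*pi}"
    proof (rule fundamental_theorem_of_calculus)
     fix th 
     have "((%th. ps' 0 (1 * cis th)) has_vector_derivative ps' 0 (1*(\<i> * cis th))) (at th)"
      using bounded_linear.has_vector_derivative[OF has_derivative_bounded_linear[OF d] dcis] .
     then show "((%th. ps' 0 (1 * cis th)) has_vector_derivative f2 (r,th)) (at th within {0..2*pi})"
      by (simp add: f2_def True has_vector_derivative_at_within)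
    qed simp
    then show ?thesis by simp
   next
    case False
    have "((%th. f2 (r,th)) has_integral (ps (r * cis (2*pi)) /\<^sub>R r-ps (r * cis 0) /\<^sub>R r)) {0..2*pi}"
    proof (rule fundamental_theorem_of_calculus)
     fix th 
     have "(ps \<circ> (%th. r * cis th) has_vector_derivative ps' (r * cis th) (r * (\<i> * cis th))) (at th)"
      using vector_derivative_diff_chain_within[of "%th. r * cis th" _ th UNIV ps "ps' (r * cis th)"] dcis has_derivative_subset[OF d] by auto
     then have "((%th. ps (r * cis th) /\<^sub>R r) has_vector_derivative ps' (r * cis th) (r * (\<i> * cis th)) /\<^sub>R r) (at th)"
      unfolding o_def by (rule bounded_linear.has_vector_derivative[OF bounded_linear_scaleR_right])
     moreover have "ps' (r * cis th) (r * (\<i> * cis th)) = r *R ps' (r * cis th) (\<i> * cis th)"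
      using linear_scale[OF lin, of "r * cis th" r "\<i> * cis th"] by (simp add: scaleR_conv_of_real)
     ultimately show "((%th. ps (r * cis th) /\<^sub>R r) has_vector_derivative f2 (r,th)) (at th within {0..2*pi})"
      using False by (simp add: f2_def has_vector_derivative_at_within)
    qed simp
    then show ?thesis by simp
   qed
   then show ?thesis by (simp add: integral_unique)
  qed
  then have "integral (cbox 0 B) (%r. integral (cbox 0 (2*pi)) (%th. f2 (r,th))) = integral (cbox 0 B) (%r. 0)"
   by (intro integral_cong)
  then show ?thesis unfolding eq2 by simp
 qed
 have "integral (cbox (0,0) (B,2*pi)) (%p. (f1 p+\<i> * f2 p)/2) = (integral (cbox (0,0) (B,2*pi)) f1+\<i> * integral (cbox (0,0) (B,2*pi)) f2)/2"
  by (simp add: integral_add integral_divide integrable_continuous[OF c1] integrable_continuous[OF c2] integrable_on_cmult_iff)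
 then show ?thesis unfolding eq I1 I2 by simp
qed

subsection \<open>One-sided extension of CR functions\<close>

text \<open>The \<open>k\<close>-th coordinate runs along the analytic disc, the other coordinates
  are small parameters, and the box reaches deeper down (\<open>d1\<close>) than the width
  \<open>d\<close> of the parameters requires.\<close>

definition hbox :: "'m::finite => real => real => real => 'm cn set" where
 "hbox k R d d1 = {t. cmod (fst t $ k) < R & (ALL i. i ~= k --> cmod (fst t $ i) < d) &
  \<bar>Re (snd t)\<bar> < d & - d1 < Im (snd t) & Im (snd t) < d}"

lemma open_coord_box: "open {t :: 'm::finite cn. (ALL i:I. cmod (fst t $ i) < d)}"
proof -
 have "{t :: 'm cn. (ALL i:I. cmod (fst t $ i) < d)} = (\<Inter>i\<in>I. {t. cmod (fst t $ i) < d})" by auto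
 moreover have "open {t :: 'm cn. cmod (fst t $ i) < d}" for i
  by (intro open_Collect_less continuous_intros)
 ultimately show ?thesis by (simp add: open_INT)
qed

text \<open>The geometry of a hat: by \<open>rho_w\<close> the side where \<open>rh\<close> is
  positive meets each complex line in direction \<open>k\<close> only inside the unit disc, by
  \<open>rho_z\<close> the other side contains the bottom of the box, and by \<open>rho_y\<close> it
  lies below. The first fact makes the maximum principle and the Cauchy transform along
  \<open>k\<close> available, the second forces that transform to vanish below \<open>M\<close>. The
  function \<open>rh\<close> is complex valued with zero imaginary part so that the calculus of
  \<open>bsm\<close> applies to it.\<close>

locale hat =
 fixes k :: "'m::finite" and R d d1 :: real and rh :: "'m cn => complex"
 assumes R: "R > 1" and d: "d > 0" and d1: "d1 > 0"
  and rho_bsm: "bsm False (hbox k R d d1) rh"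
  and rho_real: "t : hbox k R d d1 ==> Im (rh t) = 0"
  and rho_y: "t : hbox k R d d1 ==> Re (fd rh t (0,\<i>)) > 0"
  and rho_w: "t : hbox k R d d1 ==> cmod (fst t $ k) >= 1 ==> Re (rh t) < 0"
  and rho_z: "t : hbox k R d d1 ==> Im (snd t) <= - d1/2 ==> Re (rh t) < 0"
begin

definition "N = hbox k R d d1"
text \<open>The Cauchy transform integrates over translates in direction \<open>k\<close> that leave
  \<open>N\<close>, hence the box without a bound on that coordinate.\<close>

definition "Ninf = {t :: 'm cn. (ALL i. i ~= k --> cmod (fst t $ i) < d) &
  \<bar>Re (snd t)\<bar> < d & - d1 < Im (snd t) & Im (snd t) < d}"
definition "M = {t : N. rh t = 0}"
definition "P = {t : N. Re (rh t) > 0}"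
definition "Q = {t : N. Re (rh t) < 0}"
definition "K = {t : N. Re (rh t) >= 0}"
definition ez :: "'m cn" where "ez = (0,1)"
definition ey :: "'m cn" where "ey = (0,\<i>)"
definition ek :: "'m cn" where "ek = (axis k 1,0)"

lemmas rho_bsm' = rho_bsm[folded N_def] and rho_real' = rho_real[folded N_def]
 and rho_y' = rho_y[folded N_def ey_def] and rho_w' = rho_w[folded N_def] and rho_z' = rho_z[folded N_def]

lemma cs_i_ez [simp]: "cs \<i> ez = ey"
 by (simp add: ez_def ey_def cs.zero_right)

lemma norm_ey [simp]: "norm ey = 1"
 by (simp add: ey_def norm_Pair)

lemma open_Ninf: "open Ninf"
proof -
 have "Ninf = {t. ALL i:-{k}. cmod (fst t $ i) < d} Int {t. \<bar>Re (snd t)\<bar> < d} Int {t. - d1 < Im (snd t)} Int {t. Im (snd t) < d}"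
  by (auto simp: Ninf_def)
 moreover have "open {t :: 'm cn. \<bar>Re (snd t)\<bar> < d}" "open {t :: 'm cn. - d1 < Im (snd t)}" "open {t :: 'm cn. Im (snd t) < d}"
  by (intro open_Collect_less continuous_intros)+
 moreover have "open {t :: 'm cn. ALL i:-{k}. cmod (fst t $ i) < d}" by (rule open_coord_box)
 ultimately show ?thesis by (metis (no_types, lifting) open_Int)
qed

lemma N_eq: "N = Ninf Int {t. cmod (fst t $ k) < R}"
 by (auto simp: N_def hbox_def Ninf_def)

lemma N_Ninf: "N <= Ninf"
 by (auto simp: N_eq)

lemma open_N: "open N"
proof -
 have "open {t :: 'm cn. cmod (fst t $ k) < R}"
  by (intro open_Collect_less continuous_intros)
 then show ?thesis unfolding N_eq using open_Ninf by blast
qed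

lemma cont_rho: "continuous_on N rh"
 by (rule bsm_continuous_on[OF rho_bsm'])

lemma open_P: "open P" and open_Q: "open Q"
proof -
 have c: "continuous_on N (%t. Re (rh t))" by (intro continuous_intros cont_rho)
 have "P = N Int (%t. Re (rh t)) -` {0<..}" "Q = N Int (%t. Re (rh t)) -` {..<0}"
  by (auto simp: P_def Q_def)
 then show "open P" "open Q"
  using continuous_open_preimage[OF c open_N] by auto
qed

lemma N_cases: "t : N ==> t : P | t : M | t : Q"
 using rho_real' by (auto simp: P_def M_def Q_def complex_eq_iff)

lemma K_eq: "K = P Un M" and P_N: "P <= N" and M_N: "M <= N" and Q_N: "Q <= N" and K_N: "K <= N"
 using rho_real' by (auto simp: P_def M_def Q_def K_def complex_eq_iff)

lemma PQ_disj: "t : Q ==> t ~: P" "t : M ==> t ~: P"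
 by (auto simp: P_def M_def Q_def)

lemma N_vertical:
 assumes "t : N" "t+y *R ey : N" "0 <= ta" "ta <= y" shows "t+ta *R ey : N"
 using assms by (auto simp: N_def hbox_def ey_def)

lemma rho_mono:
 assumes "t : N" "0 < y" "t+y *R ey : N" shows "Re (rh t) < Re (rh (t+y *R ey))"
proof -
 have "Re (rh (t+0 *R ey)) < Re (rh (t+y *R ey))"
 proof (rule DERIV_pos_imp_increasing[OF assms(2)])
  fix ta assume ta: "0 <= ta" "ta <= y"
  have in': "t+ta *R ey : N" using N_vertical assms ta by blast
  have "((%ta. rh (t+ta *R ey)) has_vector_derivative fd rh (t+ta *R ey) ey) (at ta)"
   by (rule has_vector_derivative_line[OF bsm_open(1)[OF open_N rho_bsm' in']])
  then have "((%ta. Re (rh (t+ta *R ey))) has_vector_derivative Re (fd rh (t+ta *R ey) ey)) (at ta)"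
   by (rule bounded_linear.has_vector_derivative[OF bounded_linear_Re])
  then show "EX D. ((%ta. Re (rh (t+ta *R ey))) has_real_derivative D) (at ta) & 0 < D"
   using rho_y'[OF in'] by (auto simp: has_real_derivative_iff_has_vector_derivative)
 qed
 then show ?thesis by simp
qed

lemma fd_rho_real: "t : N ==> Im (fd rh t v) = 0"
proof -
 assume t: "t : N"
 have "((%x. Im (rh x)) has_derivative (%v. Im (fd rh t v))) (at t)"
  by (rule bounded_linear.has_derivative[OF bounded_linear_Im bsm_open(1)[OF open_N rho_bsm' t]])
 moreover have "((%x. Im (rh x)) has_derivative (%v. 0)) (at t)"
  by (rule has_derivative_transform_within_open[OF has_derivative_const open_N t, of 0]) (simp add: rho_real')
 ultimately show ?thesis by (metis has_derivative_unique)
qed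

lemma fd_rho_eq: "t : N ==> fd rh t v = of_real (Re (fd rh t v))"
 using fd_rho_real by (simp add: complex_eq_iff)

lemma wb_ez_rho: "t : N ==> wb ez rh t ~= 0"
 using rho_y' fd_rho_eq by (simp add: wb_def complex_eq_iff) (metis Im_complex_of_real Re_complex_of_real less_irrefl)

lemma lin_rho: "t : N ==> linear (frechet_derivative rh (at t))"
 by (rule fd_linear[OF open_N rho_bsm'])

text \<open>The curve is \<open>t+s *R v\<close> corrected vertically by \<open>Y s\<close>, found
  by the intermediate value theorem because \<open>rh\<close> increases along \<open>ey\<close>.
  Since \<open>v\<close> kills the differential, the correction is of smaller order than
  \<open>s\<close>, so the velocity at \<open>0\<close> is \<open>v\<close>.\<close>

lemma tangent_curve:
 assumes t: "t : M" and v: "fd rh t v = 0"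
 obtains ga e where "e > 0" "!!s. s : {-e<..<e} ==> ga s : M" "ga 0 = t" "(ga has_vector_derivative v) (at (0::real))"
proof -
 have tN: "t : N" and rt: "rh t = 0" using t by (auto simp: M_def)
 define a where "a = Re (fd rh t ey)"
 have a: "a > 0" using rho_y'[OF tN] by (simp add: a_def)
 obtain r where r: "r > 0" "ball t r <= N" using open_N tN open_contains_ball by blast
 have der: "ALL e>0. EX d>0. ALL y. norm (y-t) < d --> norm (rh y-rh t-fd rh t (y-t)) <= e * norm (y-t)"
  using bsm_open(1)[OF open_N rho_bsm' tN] unfolding has_derivative_at_alt by blast
 \<comment> \<open>A vertical shift by \<open>et * abs s\<close> changes \<open>rh\<close> to first
   order by that amount times \<open>a\<close>, and for small \<open>s\<close> this dominates the
   remainder. So the two shifted points lie on opposite sides of \<open>M\<close>.\<close>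
 have C: "EX e>0. ALL s. (abs s) < e --> (ALL ta. (abs ta) <= (abs s) --> t+s *R v+ta *R ey : N) &
   Re (rh (t+s *R v+(et * (abs s)) *R ey)) >= 0 & Re (rh (t+s *R v+(- et * (abs s)) *R ey)) <= 0"
  if et: "0 < et" "et <= 1" for et
 proof -
  define m where "m = norm v+1"
  have m: "m > 0" unfolding m_def by (smt (verit) norm_ge_zero)
  have "a * et/m > 0" using a et m by simp
  then obtain d0 where d0: "d0 > 0" "!!y. norm (y-t) < d0 ==> norm (rh y-rh t-fd rh t (y-t)) <= a * et/m * norm (y-t)"
   using der by blast
  define e where "e = min d0 r/m"
  have "e > 0" using d0 r m by (simp add: e_def)
  have nb: "norm (s *R v+ta *R ey) <= (abs s) * m" if "(abs ta) <= (abs s)" for s ta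
   using norm_triangle_ineq[of "s *R v" "ta *R ey"] that by (simp add: m_def algebra_simps)
  have small: "norm (s *R v+ta *R ey) < min d0 r" if "(abs s) < e" "(abs ta) <= (abs s)" for s ta
   using nb[OF that(2)] that(1) m by (simp add: e_def pos_less_divide_eq)
  have est: "\<bar>Re (rh (t+s *R v+ta *R ey))-ta * a\<bar> <= a * et * (abs s)" if "(abs s) < e" "(abs ta) <= (abs s)" for s ta
  proof -
   have f: "fd rh t (s *R v+ta *R ey) = of_real (ta * a)"
    using lin_rho[OF tN] fd_rho_eq[OF tN, of ey] v by (simp add: linear_add linear_scale a_def scaleR_conv_of_real)
   have "norm (rh (t+s *R v+ta *R ey)-rh t-fd rh t (s *R v+ta *R ey)) <= a * et/m * norm (s *R v+ta *R ey)"
    using d0(2)[of "t+s *R v+ta *R ey"] small[OF that] by (simp add: add.assoc)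
   also have "... <= a * et/m * ((abs s) * m)"
    using nb[OF that(2)] a et m by (intro mult_left_mono) auto
   finally have "cmod (rh (t+s *R v+ta *R ey)-of_real (ta * a)) <= a * et * (abs s)"
    using m by (simp add: f rt)
   then show ?thesis using abs_Re_le_cmod[of "rh (t+s *R v+ta *R ey)-of_real (ta * a)"] by simp
  qed
  show ?thesis
  proof (intro exI[of _ e] conjI allI impI)
   fix s assume s: "(abs s) < e"
   show "t+s *R v+ta *R ey : N" if "(abs ta) <= (abs s)" for ta
   proof -
    have "t+s *R v+ta *R ey : ball t r" using small[OF s that] by (simp add: dist_norm add.assoc) (metis norm_minus_cancel minus_add_distrib uminus_add_conv_diff add.commute)
    then show ?thesis using r(2) by blast
   qed
   have "\<bar>et * (abs s)\<bar> <= (abs s)" "\<bar>- et * (abs s)\<bar> <= (abs s)" using et by (auto simp: abs_mult mult_left_le_one_le)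
   from est[OF s this(1)] est[OF s this(2)]
   show "Re (rh (t+s *R v+(et * (abs s)) *R ey)) >= 0" "Re (rh (t+s *R v+(- et * (abs s)) *R ey)) <= 0"
    by (auto simp: abs_le_iff algebra_simps)
  qed fact
 qed
 have Z: "EX e>0. ALL s. (abs s) < e --> (EX y. (abs y) <= et * (abs s) & t+s *R v+y *R ey : M)" if et: "0 < et" "et <= 1" for et
 proof -
  obtain e where e: "e > 0" and E: "!!s. (abs s) < e ==> (ALL ta. (abs ta) <= (abs s) --> t+s *R v+ta *R ey : N) &
   Re (rh (t+s *R v+(et * (abs s)) *R ey)) >= 0 & Re (rh (t+s *R v+(- et * (abs s)) *R ey)) <= 0"
   using C[OF et] by blast
  have "EX y. (abs y) <= et * (abs s) & t+s *R v+y *R ey : M" if s: "(abs s) < e" for s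
  proof -
   have in': "t+s *R v+ta *R ey : N" if "ta : {- et * (abs s)..et * (abs s)}" for ta
   proof -
    have "(abs ta) <= et * (abs s)" using that by auto
    also have "... <= (abs s)" using et by (simp add: mult_left_le_one_le)
    finally show ?thesis using E[OF s] by blast
   qed
   have "EX x>=- et * (abs s). x <= et * (abs s) & Re (rh (t+s *R v+x *R ey)) = 0"
   proof (rule IVT')
    show "continuous_on {- et * (abs s)..et * (abs s)} (%x. Re (rh (t+s *R v+x *R ey)))"
     by (intro continuous_intros continuous_on_compose2[OF cont_rho]) (use in' in auto)
   qed (use E[OF s] et in auto)
   then obtain x where x: "x : {- et * (abs s)..et * (abs s)}" "Re (rh (t+s *R v+x *R ey)) = 0" by auto
   then have "(abs x) <= et * (abs s)" "t+s *R v+x *R ey : M"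
    using in'[OF x(1)] rho_real' by (auto simp: M_def complex_eq_iff)
   then show ?thesis by blast
  qed
  then show ?thesis using e by blast
 qed
 obtain e where e: "e > 0" "!!s. (abs s) < e ==> EX y. (abs y) <= (abs s) & t+s *R v+y *R ey : M"
  using Z[of 1] by auto
 then obtain Y where Y: "!!s. (abs s) < e ==> \<bar>Y s\<bar> <= (abs s) & t+s *R v+Y s *R ey : M" by metis
 \<comment> \<open>Strict monotonicity allows one zero per vertical line, so the zeros found for
   smaller \<open>et\<close> are the values already chosen by \<open>Y\<close>.\<close>
 have uniq: "y = y'" if "x+y *R ey : M" "x+y' *R ey : M" for x y y'
 proof (rule ccontr)
  have aux: False if "x+y *R ey : M" "x+y' *R ey : M" "y < y'" for y y'
   using rho_mono[of "x+y *R ey" "y'-y"] that by (auto simp: M_def add.assoc simp flip: scaleR_add_left)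
  assume "y ~= y'"
  then show False using aux[OF that] aux[OF that(2,1)] by linarith
 qed
 define ga where "ga s = t+s *R v+Y s *R ey" for s
 have Y0: "Y 0 = 0" using Y[of 0] e by simp
 have "(ga has_derivative (%s. s *R v)) (at 0)"
  unfolding has_derivative_at_alt
 proof (intro conjI allI impI)
  show "bounded_linear (%s. s *R v)" by (rule bounded_linear_scaleR_left)
  fix ep :: real assume "ep > 0"
  define et where "et = min ep 1"
  have et: "0 < et" "et <= 1" "et <= ep" using \<open>ep>0\<close> by (auto simp: et_def)
  obtain e' where e': "e' > 0" "!!s. (abs s) < e' ==> EX y. (abs y) <= et * (abs s) & t+s *R v+y *R ey : M"
   using Z[OF et(1,2)] by blast
  have "norm (ga s-ga 0-(s-0) *R v) <= ep * norm (s-0)" if s: "norm (s-0) < min e e'" for s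
  proof -
   obtain y where y: "(abs y) <= et * (abs s)" "t+s *R v+y *R ey : M" using e'(2)[of s] s by auto
   have "y = Y s" using uniq[OF y(2)] Y[of s] s by auto
   have "norm (ga s-ga 0-(s-0) *R v) = \<bar>Y s\<bar>" by (simp add: ga_def Y0)
   also have "... <= et * (abs s)" using y \<open>y = Y s\<close> by simp
   also have "... <= ep * (abs s)" using et by (intro mult_right_mono) auto
   finally show ?thesis by simp
  qed
  then show "EX d>0. ALL y. norm (y-0) < d --> norm (ga y-ga 0-(y-0) *R v) <= ep * norm (y-0)"
   using e e' by (intro exI[of _ "min e e'"]) auto
 qed
 then have "(ga has_vector_derivative v) (at 0)" by (simp add: has_vector_derivative_def)
 moreover have "ga s : M" if "s : {-e<..<e}" for s using Y[of s] that by (auto simp: ga_def)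
 moreover have "ga 0 = t" by (simp add: ga_def Y0)
 ultimately show ?thesis using that e(1) by blast
qed

text \<open>Differentiation along curves in \<open>M\<close> shows that the differential of
  \<open>ps\<close> kills the kernel of that of \<open>rh\<close>. The two are therefore
  proportional, and the factor is read off in the transversal direction \<open>ey\<close>.\<close>

lemma vanishing_on_M:
 assumes ps: "bsm False N ps" and z: "!!t. t : M ==> ps t = 0" and t: "t : M"
 shows "fd ps t v = fd ps t ey/fd rh t ey * fd rh t v"
proof -
 have tN: "t : N" using t M_N by blast
 have ker: "fd ps t w = 0" if w: "fd rh t w = 0" for w
 proof -
  obtain ga e where ga: "e > 0" "!!s. s : {-e<..<e} ==> ga s : M" "ga 0 = t" "(ga has_vector_derivative w) (at (0::real))"
   using tangent_curve[OF t w] by blast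
  have "(ps has_derivative frechet_derivative ps (at t)) (at (ga 0))"
   using bsm_open(1)[OF open_N ps tN] ga(3) by simp
  from has_derivative_compose[OF ga(4)[unfolded has_vector_derivative_def] this]
  have "((%s. ps (ga s)) has_derivative (%s. fd ps t (s *R w))) (at 0)" .
  moreover have "((%s. ps (ga s)) has_derivative (%s. 0)) (at 0)"
   by (rule has_derivative_transform_within_open[OF has_derivative_const, of "{-e<..<e}" 0 0]) (use ga z in auto)
  ultimately have "(%s. fd ps t (s *R w)) = (%s. 0)" by (rule has_derivative_unique)
  then show ?thesis by (metis scaleR_one)
 qed
 define a c where "a = Re (fd rh t ey)" and "c = Re (fd rh t v)"
 have a: "fd rh t ey = of_real a" "a ~= 0" and c: "fd rh t v = of_real c"
  using fd_rho_eq[OF tN] rho_y'[OF tN] by (auto simp: a_def c_def)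
 have lin: "linear (frechet_derivative ps (at t))" by (rule fd_linear[OF open_N ps tN])
 have "fd rh t (v-(c/a) *R ey) = 0"
  using lin_rho[OF tN] a c by (simp add: linear_diff linear_scale scaleR_conv_of_real)
 then have "fd ps t (v-(c/a) *R ey) = 0" by (rule ker)
 then show ?thesis using lin a c by (simp add: linear_diff linear_scale scaleR_conv_of_real)
qed

text \<open>The tangential Cauchy-Riemann equations, written as dbar \<open>f\<close> wedge dbar
  \<open>rh\<close> being zero on \<open>M\<close>, with \<open>ez\<close> as the transversal
  direction of comparison. The function is given with a smooth extension to
  \<open>N\<close>.\<close>

definition crf :: "('m cn => complex) => bool" where
 "crf f \<longleftrightarrow> bsm False N f & (ALL t:M. ALL u. wb u f t * wb ez rh t = wb ez f t * wb u rh t)"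

lemmas wbs = bsm_wb[OF open_N] bsm_wd[OF open_N]

text \<open>Subtracting a multiple of \<open>rh\<close> removes dbar on \<open>M\<close>, which is
  possible by the CR equations; subtracting a multiple of \<open>rh\<close> squared then removes the
  first derivatives of dbar as well. This order of flatness makes the extension of dbar by zero
  continuously differentiable.\<close>

lemma flat_extension:
 assumes f: "crf f"
 obtains g where "bsm False N g" "!!t. t : M ==> g t = f t"
  "!!u t. t : M ==> wb u g t = 0" "!!u v t. t : M ==> fd (wb u g) t v = 0"
proof -
 have fb: "bsm False N f" using f by (simp add: crf_def)
 define c where "c = (%t. wb ez f t/wb ez rh t)"
 have cb: "bsm False N c" unfolding c_def by (intro bsm_divide wbs fb rho_bsm' wb_ez_rho)
 define g1 where "g1 = (%t. f t-rh t * c t)"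
 have g1b: "bsm False N g1" unfolding g1_def by (intro bsm_diff bsm_mult fb rho_bsm' cb)
 have w1: "wb u g1 t = 0" if t: "t : M" for u t
 proof -
  have tN: "t : N" and r0: "rh t = 0" using t by (auto simp: M_def)
  have "wb u g1 t = wb u f t-wb u rh t * c t"
   unfolding g1_def using r0
   by (simp add: wb_diff[OF open_N fb bsm_mult[OF rho_bsm' cb] tN] wb_mult[OF open_N rho_bsm' cb tN])
  also have "... = 0"
  proof -
   have "wb u f t * wb ez rh t = wb ez f t * wb u rh t" using f t unfolding crf_def by blast
   then show ?thesis using wb_ez_rho[OF tN] by (simp add: c_def field_simps)
  qed
  finally show ?thesis .
 qed
 \<comment> \<open>The factor \<open>1/2\<close> compensates the \<open>2\<close> that arises when
   the square of \<open>rh\<close> is differentiated twice.\<close>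
 define c2 where "c2 = (%t. wb ez (wb ez g1) t/(wb ez rh t * wb ez rh t)/2)"
 have c2b: "bsm False N c2" unfolding c2_def by (intro bsm_divide bsm_mult wbs g1b rho_bsm' bsm_const) (auto simp: wb_ez_rho)
 define g2 where "g2 = (%t. g1 t-rh t * (rh t * c2 t))"
 have rcb: "bsm False N (%t. rh t * c2 t)" by (intro bsm_mult rho_bsm' c2b)
 have g2b: "bsm False N g2" unfolding g2_def by (intro bsm_diff bsm_mult g1b rho_bsm' c2b)
 define E where "E u = (%t. 2 * wb u rh t * c2 t+rh t * wb u c2 t)" for u
 have Eb: "bsm False N (E u)" for u unfolding E_def by (intro bsm_add bsm_mult bsm_const wbs rho_bsm' c2b)
 have w2: "wb u g2 t = wb u g1 t-rh t * E u t" if "t : N" for u t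
  unfolding g2_def E_def
  by (simp only: wb_diff[OF open_N g1b bsm_mult[OF rho_bsm' rcb] that] wb_mult[OF open_N rho_bsm' rcb that]
    wb_mult[OF open_N rho_bsm' c2b that]) (simp add: algebra_simps)
 show ?thesis
 proof (rule that[of g2])
  show "bsm False N g2" by fact
  show "g2 t = f t" if "t : M" for t using that by (simp add: g2_def g1_def M_def)
  show "wb u g2 t = 0" if "t : M" for u t using w2[of t u] w1[OF that] that by (simp add: M_def)
  show "fd (wb u g2) t v = 0" if t: "t : M" for u v t
  proof -
   have tN: "t : N" and r0: "rh t = 0" using t by (auto simp: M_def)
   define A where "A u = fd (wb u g1) t ey/fd rh t ey" for u
   have A: "fd (wb u g1) t v = A u * fd rh t v" for u v
    unfolding A_def by (rule vanishing_on_M[OF wbs(1)[OF g1b] w1 t])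
   have A': "wb v (wb u g1) t = A u * wb v rh t" for u v
    by (simp add: wb_def[of v] A field_simps)
   \<comment> \<open>Commuting dbar derivatives make the coefficients \<open>A u\<close>
     proportional to \<open>wb u rh t\<close>, so one function \<open>c2\<close> serves all
     directions \<open>u\<close>.\<close>
   have "A u * wb ez rh t = A ez * wb u rh t"
    using wb_wb_commute[OF open_N g1b tN, of ez u] by (simp add: A')
   then have Au: "A u = A ez/wb ez rh t * wb u rh t" using wb_ez_rho[OF tN] by (simp add: field_simps)
   have c2t: "2 * c2 t = A ez/wb ez rh t" using wb_ez_rho[OF tN] by (simp add: c2_def A')
   have "fd (wb u g2) t v = fd (%t. wb u g1 t-rh t * E u t) t v"
    using fd_cong[OF open_N w2 tN] by simp
   also have "... = fd (wb u g1) t v-fd rh t v * E u t"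
    using r0 by (simp add: fd_diff[OF open_N wbs(1)[OF g1b] bsm_mult[OF rho_bsm' Eb] tN] fd_mult[OF open_N rho_bsm' Eb tN])
   also have "E u t = 2 * c2 t * wb u rh t" using r0 by (simp add: E_def)
   also have "fd (wb u g1) t v-fd rh t v * (2 * c2 t * wb u rh t) = 0"
    unfolding A Au c2t by simp
   finally show ?thesis .
  qed
 qed
qed

end

lemma dominated_zero_derivative:
 assumes F: "(F has_derivative (%_. 0)) (at t)" "F t = 0" and N: "open N" "t : N"
  and le: "!!y. y : N ==> norm (G y) <= norm (F y)"
 shows "(G has_derivative (%_. 0)) (at t)"
 unfolding has_derivative_at_alt
proof (intro conjI allI impI)
 fix e :: real assume "e > 0"
 then obtain dl where dl: "dl > 0" "!!y. norm (y-t) < dl ==> norm (F y-F t-0) <= e * norm (y-t)"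
  using F(1) unfolding has_derivative_at_alt by blast
 obtain r where r: "r > 0" "ball t r <= N" using N open_contains_ball by blast
 have "G t = 0" using le[OF N(2)] F(2) by simp
 have "norm (G y-G t-0) <= e * norm (y-t)" if "norm (y-t) < min dl r" for y
 proof -
  have "y : N" using that r(2) by (auto simp: dist_norm norm_minus_commute)
  then show ?thesis using le[of y] dl(2)[of y] that F(2) \<open>G t = 0\<close> by simp
 qed
 then show "EX d>0. ALL y. norm (y-t) < d --> norm (G y-G t-0) <= e * norm (y-t)"
  using dl(1) r(1) by (intro exI[of _ "min dl r"]) auto
qed simp

context hat
begin

section \<open>The Cauchy transform along the disc direction\<close>

definition "O1 = {t :: 'm cn. cmod (fst t $ k) > 1}"

lemma P_O1: "t : O1 ==> t ~: P"
 using rho_w'[of t] by (auto simp: P_def O1_def)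

lemma open_O1: "open O1"
 unfolding O1_def by (intro open_Collect_less continuous_intros)

lemma Ninf_cases: "t : Ninf ==> t : P | t : M | t : Q Un O1"
 using N_cases[of t] R by (cases "cmod (fst t $ k) < R") (auto simp: N_eq O1_def)

text \<open>Outside \<open>N\<close> only points with \<open>k\<close>-th coordinate larger than
  \<open>1\<close> in modulus are added, and near them \<open>P\<close> is absent. So
  \<open>M\<close> is the only place where the two definitions meet.\<close>

lemma zero_extension_continuous:
 fixes F :: "'m cn => complex"
 assumes F: "continuous_on N F" and z: "!!t. t : M ==> F t = 0"
 shows "continuous_on Ninf (%t. if t : P then F t else 0)"
proof -
 define G where "G t = (if t : P then F t else 0)" for t
 have cF: "isCont F t" if "t : N" for t using F open_N that by (simp add: continuous_on_eq_continuous_at)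
 have loc: "isCont G t" if "isCont H t" "open S" "t : S" "!!y. y : S ==> H y = G y" for H S t
 proof -
  have "\<forall>\<^sub>F y in nhds t. H y = G y"
   using that eventually_nhds by blast
  then show ?thesis using that(1) isCont_cong by blast
 qed
 have "isCont G t" if t: "t : Ninf" for t
 proof -
  consider "t : P" | "t : M" | "t : Q Un O1" using Ninf_cases[OF t] by blast
  then show ?thesis
  proof cases
   case 1
   then have "t : N" using P_N by blast
   from loc[OF cF[OF this] open_P 1] show ?thesis by (simp add: G_def)
  next
   case 3
   have "y ~: P" if "y : Q Un O1" for y using that P_O1 PQ_disj by blast
   then show ?thesis using loc[of t "%_. 0", OF _ open_Un[OF open_Q open_O1] 3] by (simp add: G_def)
  next
   case 2
   then have tN: "t : N" using M_N by blast
   have "G t = 0" using 2 PQ_disj by (simp add: G_def)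
   have "(F \<longlongrightarrow> 0) (at t)" using cF[OF tN] z[OF 2] by (simp add: isCont_def)
   then have "((%y. norm (F y)) \<longlongrightarrow> 0) (at t)" by (rule tendsto_norm_zero)
   then have "(G \<longlongrightarrow> 0) (at t)"
    by (rule Lim_null_comparison[rotated]) (auto simp: G_def)
   then show ?thesis using \<open>G t = 0\<close> by (simp add: isCont_def)
  qed
 qed
 then show ?thesis unfolding G_def by (simp add: continuous_at_imp_continuous_on)
qed

context
 fixes g :: "'m cn => complex"
 assumes gb: "bsm False N g" and g_flat: "ALL u. ALL t:M. wb u g t = 0 & (ALL v. fd (wb u g) t v = 0)"
begin

lemma g0: "t : M ==> wb u g t = 0" and g1: "t : M ==> fd (wb u g) t v = 0"
 using g_flat by blast+

text \<open>The form dbar \<open>g\<close> cut off to the side \<open>P\<close>. Flatness of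
  \<open>g\<close> on \<open>M\<close> keeps it continuously differentiable on \<open>Ninf\<close>,
  with derivative \<open>U'\<close>.\<close>

definition U :: "'m cn => 'm cn => complex" where
 "U u t = (if t : P then wb u g t else 0)"

definition U' :: "'m cn => 'm cn => 'm cn => complex" where
 "U' u t v = (if t : P then fd (wb u g) t v else 0)"

lemma U_cont: "continuous_on Ninf (U u)"
 unfolding U_def[abs_def]
 by (rule zero_extension_continuous) (use bsm_continuous_on[OF wbs(1)[OF gb]] g0 in auto)

lemma U'_cont: "continuous_on Ninf (%t. U' u t v)"
 unfolding U'_def
 by (rule zero_extension_continuous)
  (use bsm_continuous_on[OF bsm_open(2)[OF open_N wbs(1)[OF gb]]] g1 in auto)

lemma U_deriv:
 assumes t: "t : Ninf" shows "(U u has_derivative U' u t) (at t)"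
proof -
 consider "t : P" | "t : M" | "t : Q Un O1" using Ninf_cases[OF t] by blast
 then show ?thesis
 proof cases
  case 1
  have "(wb u g has_derivative fd (wb u g) t) (at t)"
   using 1 P_N by (intro bsm_open(1)[OF open_N wbs(1)[OF gb]]) auto
  from has_derivative_transform_within_open[OF this open_P 1, of "U u"]
  show ?thesis using 1 by (simp add: U_def U'_def[abs_def])
 next
  case 3
  have z: "y ~: P" if "y : Q Un O1" for y using that P_O1 PQ_disj by blast
  have "((%_. 0) has_derivative (%_. 0)) (at t)" by simp
  from has_derivative_transform_within_open[OF this open_Un[OF open_Q open_O1] 3, of "U u"]
  have "(U u has_derivative (%_. 0)) (at t)" using z by (simp add: U_def)
  then show ?thesis using z[OF 3] by (simp add: U'_def[abs_def])
 next
  case 2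
  then have tN: "t : N" using M_N by blast
  have "fd (wb u g) t = (%_. 0)" using g1[OF 2] by auto
  then have "(wb u g has_derivative (%_. 0)) (at t)"
   using bsm_open(1)[OF open_N wbs(1)[OF gb] tN, of u] by simp
  from dominated_zero_derivative[OF this g0[OF 2] open_N tN, of "U u"]
  show ?thesis using 2 PQ_disj by (auto simp: U_def U'_def[abs_def])
 qed
qed

definition "arg t p = t+cs (of_real (fst p) * cis (snd p)) ek" for p :: "real \<times> real"
definition "Box = cbox (0 :: real,0 :: real) (R+2,2 * pi)"
text \<open>The Cauchy transform of the \<open>k\<close>-component, in the polar form where the
  kernel times the area element is \<open>cis (- th)\<close>. Radius \<open>R+2\<close> exceeds the
  support: points of \<open>P\<close> have \<open>k\<close>-th coordinate below \<open>1\<close> in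
  modulus, points of \<open>N\<close> below \<open>R\<close>.\<close>

definition "V t = - (1/pi) * integral Box (%p. U ek (arg t p) * cis (- snd p))"
definition "V' t v = - (1/pi) * integral Box (%p. U' ek (arg t p) v * cis (- snd p))"

lemma line_Ninf: "t : Ninf ==> t+cs zt ek : Ninf"
 by (auto simp: Ninf_def ek_def axis_def)

lemma arg_Ninf: "t : Ninf ==> arg t p : Ninf"
 unfolding arg_def by (rule line_Ninf)

lemma cont_arg [continuous_intros]: "continuous_on S (%q. arg (fst q) (snd q))"
 unfolding arg_def by (intro continuous_intros cs.continuous_on)

lemma cont_arg2 [continuous_intros]: "continuous_on S (arg t)"
 unfolding arg_def[abs_def] by (intro continuous_intros cs.continuous_on)

lemma U'_integrable: "t : Ninf ==> (%p. U' u (arg t p) v * cis (- snd p)) integrable_on Box"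
 unfolding Box_def
 by (intro integrable_continuous continuous_intros continuous_on_compose2[OF U'_cont] image_subsetI arg_Ninf)

lemma V_deriv:
 assumes t: "t : Ninf" shows "(V has_derivative V' t) (at t)"
proof -
 obtain r where r: "r > 0" "ball t r <= Ninf" using open_Ninf t open_contains_ball by blast
 define fx where "fx x p = Blinfun (%v. U' ek (arg x p) v * cis (- snd p))" for x p
 have bl: "bounded_linear (%v. U' ek (arg x p) v * cis (- snd p))" if "x : Ninf" for x p
  using has_derivative_bounded_linear[OF U_deriv[OF arg_Ninf[OF that]]] by (rule bounded_linear_mult_const)
 have app: "blinfun_apply (fx x p) v = U' ek (arg x p) v * cis (- snd p)" if "x : Ninf" for x p v
  unfolding fx_def using bounded_linear_Blinfun_apply[OF bl[OF that]] by simp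
 have app': "blinfun_apply (fx x p) = (%v. U' ek (arg x p) v * cis (- snd p))" if "x : Ninf" for x p
  using app[OF that] by blast
 have c0: "continuous_on (ball t r \<times> Box) (%q. fx (fst q) (snd q))"
 proof (rule continuous_on_blinfun_componentwise)
  fix i :: "'m cn" assume "i : Basis"
  have "continuous_on (ball t r \<times> Box) (%q. U' ek (arg (fst q) (snd q)) i * cis (- snd (snd q)))"
   by (intro continuous_intros continuous_on_compose2[OF U'_cont] image_subsetI arg_Ninf) (insert r(2), auto simp: mem_Times_iff)
  moreover have "U' ek (arg (fst q) (snd q)) i * cis (- snd (snd q)) = blinfun_apply (fx (fst q) (snd q)) i"
   if "q : ball t r \<times> Box" for q
  proof -
   have "fst q : Ninf" using that r(2) by (auto simp only: mem_Times_iff)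
   from app[OF this, of "snd q" i] show ?thesis by simp
  qed
  ultimately show "continuous_on (ball t r \<times> Box) (%q. blinfun_apply (fx (fst q) (snd q)) i)"
   by (rule continuous_on_eq)
 qed
 have "((%x. integral (cbox (0 :: real,0 :: real) (R+2,2 * pi)) (%p. U ek (arg x p) * cis (- snd p))) has_derivative
   blinfun_apply (integral (cbox (0 :: real,0 :: real) (R+2,2 * pi)) (fx t))) (at t within ball t r)"
 proof (rule leibniz_rule)
  fix x p assume x: "x : ball t r" and p: "p : cbox (0 :: real,0 :: real) (R+2,2 * pi)"
  have xN: "x : Ninf" using x r by blast
  have "((%x. arg x p) has_derivative (%v. v)) (at x)" unfolding arg_def by (auto intro!: derivative_eq_intros)
  from has_derivative_compose[OF this U_deriv[OF arg_Ninf[OF xN]]]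
  have "((%x. U ek (arg x p)) has_derivative U' ek (arg x p)) (at x)" by simp
  from has_derivative_mult_left[OF this, of "cis (- snd p)"]
  show "((%x. U ek (arg x p) * cis (- snd p)) has_derivative blinfun_apply (fx x p)) (at x within ball t r)"
   unfolding app'[OF xN] by (rule has_derivative_at_withinI)
 next
  fix x assume "x : ball t r"
  then show "(%p. U ek (arg x p) * cis (- snd p)) integrable_on cbox (0,0) (R+2,2 * pi)"
   by (intro integrable_continuous continuous_intros continuous_on_compose2[OF U_cont] image_subsetI arg_Ninf) (use r(2) in blast)
 next
  show "continuous_on (ball t r \<times> cbox (0,0) (R+2,2 * pi)) (%(x,p). fx x p)"
   using c0 by (simp add: case_prod_beta Box_def)
 qed (use r in auto)
 moreover have "blinfun_apply (integral (cbox (0 :: real,0 :: real) (R+2,2 * pi)) (fx t)) = (%v. integral Box (%p. U' ek (arg t p) v * cis (- snd p)))"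
 proof
  fix v
  have "fx t integrable_on Box"
   unfolding Box_def
  proof (rule integrable_continuous)
   show "continuous_on (cbox (0,0) (R+2,2 * pi)) (fx t)"
   proof -
    have "continuous_on (cbox (0,0) (R+2,2 * pi)) (%p. fx (fst (t,p)) (snd (t,p)))"
     by (rule continuous_on_compose2[OF c0]) (insert r, auto simp: Box_def intro!: continuous_intros)
    then show ?thesis by simp
   qed
  qed
  from blinfun_apply_integral[OF this, of v]
  show "blinfun_apply (integral (cbox (0 :: real,0 :: real) (R+2,2 * pi)) (fx t)) v = integral Box (%p. U' ek (arg t p) v * cis (- snd p))"
   by (simp add: app[OF t] Box_def)
 qed
 ultimately have "((%x. integral Box (%p. U ek (arg x p) * cis (- snd p))) has_derivative
   (%v. integral Box (%p. U' ek (arg t p) v * cis (- snd p)))) (at t)"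
  using r by (simp add: Box_def at_within_open[OF _ open_ball])
 from has_derivative_mult_right[OF this, of "- (1/pi)"]
 show ?thesis by (simp add: V_def[abs_def] V'_def[abs_def])
qed

lemma V'_cont: "continuous_on Ninf (%t. V' t v)"
proof -
 have "continuous_on (Ninf \<times> cbox (0,0) (R+2,2 * pi)) (%(t,p). U' ek (arg t p) v * cis (- snd p))"
  unfolding case_prod_beta
  by (intro continuous_intros continuous_on_compose2[OF U'_cont] image_subsetI arg_Ninf) (simp add: mem_Times_iff)
 from integral_continuous_on_param[OF this] show ?thesis
  unfolding V'_def Box_def by (intro continuous_intros)
qed

text \<open>This is the closedness of dbar \<open>g\<close>. It lets a transform in the single
  direction \<open>k\<close> solve the equation in every direction.\<close>

lemma U'_wb_sym: "U' ek t u+\<i> * U' ek t (cs \<i> u) = U' u t ek+\<i> * U' u t (cs \<i> ek)"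
proof (cases "t : P")
 case True
 then have "wb u (wb ek g) t = wb ek (wb u g) t" using wb_wb_commute[OF open_N gb] P_N by blast
 then have "(fd (wb ek g) t u+\<i> * fd (wb ek g) t (cs \<i> u))/2 = (fd (wb u g) t ek+\<i> * fd (wb u g) t (cs \<i> ek))/2"
  unfolding wb_def[of _ "wb _ _"] .
 then have "fd (wb ek g) t u+\<i> * fd (wb ek g) t (cs \<i> u) = fd (wb u g) t ek+\<i> * fd (wb u g) t (cs \<i> ek)"
  by (metis divide_cancel_right zero_neq_numeral)
 then show ?thesis using True by (simp add: U'_def)
qed (simp add: U'_def)

text \<open>Differentiating under the integral and exchanging directions by closedness leaves the
  dbar derivative of the \<open>u\<close>-component along \<open>ek\<close>, and Cauchy-Pompeiu on
  the complex line through \<open>t\<close> returns its value at \<open>t\<close>.\<close>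

lemma V'_wb:
 assumes t: "t : N" shows "V' t u+\<i> * V' t (cs \<i> u) = 2 * U u t"
proof -
 have tI: "t : Ninf" using t N_Ninf by blast
 define ps where "ps zt = U u (t+cs zt ek)" for zt
 define ps' where "ps' zt w = U' u (t+cs zt ek) (cs w ek)" for zt w
 have "integral (cbox (0,0) (R+2,2*pi)) (%p. (ps' (of_real (fst p) * cis (snd p)) 1+\<i> * ps' (of_real (fst p) * cis (snd p)) \<i>)/2 * cis (- snd p)) = - pi * ps 0"
 proof (rule polar_cauchy_pompeiu)
  fix zt
  have "((%zt. t+cs zt ek) has_derivative (%w. cs w ek)) (at zt)"
   using has_derivative_add[OF has_derivative_const bounded_linear_imp_has_derivative[OF cs.bounded_linear_left]] by simp
  from has_derivative_compose[OF this U_deriv[OF line_Ninf[OF tI]]]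
  show "(ps has_derivative ps' zt) (at zt)" unfolding ps_def ps'_def .
 next
  fix v show "continuous_on UNIV (%zt. ps' zt v)"
   unfolding ps'_def
   by (intro continuous_on_compose2[OF U'_cont] continuous_intros cs.continuous_on image_subsetI line_Ninf tI)
 next
  fix zt assume "R+2 <= cmod zt"
  moreover have "cmod zt <= cmod (fst t $ k+zt)+cmod (fst t $ k)"
   using norm_triangle_ineq4[of "fst t $ k+zt" "fst t $ k"] by simp
  ultimately have "t+cs zt ek : O1" using t by (simp add: O1_def ek_def N_eq)
  then show "ps zt = 0" using P_O1 by (simp add: ps_def U_def)
 qed (use R in auto)
 then have "- pi * U u t = integral Box (%p. (U' u (arg t p) ek+\<i> * U' u (arg t p) (cs \<i> ek))/2 * cis (- snd p))"
  by (simp add: ps_def ps'_def Box_def arg_def cs.zero_left)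
 also have "... = integral Box (%p. (U' ek (arg t p) u+\<i> * U' ek (arg t p) (cs \<i> u))/2 * cis (- snd p))"
  by (simp only: U'_wb_sym)
 also have "... = integral Box (%p. (U' ek (arg t p) u * cis (- snd p)+\<i> * (U' ek (arg t p) (cs \<i> u) * cis (- snd p)))/2)"
  by (simp add: algebra_simps)
 also have "... = (integral Box (%p. U' ek (arg t p) u * cis (- snd p))+\<i> * integral Box (%p. U' ek (arg t p) (cs \<i> u) * cis (- snd p)))/2"
  by (simp add: integral_add integral_divide U'_integrable[OF tI] integrable_on_cmult_iff)
 finally have "- pi * U u t = (integral Box (%p. U' ek (arg t p) u * cis (- snd p))+\<i> * integral Box (%p. U' ek (arg t p) (cs \<i> u) * cis (- snd p)))/2" .
 moreover have "V' t u+\<i> * V' t (cs \<i> u) = - 2/pi * ((integral Box (%p. U' ek (arg t p) u * cis (- snd p))+\<i> * integral Box (%p. U' ek (arg t p) (cs \<i> u) * cis (- snd p)))/2)"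
  by (simp add: V'_def add_divide_distrib)
 ultimately have "V' t u+\<i> * V' t (cs \<i> u) = - 2/pi * (- pi * U u t)" by (simp only:)
 then show ?thesis by simp
qed

lemma V_zero_deep:
 assumes "t : N" "Im (snd t) <= - d1/2" shows "V t = 0"
proof -
 have "U ek (arg t p) = 0" for p
 proof -
  have "arg t p ~: P"
   using rho_z'[of "arg t p"] assms(2) by (auto simp: P_def arg_def ek_def)
  then show ?thesis by (simp add: U_def)
 qed
 then show ?thesis by (simp add: V_def)
qed

lemma V_hol: "hol Q V"
 unfolding hol_def
proof (intro conjI ballI)
 show "open Q" by (rule open_Q)
 fix t assume t: "t : Q"
 then have tN: "t : N" using Q_N by blast
 have d: "(V has_derivative V' t) (at t)" using V_deriv tN N_Ninf by blast
 have "clin (V' t)"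
  by (rule clin_if_wb_zero[OF has_derivative_linear[OF d]]) (insert V'_wb[OF tN] PQ_disj t, simp add: U_def)
 then show "EX L. (V has_derivative L) (at t) & clin L" using d by blast
qed

text \<open>Below \<open>M\<close> the transform is holomorphic, and it vanishes near the bottom,
  where the lines of integration miss \<open>P\<close>. For fixed \<open>w\<close> the part of the
  \<open>z\<close>-slice in \<open>Q\<close> is connected, so the identity theorem spreads the zero
  over all of it.\<close>

lemma V_zero_Q:
 assumes t: "t : Q" shows "V t = 0"
proof -
 obtain w z0 where tw: "t = (w,z0)" by (cases t)
 define A where "A = {z. (w,z) : Q}"
 define S where "S = {z. (w,z) : N & Im z < - d1/2}"
 have tN: "t : N" using t Q_N by blast
 have Nw: "(w,z) : N \<longleftrightarrow> (abs (Re z)) < d & - d1 < Im z & Im z < d" for z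
  using tN by (auto simp: N_def hbox_def tw)
 have oA: "open A"
  using open_vimage[OF open_Q, of "%z. (w,z)"] by (simp add: A_def vimage_def continuous_intros)
 have S_eq: "S = {z. - d < Re z} Int {z. Re z < d} Int {z. - d1 < Im z} Int {z. Im z < - d1/2}"
  using d d1 by (auto simp: S_def Nw)
 have oS: "open S" unfolding S_eq
  by (intro open_Int open_halfspace_Re_gt open_halfspace_Re_lt open_halfspace_Im_gt open_halfspace_Im_lt)
 have cS: "convex S" unfolding S_eq
  by (intro convex_Int convex_halfspace_Re_gt convex_halfspace_Re_lt convex_halfspace_Im_gt convex_halfspace_Im_lt)
 have SA: "S <= A" using rho_z' by (auto simp: S_def A_def Q_def)
 define z1 where "z1 = Complex 0 (- 3 * d1/4)"
 have z1: "z1 : S" using d d1 by (simp add: S_eq z1_def)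
 \<comment> \<open>Moving straight down decreases \<open>rh\<close>, so every point of the slice
   reaches the convex bottom strip without leaving \<open>Q\<close>.\<close>
 have vert: "connected_component A z z1" if z: "z : A" for z
 proof -
  define z' where "z' = Complex (Re z) (min (Im z) (- 3 * d1/4))"
  have zN: "(w,z) : N" using z Q_N by (auto simp: A_def)
  have z'S: "z' : S" using zN d1 by (auto simp: S_eq z'_def Nw min_def)
  have seg: "closed_segment z z' <= A"
  proof
   fix y assume "y : closed_segment z z'"
   then have ry: "Re y = Re z" and iy: "Im z' <= Im y" "Im y <= Im z"
   proof -
    obtain u where u: "0 <= u" "u <= 1" "y = (1-u) *R z+u *R z'" using \<open>y \<in> closed_segment z z'\<close> by (auto simp: in_segment)
    have "Re y = (1-u) * Re z+u * Re z'" by (simp add: u(3))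
    then show "Re y = Re z" by (simp add: z'_def algebra_simps)
    have le: "Im z' <= Im z" by (simp add: z'_def)
    have "Im y = (1-u) * Im z+u * Im z'" by (simp add: u(3))
    then have "Im y = Im z-u * (Im z-Im z')" by (simp add: algebra_simps)
    moreover have "0 <= u * (Im z-Im z')" "u * (Im z-Im z') <= 1*(Im z-Im z')"
     using u(1,2) le by (simp, intro mult_right_mono) auto
    ultimately show "Im z' <= Im y" "Im y <= Im z" by auto
   qed
   have yN: "(w,y) : N" using z'S zN ry iy d1 by (auto simp: Nw S_eq)
   have "Re (rh (w,y)) < 0"
   proof (cases "Im y = Im z")
    case True
    then have "y = z" using ry by (simp add: complex_eq_iff)
    then show ?thesis using z by (simp add: A_def Q_def)
   next
    case False
    have "(w,y)+(Im z-Im y) *R ey = (w,z)" using ry by (simp add: ey_def complex_eq_iff)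
    then have "Re (rh (w,y)) < Re (rh (w,z))"
     using rho_mono[OF yN, of "Im z-Im y"] False iy zN by simp
    then show ?thesis using z by (simp add: A_def Q_def)
   qed
   then show "y : A" using yN by (simp add: A_def Q_def)
  qed
  have "connected_component A z z'"
   unfolding connected_component_def using seg by (intro exI[of _ "closed_segment z z'"]) auto
  moreover have "connected_component A z' z1"
   unfolding connected_component_def using SA z'S z1 convex_connected[OF cS] by blast
  ultimately show ?thesis by (rule connected_component_trans)
 qed
 have cA: "connected A"
  unfolding connected_iff_connected_component
  using vert connected_component_sym connected_component_trans by metis
 have hA: "(%z. V (w,z)) holomorphic_on A"
  using hol_compose[OF V_hol hol_Pair[OF hol_const[OF oA, of w] hol_id[OF oA]]] hol_iff_holomorphic_on[OF oA] by (simp add: A_def)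
 have "V (w,z0) = 0"
 proof (rule analytic_continuation_open[OF oS oA _ cA SA hA holomorphic_on_const])
  show "S ~= {}" using z1 by blast
  show "V (w,z) = 0" if "z : S" for z using V_zero_deep[of "(w,z)"] that by (simp add: S_def)
  show "z0 : A" using t by (simp add: A_def tw)
 qed
 then show ?thesis by (simp add: tw)
qed

lemma limit_from_Q:
 fixes F :: "'m cn => complex"
 assumes F: "continuous_on N F" and z: "!!t. t : Q ==> F t = 0" and t: "t : M" shows "F t = 0"
proof -
 have tN: "t : N" using t M_N by blast
 obtain r where r: "r > 0" "ball t r <= N" using open_N tN open_contains_ball by blast
 have lim: "((%s. t-s *R ey) \<longlongrightarrow> t) (at_right 0)" by (auto intro!: tendsto_eq_intros)
 have "isCont F t" using F open_N tN by (simp add: continuous_on_eq_continuous_at)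
 then have 1: "((%s. F (t-s *R ey)) \<longlongrightarrow> F t) (at_right 0)"
  by (rule isCont_tendsto_compose[OF _ lim])
 have "t-s *R ey : Q" if "0 < s" "s < r" for s
 proof -
  have "t-s *R ey : N" using r that by (auto simp: dist_norm intro!: subsetD[OF r(2)])
  then show ?thesis using rho_mono[of "t-s *R ey" s] that tN t by (auto simp: Q_def M_def)
 qed
 then have "\<forall>\<^sub>F s in at_right 0. F (t-s *R ey) = 0"
  unfolding eventually_at_right[OF zero_less_one] using r(1) z by blast
 from tendsto_cong[OF this] 1 have "((%s. 0) \<longlongrightarrow> F t) (at_right (0::real))" by simp
 then show ?thesis using tendsto_const_iff trivial_limit_at_right_real by (metis (no_types) tendsto_unique tendsto_const)
qed

lemma V_zero_M: "t : M ==> V t = 0"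
proof (rule limit_from_Q)
 show "continuous_on N V"
  using V_deriv N_Ninf by (auto intro!: continuous_at_imp_continuous_on has_derivative_continuous)
qed (use V_zero_Q in auto)

lemma V'_zero_M: "t : M ==> V' t v = 0"
proof (rule limit_from_Q[where F="%t. V' t v"])
 show "continuous_on N (%t. V' t v)" using V'_cont N_Ninf continuous_on_subset by blast
 fix t assume t: "t : Q"
 have "((%_. 0) has_derivative (%_. 0)) (at t)" by simp
 from has_derivative_transform_within_open[OF this open_Q t, of V]
 have "(V has_derivative (%_. 0)) (at t)" using V_zero_Q by auto
 moreover have "(V has_derivative V' t) (at t)" using V_deriv t Q_N N_Ninf by blast
 ultimately show "V' t v = 0" by (metis has_derivative_unique)
qed

text \<open>Since \<open>V\<close> and its differential vanish on \<open>M\<close> as limits from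
  \<open>Q\<close>, the corrected function keeps the first order data of \<open>g\<close> there,
  while dbar of \<open>V\<close> cancels dbar of \<open>g\<close> on \<open>K\<close>. The last
  conclusion identifies the boundary values of its derivatives.\<close>

lemma hartogs_difference:
 defines "F \<equiv> %t. g t-V t"
 shows "!!t. t : N ==> (F has_derivative frechet_derivative F (at t)) (at t)"
  and "!!t. t : K ==> clin (frechet_derivative F (at t))"
  and "!!v. continuous_on N (%t. fd F t v)"
  and "!!t. t : M ==> F t = g t"
  and "!!t v. t : M ==> fd F t v = wd v g t"
proof -
 have D: "(F has_derivative (%v. fd g t v-V' t v)) (at t)" if "t : N" for t
  unfolding F_def by (intro has_derivative_diff bsm_open(1)[OF open_N gb that] V_deriv) (use that N_Ninf in auto)
 then have e: "frechet_derivative F (at t) = (%v. fd g t v-V' t v)" if "t : N" for t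
  using frechet_derivative_at[OF D[OF that]] by simp
 show d: "(F has_derivative frechet_derivative F (at t)) (at t)" if "t : N" for t
  using D[OF that] e[OF that] by simp
 show "continuous_on N (%t. fd F t v)" for v
  using e bsm_continuous_on[OF bsm_open(2)[OF open_N gb], of v] continuous_on_subset[OF V'_cont N_Ninf, of v]
  by (simp add: continuous_intros cong: continuous_on_cong)
 show "F t = g t" if "t : M" for t using V_zero_M[OF that] by (simp add: F_def)
 show "fd F t v = wd v g t" if t: "t : M" for t v
 proof -
  have "t : N" using t M_N by blast
  then show ?thesis using e[of t] V'_zero_M[OF t] g0[OF t, of v] fd_eq_wd_wb[of g t v] by simp
 qed
 show "clin (frechet_derivative F (at t))" if t: "t : K" for t
 proof (rule clin_if_wb_zero)
  have tN: "t : N" using t K_N by blast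
  show "linear (frechet_derivative F (at t))" using d[OF tN] by (rule has_derivative_linear)
  fix u
  have "fd F t u+\<i> * fd F t (cs \<i> u) = 2 * wb u g t-(V' t u+\<i> * V' t (cs \<i> u))"
   by (simp add: e[OF tN] wb_def algebra_simps)
  also have "... = 2 * wb u g t-2 * U u t" by (simp add: V'_wb[OF tN])
  also have "... = 0" using t g0[of t u] PQ_disj by (auto simp: U_def K_eq)
  finally show "fd F t u+\<i> * fd F t (cs \<i> u) = 0" .
 qed
qed

end

definition Ext :: "('m cn => complex) => ('m cn => complex) => bool" where
 "Ext f F \<longleftrightarrow> continuous_on K F & hol P F & (ALL t:M. F t = f t)"

text \<open>The derivative of the extension in direction \<open>v\<close> has boundary values
  \<open>wd v g\<close>, and these are CR again: \<open>wb\<close> commutes with \<open>wd\<close>,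
  and the first derivatives of \<open>wb u g\<close> vanish on \<open>M\<close>. This makes the
  construction repeatable.\<close>

lemma Ext_exists:
 assumes f: "crf f"
 shows "EX F. Ext f F & (ALL t:K. (F has_derivative frechet_derivative F (at t)) (at t) & clin (frechet_derivative F (at t))) &
  (ALL v. EX h. crf h & Ext h (%t. fd F t v))"
proof -
 obtain g where g: "bsm False N g" "!!t. t : M ==> g t = f t"
  "!!u t. t : M ==> wb u g t = 0" "!!u v t. t : M ==> fd (wb u g) t v = 0"
  using flat_extension[OF f] by blast
 define F where "F = (%t. g t-V g t)"
 have "ALL u. ALL t:M. wb u g t = 0 & (ALL v. fd (wb u g) t v = 0)" using g(3,4) by blast
 note h = hartogs_difference[OF g(1) this, folded F_def]
 have hP: "hol P F"
  unfolding hol_def using open_P h(1,2) P_N K_eq by blast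
 have cF: "continuous_on N F"
  using h(1) by (auto intro!: continuous_at_imp_continuous_on has_derivative_continuous)
 have "Ext f F" unfolding Ext_def using continuous_on_subset[OF cF K_N] hP h(4) g(2) unfolding F_def by metis
 moreover have "EX h. crf h & Ext h (%t. fd F t v)" for v
 proof (intro exI conjI)
  show "crf (wd v g)"
   unfolding crf_def
  proof (intro conjI ballI allI)
   show "bsm False N (wd v g)" by (rule wbs(2)[OF g(1)])
   fix t u assume t: "t : M"
   then have tN: "t : N" using M_N by blast
   have "wb u (wd v g) t = 0" for u
    unfolding wb_wd_commute[OF open_N g(1) tN] wd_def[of v "wb u g"] using g(4)[OF t] by simp
   then show "wb u (wd v g) t * wb ez rh t = wb ez (wd v g) t * wb u rh t" by simp
  qed
  have "hol P (%t. fd F t v)"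
   by (rule hol_cong[OF hol_ldv[OF hP, of v]]) (simp add: hol_frechet_eq_ldv[OF hP])
  then show "Ext (wd v g) (%t. fd F t v)"
   unfolding Ext_def using continuous_on_subset[OF h(3) K_N] h(5) by simp
 qed
 ultimately show ?thesis using h(1,2) K_N by blast
qed

text \<open>On the complex line in direction \<open>k\<close> through \<open>t\<close> the part in
  \<open>P\<close> is bounded and its frontier lies in \<open>M\<close>, because \<open>rh\<close>
  is negative where the \<open>k\<close>-th coordinate has modulus at least \<open>1\<close>. The
  maximum principle applies to the difference.\<close>

lemma Ext_unique:
 assumes "Ext f F1" "Ext f F2" "t : K" shows "F1 t = F2 t"
proof (cases "t : P")
 case False
 then show ?thesis using assms by (auto simp: Ext_def K_eq)
next
 case True
 define D where "D = (%t. F1 t-F2 t)"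
 have D: "continuous_on K D" "hol P D" "!!t. t : M ==> D t = 0"
  using assms by (auto simp: Ext_def D_def intro!: continuous_intros)
 define S where "S = {zt. t+cs zt ek : P}"
 have oS: "open S" unfolding S_def by (rule open_line[OF open_P])
 have tN: "t : N" using True P_N by blast
 have tI: "t : Ninf" using tN N_Ninf by blast
 have kk: "fst (t+cs zt ek) $ k = fst t $ k+zt" for zt by (simp add: ek_def)
 have lineI: "t+cs zt ek : Ninf" for zt using tI by (auto simp: Ninf_def ek_def axis_def)
 have S1: "cmod (fst t $ k+zt) < 1" if "zt : S" for zt
  using that rho_w'[of "t+cs zt ek"] kk[of zt] by (force simp: S_def P_def)
 have clS: "t+cs zt ek : K" if zt: "zt : closure S" for zt
 proof -
  have "closure S <= {zt. cmod (fst t $ k+zt) <= 1}"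
   by (rule closure_minimal) (insert S1, force intro: closed_Collect_le continuous_intros)+
  then have b1: "t+cs zt ek : N" if "zt : closure S" for zt
   using that lineI[of zt] R kk[of zt] by (auto simp: N_eq)
  have "continuous_on (closure S) (%zt. Re (rh (t+cs zt ek)))"
   by (intro continuous_intros continuous_on_compose2[OF cont_rho] cs.continuous_on) (use b1 in auto)
  moreover have "ALL zt:S. 0 <= Re (rh (t+cs zt ek))" by (auto simp: S_def P_def)
  ultimately have "0 <= Re (rh (t+cs zt ek))"
   using continuous_ge_on_closure[of S "%zt. Re (rh (t+cs zt ek))" zt 0] zt by blast
  then show ?thesis using b1[OF zt] by (simp add: K_def)
 qed
 have "cmod (D (t+cs 0 ek)) <= 0"
 proof (rule maximum_modulus_frontier[where S=S and f="%zt. D (t+cs zt ek)"])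
  show "(%zt. D (t+cs zt ek)) holomorphic_on interior S"
   using hol_imp_ghol[OF D(2)] unfolding ghol_def interior_open[OF oS] unfolding S_def by blast
  show "continuous_on (closure S) (%zt. D (t+cs zt ek))"
   by (intro continuous_on_compose2[OF D(1)] continuous_intros cs.continuous_on) (use clS in auto)
  have "S <= cball (- fst t $ k) 1"
   using S1 by (force simp: dist_norm norm_minus_commute add.commute)
  then show "bounded S" using bounded_cball bounded_subset by blast
  show "0 : S" using True by (simp add: S_def cs.zero_left)
  fix z assume z: "z : frontier S"
  then have "z : closure S" "z ~: S" using oS by (auto simp: frontier_def interior_open)
  then have "t+cs z ek : M" using clS[of z] by (auto simp: S_def K_eq)
  then show "cmod (D (t+cs z ek)) <= 0" using D(3) by simp
 qed
 then show ?thesis by (simp add: D_def cs.zero_left)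
qed

text \<open>A single construction controls first derivatives only. By uniqueness each derivative of
  a good extension is the good extension of another CR function, so coinduction delivers all orders
  up to the boundary.\<close>

theorem CR_extension:
 assumes f: "crf f" obtains F where "bsm True K F" "!!t. t : M ==> F t = f t"
proof -
 define good where "good F \<longleftrightarrow> (EX f. crf f & Ext f F &
  (ALL t:K. (F has_derivative frechet_derivative F (at t)) (at t) & clin (frechet_derivative F (at t))) &
  (ALL v. EX h. crf h & Ext h (%t. fd F t v)))" for F
 have ex: "EX F. good F & Ext h F" if "crf h" for h
  using Ext_exists[OF that] that unfolding good_def by blast
 have "bsm True K F" if "good F" for F
  using that
 proof (rule bsm_coinduct_set)
  fix F assume F: "good F"
  then obtain H where H: "!!v. crf (H v)" "!!v. Ext (H v) (%t. fd F t v)"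
   unfolding good_def by metis
  obtain F' where F': "!!v. good (F' v)" "!!v. Ext (H v) (F' v)" using ex[OF H(1)] by metis
  have e: "frechet_derivative F (at t) = (%v. F' v t)" if "t : K" for t
   using Ext_unique[OF H(2) F'(2) that] by blast
  have "hasder True K F F'"
   unfolding hasder_def using F e unfolding good_def by (metis has_derivative_at_withinI)
  then show "EX f'. hasder True K F f' & (ALL v. good (f' v) | bsm True K (f' v))" using F'(1) by blast
 qed
 then show ?thesis using ex[OF f] that unfolding Ext_def by blast
qed

end

subsection \<open>Complexification of real analytic functions\<close>

definition cj :: "'m::finite cn => 'm cn" where
 "cj t = (\<chi> i. cnj (fst t $ i),cnj (snd t))"

lemma fst_cj [simp]: "fst (cj t) $ i = cnj (fst t $ i)"
 and snd_cj [simp]: "snd (cj t) = cnj (snd t)"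
 by (simp_all add: cj_def)

lemma cj_cj [simp]: "cj (cj t) = t"
 by (simp add: prod_eq_iff vec_eq_iff)

lemma cj_0 [simp]: "cj 0 = 0"
 by (simp add: prod_eq_iff vec_eq_iff)

lemma cj_add: "cj (s+t) = cj s+cj t" and cj_cs: "cj (cs c t) = cs (cnj c) (cj t)"
 and cj_diff: "cj (s-t) = cj s-cj t"
 by (simp_all add: prod_eq_iff vec_eq_iff)

lemma norm_cj [simp]: "norm (cj t) = norm t"
 by (simp add: norm_prod_def norm_vec_def L2_set_def)

lemma bounded_linear_cj: "bounded_linear cj"
 by (rule bounded_linear_intro[of _ 1]) (auto simp: cj_add prod_eq_iff vec_eq_iff)

lemma cj_ball [simp]: "cj t : ball 0 s \<longleftrightarrow> t : ball 0 s"
 by simp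

lemma clin_conj:
 assumes "clin L" shows "clin (%v. cj (L (cj v)))"
 unfolding clin_def
proof (intro allI)
 fix c v show "cj (L (cj (cs c v))) = cs c (cj (L (cj v)))"
  unfolding cj_cs clinD[OF assms] by simp
qed

lemma hol_conj:
 assumes f: "hol S f" shows "hol {t. cj t : S} (%t. cj (f (cj t)))"
 unfolding hol_def
proof (intro conjI ballI)
 have "open (cj -` S)" by (rule open_vimage[OF hol_open[OF f]]) (rule linear_continuous_on[OF bounded_linear_cj])
 then show "open {t. cj t : S}" by (simp add: vimage_def)
 fix t assume "t : {t. cj t : S}"
 then have t: "cj t : S" by simp
 have "((%t. cj (f (cj t))) has_derivative (%v. cj (frechet_derivative f (at (cj t)) (cj v)))) (at t)"
  by (intro bounded_linear.has_derivative[OF bounded_linear_cj]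
    has_derivative_compose[OF bounded_linear_imp_has_derivative[OF bounded_linear_cj] hol_deriv(1)[OF f t]])
 then show "EX L. ((%t. cj (f (cj t))) has_derivative L) (at t) & clin L"
  using clin_conj[OF hol_deriv(2)[OF f t]] by blast
qed

text \<open>Each real coordinate in the power series is replaced by the complex linear form
  \<open>X b\<close> on pairs, which returns that coordinate when the second argument is the
  conjugate of the first. Real coefficients give the Hermitian symmetry.\<close>

lemma real_analytic_complexify:
 fixes rh :: "'m::finite cn => real"
 assumes ra: "real_analytic_on V rh" and p: "p : V"
 obtains s sx where "s > 0" "hol (ball 0 s \<times> ball 0 s) sx"
  "!!t ta. t : ball 0 s ==> ta : ball 0 s ==> sx (cj ta,cj t) = cnj (sx (t,ta))"
  "!!t. t : ball 0 s ==> sx (t,cj t) = of_real (rh (p+t))"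
proof -
 define A where "A = {al :: 'm cn => nat. ALL b. b ~: Basis --> al b = 0}"
 obtain r c where r: "r > 0" and sm: "!!x. x : ball p r ==>
   ((%al. c al * (\<Prod>b\<in>Basis. ((x-p) \<bullet> b)^(al b))) has_sum rh x) A"
  using ra p unfolding real_analytic_on_def A_def by blast
 \<comment> \<open>The point \<open>x1\<close> with all real coordinates equal to \<open>s0\<close>
   still lies in the ball, and convergence there supplies the majorant for the complexified
   series.\<close>
 define s0 where "s0 = r/(2 * DIM('m cn))"
 have s0: "s0 > 0" using r by (simp add: s0_def)
 define x1 where "x1 = (\<Sum>b\<in>Basis. s0 *R b :: 'm cn)"
 have "norm x1 <= (\<Sum>b\<in>(Basis :: 'm cn set). s0)"
  unfolding x1_def by (rule sum_norm_le) (use s0 in auto)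
 also have "... = r/2" using DIM_positive[where 'a="'m cn"] by (simp add: s0_def del: DIM_prod DIM_cart DIM_complex)
 also have "... < r" using r by simp
 finally have "p+x1 : ball p r" by (simp add: dist_norm)
 moreover have "(p+x1-p) \<bullet> b = s0" if "b : Basis" for b
  using that by (simp add: x1_def inner_sum_left inner_Basis sum.delta' if_distrib cong: if_cong)
 ultimately have "((%al. c al * (\<Prod>b\<in>(Basis :: 'm cn set). s0^al b)) has_sum rh (p+x1)) A"
  using sm[of "p+x1"] by simp
 then have "(%al. c al * (\<Prod>b\<in>(Basis :: 'm cn set). s0^al b)) summable_on A"
  by (rule has_sum_imp_summable)
 then have "(%al. norm (c al * (\<Prod>b\<in>(Basis :: 'm cn set). s0^al b))) summable_on A"
  by (rule summable_on_iff_abs_summable_on_real[THEN iffD1])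
 moreover have "norm (c al * (\<Prod>b\<in>(Basis :: 'm cn set). s0^al b)) = \<bar>c al\<bar> * (\<Prod>b\<in>(Basis :: 'm cn set). s0^al b)" for al
  using s0 by (simp add: abs_mult abs_prod power_abs)
 ultimately have sumM: "(%al. \<bar>c al\<bar> * (\<Prod>b\<in>(Basis :: 'm cn set). s0^al b)) summable_on A"
  by simp
 define s where "s = s0/2"
 have s: "s > 0" using s0 by (simp add: s_def)
 have sr: "s < r"
 proof -
  have "1 <= real DIM('m cn)" using DIM_positive[where 'a="'m cn"] by linarith
  then have "s0 <= r/2" unfolding s0_def using r by (intro divide_left_mono) auto
  then show ?thesis using s0 by (simp add: s_def)
 qed
 \<comment> \<open>The complex linear functional whose real part is the coordinate along
   \<open>b\<close>.\<close>
 define l where "l b t = complex_of_real (t \<bullet> b)-\<i> * of_real (cs \<i> t \<bullet> b)" for b t :: "'m cn"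
 define X where "X b q = (l b (fst q)+cnj (l b (cj (snd q))))/2" for b :: "'m cn" and q
 have l_bl: "bounded_linear (l b)" for b
  unfolding l_def
  by (intro bounded_linear_sub bounded_linear_compose[OF bounded_linear_of_real] bounded_linear_inner_left
    bounded_linear_const_mult bounded_linear_compose[OF bounded_linear_inner_left cs.bounded_linear_right])
 have l_clin: "clin (l b)" for b
  unfolding clin_def l_def
 proof (intro allI)
  fix d :: complex and v :: "'m cn"
  have 1: "cs d v \<bullet> b = Re d * (v \<bullet> b)+Im d * (cs \<i> v \<bullet> b)"
   by (subst cs_split) (simp add: inner_add_left)
  have "cs \<i> (cs d v) = cs d (cs \<i> v)" by (simp only: cs_cs mult.commute)
  then have 2: "cs \<i> (cs d v) \<bullet> b = Re d * (cs \<i> v \<bullet> b)-Im d * (v \<bullet> b)"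
   by (simp only: cs_split[of d "cs \<i> v"]) (simp add: inner_add_left inner_diff_left)
  show "complex_of_real (cs d v \<bullet> b)-\<i> * complex_of_real (cs \<i> (cs d v) \<bullet> b) =
   cs d (complex_of_real (v \<bullet> b)-\<i> * complex_of_real (cs \<i> v \<bullet> b))"
   unfolding 1 2 by (simp add: complex_eq_iff algebra_simps)
 qed
 have l_bound: "cmod (l b t) <= 2 * norm t" if "b : Basis" for b t
 proof -
  have "cmod (l b t) <= cmod (complex_of_real (t \<bullet> b))+cmod (\<i> * of_real (cs \<i> t \<bullet> b))"
   unfolding l_def by (rule norm_triangle_ineq4)
  also have "... <= norm t+norm (cs \<i> t)"
   using Basis_le_norm[OF that, of t] Basis_le_norm[OF that, of "cs \<i> t"] by (simp add: norm_mult)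
  finally show ?thesis by simp
 qed
 have X_bound: "cmod (X b q) <= s0" if "b : Basis" "q : ball 0 s \<times> ball 0 s" for b q
 proof -
  have "cmod (X b q) <= (cmod (l b (fst q))+cmod (cnj (l b (cj (snd q)))))/2"
   unfolding X_def norm_divide using norm_triangle_ineq[of "l b (fst q)" "cnj (l b (cj (snd q)))"] by simp
  also have "... <= norm (fst q)+norm (snd q)"
   using l_bound[OF that(1), of "fst q"] l_bound[OF that(1), of "cj (snd q)"] by simp
  also have "... <= s0" using that(2) by (simp add: s_def mem_Times_iff)
  finally show ?thesis .
 qed
 have oS: "open (ball (0 :: 'm cn) s \<times> ball (0 :: 'm cn) s)" by (intro open_Times open_ball)
 have X_hol: "hol UNIV (X b)" for b
 proof (rule hol_linear)
  have "bounded_linear (%q. l b (fst q)+cnj (l b (cj (snd q))))"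
   by (intro bounded_linear_add bounded_linear_compose[OF bounded_linear_cnj] bounded_linear_compose[OF l_bl]
     bounded_linear_compose[OF bounded_linear_cj] bounded_linear_fst bounded_linear_snd)
  then show "bounded_linear (X b)" unfolding X_def[abs_def]
   by (rule bounded_linear_compose[OF bounded_linear_divide])
  show "clin (X b)"
   unfolding clin_def
  proof (intro allI)
   fix e and v :: "'m cn \<times> 'm cn"
   show "X b (cs e v) = cs e (X b v)"
    by (simp add: X_def cj_cs clinD[OF l_clin] add_divide_distrib distrib_left)
  qed
 qed simp
 define T where "T al q = complex_of_real (c al)*(\<Prod>b\<in>Basis. X b q^al b)" for al q
 define sx where "sx q = (\<Sum>\<^sub>\<infinity>al\<in>A. T al q)" for q
 have T_bound: "norm (T al q) <= \<bar>c al\<bar> * (\<Prod>b\<in>(Basis :: 'm cn set). s0^al b)"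
  if "q : ball 0 s \<times> ball 0 s" for al q
  unfolding T_def norm_mult prod_norm[symmetric] norm_power norm_of_real
  by (intro mult_left_mono prod_mono conjI power_mono X_bound that) auto
 have ul: "uniform_limit (ball 0 s \<times> ball 0 s) (%Y q. \<Sum>al\<in>Y. T al q) sx (finite_subsets_at_top A)"
  unfolding sx_def[abs_def] by (rule Weierstrass_m_test_general[OF T_bound sumM])
 have T_hol: "hol (ball 0 s \<times> ball 0 s) (T al)" for al
  unfolding T_def[abs_def] by (intro hol_mult hol_const hol_prod hol_power oS hol_subset[OF X_hol oS]) auto
 have hol: "hol (ball 0 s \<times> ball 0 s) sx"
 proof (rule hol_uniform_limit[OF finite_subsets_at_top_neq_bot[of A]])
  fix q assume "q : ball (0 :: 'm cn) s \<times> ball (0 :: 'm cn) s"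
  have "\<forall>\<^sub>F Y in finite_subsets_at_top A. hol (ball 0 s \<times> ball 0 s) (%q. \<Sum>al\<in>Y. T al q)"
   by (rule always_eventually) (intro allI hol_sum oS T_hol)
  then show "EX Z. q : Z & Z <= ball 0 s \<times> ball 0 s & open Z &
   (\<forall>\<^sub>F Y in finite_subsets_at_top A. hol Z (%q. \<Sum>al\<in>Y. T al q)) & uniform_limit Z (%Y q. \<Sum>al\<in>Y. T al q) sx (finite_subsets_at_top A)"
   using ul oS \<open>q \<in> _\<close> by (intro exI[of _ "ball 0 s \<times> ball 0 s"] conjI subset_refl)
 qed
 show ?thesis
 proof (rule that[OF s hol])
  fix t ta :: "'m cn"
  have "X b (cj ta,cj t) = cnj (X b (t,ta))" for b by (simp add: X_def add.commute)
  then have "T al (cj ta,cj t) = cnj (T al (t,ta))" for al by (simp add: T_def)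
  then show "sx (cj ta,cj t) = cnj (sx (t,ta))" by (simp add: sx_def infsum_cnj)
 next
  fix t :: "'m cn" assume t: "t : ball 0 s"
  have "X b (t,cj t) = of_real (t \<bullet> b)" for b by (simp add: X_def l_def)
  then have e: "T al (t,cj t) = of_real (c al * (\<Prod>b\<in>Basis. (t \<bullet> b)^al b))" for al by (simp add: T_def)
  have "p+t : ball p r" using t sr by (simp add: dist_norm)
  from sm[OF this] have "((%al. c al * (\<Prod>b\<in>Basis. (t \<bullet> b)^al b)) has_sum rh (p+t)) A" by simp
  then have "((%al. complex_of_real (c al * (\<Prod>b\<in>Basis. (t \<bullet> b)^al b))) has_sum of_real (rh (p+t))) A"
   by (rule has_sum_of_real)
  then show "sx (t,cj t) = of_real (rh (p+t))" by (simp add: sx_def e infsumI del: of_real_mult)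
 qed
qed

subsection \<open>Normal form of the defining equation\<close>

lemma ldv_eqI: "(f has_derivative L) (at x) ==> ghol S f ==> x : S ==> ldv f x v = L v"
 using ghol_has_derivative(1) has_derivative_unique by metis

lemma hol_derivL: "hol S (f :: 'a::cvec => complex) ==> x : S ==> (f has_derivative ldv f x) (at x)"
 using ghol_has_derivative(1) ghol_iff_hol by blast

lemma ldv_linear: "hol S (f :: 'a::cvec => complex) ==> x : S ==> linear (ldv f x)"
 using hol_derivL has_derivative_linear by blast

text \<open>A complexified real function: the second argument ranges over the conjugate domain, and
  the symmetry makes values on the diagonal \<open>(t,cj t)\<close> real.\<close>

definition real_cx :: "'m::finite cn set => ('m cn \<times> 'm cn => complex) => bool" where
 "real_cx S sx \<longleftrightarrow> hol (S \<times> {ta. cj ta : S}) sx & (ALL t:S. ALL ta. cj ta : S --> sx (cj ta,cj t) = cnj (sx (t,ta)))"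

lemma real_cx_pullback:
 assumes sx: "real_cx S sx" and A: "hol T A" "!!t. t : T ==> A t : S"
 shows "real_cx T (%q. sx (A (fst q),cj (A (cj (snd q)))))"
 unfolding real_cx_def
proof (intro conjI ballI allI impI)
 have oT: "open T" using A(1) by (rule hol_open)
 have h2: "hol {ta. cj ta : T} (%ta. cj (A (cj ta)))" by (rule hol_conj[OF A(1)])
 have o: "open (T \<times> {ta. cj ta : T})" using oT hol_open[OF h2] by (rule open_Times)
 show "hol (T \<times> {ta. cj ta : T}) (%q. sx (A (fst q),cj (A (cj (snd q)))))"
 proof (rule hol_compose[where T="S \<times> {ta. cj ta : S}"])
  show "hol (S \<times> {ta. cj ta : S}) sx" using sx by (simp add: real_cx_def)
  show "hol (T \<times> {ta. cj ta : T}) (%q. (A (fst q),cj (A (cj (snd q)))))"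
  proof (rule hol_Pair)
   show "hol (T \<times> {ta. cj ta : T}) (%q. A (fst q))"
    by (rule hol_compose[OF A(1)]) (use o in auto)
   show "hol (T \<times> {ta. cj ta : T}) (%q. cj (A (cj (snd q))))"
    by (rule hol_compose[OF h2]) (use o in auto)
  qed
  show "(A (fst q),cj (A (cj (snd q)))) : S \<times> {ta. cj ta : S}" if "q : T \<times> {ta. cj ta : T}" for q
   using that A(2)[of "fst q"] A(2)[of "cj (snd q)"] by (simp add: mem_Times_iff)
 qed
next
 fix t ta assume "t : T" "cj ta : T"
 then have "A t : S" "cj (cj (A (cj ta))) : S" using A(2)[of t] A(2)[of "cj ta"] by simp_all
 then have "sx (cj (cj (A (cj ta))),cj (A t)) = cnj (sx (A t,cj (A (cj ta))))"
  using sx unfolding real_cx_def by blast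
 then show "sx (A (fst (cj ta,cj t)),cj (A (cj (snd (cj ta,cj t))))) = cnj (sx (A (fst (t,ta)),cj (A (cj (snd (t,ta))))))"
  by simp
qed

text \<open>The chart straightens the Segre variety of \<open>p\<close>, the zero set of
  \<open>sx (t,0)\<close>, to the hyperplane where the last coordinate is \<open>0\<close>.
  Minimality then says exactly what the last conclusion records: this hyperplane is not contained in
  \<open>M\<close> near the origin. The maps \<open>Xi\<close> and \<open>Ps\<close> are the chart
  and its local inverse.\<close>

lemma normal_chart:
 fixes M :: "'m::finite cn set"
 assumes M: "real_analytic_hypersurface M" and p: "p : M" and V0: "open V0" "p : V0" and min: "minimal_at M p"
 obtains s and Xi :: "'m cn => 'm cn" and sx and V1 :: "'m cn set" and Ps :: "'m cn => 'm cn" where "s > 0" "hol (ball 0 s) Xi" "Xi 0 = p" "!!t. t : ball 0 s ==> Xi t : V0"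
  "real_cx (ball 0 s) sx" "!!t. t : ball 0 s ==> sx (t,0) = snd t/(2 * \<i>)"
  "!!t. t : ball 0 s ==> Xi t : M \<longleftrightarrow> sx (t,cj t) = 0"
  "open V1" "p : V1" "hol V1 Ps" "Ps p = 0" "!!x. x : V1 ==> Ps x : ball 0 s & Xi (Ps x) = x"
  "!!e. e > 0 ==> EX w. norm w < e & sx ((w,0),cj (w,0)) ~= 0"
proof -
 obtain V rh where V: "open V" "p : V" and ra: "real_analytic_on V rh" and MV: "M Int V = {x\<in>V. rh x = 0}"
  and dr: "ALL x:V. EX D. (rh has_derivative D) (at x) & D ~= (%_. 0)"
  using M p unfolding real_analytic_hypersurface_def by blast
 obtain s1 sx0 where s1: "s1 > 0" and h1: "hol (ball 0 s1 \<times> ball 0 s1) sx0"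
  and re1: "!!t ta. t : ball 0 s1 ==> ta : ball 0 s1 ==> sx0 (cj ta,cj t) = cnj (sx0 (t,ta))"
  and eq1: "!!t. t : ball 0 s1 ==> sx0 (t,cj t) = of_real (rh (p+t))"
  using real_analytic_complexify[OF ra V(2)] by blast
 have "open (V Int V0)" "p : V Int V0" using V V0 by auto
 then obtain s2 where s2: "s2 > 0" "ball p s2 <= V Int V0" using open_contains_ball by blast
 define s0 where "s0 = min s1 s2"
 have s0: "s0 > 0" "s0 <= s1" "s0 <= s2" using s1 s2 by (auto simp: s0_def)
 define B where "B = ball (0 :: 'm cn) s0"
 have B1: "B <= ball 0 s1" and B0: "0 : B" using s0 by (auto simp: B_def)
 have Bc: "cj t : B \<longleftrightarrow> t : B" for t by (simp add: B_def)
 have BV: "p+t : V" "p+t : V0" if "t : B" for t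
 proof -
  have "p+t : ball p s2" using that s0 by (simp add: B_def dist_norm)
  then show "p+t : V" "p+t : V0" using s2(2) by blast+
 qed
 have cx: "real_cx B sx0"
  unfolding real_cx_def
 proof (intro conjI ballI allI impI)
  show "hol (B \<times> {ta. cj ta : B}) sx0" using h1
  proof (rule hol_subset)
   show "open (B \<times> {ta. cj ta : B})" by (simp only: Bc Collect_mem_eq) (simp add: B_def open_Times)
   show "B \<times> {ta. cj ta : B} <= ball 0 s1 \<times> ball 0 s1" unfolding Bc using B1 by blast
  qed
  show "sx0 (cj ta,cj t) = cnj (sx0 (t,ta))" if "t : B" "cj ta : B" for t ta
   using re1 that B1 Bc by blast
 qed
 have eq: "sx0 (t,cj t) = of_real (rh (p+t))" if "t : B" for t using eq1 that B1 by blast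
 have hB: "hol (B \<times> B) sx0" using cx unfolding real_cx_def by (simp add: Bc)
 have oB: "open B" by (simp add: B_def)
 define G where "G t = sx0 (t,0)" for t
 have hG: "hol B G" unfolding G_def
  by (rule hol_compose[OF hB]) (use B0 oB in auto)
 have G0: "G 0 = 0"
 proof -
  have "rh p = 0" using MV p V by blast
  then show ?thesis using eq[OF B0] by (simp add: G_def)
 qed
 \<comment> \<open>By Hermitian symmetry a vanishing differential in the first argument also
   vanishes in the second, which would kill the differential of \<open>rh\<close> at
   \<open>p\<close>.\<close>
 have dG: "EX v. ldv G 0 v ~= 0"
 proof (rule ccontr)
  assume "\<nexists>v. ldv G 0 v ~= 0"
  then have z: "ldv G 0 = (%_. 0)" by auto
  have D: "(sx0 has_derivative ldv sx0 (0,0)) (at (0,0))" by (rule hol_derivL[OF hB]) (use B0 in simp)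
  note lin = has_derivative_linear[OF D]
  have "((%t. sx0 (t,0)) has_derivative (%v. ldv sx0 (0,0) (v,0))) (at 0)"
   by (rule has_derivative_compose[where f="%t. (t,0)" and g=sx0]) (auto intro!: derivative_eq_intros D)
  moreover have "((%t. sx0 (t,0)) has_derivative (%_. 0)) (at 0)"
   using hol_derivL[OF hG B0] z by (simp add: G_def[abs_def])
  ultimately have z1: "ldv sx0 (0,0) (v,0) = 0" for v using has_derivative_unique by metis
  have "((%t. cnj (G (cj t))) has_derivative (%v. cnj (ldv G 0 (cj v)))) (at 0)"
   using hol_derivL[OF hG B0]
   by (intro has_derivative_cnj has_derivative_compose[OF bounded_linear_imp_has_derivative[OF bounded_linear_cj]]) simp
  then have "((%t. cnj (G (cj t))) has_derivative (%v. 0)) (at 0)" by (simp add: z)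
  then have "((%t. sx0 (0,t)) has_derivative (%v. 0)) (at 0)"
  proof (rule has_derivative_transform_within_open[OF _ oB B0])
   fix t assume "t : B"
   then have "sx0 (cj (cj 0),cj (cj t)) = cnj (sx0 (cj t,cj 0))"
    using cx B0 Bc unfolding real_cx_def by blast
   then show "cnj (G (cj t)) = sx0 (0,t)" by (simp add: G_def)
  qed
  moreover have "((%t. sx0 (0,t)) has_derivative (%v. ldv sx0 (0,0) (0,v))) (at 0)"
   by (rule has_derivative_compose[where f="%t. (0,t)" and g=sx0]) (auto intro!: derivative_eq_intros D)
  ultimately have z2: "ldv sx0 (0,0) (0,v) = 0" for v using has_derivative_unique by metis
  have z3: "ldv sx0 (0,0) u = 0" for u
   using linear_add[OF lin, of "(fst u,0)" "(0,snd u)"] z1 z2 by simp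
  obtain D' where D': "(rh has_derivative D') (at p)" "D' ~= (%_. 0)" using dr V by blast
  have "((%t. complex_of_real (rh (p+t))) has_derivative (%v. of_real (D' v))) (at 0)"
   by (intro bounded_linear.has_derivative[OF bounded_linear_of_real] has_derivative_compose[where g=rh and f="%t. p+t" and f'="%v. v"])
    (insert D', auto intro!: derivative_eq_intros)
  moreover have "((%t. complex_of_real (rh (p+t))) has_derivative (%v. 0)) (at 0)"
  proof (rule has_derivative_transform_within_open[OF _ oB B0])
   have "((%t. (t,cj t)) has_derivative (%v. (v,cj v))) (at 0)"
    by (intro has_derivative_Pair has_derivative_ident bounded_linear_imp_has_derivative bounded_linear_cj)
   from has_derivative_compose[OF this, of sx0 "%_. 0"]
   show "((%t. sx0 (t,cj t)) has_derivative (%v. 0)) (at 0)" using D z3 by (simp add: ext[of "ldv sx0 (0,0)" "%_. 0"])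
  qed (use eq in auto)
  ultimately have "complex_of_real (D' v) = 0" for v using has_derivative_unique by metis
  then show False using D'(2) by auto
 qed
 have linG: "linear (ldv G 0)" by (rule ldv_linear[OF hG B0])
 obtain a where a: "ldv G 0 (a,1) ~= 0"
 proof (cases "ldv G 0 (0,1) = 0")
  case False then show ?thesis by (rule that)
 next
  case True
  obtain v where v: "ldv G 0 v ~= 0" using dG by blast
  have "ldv G 0 (0,snd v) = snd v * ldv G 0 (0,1)"
   using ldv_cs[OF hol_imp_ghol[OF hG] B0, of "snd v" "(0,1)"] by (simp add: cs.zero_right)
  then have "ldv G 0 (fst v,0) ~= 0" 
   using v True linear_add[OF linG, of "(fst v,0)" "(0,snd v)"] by simp
  then have "ldv G 0 (fst v,1) ~= 0"
   using True linear_add[OF linG, of "(fst v,0)" "(0,1)"] by simp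
  then show ?thesis by (rule that)
 qed
 \<comment> \<open>The vertical axis is tilted along \<open>(a,1)\<close>, where the differential of
   \<open>G\<close> is nonzero, so that the new coordinate can be solved for.\<close>
 define \<Lambda> where "\<Lambda> w y = (w+cs y a,y)" for w :: "complex^'m" and y :: complex
 have \<Lambda>0: "\<Lambda> 0 0 = 0" by (simp add: \<Lambda>_def cs.zero_left zero_prod_def)
 define S where "S = {q :: 'm cn \<times> complex. \<Lambda> (fst (fst q)) (snd q) : B}"
 have h\<Lambda>: "hol T (%q. \<Lambda> (f q) (g q))" if "hol T f" "hol T g" for T :: "'x::cvec set" and f g
  unfolding \<Lambda>_def using that by (intro hol_Pair hol_add hol_cs hol_const) (auto intro: hol_open)
 have oS: "open S"
 proof -
  have "hol UNIV (%q :: 'm cn \<times> complex. \<Lambda> (fst (fst q)) (snd q))" by (intro h\<Lambda> hol_fst hol_snd hol_id) auto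
  from open_vimage[OF oB hol_continuous_on[OF this]] show ?thesis by (simp add: S_def vimage_def)
 qed
 define H where "H q = 2 * \<i> * G (\<Lambda> (fst (fst q)) (snd q))-snd (fst q)" for q :: "'m cn \<times> complex"
 have hH: "hol S H"
  unfolding H_def
  by (intro hol_diff hol_mult hol_const oS hol_compose[OF hG] h\<Lambda> hol_fst hol_snd hol_id) (auto simp: S_def)
 have S0: "(0,0) : S" using B0 by (simp add: S_def \<Lambda>0)
 have H0: "H (0,0) = 0" by (simp add: H_def \<Lambda>0 G0)
 have dH: "ldv H (0,0) (0,1) ~= 0"
 proof -
  have "((%y. G (\<Lambda> 0 y)) has_derivative (%v. ldv G 0 (cs v a,v))) (at 0)"
   unfolding \<Lambda>_def
  proof (rule has_derivative_compose[where f="%y. (0+cs y a,y)" and g=G])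
   show "((%y. (0+cs y a,y)) has_derivative (%v. (cs v a,v))) (at 0)"
    by (simp add: has_derivative_Pair bounded_linear_imp_has_derivative cs.bounded_linear_left)
   have "(0+cs 0 a,0) = (0 :: 'm cn)" by (simp add: cs.zero_left prod_eq_iff)
   then show "(G has_derivative ldv G 0) (at (0+cs 0 a,0))"
    using hol_derivL[OF hG B0] by (simp only:)
  qed
  then have "((%y. H (0,y)) has_derivative (%v. 2 * \<i> * ldv G 0 (cs v a,v))) (at 0)"
   unfolding H_def by (auto intro!: derivative_eq_intros)
  moreover have "((%y. H (0,y)) has_derivative (%v. ldv H (0,0) (0,v))) (at 0)"
   by (rule has_derivative_compose[where f="%y. (0,y)" and g=H])
    (insert hol_derivL[OF hH S0], auto intro!: derivative_eq_intros)
  ultimately have "(%v. 2 * \<i> * ldv G 0 (cs v a,v)) = (%v. ldv H (0,0) (0,v))"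
   by (rule has_derivative_unique)
  from fun_cong[OF this, of 1] have "ldv H (0,0) (0,1) = 2 * \<i> * ldv G 0 (a,1)" by simp
  then show ?thesis using a by simp
 qed
 obtain U e g where U: "open U" "0 : U" "0 < e" "e <= 1" "hol U g" "g 0 = 0"
  and gU: "ALL u:U. g u : ball 0 e"
  and sol: "ALL u:U. ALL y:ball 0 e. (u,y) : S & (H (u,y) = 0 \<longleftrightarrow> y = g u)"
  using hol_implicit_function[OF hH S0 H0 dH zero_less_one] by blast
 obtain s where s: "s > 0" "ball 0 s <= U" using U(1,2) open_contains_ball by blast
 define A where "A t = \<Lambda> (fst t) (g t)" for t
 have hA: "hol (ball 0 s) A" unfolding A_def
  by (intro h\<Lambda> hol_fst hol_id hol_subset[OF U(5) _ s(2)]) auto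
 have AB: "A t : B" if "t : ball 0 s" for t
 proof -
  have tU: "t : U" using that s(2) by blast
  then have "(t,g t) : S" using sol gU by blast
  then show ?thesis by (simp add: A_def S_def)
 qed
 have GA: "G (A t) = snd t/(2 * \<i>)" if "t : ball 0 s" for t
 proof -
  have tU: "t : U" using that s(2) by blast
  then have "H (t,g t) = 0" using sol gU by blast
  then show ?thesis by (simp add: A_def H_def field_simps)
 qed
 have A0: "A 0 = 0" by (simp add: A_def U(6) \<Lambda>0)
 define Xi where "Xi t = p+A t" for t
 define sx where "sx q = sx0 (A (fst q),cj (A (cj (snd q))))" for q
 have cxsx: "real_cx (ball 0 s) sx" unfolding sx_def by (rule real_cx_pullback[OF cx hA AB])
 have Msx: "Xi t : M \<longleftrightarrow> sx (t,cj t) = 0" if "t : ball 0 s" for t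
 proof -
  have "Xi t : M \<longleftrightarrow> rh (p+A t) = 0" using MV BV(1)[OF AB[OF that]] by (auto simp: Xi_def)
  then show ?thesis using eq[OF AB[OF that]] by (simp add: sx_def)
 qed
 define Ps where "Ps x = (fst (x-p)-cs (snd (x-p)) a,2 * \<i> * G (x-p))" for x
 define V2 where "V2 = {x. x-p : B}"
 have oV2: "open V2" using open_vimage[OF oB, of "%x. x-p"] by (simp add: V2_def vimage_def continuous_intros)
 have hPs: "hol V2 Ps"
  unfolding Ps_def
  by (intro hol_Pair hol_diff hol_fst hol_snd hol_cs hol_mult hol_id hol_const oV2 hol_compose[OF hG]) (auto simp: V2_def)
 define V1 where "V1 = {x : V2. Ps x : ball 0 s & snd (x-p) : ball 0 e}"
 have oV1: "open V1"
 proof -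
  have "open (V2 Int (%x. (Ps x,snd (x-p))) -` (ball 0 s \<times> ball 0 e))"
   by (rule continuous_open_preimage[OF _ oV2])
    (intro continuous_intros hol_continuous_on[OF hPs] open_Times open_ball)+
  moreover have "V1 = V2 Int (%x. (Ps x,snd (x-p))) -` (ball 0 s \<times> ball 0 e)" by (auto simp: V1_def)
  ultimately show ?thesis by simp
 qed
 have Psp: "Ps p = 0" by (simp add: Ps_def G0 cs.zero_left prod_eq_iff)
 have pV1: "p : V1" using B0 Psp s U(3) by (simp add: V1_def V2_def)
 have inv: "Ps x : ball 0 s & Xi (Ps x) = x" if x: "x : V1" for x
 proof -
  have PsU: "Ps x : ball 0 s" "snd (x-p) : ball 0 e" using x by (auto simp: V1_def)
  have L: "\<Lambda> (fst (Ps x)) (snd (x-p)) = x-p" by (simp add: \<Lambda>_def Ps_def prod_eq_iff)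
  then have "H (Ps x,snd (x-p)) = 0" by (simp add: H_def) (simp add: Ps_def)
  then have "snd (x-p) = g (Ps x)" using sol PsU s(2) by blast
  then have "A (Ps x) = x-p" using L by (simp add: A_def)
  then show ?thesis using PsU by (simp add: Xi_def)
 qed
 \<comment> \<open>Otherwise \<open>snd (Ps x)\<close> would define a complex hypersurface germ
   inside \<open>M\<close>, against minimality.\<close>
 have nz: "EX w. norm w < ep & sx ((w,0),cj (w,0)) ~= 0" if ep: "ep > 0" for ep
 proof (rule ccontr)
  assume "~ ?thesis"
  then have z: "sx ((w,0),cj (w,0)) = 0" if "norm w < ep" for w using that by blast
  define V3 where "V3 = {x : V1. norm (fst (Ps x)) < ep}"
  have h1: "hol V1 Ps" by (rule hol_subset[OF hPs oV1]) (auto simp: V1_def)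
  have oV3: "open V3"
  proof -
   have "open (V1 Int (%x. fst (Ps x)) -` ball 0 ep)"
    by (intro continuous_open_preimage[OF _ oV1] continuous_intros hol_continuous_on[OF h1] open_ball)
   moreover have "V3 = V1 Int (%x. fst (Ps x)) -` ball 0 ep" by (auto simp: V3_def)
   ultimately show ?thesis by simp
  qed
  have "minimal_at M p \<longleftrightarrow> False"
   unfolding minimal_at_def
  proof (simp, intro exI[of _ V3] exI[of _ "%x. snd (Ps x)"] conjI)
   show "open V3" by fact
   show "p : V3" using pV1 ep by (simp add: V3_def Psp)
   show "holo_fun V3 (%x. snd (Ps x))"
    unfolding holo_fun_iff_hol by (intro hol_snd hol_subset[OF h1 oV3]) (auto simp: V3_def)
   show "snd (Ps p) = 0" by (simp add: Psp)
   show "{x : V3. snd (Ps x) = 0} <= M"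
   proof
    fix x assume "x : {x : V3. snd (Ps x) = 0}"
    then have x: "x : V1" "norm (fst (Ps x)) < ep" "Ps x = (fst (Ps x),0)" by (auto simp: V3_def prod_eq_iff)
    have "sx (Ps x,cj (Ps x)) = 0" using z[OF x(2)] x(3) by simp
    then show "x : M" using inv[OF x(1)] Msx[of "Ps x"] by simp
   qed
   have "((%x. snd (Ps x)) has_derivative (%v. 2 * \<i> * ldv G 0 v)) (at p)"
   proof -
    have "((%x. G (x-p)) has_derivative ldv G 0) (at p)"
     by (rule has_derivative_compose[where f="%x. x-p" and f'="%v. v" and g=G])
      (insert hol_derivL[OF hG B0], auto intro!: derivative_eq_intros)
    then show ?thesis unfolding Ps_def by (auto intro!: derivative_eq_intros)
   qed
   then have "frechet_derivative (%x. snd (Ps x)) (at p) = (%v. 2 * \<i> * ldv G 0 v)"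
    using frechet_derivative_at by metis
   then show "frechet_derivative (%x. snd (Ps x)) (at p) ~= (%_. 0)"
    using dG by (auto simp: fun_eq_iff)
  qed
  then show False using min by simp
 qed
 show ?thesis
 proof (rule that[of s Xi sx V1 Ps])
  show "hol (ball 0 s) Xi" unfolding Xi_def by (intro hol_add hol_const hA) auto
  show "Xi t : V0" if "t : ball 0 s" for t using BV(2)[OF AB[OF that]] by (simp add: Xi_def)
  show "sx (t,0) = snd t/(2 * \<i>)" if "t : ball 0 s" for t
   using GA[OF that] by (simp add: sx_def A0 G_def)
  show "hol V1 Ps" by (rule hol_subset[OF hPs oV1]) (auto simp: V1_def)
 qed (insert s cxsx Msx oV1 pV1 inv nz Psp, auto simp: Xi_def A0)
qed

subsection \<open>Analytic discs with boundary on one side\<close>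

lemma taylor_truncation:
 fixes f :: "complex => complex"
 assumes f: "f holomorphic_on ball 0 r" and rh: "0 < rh" "rh < r" and B: "!!z. cmod z <= rh ==> cmod (f z) <= B"
 shows "cmod ((deriv ^^ j) f 0/fact j) <= B/rh^j"
  and "cmod z <= rh/2 ==> cmod (f z-(\<Sum>j\<le>J. (deriv ^^ j) f 0/fact j * z^j)) <= 2 * B * (cmod z/rh)^Suc J"
proof -
 define a where "a j = (deriv ^^ j) f 0/fact j" for j
 have sub: "cball 0 rh <= ball (0::complex) r" using rh by auto
 have a: "cmod (a j) <= B/rh^j" for j
 proof -
  have "cmod ((deriv ^^ j) f 0) <= fact j * B/rh^j"
  proof (rule Cauchy_inequality)
   show "f holomorphic_on ball 0 rh" using f by (rule holomorphic_on_subset) (use rh in auto)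
   show "continuous_on (cball 0 rh) f" 
    using holomorphic_on_imp_continuous_on[OF f] sub by (rule continuous_on_subset)
  qed (use B rh in auto)
  then show ?thesis by (simp add: a_def norm_divide field_simps)
 qed
 then show "cmod ((deriv ^^ j) f 0/fact j) <= B/rh^j" by (simp add: a_def)
 have B0: "0 <= B" using B[of 0] rh by (smt (verit) norm_ge_zero norm_zero)
 assume z: "cmod z <= rh/2"
 define q where "q = cmod z/rh"
 have q: "0 <= q" "q <= 1/2" using z rh by (auto simp: q_def divide_simps)
 have "z : ball 0 r" using z rh by auto
 from holomorphic_power_series[OF f this]
 have s: "(%n. a n * z^n) sums f z" by (simp add: a_def)
 have t: "(%n. a (n+Suc J) * z^(n+Suc J)) sums (f z-(\<Sum>j<Suc J. a j * z^j))"
  using sums_split_initial_segment[OF s] .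
 have bd: "norm (a (n+Suc J) * z^(n+Suc J)) <= B * q^Suc J * q^n" for n
 proof -
  have "norm (a (n+Suc J) * z^(n+Suc J)) <= B/rh^(n+Suc J) * cmod z^(n+Suc J)"
   unfolding norm_mult norm_power by (intro mult_right_mono a) auto
  also have "... = B * q^Suc J * q^n" using rh by (simp add: q_def power_divide power_add field_simps)
  finally show ?thesis .
 qed
 have g: "(%n. B * q^Suc J * q^n) sums (B * q^Suc J * (1/(1-q)))"
  by (intro sums_mult geometric_sums) (use q in auto)
 have "norm (f z-(\<Sum>j<Suc J. a j * z^j)) <= B * q^Suc J * (1/(1-q))"
  by (rule norm_sums_le[OF t g bd])
 also have "... <= B * q^Suc J * 2"
  using q B0 by (intro mult_left_mono) (auto simp: divide_simps)
 finally show "cmod (f z-(\<Sum>j\<le>J. (deriv ^^ j) f 0/fact j * z^j)) <= 2 * B * (cmod z/rh)^Suc J"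
  by (simp add: a_def q_def lessThan_Suc_atMost mult_ac)
qed

lemma hol_iterated_partial:
 fixes S :: "complex \<times> complex => complex"
 assumes S: "hol (A \<times> B) S" and oA: "open A"
 shows "hol (A \<times> B) (%q. (deriv ^^ j) (%zt. S (zt,snd q)) (fst q))"
proof (induction j)
 case 0 then show ?case using S by simp
next
 case (Suc j)
 define F where "F q = (deriv ^^ j) (%zt. S (zt,snd q)) (fst q)" for q
 have "ldv F q (1,0) = (deriv ^^ Suc j) (%zt. S (zt,snd q)) (fst q)" for q
 proof -
  have "ldv F q (1,0) = deriv (%z. (deriv ^^ j) (%zt. S (zt,snd q)) (fst q+z)) 0"
   by (simp add: ldv_def F_def cs.zero_right)
  also have "... = deriv ((deriv ^^ j) (%zt. S (zt,snd q))) (fst q)"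
   using deriv_shift_0[of "(deriv ^^ j) (%zt. S (zt,snd q))" "fst q"] by (simp add: o_def)
  finally show ?thesis by simp
 qed
 moreover have "hol (A \<times> B) (%q. ldv F q (1,0))"
  using Suc by (intro hol_ldv) (simp add: F_def[abs_def])
 ultimately show ?case by simp
qed

text \<open>Expansion first in one variable, then of each coefficient in the other. The Cauchy
  bounds at radius \<open>3\<close> make the truncation errors of the coefficients decay like
  \<open>(1/3)^j\<close>, and the factor \<open>5\<close> is \<open>2\<close> from the outer
  truncation plus \<open>2\<close> times the geometric sum \<open>3/2\<close>. The vanishing on both
  axes removes the pure terms.\<close>

lemma double_taylor:
 fixes S :: "complex \<times> complex => complex"
 assumes S: "hol (ball 0 4 \<times> ball 0 4) S"
  and z1: "!!zt. cmod zt < 4 ==> S (zt,0) = 0" and z2: "!!et. cmod et < 4 ==> S (0,et) = 0"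
 obtains s B where "0 <= B" "!!j. s j 0 = 0" "!!k. s 0 k = 0"
  "!!J dl zt et. dl <= 1 ==> cmod zt <= dl ==> cmod et <= dl ==>
   cmod (S (zt,et)-(\<Sum>j\<le>J. \<Sum>k\<le>J. s j k * zt^j * et^k)) <= 5 * B * (dl/3)^Suc J"
proof -
 have "continuous_on (cball 0 3 \<times> cball 0 3) S"
  using hol_continuous_on[OF S] by (rule continuous_on_subset) auto
 from continuous_on_compact_bound[OF compact_Times[OF compact_cball compact_cball] this]
 obtain B where B0: "B >= 0" and B': "!!q. q : cball 0 3 \<times> cball 0 3 ==> norm (S q) <= B" by blast
 have B: "cmod (S (zt,et)) <= B" if "cmod zt <= 3" "cmod et <= 3" for zt et using B'[of "(zt,et)"] that by simp
 define a where "a j et = (deriv ^^ j) (%zt. S (zt,et)) 0/fact j" for j et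
 define s where "s j k = (deriv ^^ k) (a j) 0/fact k" for j k
 have ah: "a j holomorphic_on ball 0 4" for j
 proof -
  have "hol (ball 0 4) (%et. (0 :: complex,et :: complex))" by (intro hol_Pair hol_const hol_id) auto
  from hol_compose[OF hol_iterated_partial[OF S open_ball, of j] this]
  have "hol (ball 0 4) (%et. (deriv ^^ j) (%zt. S (zt,et)) 0)" by simp
  then show ?thesis unfolding a_def
   by (intro holomorphic_on_divide) (auto simp: hol_iff_holomorphic_on)
 qed
 have Sh: "(%zt. S (zt,et)) holomorphic_on ball 0 4" if "cmod et <= 3" for et
 proof -
  have "hol (ball 0 4) (%zt. S (zt,et))" by (rule hol_compose[OF S]) (use that in auto)
  then show ?thesis by (simp add: hol_iff_holomorphic_on)
 qed
 have ab: "cmod (a j et) <= B/3^j" if "cmod et <= 3" for j et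
  unfolding a_def by (rule taylor_truncation(1)[OF Sh[OF that]]) (use B that in auto)
 show ?thesis
 proof (rule that[of B s])
  show "s j 0 = 0" for j
  proof -
   have "(deriv ^^ j) (%zt. S (zt,0)) 0 = (deriv ^^ j) (%zt. 0) 0"
    by (rule higher_deriv_transform_within_open[where S="ball 0 4"]) (use Sh[of 0] z1 in auto)
   then show ?thesis by (simp add: s_def a_def)
  qed
  show "s 0 k = 0" for k
  proof -
   have "(deriv ^^ k) (a 0) 0 = (deriv ^^ k) (%zt. 0) 0"
    by (rule higher_deriv_transform_within_open[where S="ball 0 4"]) (insert ah z2, auto simp: a_def)
   then show ?thesis by (simp add: s_def)
  qed
  fix J dl zt et assume d: "dl <= (1::real)" "cmod zt <= dl" "cmod et <= dl"
  then have d0: "0 <= dl" using norm_ge_zero order_trans by blast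
  define E where "E = (dl/3)^Suc J"
  have E0: "E >= 0" using d0 by (simp add: E_def)
  have pw: "(cmod z/3)^Suc J <= E" if "cmod z <= dl" for z
   unfolding E_def by (rule power_mono) (use that in auto)
  have "cmod (S (zt,et)-(\<Sum>j\<le>J. a j et * zt^j)) <= 2 * B * (cmod zt/3)^Suc J"
   unfolding a_def by (rule taylor_truncation(2)[OF Sh]) (use B d in auto)
  also have "... <= 2 * B * E" using pw[OF d(2)] B0 by (intro mult_left_mono) auto
  finally have 1: "cmod (S (zt,et)-(\<Sum>j\<le>J. a j et * zt^j)) <= 2 * B * E" .
  have "cmod ((\<Sum>j\<le>J. a j et * zt^j)-(\<Sum>j\<le>J. \<Sum>k\<le>J. s j k * zt^j * et^k))
    = cmod (\<Sum>j\<le>J. (a j et-(\<Sum>k\<le>J. s j k * et^k)) * zt^j)"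
  proof -
   have "(\<Sum>j\<le>J. (a j et-(\<Sum>k\<le>J. s j k * et^k)) * zt^j) =
     (\<Sum>j\<le>J. a j et * zt^j-(\<Sum>k\<le>J. s j k * zt^j * et^k))"
    by (rule sum.cong) (simp_all add: left_diff_distrib right_diff_distrib sum_distrib_right sum_distrib_left mult_ac)
   then show ?thesis by (simp add: sum_subtractf)
  qed
  also have "... <= (\<Sum>j\<le>J. 2 * B * E * (1/3)^j)"
  proof (rule sum_norm_le)
   fix j
   have "cmod (a j et-(\<Sum>k\<le>J. s j k * et^k)) <= 2*(B/3^j)*(cmod et/3)^Suc J"
    unfolding s_def by (rule taylor_truncation(2)[OF ah]) (use ab d in auto)
   also have "... <= 2*(B/3^j) * E" using pw[OF d(3)] B0 by (intro mult_left_mono) auto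
   finally have "cmod (a j et-(\<Sum>k\<le>J. s j k * et^k)) * cmod zt^j <= 2*(B/3^j) * E * 1"
    using d d0 E0 B0 by (intro mult_mono power_le_one) auto
   then show "cmod ((a j et-(\<Sum>k\<le>J. s j k * et^k)) * zt^j) <= 2 * B * E * (1/3)^j"
    by (simp add: norm_mult norm_power power_one_over mult_ac)
  qed
  also have "... = 2 * B * E * (\<Sum>j\<le>J. (1/3)^j)" by (simp add: sum_distrib_left)
  also have "... <= 2 * B * E * (3/2)"
  proof (rule mult_left_mono)
   have "(\<Sum>j\<le>J. (1/3)^j) <= (\<Sum>j. (1/3::real)^j)"
    by (rule sum_le_suminf) (auto intro: summable_geometric)
   then show "(\<Sum>j\<le>J. (1/3)^j) <= (3/2::real)" by (simp add: suminf_geometric)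
  qed (use B0 E0 in auto)
  finally have 2: "cmod ((\<Sum>j\<le>J. a j et * zt^j)-(\<Sum>j\<le>J. \<Sum>k\<le>J. s j k * zt^j * et^k)) <= 3 * B * E" by simp
  show "cmod (S (zt,et)-(\<Sum>j\<le>J. \<Sum>k\<le>J. s j k * zt^j * et^k)) <= 5 * B * (dl/3)^Suc J"
   using norm_triangle_le[OF add_mono[OF 1 2]] unfolding E_def by (simp add: algebra_simps)
 qed (rule B0)
qed

text \<open>On the unit circle the real part of \<open>f\<close> is made constant by the imaginary
  part of an entire function. As \<open>g 0 = 0\<close>, the constant \<open>ka\<close> is the mean
  of \<open>Re f\<close> over the circle.\<close>

definition rep :: "(complex => complex) => real => bool" where
 "rep f ka \<longleftrightarrow> (EX g. g holomorphic_on UNIV & g 0 = 0 & (ALL zt. cmod zt = 1 --> Re (f zt)+Im (g zt) = ka))"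

lemma rep_add: "rep f ka ==> rep g \<mu> ==> rep (%zt. f zt+g zt) (ka+\<mu>)"
proof -
 assume "rep f ka" "rep g \<mu>"
 then obtain a b where "a holomorphic_on UNIV" "a 0 = 0" "!!zt. cmod zt = 1 ==> Re (f zt)+Im (a zt) = ka"
  "b holomorphic_on UNIV" "b 0 = 0" "!!zt. cmod zt = 1 ==> Re (g zt)+Im (b zt) = \<mu>"
  unfolding rep_def by blast
 then show ?thesis unfolding rep_def
  by (intro exI[of _ "%zt. a zt+b zt"]) (auto intro!: holomorphic_intros simp: algebra_simps)
qed

lemma rep_sum: "(!!i. i : I ==> rep (f i) (ka i)) ==> rep (%zt. \<Sum>i\<in>I. f i zt) (\<Sum>i\<in>I. ka i)"
proof (induction I rule: infinite_finite_induct)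
 case (insert x F) then show ?case by (simp add: rep_add)
qed (auto simp: rep_def intro!: exI[of _ "%_. 0"])

text \<open>On the circle \<open>zt * cnj zt\<close> is \<open>1\<close>, so the monomial reduces to
  a power of \<open>zt\<close> or of \<open>cnj zt\<close>, and the real part of the latter is that
  of a holomorphic power. Only equal exponents leave a mean.\<close>

lemma rep_monomial: "rep (%zt. C * zt^p * cnj zt^q) (if p = q then Re C else 0)"
proof -
 have one: "zt * cnj zt = 1" if "cmod zt = 1" for zt
  using that by (simp add: complex_mult_cnj cmod_def)
 have red: "zt^(n+d) * cnj zt^n = zt^d" "zt^n * cnj zt^(n+d) = cnj zt^d" if "cmod zt = 1" for zt n d
  using one[OF that] by (simp_all add: power_add mult_ac flip: power_mult_distrib)
 consider d where "p = q+d" "d > 0" | "p = q" | d where "q = p+d" "d > 0"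
  by (metis less_imp_add_positive linorder_neqE_nat)
 then show ?thesis
 proof cases
  case 1
  then show ?thesis unfolding rep_def
   by (intro exI[of _ "%zt. - \<i> * C * zt^d"]) (auto simp: mult.assoc red intro!: holomorphic_intros)
 next
  case 2
  then show ?thesis unfolding rep_def
   by (intro exI[of _ "%zt. 0"]) (insert red[of _ q 0], auto simp: mult.assoc)
 next
  case 3
  have "Re (C * cnj zt^d) = Re (cnj C * zt^d)" for zt
  proof -
   have "C * cnj zt^d = cnj (cnj C * zt^d)" by simp
   then show ?thesis by (metis complex_cnj(1) complex_cnj_cnj cnj.simps(1))
  qed
  with 3 show ?thesis unfolding rep_def
   by (intro exI[of _ "%zt. - \<i> * cnj C * zt^d"]) (auto simp: mult.assoc red intro!: holomorphic_intros)
 qed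
qed

text \<open>First order expansion \<open>f0+b * f1\<close> with quadratic error and one constant for
  everything, so that expansions can be multiplied.\<close>

definition app :: "real => real => complex => complex => complex => bool" where
 "app b K f f0 f1 \<longleftrightarrow> cmod f0 <= K & cmod f1 <= K & cmod (f-f0-b * f1) <= K * b^2"

lemma app_mono: "app b K f f0 f1 ==> K <= K' ==> app b K' f f0 f1"
 unfolding app_def by (meson mult_right_mono order_trans zero_le_power2)

lemma app_mult:
 assumes b: "0 <= b" "b <= 1" and f: "app b K f f0 f1" and g: "app b K g g0 g1"
 shows "app b (6 * K^2) (f * g) (f0 * g0) (f0 * g1+f1 * g0)"
proof -
 define e where "e = f-f0-b * f1"
 define e' where "e' = g-g0-b * g1"
 have K: "0 <= K" using f unfolding app_def using norm_ge_zero order_trans by blast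
 have be: "cmod f0 <= K" "cmod f1 <= K" "cmod g0 <= K" "cmod g1 <= K" "cmod e <= K * b^2" "cmod e' <= K * b^2"
  using f g by (auto simp: app_def e_def e'_def)
 have m: "cmod (x * y) <= K^2" if "cmod x <= K" "cmod y <= K" for x y
  unfolding norm_mult power2_eq_square using that K by (intro mult_mono) auto
 have m2: "cmod (x * y) <= K^2 * b^2" if "cmod x <= K" "cmod y <= K * b^2" for x y
 proof -
  have "cmod (x * y) <= K * (K * b^2)" unfolding norm_mult using that K by (intro mult_mono) auto
  then show ?thesis by (simp add: power2_eq_square mult_ac)
 qed
 have b2: "b^2 <= 1" using b by (simp add: power_le_one)
 have bK: "cmod e <= K" using be(5) mult_left_mono[OF b2 K] by simp
 have bm: "cmod (of_real b * x) <= K" if "cmod x <= K" for x :: complex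
  using that b mult_mono[of b 1 "cmod x" K] by (simp add: norm_mult)
 have bb: "cmod (of_real (b^2)*(f1 * g1)) <= K^2 * b^2"
  using mult_right_mono[OF m[OF be(2,4)], of "b^2"] by (simp add: norm_mult norm_power mult.commute)
 have "f * g-f0 * g0-b * (f0 * g1+f1 * g0) =
   of_real (b^2)*(f1 * g1)+f0 * e'+(b * f1) * e'+g0 * e+(b * g1) * e+e * e'"
  by (simp add: e_def e'_def power2_eq_square algebra_simps)
 also have "cmod ... <= K^2 * b^2+K^2 * b^2+K^2 * b^2+K^2 * b^2+K^2 * b^2+K^2 * b^2"
  by (intro norm_triangle_mono bb m2 be bK bm[OF be(2)] bm[OF be(4)])
 finally have 1: "cmod (f * g-f0 * g0-b * (f0 * g1+f1 * g0)) <= 6 * K^2 * b^2" by simp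
 have 2: "cmod (f0 * g0) <= 6 * K^2" using m[OF be(1,3)] by (simp add: order_trans[OF _ mult_right_mono[of 1 6 "K^2"]])
 have "cmod (f0 * g1+f1 * g0) <= K^2+K^2" by (intro norm_triangle_mono m be)
 then have "cmod (f0 * g1+f1 * g0) <= 6 * K^2" by (simp add: order_trans[OF _ mult_right_mono[of 2 6 "K^2"]])
 with 1 2 show ?thesis by (simp add: app_def)
qed

lemma app_power:
 "EX K. ALL b x x1. 0 <= b --> b <= 1 --> cmod x <= E --> cmod x1 <= E -->
  app b K ((x+b * x1)^p) (x^p) (of_nat p * x^(p-1) * x1)"
proof (induction p)
 case 0 then show ?case by (intro exI[of _ 1]) (simp add: app_def)
next
 case (Suc p)
 then obtain K where K: "!!b x x1. 0 <= b ==> b <= 1 ==> cmod x <= E ==> cmod x1 <= E ==>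
  app b K ((x+b * x1)^p) (x^p) (of_nat p * x^(p-1) * x1)" by blast
 show ?case
 proof (intro exI[of _ "6*(max K E)^2"] allI impI)
  fix b :: real and x x1 assume b: "0 <= b" "b <= 1" and x: "cmod x <= E" "cmod x1 <= E"
  have E0: "0 <= E" using x norm_ge_zero order_trans by blast
  have 1: "app b (max K E) (x+b * x1) x x1" using x E0 by (auto simp: app_def le_max_iff_disj)
  have 2: "app b (max K E) ((x+b * x1)^p) (x^p) (of_nat p * x^(p-1) * x1)"
   by (rule app_mono[OF K[OF b x]]) simp
  have e: "x * (of_nat p * x^(p-1) * x1)+x1 * x^p = of_nat (Suc p) * x^(Suc p-1) * x1"
   by (cases p) (simp_all add: algebra_simps)
  show "app b (6*(max K E)^2) ((x+b * x1)^Suc p) (x^Suc p) (of_nat (Suc p) * x^(Suc p-1) * x1)"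
   using app_mult[OF b 1 2] unfolding e by simp
 qed
qed

lemma app_monomial:
 "EX K. ALL b x x1. 0 <= b --> b <= 1 --> cmod x <= E --> cmod x1 <= E -->
  cmod ((x+b * x1)^p * cnj (x+b * x1)^q-x^p * cnj x^q -
   b * (x^p * (of_nat q * cnj x^(q-1) * cnj x1) + of_nat p * x^(p-1) * x1 * cnj x^q)) <= K * b^2"
proof -
 obtain K1 where K1: "!!b x x1. 0 <= b ==> b <= 1 ==> cmod x <= E ==> cmod x1 <= E ==>
  app b K1 ((x+b * x1)^p) (x^p) (of_nat p * x^(p-1) * x1)" using app_power by blast
 obtain K2 where K2: "!!b x x1. 0 <= b ==> b <= 1 ==> cmod x <= E ==> cmod x1 <= E ==>
  app b K2 ((x+b * x1)^q) (x^q) (of_nat q * x^(q-1) * x1)" using app_power by blast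
 show ?thesis
 proof (intro exI[of _ "6*(max K1 K2)^2"] allI impI)
  fix b :: real and x x1 assume b: "0 <= b" "b <= 1" and x: "cmod x <= E" "cmod x1 <= E"
  have 1: "app b (max K1 K2) ((x+b * x1)^p) (x^p) (of_nat p * x^(p-1) * x1)"
   by (rule app_mono[OF K1[OF b x]]) simp
  have 2: "app b (max K1 K2) ((cnj x+b * cnj x1)^q) (cnj x^q) (of_nat q * cnj x^(q-1) * cnj x1)"
   by (rule app_mono[OF K2[OF b, of "cnj x" "cnj x1"]]) (use x in auto)
  show "cmod ((x+b * x1)^p * cnj (x+b * x1)^q-x^p * cnj x^q -
   b * (x^p * (of_nat q * cnj x^(q-1) * cnj x1) + of_nat p * x^(p-1) * x1 * cnj x^q)) <= 6*(max K1 K2)^2 * b^2"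
   using app_mult[OF b 1 2] by (simp add: app_def)
 qed
qed

text \<open>Multiplied by \<open>zt^m\<close> the sum becomes a polynomial in \<open>zt^2\<close>.
  Every point of the circle is such a square, so a nonzero coefficient would bound the number of
  roots by a finite one.\<close>

lemma circle_polynomial_zero:
 assumes "!!zt. cmod zt = 1 ==> (\<Sum>j\<le>m. d j * zt^j * cnj zt^(m-j)) = 0" and "j <= m"
 shows "d j = (0::complex)"
proof (rule ccontr)
 assume nz: "d j ~= 0"
 have "finite {u. (\<Sum>j\<le>m. d j * u^j) = 0}"
  using polyfun_rootbound[where c=d and n=m] nz assms(2) by blast
 moreover have "sphere 0 1 <= {u. (\<Sum>j\<le>m. d j * u^j) = 0}"
 proof
  fix u :: complex assume "u : sphere 0 1"
  then have u: "cmod u = 1" by simp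
  define zt where "zt = csqrt u"
  have zt: "zt^2 = u" "cmod zt = 1" using u by (simp_all add: zt_def norm_csqrt)
  have one: "zt * cnj zt = 1" using zt(2) by (simp add: complex_mult_cnj cmod_def)
  have dj: "d j * u^j = zt^m * (d j * zt^j * cnj zt^(m-j))" if "j <= m" for j
  proof -
   have "zt^m = zt^j * zt^(m-j)" using that by (simp flip: power_add)
   then have "zt^m * (d j * zt^j * cnj zt^(m-j)) = d j * (zt^j * zt^j)*(zt * cnj zt)^(m-j)"
    by (simp add: power_mult_distrib mult_ac)
   also have "zt^j * zt^j = u^j" by (simp add: zt(1)[symmetric] power2_eq_square power_mult_distrib)
   finally have "zt^m * (d j * zt^j * cnj zt^(m-j)) = d j * u^j * (zt * cnj zt)^(m-j)" .
   from this[unfolded one power_one mult_1_right] show ?thesis by (rule sym)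
  qed
  have "(\<Sum>j\<le>m. d j * u^j) = zt^m * (\<Sum>j\<le>m. d j * zt^j * cnj zt^(m-j))"
   unfolding sum_distrib_left by (rule sum.cong[OF refl], rule dj) simp
  then show "u : {u. (\<Sum>j\<le>m. d j * u^j) = 0}" using assms(1)[OF zt(2)] by simp
 qed
 ultimately have "finite (sphere (0::complex) 1)" using finite_subset by blast
 moreover have "connected (sphere (0::complex) 1)" by (rule connected_sphere) simp
 ultimately have "sphere (0::complex) 1 = {} | (EX a. sphere (0::complex) 1 = {a})"
  by (simp add: connected_finite_iff_sing)
 moreover have "(1::complex) : sphere 0 1" "(-1::complex) : sphere 0 1" by auto
 ultimately have "(1::complex) = -1" by (metis emptyE singletonD)
 then show False by simp
qed

text \<open>The leading homogeneous part of a real function without pure terms is not harmonic, so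
 its mean over a suitably bent small disc does not vanish.\<close>

lemma bent_disc:
 fixes a :: "nat => complex" and m :: nat
 defines "P \<equiv> %zt. \<Sum>j\<le>m. a j * zt^j * cnj zt^(m-j)"
 assumes re: "!!zt. cmod zt = 1 ==> Im (P zt) = 0" and a0: "a 0 = 0" and am: "a m = 0"
  and nz: "j1 <= m" "a j1 ~= 0"
 obtains W g ka where "W holomorphic_on UNIV" "W 0 = 0" "deriv W 0 ~= 0" "g holomorphic_on UNIV" "g 0 = 0" "ka ~= 0"
  "!!zt. cmod zt = 1 ==> cmod (W zt) <= 2" "!!zt. cmod zt = 1 ==> \<bar>Re (P (W zt))+Im (g zt)-ka\<bar> <= (abs ka)/8"
proof -
 \<comment> \<open>Real values on the circle force Hermitian coefficients.\<close>
 have herm: "a (m-j) = cnj (a j)" if "j <= m" for j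
 proof -
  have "(%j. a j-cnj (a (m-j))) j = 0"
  proof (rule circle_polynomial_zero[OF _ that])
   fix zt :: complex assume zt: "cmod zt = 1"
   have "cnj (P zt) = (\<Sum>j\<le>m. cnj (a j) * cnj zt^j * zt^(m-j))" by (simp add: P_def)
   also have "... = (\<Sum>j\<le>m. cnj (a (m-j)) * zt^j * cnj zt^(m-j))"
    by (rule sum.reindex_bij_witness[of _ "%j. m-j" "%j. m-j"]) auto
   finally have "(\<Sum>j\<le>m. (a j-cnj (a (m-j))) * zt^j * cnj zt^(m-j)) = P zt-cnj (P zt)"
    by (simp add: P_def left_diff_distrib sum_subtractf)
   also have "... = 0" using re[OF zt] by (simp add: complex_eq_iff)
   finally show "(\<Sum>j\<le>m. (a j-cnj (a (m-j))) * zt^j * cnj zt^(m-j)) = 0" .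
  qed
  then show ?thesis by (metis complex_cnj_cnj eq_iff_diff_eq_0)
 qed
 have repP: "rep P (\<Sum>j\<le>m. if j = m-j then Re (a j) else 0)"
  unfolding P_def by (intro rep_sum rep_monomial)
 show ?thesis
 proof (cases "EX j<=m. j = m-j & a j ~= 0")
  case True
  \<comment> \<open>A nonzero balanced coefficient is itself the mean of \<open>P\<close>, so the
    straight disc suffices.\<close>
  then obtain j where j: "j <= m" "j = m-j" "a j ~= 0" by blast
  have "(\<Sum>i\<le>m. if i = m-i then Re (a i) else 0) = (\<Sum>i\<le>m. if i = j then Re (a j) else 0)"
   by (rule sum.cong) (use j in auto)
  then have rP: "rep P (Re (a j))" using repP j by simp
  have "Im (a j) = 0" using herm[OF j(1)] j(2) by (metis Im_complex_of_real Reals_cnj_iff complex_is_Real_iff)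
  then have k: "Re (a j) ~= 0" using j(3) by (simp add: complex_eq_iff)
  obtain g where g: "g holomorphic_on UNIV" "g 0 = 0" "!!zt. cmod zt = 1 ==> Re (P zt)+Im (g zt) = Re (a j)"
   using rP unfolding rep_def by blast
  show ?thesis
   by (rule that[of "%zt. zt" g "Re (a j)"]) (insert g k, auto simp: holomorphic_on_ident)
 next
  case False
  then have "(\<Sum>j\<le>m. if j = m-j then Re (a j) else 0) = 0"
   by (intro sum.neutral) auto
  then have rP: "rep P 0" using repP by simp
  \<comment> \<open>Without a balanced term, Hermitian symmetry places a nonzero coefficient above
    the middle degree.\<close>
  obtain j0 where j0: "j0 <= m" "a j0 ~= 0" "m < 2 * j0"
  proof (cases "m < 2 * j1")
   case True then show ?thesis using that nz by blast
  next
   case F: False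
   have "2 * j1 ~= m" using False nz by auto
   then show ?thesis using that[of "m-j1"] F nz herm[of j1] by auto
  qed
  have j0m: "j0 < m" using j0 am by (cases "j0 = m") auto
  \<comment> \<open>The exponent is tuned so that, when the disc is bent by
    \<open>b * c * zt^n\<close>, exactly the terms with index \<open>j0\<close> and
    \<open>m-j0\<close> of the first variation \<open>L\<close> become balanced. With
    \<open>c = a j0\<close> both contribute \<open>(m-j0)\<close> times the squared modulus of
    \<open>c\<close>, and the mean \<open>\<mu>\<close> is positive. As \<open>n >= 2\<close>, the
    disc keeps derivative \<open>1\<close> at \<open>0\<close>.\<close>
  define n where "n = 2 * j0-m+1"
  define c where "c = a j0"
  define L where "L zt = (\<Sum>j\<le>m. (a j * of_nat (m-j) * cnj c) * zt^j * cnj zt^(m-j-1+n) +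
    (a j * of_nat j * c) * zt^(j-1+n) * cnj zt^(m-j))" for zt
  define \<mu> where "\<mu> = 2 * of_nat (m-j0)*(cmod c)^2"
  have \<mu>: "\<mu> > 0" using j0 j0m by (simp add: \<mu>_def c_def)
  have re_sq: "Re (x * of_nat k * cnj x) = of_nat k * (cmod x)^2" for x :: complex and k
  proof -
   have "x * of_nat k * cnj x = of_real (of_nat k * (cmod x)^2)"
    by (simp add: complex_norm_square[symmetric] mult_ac)
   then show ?thesis by (metis Re_complex_of_real)
  qed
  have repL: "rep L \<mu>"
  proof -
   have 1: "rep L (\<Sum>j\<le>m. (if j = m-j-1+n then Re (a j * of_nat (m-j) * cnj c) else 0) +
    (if j-1+n = m-j then Re (a j * of_nat j * c) else 0))"
    unfolding L_def by (intro rep_sum rep_add rep_monomial)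
   have "(\<Sum>j\<le>m. (if j = m-j-1+n then Re (a j * of_nat (m-j) * cnj c) else 0)) =
     (\<Sum>j\<le>m. if j = j0 then of_nat (m-j0)*(cmod c)^2 else 0)"
   proof (rule sum.cong)
    fix j assume j: "j : {..m}"
    show "(if j = m-j-1+n then Re (a j * of_nat (m-j) * cnj c) else 0) = (if j = j0 then of_nat (m-j0)*(cmod c)^2 else 0)"
    proof (cases "j = m")
     case True then show ?thesis using j0m by (simp add: am)
    next
     case jm: False
     then have "j = m-j-1+n \<longleftrightarrow> j = j0" using j j0 j0m by (auto simp: n_def)
     moreover have "Re (c * of_nat (m-j0) * cnj c) = of_nat (m-j0)*(cmod c)^2"
      by (rule re_sq)
     ultimately show ?thesis by (auto simp: c_def)
    qed
   qed simp
   also have "... = of_nat (m-j0)*(cmod c)^2" using j0 by simp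
   finally have 2: "(\<Sum>j\<le>m. (if j = m-j-1+n then Re (a j * of_nat (m-j) * cnj c) else 0)) = of_nat (m-j0)*(cmod c)^2" .
   have "(\<Sum>j\<le>m. (if j-1+n = m-j then Re (a j * of_nat j * c) else 0)) =
     (\<Sum>j\<le>m. if j = m-j0 then of_nat (m-j0)*(cmod c)^2 else 0)"
   proof (rule sum.cong)
    fix j assume j: "j : {..m}"
    show "(if j-1+n = m-j then Re (a j * of_nat j * c) else 0) = (if j = m-j0 then of_nat (m-j0)*(cmod c)^2 else 0)"
    proof (cases "j = 0")
     case True then show ?thesis using j0m by (simp add: a0)
    next
     case jm: False
     then have "j-1+n = m-j \<longleftrightarrow> j = m-j0" using j j0 j0m by (auto simp: n_def)
     moreover have "Re (cnj c * of_nat (m-j0) * c) = of_nat (m-j0)*(cmod c)^2"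
      using re_sq[of "cnj c" "m-j0"] by simp
     ultimately show ?thesis using herm[OF j0(1)] by (auto simp: c_def)
    qed
   qed simp
   also have "... = of_nat (m-j0)*(cmod c)^2" by simp
   finally have 3: "(\<Sum>j\<le>m. (if j-1+n = m-j then Re (a j * of_nat j * c) else 0)) = of_nat (m-j0)*(cmod c)^2" .
   show ?thesis using 1 unfolding sum.distrib 2 3 \<mu>_def by (simp add: mult.assoc)
  qed
  define E where "E = 1+cmod c"
  have "ALL j. EX K. ALL b x x1. 0 <= b --> b <= 1 --> cmod x <= E --> cmod x1 <= E -->
  cmod ((x+b * x1)^j * cnj (x+b * x1)^(m-j)-x^j * cnj x^(m-j) -
   b * (x^j * (of_nat (m-j) * cnj x^(m-j-1) * cnj x1) + of_nat j * x^(j-1) * x1 * cnj x^(m-j))) <= K * b^2"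
   using app_monomial by blast
  then obtain K where K: "!!j b x x1. 0 <= b ==> b <= 1 ==> cmod x <= E ==> cmod x1 <= E ==>
  cmod ((x+b * x1)^j * cnj (x+b * x1)^(m-j)-x^j * cnj x^(m-j) -
   b * (x^j * (of_nat (m-j) * cnj x^(m-j-1) * cnj x1) + of_nat j * x^(j-1) * x1 * cnj x^(m-j))) <= K j * b^2"
   by metis
  define K' where "K' = (\<Sum>j\<le>m. cmod (a j) * \<bar>K j\<bar>)"
  have K'0: "K' >= 0" by (auto simp: K'_def intro: sum_nonneg)
  \<comment> \<open>The first bound keeps \<open>b * cmod c\<close> at most \<open>1\<close>, hence
    \<open>W\<close> within radius \<open>2\<close>; the second keeps the quadratic error below an
    eighth of the gain \<open>b * \<mu>\<close>.\<close>
  define b where "b = min (1/(1+cmod c)) (\<mu>/(8*(K'+1)))"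
  have c1: "0 < 1+cmod c" by (smt (verit) norm_ge_zero)
  have b: "b > 0" using \<mu> K'0 c1 by (simp add: b_def)
  have b1: "b <= 1" unfolding b_def by (rule min.coboundedI1) (insert c1, simp add: divide_le_eq)
  have bc: "b * cmod c <= 1"
  proof -
   have "b * (1+cmod c) <= 1" using c1 by (simp add: b_def min_def divide_simps mult.commute split: if_splits)
   then show ?thesis using b by (simp add: distrib_left)
  qed
  have bK: "K' * b <= \<mu>/8"
  proof -
   have "(K'+1) * b <= (K'+1)*(\<mu>/(8*(K'+1)))" using K'0 by (intro mult_left_mono) (auto simp: b_def)
   also have "... = \<mu>/8" using K'0 by (simp add: field_simps)
   finally show ?thesis using K'0 b by (simp add: distrib_right)
  qed
  define W where "W zt = zt + of_real b * (c * zt^n)" for zt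
  have n2: "n >= 2" using j0 by (simp add: n_def)
  have dW: "(W has_field_derivative 1 + of_real b * (c * (of_nat n * 0^(n-1)))) (at 0)"
   unfolding W_def by (auto intro!: derivative_eq_intros)
  then have dW1: "deriv W 0 = 1" using n2 DERIV_imp_deriv by fastforce
  have exp: "cmod (P (W zt)-P zt-b * L zt) <= K' * b^2" if zt: "cmod zt = 1" for zt
  proof -
   have z1: "cmod zt <= E" "cmod (c * zt^n) <= E" using zt by (auto simp: E_def norm_mult norm_power)
   have eq: "P (W zt)-P zt-b * L zt = (\<Sum>j\<le>m. a j * ((zt+b * (c * zt^n))^j * cnj (zt+b * (c * zt^n))^(m-j)-zt^j * cnj zt^(m-j) -
   b * (zt^j * (of_nat (m-j) * cnj zt^(m-j-1) * cnj (c * zt^n)) + of_nat j * zt^(j-1)*(c * zt^n) * cnj zt^(m-j))))"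
    unfolding P_def L_def W_def sum_distrib_left sum_subtractf[symmetric]
    by (rule sum.cong) (simp_all add: algebra_simps power_add)
   have "cmod (P (W zt)-P zt-b * L zt) <= (\<Sum>j\<le>m. cmod (a j) * \<bar>K j\<bar> * b^2)"
    unfolding eq
   proof (rule sum_norm_le)
    fix j
    have "cmod ((zt+b * (c * zt^n))^j * cnj (zt+b * (c * zt^n))^(m-j)-zt^j * cnj zt^(m-j) -
     b * (zt^j * (of_nat (m-j) * cnj zt^(m-j-1) * cnj (c * zt^n)) + of_nat j * zt^(j-1)*(c * zt^n) * cnj zt^(m-j))) <= K j * b^2"
     using b b1 z1 by (intro K) auto
    also have "... <= \<bar>K j\<bar> * b^2" by (intro mult_right_mono) auto
    finally show "cmod (a j * ((zt+b * (c * zt^n))^j * cnj (zt+b * (c * zt^n))^(m-j)-zt^j * cnj zt^(m-j) -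
     b * (zt^j * (of_nat (m-j) * cnj zt^(m-j-1) * cnj (c * zt^n)) + of_nat j * zt^(j-1)*(c * zt^n) * cnj zt^(m-j)))) <= cmod (a j) * \<bar>K j\<bar> * b^2"
     unfolding norm_mult mult.assoc by (rule mult_left_mono) auto
   qed
   also have "... = K' * b^2" unfolding K'_def by (rule sum_distrib_right[symmetric])
   finally show ?thesis .
  qed
  obtain g1 where g1: "g1 holomorphic_on UNIV" "g1 0 = 0" "!!zt. cmod zt = 1 ==> Re (P zt)+Im (g1 zt) = 0"
   using rP unfolding rep_def by blast
  obtain g2 where g2: "g2 holomorphic_on UNIV" "g2 0 = 0" "!!zt. cmod zt = 1 ==> Re (L zt)+Im (g2 zt) = \<mu>"
   using repL unfolding rep_def by blast
  show ?thesis
  proof (rule that[of W "%zt. g1 zt + of_real b * g2 zt" "b * \<mu>"])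
   show "W holomorphic_on UNIV" unfolding W_def by (intro holomorphic_intros)
   show "W 0 = 0" using n2 by (simp add: W_def)
   show "deriv W 0 ~= 0" using dW1 by simp
   show "(%zt. g1 zt + of_real b * g2 zt) holomorphic_on UNIV" by (intro holomorphic_intros g1 g2)
   show "b * \<mu> ~= 0" using b \<mu> by simp
   fix zt :: complex assume zt: "cmod zt = 1"
   have "cmod (W zt) <= cmod zt+cmod (of_real b * (c * zt^n))" unfolding W_def by (rule norm_triangle_ineq)
   then show "cmod (W zt) <= 2" using zt b bc by (simp add: norm_mult norm_power)
   have "Re (P (W zt))+Im (g1 zt + of_real b * g2 zt)-b * \<mu> = Re (P (W zt)-P zt-b * L zt)"
    using g1(3)[OF zt] g2(3)[OF zt] by (simp add: algebra_simps flip: g2(3)[OF zt])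
   also have "\<bar>...\<bar> <= K' * b^2" using exp[OF zt] abs_Re_le_cmod order_trans by blast
   also have "... <= b * \<mu>/8" using mult_right_mono[OF bK, of b] b by (simp add: power2_eq_square mult_ac)
   finally show "\<bar>Re (P (W zt))+Im (g1 zt + of_real b * g2 zt)-b * \<mu>\<bar> <= \<bar>b * \<mu>\<bar>/8" using b \<mu> by simp
  qed (use g1 g2 in auto)
 qed
qed

lemma real_cx_hol: "real_cx S sx ==> hol (S \<times> {ta. cj ta : S}) sx"
 by (simp add: real_cx_def)

lemma real_cx_sym: "real_cx S sx ==> t : S ==> cj ta : S ==> sx (cj ta,cj t) = cnj (sx (t,ta))"
 unfolding real_cx_def by blast

lemma real_cx_real: "real_cx S sx ==> t : S ==> Im (sx (t,cj t)) = 0"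
 using real_cx_sym[of S sx t "cj t"] by (simp add: complex_eq_iff)

lemma real_cx_diag: "t : S ==> (t,cj t) : S \<times> {ta. cj ta : S}"
 by simp

lemma bounded_linear_diag: "bounded_linear (%t. (t,cj t))"
 by (intro bounded_linear_Pair bounded_linear_ident bounded_linear_cj)

lemma ldv_Pair_snd:
 assumes sx: "hol T sx" and q: "q : T"
 shows "ldv sx q ((0,z),(0,y)) = z * ldv sx q ((0,1),0)+y * ldv sx q (0,(0,1))"
proof -
 have eq: "((0,z),(0,y)) = cs z ((0,1),0)+cs y (0,(0,1))"
  by (simp add: prod_eq_iff cs.zero_right)
 show ?thesis
  unfolding eq linear_add[OF ldv_linear[OF assms]] ldv_cs[OF hol_imp_ghol[OF sx] q] ..
qed

text \<open>The normalisation of \<open>sx (t,0)\<close> and its Hermitian reflection give the two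
  vertical partial derivatives \<open>- \<i>/2\<close> and \<open>\<i>/2\<close> at the origin, and
  \<open>z * (- \<i>/2)+cnj z * (\<i>/2)\<close> is \<open>Im z\<close>. Continuity of the
  derivatives makes this uniform nearby.\<close>

lemma vertical_expansion:
 fixes sx :: "'m::finite cn \<times> 'm cn => complex"
 assumes s: "s > 0" and cx: "real_cx (ball 0 s) sx"
  and n: "!!t. t : ball 0 s ==> sx (t,0) = snd t/(2 * \<i>)" and th: "th > 0"
 obtains r where "0 < r" "r < s/2"
  "!!w z. norm w < r ==> cmod z < r ==> cmod (sx ((w,z),cj (w,z))-sx ((w,0),cj (w,0))-Im z) <= th * cmod z"
  "!!w z. norm w < r ==> cmod z < r ==> Re (ldv sx ((w,z),cj (w,z)) ((0,\<i>),(0,- \<i>))) >= 1/2"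
proof -
 define T where "T = ball (0 :: 'm cn) s \<times> {ta :: 'm cn. cj ta : ball 0 s}"
 have h: "hol T sx" using real_cx_hol[OF cx] by (simp add: T_def)
 have T0: "(0,0) : T" using s by (simp add: T_def)
 define A where "A q = ldv sx q ((0,1),0)" for q
 define B where "B q = ldv sx q (0,(0,1))" for q
 have A0: "A (0,0) = - \<i>/2"
 proof -
  have "((%zt. zt * (- \<i>/2)) has_field_derivative-\<i>/2) (at 0)" by (auto intro!: derivative_eq_intros)
  then have "((%zt. sx ((0,0)+cs zt ((0,1),0))) has_field_derivative-\<i>/2) (at 0)"
  proof (rule has_field_derivative_transform_within_open[where S="ball 0 s"])
   fix zt :: complex assume "zt : ball 0 s"
   then have "sx ((0,zt),0) = zt/(2 * \<i>)" using n[of "(0,zt)"] by (simp add: norm_Pair)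
   moreover have "(0,0)+cs zt ((0,1),0) = ((0 :: complex^'m,zt),0 :: 'm cn)" by (simp add: prod_eq_iff cs.zero_right)
   ultimately show "zt * (- \<i>/2) = sx ((0,0)+cs zt ((0,1),0))" by (simp add: divide_simps)
  qed (use s in auto)
  then show ?thesis unfolding A_def ldv_def by (rule DERIV_imp_deriv)
 qed
 have B0: "B (0,0) = \<i>/2"
 proof -
  have "((%zt. zt * (\<i>/2)) has_field_derivative \<i>/2) (at 0)" by (auto intro!: derivative_eq_intros)
  then have "((%zt. sx ((0,0)+cs zt (0,(0,1)))) has_field_derivative \<i>/2) (at 0)"
  proof (rule has_field_derivative_transform_within_open[where S="ball 0 s"])
   fix zt :: complex assume zt: "zt : ball 0 s"
   have "sx ((0,cnj zt),0) = cnj zt/(2 * \<i>)" using n[of "(0,cnj zt)"] zt by (simp add: norm_Pair)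
   moreover have "sx (cj 0,cj (0,cnj zt)) = cnj (sx ((0,cnj zt),0))"
    by (rule real_cx_sym[OF cx]) (insert s zt, simp_all add: norm_Pair)
   moreover have "cj (0 :: complex^'m,cnj zt) = (0,zt)" by (simp add: prod_eq_iff vec_eq_iff)
   ultimately have "sx (0,(0,zt)) = cnj (cnj zt/(2 * \<i>))" by simp
   moreover have "(0,0)+cs zt (0,(0,1)) = (0 :: 'm cn,(0 :: complex^'m,zt))" by (simp add: prod_eq_iff cs.zero_right)
   ultimately show "zt * (\<i>/2) = sx ((0,0)+cs zt (0,(0,1)))" by (simp add: divide_simps)
  qed (use s in auto)
  then show ?thesis unfolding B_def ldv_def by (rule DERIV_imp_deriv)
 qed
 define th' where "th' = min (th/2) (1/4)"
 have th': "th' > 0" "2 * th' <= th" "2 * th' <= 1/2" using th by (auto simp: th'_def)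
 have "isCont A (0,0)" "isCont B (0,0)"
  using hol_continuous_on[OF hol_ldv[OF h]] hol_open[OF h] T0 unfolding A_def[abs_def] B_def[abs_def]
  by (auto simp: continuous_on_eq_continuous_at)
 then obtain r1 r2 where r12: "r1 > 0" "r2 > 0" and rA: "!!q. dist q (0,0) < r1 ==> dist (A q) (A (0,0)) < th'"
  and rB: "!!q. dist q (0,0) < r2 ==> dist (B q) (B (0,0)) < th'"
  using th'(1) unfolding continuous_at_eps_delta by metis
 define r where "r = min s (min r1 r2)/8"
 have r: "r > 0" "8 * r <= s" "8 * r <= r1" "8 * r <= r2" using r12 s by (auto simp: r_def)
 have near: "((w,z),cj (w,z)) : T & cmod (A ((w,z),cj (w,z))+\<i>/2) <= th' & cmod (B ((w,z),cj (w,z))-\<i>/2) <= th'"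
  if "norm w < r" "cmod z < r" for w :: "complex^'m" and z
 proof -
  have n1: "norm (w,z) < 2 * r" using that norm_Pair_le_add[of w z] by simp
  have "norm ((w,z),cj (w,z)) < 4 * r" using norm_Pair_le_add[of "(w,z)" "cj (w,z)"] n1 by simp
  then have "dist ((w,z),cj (w,z)) (0,0) < 4 * r" by (simp add: dist_norm flip: zero_prod_def)
  then have "cmod (A ((w,z),cj (w,z))+\<i>/2) <= th'" "cmod (B ((w,z),cj (w,z))-\<i>/2) <= th'"
   using rA[of "((w,z),cj (w,z))"] rB[of "((w,z),cj (w,z))"] r by (auto simp: A0 B0 dist_norm)
  moreover have "(w,z) : ball 0 s" using n1 r by (simp only: mem_ball_0)
  ultimately show ?thesis unfolding T_def by (simp only: mem_Times_iff mem_Collect_eq cj_cj fst_conv snd_conv simp_thms)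
 qed
 have dd: "cmod (ldv sx q ((0,z),(0,cnj z))-Im z) <= 2 * th' * cmod z"
  if "q : T" "cmod (A q+\<i>/2) <= th'" "cmod (B q-\<i>/2) <= th'" for q z
 proof -
  have "ldv sx q ((0,z),(0,cnj z))-Im z = z * (A q+\<i>/2)+cnj z * (B q-\<i>/2)"
   unfolding ldv_Pair_snd[OF h that(1)] A_def B_def by (simp add: complex_eq_iff algebra_simps)
  also have "cmod ... <= cmod z * th'+cmod z * th'"
   using that by (intro norm_triangle_mono) (auto simp: norm_mult intro!: mult_left_mono)
  finally show ?thesis by (simp add: algebra_simps)
 qed
 show ?thesis
 proof (rule that[of r])
  show "0 < r" "r < s/2" using r s by auto
  fix w :: "complex^'m" and z :: complex assume wz: "norm w < r" "cmod z < r"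
  define h where "h ta = sx (((w,0),cj (w,0))+ta *R ((0,z),(0,cnj z)))-ta *R of_real (Im z)" for ta
  have pt: "((w,0),cj (w,0))+ta *R ((0,z),(0,cnj z)) = ((w,ta *R z),cj (w,ta *R z))" for ta
   by (simp add: prod_eq_iff vec_eq_iff)
  have "norm (h 1-h 0) <= 2 * th' * cmod z * 1"
  proof (rule vector_derivative_bound_segment[where g=h])
   fix ta :: real assume ta: "ta : {0..1}"
   have z': "cmod (ta *R z) < r" using ta wz mult_left_le_one_le[of "cmod z" "(abs ta)"] by (auto simp: norm_scaleR)
   note q = near[OF wz(1) z']
   have "(sx has_derivative ldv sx ((w,ta *R z),cj (w,ta *R z))) (at (((w,0),cj (w,0))+ta *R ((0,z),(0,cnj z))))"
    unfolding pt using hol_derivL[OF \<open>hol T sx\<close>] q by blast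
   from has_vector_derivative_line[OF this]
   show "(h has_vector_derivative ldv sx ((w,ta *R z),cj (w,ta *R z)) ((0,z),(0,cnj z))-of_real (Im z)) (at ta)"
    unfolding h_def by (intro has_vector_derivative_diff) (auto intro!: derivative_eq_intros)
   show "norm (ldv sx ((w,ta *R z),cj (w,ta *R z)) ((0,z),(0,cnj z))-of_real (Im z)) <= 2 * th' * cmod z"
    using dd q by blast
  qed simp
  also have "h 1-h 0 = sx ((w,z),cj (w,z))-sx ((w,0),cj (w,0))-Im z"
   unfolding h_def pt by simp
  finally have "cmod (sx ((w,z),cj (w,z))-sx ((w,0),cj (w,0))-Im z) <= 2 * th' * cmod z" by simp
  then show "cmod (sx ((w,z),cj (w,z))-sx ((w,0),cj (w,0))-Im z) <= th * cmod z"
   using mult_right_mono[OF th'(2), of "cmod z"] by simp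
  have "cmod (ldv sx ((w,z),cj (w,z)) ((0,\<i>),(0,cnj \<i>))-Im \<i>) <= 2 * th' * cmod \<i>"
   using dd near[OF wz] by blast
  then have "cmod (ldv sx ((w,z),cj (w,z)) ((0,\<i>),(0,- \<i>))-1) <= 1/2"
   using th' by simp
  then have "\<bar>Re (ldv sx ((w,z),cj (w,z)) ((0,\<i>),(0,- \<i>))-1)\<bar> <= 1/2"
   using abs_Re_le_cmod order_trans by blast
  then show "Re (ldv sx ((w,z),cj (w,z)) ((0,\<i>),(0,- \<i>))) >= 1/2"
   unfolding minus_complex.simps one_complex.simps by linarith
 qed
qed

text \<open>Along a line on which the hyperplane section is not identically zero, the lowest
  homogeneous part \<open>P\<close> has degree \<open>m\<close>. A disc of size \<open>ep\<close> in
  \<open>w\<close> and \<open>ep^m\<close> in \<open>z\<close> balances \<open>P\<close> against the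
  vertical term \<open>Im z\<close>: to leading order \<open>sx\<close> on its boundary is
  \<open>ep^m\<close> times the nearly constant function produced by
  \<open>bent_disc\<close>.\<close>

lemma disc_exists:
 fixes sx :: "'m::finite cn \<times> 'm cn => complex"
 assumes s: "s > 0" and cx: "real_cx (ball 0 s) sx"
  and n: "!!t. t : ball 0 s ==> sx (t,0) = snd t/(2 * \<i>)"
  and nz: "!!e. e > 0 ==> EX w. norm w < e & sx ((w,0),cj (w,0)) ~= 0"
 obtains w0 W g m ka ep0 where "w0 ~= 0" "W holomorphic_on UNIV" "W 0 = 0" "deriv W 0 ~= 0"
  "g holomorphic_on UNIV" "g 0 = 0" "ka ~= 0" "m >= 1" "ep0 > 0"
  "!!ep zt t. 0 < ep ==> ep < ep0 ==> cmod zt = 1 ==> t = (cs (of_real ep * W zt) w0,of_real (ep^m) * g zt) ==>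
    \<bar>Re (sx (t,cj t))-ep^m * ka\<bar> <= ep^m * (abs ka)/2"
proof -
 obtain w0 where w0: "norm w0 < s/4" "sx ((w0,0),cj (w0,0)) ~= 0" using nz[of "s/4"] s by auto
 define w0' where "w0' = fst (cj (w0,0))"
 have nw: "norm w0' = norm w0"
  unfolding w0'_def by (simp add: norm_vec_def L2_set_def)
 have cjw: "cj (cs zt w0,0) = (cs (cnj zt) w0',0)" "cj (cs zt w0',0) = (cs (cnj zt) w0,0)" for zt
  by (simp_all add: w0'_def prod_eq_iff vec_eq_iff)
 define S where "S q = sx ((cs (fst q) w0,0),(cs (snd q) w0',0))" for q
 have inb: "(cs zt w0,0 :: complex) : ball 0 s" "(cs zt w0',0 :: complex) : ball 0 s" if "cmod zt < 4" for zt
 proof -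
  have "cmod zt * norm w0 <= 4 * norm w0" using that by (intro mult_right_mono) auto
  then have "norm (cs zt w0,0 :: complex) < s" "norm (cs zt w0',0 :: complex) < s" using w0(1) by (simp_all add: norm_Pair nw)
  then show "(cs zt w0,0 :: complex) : ball 0 s" "(cs zt w0',0 :: complex) : ball 0 s" by (simp_all only: mem_ball_0)
 qed
 have hS: "hol (ball 0 4 \<times> ball 0 4) S"
  unfolding S_def
 proof (rule hol_compose[OF real_cx_hol[OF cx]])
  show "hol (ball 0 4 \<times> ball 0 4) (%q. ((cs (fst q) w0,0 :: complex),(cs (snd q) w0',0 :: complex)))"
   by (intro hol_Pair hol_cs hol_fst hol_snd hol_id hol_const open_Times open_ball)
 qed (insert inb, auto simp del: mem_ball_0)
 have z1: "S (zt,0) = 0" if "cmod zt < 4" for zt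
  using n[OF inb(1)[OF that]] by (simp add: S_def cs.zero_left flip: zero_prod_def)
 have z2: "S (0,et) = 0" if "cmod et < 4" for et
 proof -
  have "sx (cj 0,cj (cs (cnj et) w0,0)) = cnj (sx ((cs (cnj et) w0,0),0))"
   by (rule real_cx_sym[OF cx inb(1)]) (use that s in auto)
  also have "... = 0" using n[OF inb(1), of "cnj et"] that by simp
  finally show ?thesis by (simp add: S_def cs.zero_left cjw flip: zero_prod_def)
 qed
 define good where "good c B \<longleftrightarrow> 0 <= B & (ALL j. c j 0 = 0) & (ALL k. c 0 k = 0) & (ALL J dl zt et. dl <= 1 --> cmod zt <= dl --> cmod et <= dl -->
   cmod (S (zt,et)-(\<Sum>j\<le>J. \<Sum>k\<le>J. c j k * zt^j * et^k)) <= 5 * B * (dl/3)^Suc J)" for c B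
 have "EX c B. good c B"
 proof (rule double_taylor[OF hS z1 z2])
  fix c :: "nat => nat => complex" and B :: real
  assume "0 <= B" "!!j. c j 0 = 0" "!!k. c 0 k = 0" "!!J dl zt et. dl <= 1 ==> cmod zt <= dl ==> cmod et <= dl ==>
   cmod (S (zt,et)-(\<Sum>j\<le>J. \<Sum>k\<le>J. c j k * zt^j * et^k)) <= 5 * B * (dl/3)^Suc J"
  then have "good c B" unfolding good_def by blast
  then show "EX c B. good c B" by blast
 qed
 then obtain c B where cB: "good c B" by blast
 have B0: "0 <= B" and c0: "c j 0 = 0" "c 0 k = 0" for j k using cB unfolding good_def by blast+
 have T: "cmod (S (zt,et)-(\<Sum>j\<le>J. \<Sum>k\<le>J. c j k * zt^j * et^k)) <= 5 * B * (dl/3)^Suc J"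
  if "dl <= 1" "cmod zt <= dl" "cmod et <= dl" for J dl zt et
  using cB that unfolding good_def by blast
 have "EX j k. c j k ~= 0"
 proof (rule ccontr)
  assume "~ ?thesis"
  then have le: "cmod (S (1,1)) <= 5 * B * (1/3)^Suc J" for J using T[of 1 1 1 J] by simp
  have lim: "(%J. 5 * B * (1/3)^Suc J) \<longlonglongrightarrow> 5 * B * 0"
   by (intro tendsto_mult tendsto_const LIMSEQ_Suc LIMSEQ_realpow_zero) auto
  have "cmod (S (1,1)) <= 5 * B * 0"
   by (rule LIMSEQ_le_const[OF lim]) (use le in blast)
  moreover have "S (1,1) = sx ((w0,0),cj (w0,0))" using cjw(1)[of 1] by (simp add: S_def)
  ultimately show False using w0(2) by simp
 qed
 then have ex: "EX n j k. j+k = n & c j k ~= 0" by blast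
 define m where "m = (LEAST n. EX j k. j+k = n & c j k ~= 0)"
 obtain j1 k1 where j1: "j1+k1 = m" "c j1 k1 ~= 0"
  using LeastI_ex[OF ex] unfolding m_def by blast
 have low: "c j k = 0" if "j+k < m" for j k
  using not_less_Least[of "j+k" "%n. EX j k. j+k = n & c j k ~= 0"] that unfolding m_def by blast
 have m1: "m >= 1" using j1 c0 by (cases j1) auto
 define a where "a j = c j (m-j)" for j
 define P where "P zt = (\<Sum>j\<le>m. a j * zt^j * cnj zt^(m-j))" for zt
 define K where "K = 5 * B+(\<Sum>j\<le>m. \<Sum>k\<le>m. cmod (c j k))"
 have K0: "K >= 0" using B0 by (auto simp: K_def intro!: add_nonneg_nonneg sum_nonneg)
 have est: "cmod (S (zt,cnj zt)-P zt) <= K * dl^Suc m" if d: "dl <= 1" "cmod zt <= dl" for zt dl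
 proof -
  have d0: "0 <= dl" using d norm_ge_zero order_trans by blast
  define H where "H j k = (if m < j+k then c j k * zt^j * cnj zt^k else 0)" for j k
  have sp: "(\<Sum>k\<le>m. c j k * zt^j * cnj zt^k) = a j * zt^j * cnj zt^(m-j)+(\<Sum>k\<le>m. H j k)" if j: "j <= m" for j
  proof -
   have "c j k * zt^j * cnj zt^k = (if k = m-j then a j * zt^j * cnj zt^(m-j) else 0)+H j k" for k
    using low[of j k] j by (cases "j+k < m") (auto simp: H_def a_def)
   then have "(\<Sum>k\<le>m. c j k * zt^j * cnj zt^k) = (\<Sum>k\<le>m. (if k = m-j then a j * zt^j * cnj zt^(m-j) else 0)+H j k)"
    by simp
   also have "... = a j * zt^j * cnj zt^(m-j)+(\<Sum>k\<le>m. H j k)" by (simp add: sum.distrib)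
   finally show ?thesis .
  qed
  have eq: "(\<Sum>j\<le>m. \<Sum>k\<le>m. c j k * zt^j * cnj zt^k) = P zt+(\<Sum>j\<le>m. \<Sum>k\<le>m. H j k)"
   unfolding P_def by (simp add: sp sum.distrib)
  have "cmod (\<Sum>j\<le>m. \<Sum>k\<le>m. H j k) <= (\<Sum>j\<le>m. \<Sum>k\<le>m. cmod (c j k) * dl^Suc m)"
  proof (intro sum_norm_le)
   fix j k
   show "cmod (H j k) <= cmod (c j k) * dl^Suc m"
   proof (cases "m < j+k")
    case True
    have "cmod zt^(j+k) <= dl^(j+k)" using d by (intro power_mono) auto
    also have "... <= dl^Suc m" using True d d0 by (intro power_decreasing) auto
    finally have "cmod (c j k) * cmod zt^(j+k) <= cmod (c j k) * dl^Suc m" by (rule mult_left_mono) simp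
    then show ?thesis using True by (simp add: H_def norm_mult norm_power power_add mult.assoc)
   qed (insert d0, simp add: H_def)
  qed
  then have 1: "cmod (\<Sum>j\<le>m. \<Sum>k\<le>m. H j k) <= (\<Sum>j\<le>m. \<Sum>k\<le>m. cmod (c j k)) * dl^Suc m"
   by (simp add: sum_distrib_right)
  have "5 * B * (dl/3)^Suc m <= 5 * B * dl^Suc m"
   using B0 d0 by (intro mult_left_mono power_mono) auto
  then have 2: "cmod (S (zt,cnj zt)-(\<Sum>j\<le>m. \<Sum>k\<le>m. c j k * zt^j * cnj zt^k)) <= 5 * B * dl^Suc m"
   using T[OF d(1,2), of "cnj zt" m] d(2) by simp
  have "cmod (S (zt,cnj zt)-P zt) = cmod ((S (zt,cnj zt)-(\<Sum>j\<le>m. \<Sum>k\<le>m. c j k * zt^j * cnj zt^k))+(\<Sum>j\<le>m. \<Sum>k\<le>m. H j k))"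
   by (simp add: eq)
  also have "... <= 5 * B * dl^Suc m+(\<Sum>j\<le>m. \<Sum>k\<le>m. cmod (c j k)) * dl^Suc m"
   using 1 2 by (rule norm_triangle_mono[rotated])
  finally show ?thesis by (simp add: K_def distrib_right)
 qed
 have hom: "P (of_real ep * zt) = of_real (ep^m) * P zt" for ep zt
  unfolding P_def sum_distrib_left
 proof (rule sum.cong)
  fix j assume "j : {..m}"
  then have "complex_of_real ep^m = of_real ep^j * of_real ep^(m-j)" by (simp flip: power_add)
  then show "a j * (of_real ep * zt)^j * cnj (of_real ep * zt)^(m-j) = of_real (ep^m)*(a j * zt^j * cnj zt^(m-j))"
   by (simp add: power_mult_distrib mult_ac)
 qed simp
 have Sreal: "Im (S (zt,cnj zt)) = 0" if "cmod zt < 4" for zt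
  using real_cx_real[OF cx inb(1)[OF that]] by (simp add: S_def cjw)
 \<comment> \<open>The function \<open>S\<close> is real on conjugate pairs. Dividing its expansion
   at \<open>ep * zt\<close> by \<open>ep^m\<close> and letting \<open>ep\<close> tend to
   \<open>0\<close> transfers this to the leading part.\<close>
 have Pre: "Im (P zt) = 0" if zt: "cmod zt = 1" for zt
 proof -
  have "\<bar>Im (P zt)\<bar> <= K * ep" if e: "0 < ep" "ep <= 1" for ep
  proof -
   have "cmod (S (ep * zt,cnj (ep * zt))-P (ep * zt)) <= K * ep^Suc m"
    by (rule est) (insert e zt, auto simp: norm_mult)
   then have "\<bar>Im (S (ep * zt,cnj (ep * zt))-P (ep * zt))\<bar> <= K * ep^Suc m"
    using abs_Im_le_cmod order_trans by blast
   moreover have "Im (S (ep * zt,cnj (ep * zt))-P (ep * zt)) = - (ep^m * Im (P zt))"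
    using Sreal[of "ep * zt"] e zt by (simp add: hom norm_mult del: of_real_power)
   ultimately have "ep^m * \<bar>Im (P zt)\<bar> <= ep^m * (K * ep)" using e by (simp add: abs_mult mult_ac)
   then show ?thesis using e by simp
  qed
  then have "\<bar>Im (P zt)\<bar> <= x" if "x > 0" for x
  proof -
   define ep where "ep = min 1 (x/(K+1))"
   have e: "0 < ep" "ep <= 1" using that K0 by (auto simp: ep_def)
   have "K * ep <= (K+1) * ep" using e by simp
   also have "... <= (K+1)*(x/(K+1))" using K0 by (intro mult_left_mono) (auto simp: ep_def)
   finally have "K * ep <= x" using K0 by simp
   then show ?thesis using \<open>\<And>ep. 0 < ep \<Longrightarrow> ep \<le> 1 \<Longrightarrow> \<bar>Im (P zt)\<bar> \<le> K * ep\<close>[OF e] by simp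
  qed
  then have "\<bar>Im (P zt)\<bar> <= 0" using dense_ge by blast
  then show ?thesis by simp
 qed
 have a0: "a 0 = 0" "a m = 0" using c0 by (simp_all add: a_def)
 have aj: "j1 <= m" "a j1 ~= 0" using j1 by (auto simp: a_def)
 define good2 where "good2 W g ka \<longleftrightarrow> W holomorphic_on UNIV & W 0 = 0 & deriv W 0 ~= 0 & g holomorphic_on UNIV & g 0 = 0 & ka ~= 0 &
  (ALL zt. cmod zt = 1 --> cmod (W zt) <= 2 & \<bar>Re (P (W zt))+Im (g zt)-ka\<bar> <= (abs ka)/8)" for W g ka
 have "EX W g ka. good2 W g ka"
 proof (rule bent_disc[where a=a and m=m])
  show "Im (\<Sum>j\<le>m. a j * zt^j * cnj zt^(m-j)) = 0" if "cmod zt = 1" for zt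
   using Pre[OF that] by (simp add: P_def)
  fix W g ka assume "W holomorphic_on UNIV" "W 0 = 0" "deriv W 0 ~= 0" "g holomorphic_on UNIV" "g 0 = 0" "ka ~= 0"
   "!!zt. cmod zt = 1 ==> cmod (W zt) <= 2"
   "!!zt. cmod zt = 1 ==> \<bar>Re (\<Sum>j\<le>m. a j * W zt^j * cnj (W zt)^(m-j))+Im (g zt)-ka\<bar> <= (abs ka)/8"
  then have "good2 W g ka" unfolding good2_def P_def by blast
  then show "EX W g ka. good2 W g ka" by blast
 qed (use a0 aj in auto)
 then obtain W g ka where "good2 W g ka" by blast
 then have W: "W holomorphic_on UNIV" "W 0 = 0" "deriv W 0 ~= 0" and g: "g holomorphic_on UNIV" "g 0 = 0" and ka: "ka ~= 0"
  and W2: "!!zt. cmod zt = 1 ==> cmod (W zt) <= 2"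
  and P8: "!!zt. cmod zt = 1 ==> \<bar>Re (P (W zt))+Im (g zt)-ka\<bar> <= (abs ka)/8"
  unfolding good2_def by blast+
 have "continuous_on (sphere 0 1) g" using holomorphic_on_imp_continuous_on[OF g(1)] by (rule continuous_on_subset) simp
 from continuous_on_compact_bound[OF compact_sphere this]
 obtain C where C: "C >= 0" "!!zt. cmod zt = 1 ==> cmod (g zt) <= C" by auto
 define th where "th = (abs ka)/(8*(C+1))"
 have th: "th > 0" using ka C by (simp add: th_def)
 have thC: "th * C <= (abs ka)/8"
 proof -
  have "th * C <= th * (C+1)" using th by simp
  also have "... = (abs ka)/8" using C by (simp add: th_def field_simps)
  finally show ?thesis .
 qed
 obtain r where r: "0 < r" "!!w z. norm w < r ==> cmod z < r ==> cmod (sx ((w,z),cj (w,z))-sx ((w,0),cj (w,0))-Im z) <= th * cmod z"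
  using vertical_expansion[OF s cx n th] by metis
 define D where "D = K * 2^Suc m"
 have D0: "D >= 0" using K0 by (simp add: D_def)
 \<comment> \<open>Three errors of \<open>abs ka/8\<close> are tolerated: that of the bent disc,
   that of the vertical expansion (through \<open>th\<close>) and the Taylor tail (second entry).
   The entry \<open>1/2\<close> keeps \<open>2 * ep\<close> admissible in \<open>est\<close>, the
   last entry keeps the disc where the vertical expansion holds.\<close>
 define ep0 where "ep0 = min (1/2) (min ((abs ka)/(8*(D+1))) (r/(2 * norm w0+C+1)))"
 have q: "2 * norm w0+C+1 > 0" using C by (smt (verit) norm_ge_zero)
 have e0: "ep0 > 0" using ka D0 q r by (simp add: ep0_def)
 have fin: "\<bar>Re (sx (t,cj t))-ep^m * ka\<bar> <= ep^m * (abs ka)/2"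
  if e: "0 < ep" "ep < ep0" and zt: "cmod zt = 1" and t: "t = (cs (of_real ep * W zt) w0,of_real (ep^m) * g zt)" for ep zt t
 proof -
  have e1: "2 * ep <= 1" using e by (simp add: ep0_def)
  have eD: "D * ep <= (abs ka)/8"
  proof -
   have "D * ep <= (D+1) * ep" using e by simp
   also have "... <= (D+1)*((abs ka)/(8*(D+1)))" using D0 e by (intro mult_left_mono) (auto simp: ep0_def)
   also have "... = (abs ka)/8" using D0 by (simp add: field_simps)
   finally show ?thesis .
  qed
  have er: "ep * (2 * norm w0+C+1) < r" using e q by (simp add: ep0_def pos_less_divide_eq)
  have em: "ep^m <= ep" using power_decreasing[OF m1, of ep] e e1 by simp
  have emp: "ep^m > 0" using e by simp
  define w where "w = cs (of_real ep * W zt) w0"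
  define z where "z = of_real (ep^m) * g zt"
  have "norm w <= ep * 2 * norm w0" unfolding w_def norm_cs norm_mult using W2[OF zt] e by (intro mult_right_mono) auto
  also have "... <= ep * (2 * norm w0+C+1)" using e C by (simp add: distrib_left)
  finally have wr: "norm w < r" using er by simp
  have zC: "cmod z <= ep^m * C" unfolding z_def norm_mult using C(2)[OF zt] e by (simp add: norm_power)
  also have "... <= ep * C" using em C by (intro mult_right_mono) auto
  also have "... <= ep * (2 * norm w0+C+1)" using e by (intro mult_left_mono) auto
  finally have zr: "cmod z < r" using er by simp
  have 1: "cmod (sx ((w,z),cj (w,z))-sx ((w,0),cj (w,0))-Im z) <= ep^m * ((abs ka)/8)"
  proof -
   have "th * cmod z <= th * (ep^m * C)" using zC th by (intro mult_left_mono) auto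
   also have "... <= ep^m * ((abs ka)/8)" using mult_left_mono[OF thC, of "ep^m"] emp by (simp add: mult_ac)
   finally show ?thesis using r(2)[OF wr zr] by simp
  qed
  have Sw: "sx ((w,0),cj (w,0)) = S (ep * W zt,cnj (ep * W zt))" by (simp add: S_def w_def cjw)
  have 2: "cmod (sx ((w,0),cj (w,0))-of_real (ep^m) * P (W zt)) <= ep^m * ((abs ka)/8)"
  proof -
   have "cmod (ep * W zt) <= 2 * ep" using W2[OF zt] e by (simp add: norm_mult)
   from est[OF e1 this] have "cmod (S (ep * W zt,cnj (ep * W zt))-P (ep * W zt)) <= K * (2 * ep)^Suc m" .
   also have "... = ep^m * (D * ep)" by (simp add: D_def power_mult_distrib mult_ac)
   also have "... <= ep^m * ((abs ka)/8)" using eD emp by (intro mult_left_mono) auto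
   finally show ?thesis unfolding Sw hom .
  qed
  define X Y where "X = sx ((w,z),cj (w,z))-sx ((w,0),cj (w,0))-Im z"
   and "Y = sx ((w,0),cj (w,0))-of_real (ep^m) * P (W zt)"
  have "Re (sx ((w,z),cj (w,z)))-ep^m * ka = Re X+Re Y+ep^m * (Re (P (W zt))+Im (g zt)-ka)"
   by (simp add: X_def Y_def z_def algebra_simps del: of_real_power)
  moreover have "(abs (Re X)) <= ep^m * ((abs ka)/8)" "(abs (Re Y)) <= ep^m * ((abs ka)/8)"
   using 1 2 abs_Re_le_cmod order_trans unfolding X_def Y_def by blast+
  moreover have "\<bar>ep^m * (Re (P (W zt))+Im (g zt)-ka)\<bar> <= ep^m * ((abs ka)/8)"
   unfolding abs_mult using P8[OF zt] emp by (simp add: mult_left_mono)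
  ultimately have "\<bar>Re (sx ((w,z),cj (w,z)))-ep^m * ka\<bar> <= 3*(ep^m * ((abs ka)/8))" by linarith
  also have "... <= ep^m * (abs ka)/2" using emp by (simp add: field_simps)
  finally show ?thesis unfolding t w_def z_def .
 qed
 show ?thesis
  by (rule that[OF _ W g ka m1 e0 fin]) (insert w0 n[of 0] s, auto simp: cj_0 simp flip: zero_prod_def)
qed

lemma bsm_diag:
 assumes "bsm False T sx" "!!t. t : S ==> (t,cj t) : T"
 shows "bsm False S (%t. sx (t,cj t))"
proof (rule bsm_compose[where I="Basis" and l="%b u. of_real (u \<bullet> b)" and e="%b. b" and q="%t. (t,cj t)" and q'="%v _. (v,cj v)"])
 fix L :: "'a cn \<times> 'a cn => complex" and u assume L: "linear L"
 have "L u = L (\<Sum>b\<in>Basis. (u \<bullet> b) *R b)" by (simp add: euclidean_representation)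
 also have "... = (\<Sum>b\<in>Basis. of_real (u \<bullet> b) * L b)"
  using L by (simp add: linear_sum linear_scale scaleR_conv_of_real)
 finally show "L u = (\<Sum>b\<in>Basis. of_real (u \<bullet> b) * L b)" .
next
 show "((%t. (t,cj t)) has_derivative (%v. (v,cj v))) (at y within S)" for y
  by (intro has_derivative_Pair has_derivative_ident bounded_linear_imp_has_derivative bounded_linear_cj)
qed (use assms in auto)

lemma real_cx_scale:
 assumes "real_cx S sx" shows "real_cx S (%q. of_real c * sx q)"
 using assms unfolding real_cx_def by (auto intro!: hol_mult hol_const dest: hol_open)

lemma fd_diag:
 assumes "real_cx S sx" "t : S"
 shows "((%t. sx (t,cj t)) has_derivative (%v. ldv sx (t,cj t) (v,cj v))) (at t)"
proof -
 have "(t,cj t) : S \<times> {ta. cj ta : S}" using assms(2) by (rule real_cx_diag)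
 from hol_derivL[OF real_cx_hol[OF assms(1)] this]
 have "(sx has_derivative ldv sx (t,cj t)) (at (t,cj t))" .
 from has_derivative_compose[OF bounded_linear_imp_has_derivative[OF bounded_linear_diag] this]
 show ?thesis .
qed

lemma entire_bound:
 assumes "f holomorphic_on UNIV" obtains C where "C >= 0" "!!zt. cmod zt <= 1 ==> cmod (f zt) <= C"
proof -
 have "continuous_on (cball 0 1) f" using holomorphic_on_imp_continuous_on[OF assms] by (rule continuous_on_subset) simp
 from continuous_on_compact_bound[OF compact_cball this]
 obtain C where "C >= 0" "!!x. x : cball 0 1 ==> norm (f x) <= C" by blast
 then show ?thesis using that by auto
qed

lemma norm_vec_le_sum: "norm (x :: complex^'m::finite) <= (\<Sum>i\<in>UNIV. cmod (x $ i))"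
 unfolding norm_vec_def by (rule L2_set_le_sum) auto

text \<open>The disc becomes the unit disc of the \<open>k\<close>-th coordinate axis. Its boundary
  is strictly on one side, and compactness thickens this to the whole family of nearby discs, with
  radii \<open>R\<close> and \<open>d\<close> as room; lowering the discs puts them entirely on that
  side.\<close>

lemma disc_chart:
 fixes M :: "'m::finite cn set"
 assumes M: "real_analytic_hypersurface M" and p: "p : M" and V0: "open V0" "p : V0" and min: "minimal_at M p"
 obtains k :: 'm and R d d1 and Xi :: "'m cn => 'm cn" and sx and V1 :: "'m cn set" and Ps :: "'m cn => 'm cn"
  where "hat k R d d1 (%t. sx (t,cj t))" "real_cx (hbox k R d d1) sx" "hol (hbox k R d d1) Xi" "Xi 0 = p"
  "ALL t:hbox k R d d1. Xi t : V0 & (Xi t : M \<longleftrightarrow> sx (t,cj t) = 0)"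
  "open V1" "p : V1" "hol V1 Ps" "Ps p = 0" "ALL x:V1. Ps x : hbox k R d d1 & Xi (Ps x) = x"
proof (rule normal_chart[OF M p V0 min])
 fix s :: real and Xi0 :: "'m cn => 'm cn" and sx0 and V1 :: "'m cn set" and Ps0 :: "'m cn => 'm cn"
 assume s: "s > 0" and h0: "hol (ball 0 s) Xi0" and Xi0: "Xi0 0 = p" and XiV: "!!t. t : ball 0 s ==> Xi0 t : V0"
  and cx: "real_cx (ball 0 s) sx0" and n: "!!t. t : ball 0 s ==> sx0 (t,0) = snd t/(2 * \<i>)"
  and XiM: "!!t. t : ball 0 s ==> Xi0 t : M \<longleftrightarrow> sx0 (t,cj t) = 0"
  and V1: "open V1" "p : V1" and hPs: "hol V1 Ps0" and Psp: "Ps0 p = 0"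
  and inv: "!!x. x : V1 ==> Ps0 x : ball 0 s & Xi0 (Ps0 x) = x"
  and nz: "!!e. e > 0 ==> EX w. norm w < e & sx0 ((w,0),cj (w,0)) ~= 0"
 show thesis
 proof (rule disc_exists[OF s cx n nz])
  fix w0 :: "complex^'m" and W g :: "complex => complex" and m :: nat and ka ep0 :: real
  assume w0: "w0 ~= 0" and W: "W holomorphic_on UNIV" "W 0 = 0" "deriv W 0 ~= 0"
   and g: "g holomorphic_on UNIV" "g 0 = 0" and ka: "ka ~= 0" and m: "m >= 1" and e0: "ep0 > 0"
   and disc: "!!ep zt t. 0 < ep ==> ep < ep0 ==> cmod zt = 1 ==> t = (cs (of_real ep * W zt) w0,of_real (ep^m) * g zt) ==>
    \<bar>Re (sx0 (t,cj t))-ep^m * ka\<bar> <= ep^m * (abs ka)/2"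
  obtain r where r: "0 < r" "r < s/2"
   and vert: "!!w z. norm w < r ==> cmod z < r ==> Re (ldv sx0 ((w,z),cj (w,z)) ((0,\<i>),(0,- \<i>))) >= 1/2"
   using vertical_expansion[OF s cx n, of 1] by (metis zero_less_one)
  define d1 where "d1 = r/4"
  have d1: "d1 > 0" using r by (simp add: d1_def)
  obtain Cw where Cw: "Cw >= 0" "!!zt. cmod zt <= 1 ==> cmod (W zt) <= Cw" using entire_bound[OF W(1)] by metis
  obtain Cg where Cg: "Cg >= 0" "!!zt. cmod zt <= 1 ==> cmod (g zt) <= Cg" using entire_bound[OF g(1)] by metis
  have b0s: "0 : ball (0 :: 'm cn) s" using s by simp
  have "isCont (%t. sx0 (t,cj t)) 0"
   using has_derivative_continuous[OF fd_diag[OF cx b0s]] by simp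
  moreover have "sx0 (0,cj 0) = 0" using n[OF b0s] by simp
  ultimately obtain r2 where r2: "r2 > 0" "!!t. norm t < r2 ==> cmod (sx0 (t,cj t)) < d1/8"
   unfolding continuous_at_eps_delta using d1 by (metis (no_types, lifting) diff_zero dist_norm divide_pos_pos zero_less_numeral)
  define Q where "Q = Cw * norm w0+Cg+1"
  have Q: "Q > 0" using Cw Cg by (simp add: Q_def add_nonneg_pos)
  define ep where "ep = min (min ep0 1) (min (r/8) r2/Q)/2"
  have ep: "0 < ep" "ep < ep0" "ep < 1" using e0 r r2 Q by (auto simp: ep_def)
  have epQ: "ep * Q < r/8" "ep * Q < r2"
  proof -
   have "ep < min (r/8) r2/Q"
   proof -
    define q where "q = min (r/8) r2/Q"
    have "0 < q" using r r2 Q by (simp add: q_def)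
    moreover have "ep <= q/2" by (simp add: ep_def q_def)
    ultimately have "ep < q" by linarith
    then show ?thesis by (simp only: q_def)
   qed
   then have "ep * Q < min (r/8) r2" using Q by (simp add: pos_less_divide_eq)
   then show "ep * Q < r/8" "ep * Q < r2" by auto
  qed
  \<comment> \<open>The sign turns the boundary values of the disc negative. The map
    \<open>B\<close> carries the same factor in \<open>z\<close>, so the vertical derivative keeps
    its sign because \<open>sg * sg = 1\<close>.\<close>
  define sg :: real where "sg = - sgn ka"
  have sg2: "sg * sg = 1" and sgk: "sg * ka = - (abs ka)" using ka by (auto simp: sg_def sgn_if)
  have sga: "(abs sg) = 1" using ka by (simp add: sg_def)
  obtain k where k: "w0 $ k ~= 0" using w0 by (auto simp: vec_eq_iff)
  define ga where "ga zt = of_real (ep^m) * g zt" for zt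
  \<comment> \<open>The \<open>k\<close>-th coordinate is traded for the disc parameter:
    \<open>B\<close> sends the \<open>k\<close>-axis to the analytic disc, the other coordinates
    translate it.\<close>
  define B where "B t = ((\<chi> i. (if i = k then 0 else fst t $ i) + of_real ep * W (fst t $ k) * w0 $ i),of_real sg * snd t+ga (fst t $ k))" for t :: "'m cn"
  have hB: "hol UNIV B"
  proof -
   have hW: "hol UNIV (%t :: 'm cn. W (fst t $ k))" "hol UNIV (%t :: 'm cn. g (fst t $ k))"
    by (rule hol_compose_1[OF W(1) open_UNIV], auto intro!: hol_nth hol_fst hol_id)
     (rule hol_compose_1[OF g(1) open_UNIV], auto intro!: hol_nth hol_fst hol_id)
   show ?thesis unfolding B_def ga_def
   proof (intro hol_Pair hol_add hol_mult hol_const hol_snd hol_id hW)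
    show "hol UNIV (%t :: 'm cn. \<chi> i. (if i = k then 0 else fst t $ i) + of_real ep * W (fst t $ k) * w0 $ i)"
    proof (rule hol_vec)
     fix i
     have "hol UNIV (%t :: 'm cn. if i = k then 0 else fst t $ i)" by (cases "i = k") (auto intro!: hol_nth hol_fst hol_id)
     then show "hol UNIV (%t :: 'm cn. (\<chi> i. (if i = k then 0 else fst t $ i) + of_real ep * W (fst t $ k) * w0 $ i) $ i)"
      by simp (intro hol_add hol_mult hol_const hW open_UNIV)
    qed simp
   qed auto
  qed
  define Dom where "Dom = {t. B t : ball 0 r}"
  have oDom: "open Dom"
   using open_vimage[OF open_ball hol_continuous_on[OF hB], of 0 r] by (simp add: Dom_def vimage_def)
  define sx where "sx q = of_real sg * sx0 (B (fst q),cj (B (cj (snd q))))" for q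
  have DomS: "B t : ball 0 s" if "t : Dom" for t using that r by (simp add: Dom_def)
  have cxsx: "real_cx Dom sx"
   unfolding sx_def by (rule real_cx_scale, rule real_cx_pullback[OF cx]) (use hol_subset[OF hB oDom] DomS in auto)
  define rh where "rh t = sx (t,cj t)" for t
  have rh: "rh t = of_real sg * sx0 (B t,cj (B t))" for t by (simp add: rh_def sx_def)
  have rh_real: "Im (rh t) = 0" if "t : Dom" for t unfolding rh_def by (rule real_cx_real[OF cxsx that])
  have rh_D: "(rh has_derivative frechet_derivative rh (at t)) (at t)" if "t : Dom" for t
   using fd_diag[OF cxsx that] unfolding rh_def[abs_def] using frechet_derivative_at by fastforce
  have rh_y: "Re (fd rh t (0,\<i>)) >= 1/2" if t: "t : Dom" for t
  proof -
   have Bt: "B t : ball 0 r" using t by (simp add: Dom_def)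
   have "((%ta. rh (t+ta *R (0,\<i>))) has_vector_derivative fd rh t (0,\<i>)) (at 0)"
    by (rule has_vector_derivative_line) (insert rh_D[OF t], simp add: zero_prod_def[symmetric])
   moreover have "((%ta. rh (t+ta *R (0,\<i>))) has_vector_derivative of_real sg * (sg *R ldv sx0 (B t,cj (B t)) ((0,\<i>),(0,- \<i>)))) (at 0)"
   proof -
    have eq: "B (t+ta *R (0,\<i>)) = B t+(ta * sg) *R (0,\<i>)" for ta
     by (simp add: B_def prod_eq_iff vec_eq_iff scaleR_conv_of_real algebra_simps)
    have "((%ta. sx0 (B t+ta *R (0,\<i>),cj (B t+ta *R (0,\<i>)))) has_vector_derivative ldv sx0 (B t,cj (B t)) ((0,\<i>),cj (0,\<i>))) (at (0 * sg))"
     using has_vector_derivative_line[of "%t. sx0 (t,cj t)" _ "B t" 0 "(0,\<i>)"] fd_diag[OF cx DomS[OF t]] by (simp add: zero_prod_def[symmetric])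
    moreover have "((%ta. ta * sg) has_vector_derivative sg) (at 0)" by (auto intro!: derivative_eq_intros)
    ultimately have "((%ta. sx0 (B t+ta *R (0,\<i>),cj (B t+ta *R (0,\<i>)))) \<circ> (%ta. ta * sg) has_vector_derivative
      sg *R ldv sx0 (B t,cj (B t)) ((0,\<i>),cj (0,\<i>))) (at 0)"
     by (intro vector_diff_chain_at) (simp_all add: has_real_derivative_iff_has_vector_derivative)
    moreover have "cj (0 :: complex^'m,\<i>) = (0,- \<i>)" by (simp add: prod_eq_iff vec_eq_iff)
    ultimately show ?thesis unfolding rh eq o_def by (intro has_vector_derivative_mult_right) simp
   qed
   ultimately have "fd rh t (0,\<i>) = of_real sg * (sg *R ldv sx0 (B t,cj (B t)) ((0,\<i>),(0,- \<i>)))"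
    by (rule vector_derivative_unique_at)
   also have "... = (sg * sg) *R ldv sx0 (B t,cj (B t)) ((0,\<i>),(0,- \<i>))" by (simp add: scaleR_conv_of_real)
   finally have "fd rh t (0,\<i>) = ldv sx0 (B t,cj (B t)) ((0,\<i>),(0,- \<i>))" by (simp add: sg2)
   moreover have "norm (fst (B t)) < r" "cmod (snd (B t)) < r"
    using Bt norm_fst_le[of "fst (B t)" "snd (B t)"] norm_snd_le[of "snd (B t)" "fst (B t)"] by auto
   ultimately show ?thesis using vert[of "fst (B t)" "snd (B t)"] by simp
  qed
  have mono: "Re (rh (t+y *R (0,\<i>))) >= Re (rh t)+y/2"
   if y: "0 <= y" and seg: "!!ta. 0 <= ta ==> ta <= y ==> t+ta *R (0,\<i>) : Dom" for t y
  proof -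
   have "(%ta. Re (rh (t+ta *R (0,\<i>)))-ta/2) 0 <= (%ta. Re (rh (t+ta *R (0,\<i>)))-ta/2) y"
   proof (rule DERIV_nonneg_imp_nondecreasing[OF y])
    fix ta assume ta: "0 <= ta" "ta <= y"
    have "((%ta. Re (rh (t+ta *R (0,\<i>)))) has_vector_derivative Re (fd rh (t+ta *R (0,\<i>)) (0,\<i>))) (at ta)"
     by (rule bounded_linear.has_vector_derivative[OF bounded_linear_Re has_vector_derivative_line[OF rh_D[OF seg[OF ta]]]])
    then have "((%ta. Re (rh (t+ta *R (0,\<i>)))-ta/2) has_real_derivative Re (fd rh (t+ta *R (0,\<i>)) (0,\<i>))-1/2) (at ta)"
     unfolding has_real_derivative_iff_has_vector_derivative[symmetric]
     by (rule DERIV_diff) (auto intro!: derivative_eq_intros)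
    then show "EX D. ((%ta. Re (rh (t+ta *R (0,\<i>)))-ta/2) has_real_derivative D) (at ta) & 0 <= D"
     using rh_y[OF seg[OF ta]] by (intro exI conjI) auto
   qed
   then show ?thesis by (simp add: zero_prod_def[symmetric])
  qed
  define c where "c zt y = (axis k zt,Complex 0 y)" for zt :: complex and y :: real
  have Bc: "B (c zt y) = (cs (of_real ep * W zt) w0,of_real (ep^m) * g zt)+(y * sg) *R (0,\<i>)" for zt y
   by (auto simp: B_def c_def ga_def prod_eq_iff vec_eq_iff axis_def complex_eq_iff)
  have nA: "norm (cs (of_real ep * W zt) w0,of_real (ep^m) * g zt) <= ep * Q" if zt: "cmod zt <= 1" for zt
  proof -
   have "ep^m <= ep" using power_decreasing[OF m, of ep] ep by simp
   then have 2: "cmod (of_real (ep^m) * g zt) <= ep * Cg"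
    unfolding norm_mult using Cg(2)[OF zt] ep by (intro mult_mono) (auto simp: norm_power)
   have 1: "norm (cs (of_real ep * W zt) w0) <= ep * (Cw * norm w0)"
    unfolding norm_cs norm_mult mult.assoc using Cw(2)[OF zt] ep Cw(1) by (intro mult_mono) (auto intro: mult_right_mono)
   have "norm (cs (of_real ep * W zt) w0,of_real (ep^m) * g zt) <= ep * (Cw * norm w0)+ep * Cg"
    using norm_Pair_le_add 1 2 add_mono order_trans by blast
   also have "... <= ep * Q" using ep by (simp add: Q_def distrib_left)
   finally show ?thesis .
  qed
  have cDom: "c zt y : Dom" if "cmod zt <= 1" "(abs y) <= d1" for zt y
  proof -
   have "norm ((y * sg) *R (0 :: complex^'m,\<i>)) = (abs y)" using sga by (simp add: norm_Pair abs_mult)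
   then have "norm (B (c zt y)) <= ep * Q+d1" unfolding Bc using nA[OF that(1)] that(2) norm_triangle_le add_mono by metis
   then have "norm (B (c zt y)) < r" using epQ r by (simp add: d1_def)
   then show ?thesis by (simp add: Dom_def)
  qed
  have cshift: "c zt y+ta *R (0,\<i>) = c zt (y+ta)" for zt y ta
   by (simp add: c_def prod_eq_iff complex_eq_iff)
  have C1: "Re (rh (c zt 0)) < 0" if zt: "cmod zt = 1" for zt
  proof -
   define X where "X = Re (sx0 (B (c zt 0),cj (B (c zt 0))))"
   have "\<bar>X-ep^m * ka\<bar> <= ep^m * (abs ka)/2"
    unfolding X_def by (rule disc[OF ep(1,2) zt]) (simp add: Bc)
   then have "\<bar>sg * (X-ep^m * ka)\<bar> <= ep^m * (abs ka)/2" using sga by (simp add: abs_mult)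
   moreover have "sg * (X-ep^m * ka) = sg * X+ep^m * (abs ka)"
   proof -
    have "sg * (X-ep^m * ka) = sg * X-ep^m * (sg * ka)" by (simp add: algebra_simps)
    then show ?thesis by (simp add: sgk)
   qed
   moreover have "ep^m * (abs ka) > 0" using ep ka by simp
   ultimately have "sg * X < 0" by linarith
   then show ?thesis by (simp add: rh X_def)
  qed
  \<comment> \<open>On the disc \<open>rh\<close> is below \<open>d1/8\<close>; going down by at
    least \<open>d1/2\<close> with slope at least \<open>1/2\<close> loses at least
    \<open>d1/4\<close>.\<close>
  have C2: "Re (rh (c zt y)) < 0" if zt: "cmod zt <= 1" and y: "- d1 <= y" "y <= - d1/2" for zt y
  proof -
   have "c zt y+ta *R (0,\<i>) : Dom" if "0 <= ta" "ta <= - y" for ta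
    unfolding cshift by (rule cDom[OF zt]) (use that y in auto)
   then have "Re (rh (c zt y))+- y/2 <= Re (rh (c zt y+(- y) *R (0,\<i>)))"
    by (intro mono) (use y d1 in auto)
   then have "Re (rh (c zt y)) <= Re (rh (c zt 0))+y/2" unfolding cshift by simp
   moreover have "cmod (sx0 (B (c zt 0),cj (B (c zt 0)))) < d1/8"
    using nA[OF zt] epQ by (intro r2(2)) (simp add: Bc zero_prod_def[symmetric])
   then have "cmod (rh (c zt 0)) < d1/8" using sga by (simp add: rh norm_mult)
   then have "Re (rh (c zt 0)) < d1/8" using complex_Re_le_cmod order_le_less_trans by blast
   ultimately show ?thesis using y d1 by linarith
  qed
  define O1 where "O1 = {t : Dom. Re (rh t) < 0}"
  have crh: "continuous_on Dom rh" using rh_D has_derivative_continuous by (blast intro: continuous_at_imp_continuous_on)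
  have oO1: "open O1"
  proof -
   have "open (Dom Int (%t. Re (rh t)) -` {..<0})"
    by (intro continuous_open_preimage oDom continuous_intros crh)
   then show ?thesis by (simp add: O1_def vimage_def Int_def)
  qed
  have cc: "continuous_on S (%q. c (fst q) (snd q))" for S
   unfolding c_def Complex_eq
   by (intro continuous_intros bounded_linear.continuous_on[OF bounded_linear_axis])
  \<comment> \<open>Boundary of the disc (\<open>K1\<close>), the sufficiently lowered discs
    (\<open>K2\<close>) and everything swept out in between (\<open>K3\<close>): compact sets whose
    ball neighbourhoods determine the size of the box.\<close>
  define K1 where "K1 = (%q. c (fst q) (snd q)) ` (sphere 0 1 \<times> {0..0})"
  define K2 where "K2 = (%q. c (fst q) (snd q)) ` (cball 0 1 \<times> {-d1..-d1/2})"
  define K3 where "K3 = (%q. c (fst q) (snd q)) ` (cball 0 1 \<times> {-d1..0})"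
  have "compact K1" "compact K2" "compact K3"
   unfolding K1_def K2_def K3_def by (intro compact_continuous_image cc compact_Times compact_sphere compact_cball compact_Icc)+
  moreover have "K1 <= O1" using C1 cDom d1 by (auto simp: K1_def O1_def)
  moreover have "K2 <= O1" using C2 cDom d1 by (auto simp: K2_def O1_def)
  moreover have "K3 <= Dom" using cDom d1 by (auto simp: K3_def)
  ultimately obtain e1 e2 e3 where e123: "e1 > 0" "e2 > 0" "e3 > 0" and E1: "(\<Union>x\<in>K1. ball x e1) <= O1"
   and E2: "(\<Union>x\<in>K2. ball x e2) <= O1" and E3: "(\<Union>x\<in>K3. ball x e3) <= Dom"
   using compact_subset_open_imp_ball_epsilon_subset oO1 oDom by metis
  define e where "e = min e1 (min e2 e3)"
  have e: "e > 0" "e <= e1" "e <= e2" "e <= e3" using e123 by (auto simp: e_def)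
  define R where "R = 1+e/4"
  \<comment> \<open>A point of the box differs from its model point by \<open>e/4\<close> radially,
    \<open>d\<close> in each coordinate and \<open>2 * d\<close> in \<open>z\<close>; with this
    \<open>d\<close> the total is \<open>e/2\<close>.\<close>
  define d where "d = e/(4*(real CARD('m)+2))"
  have d: "d > 0" "(real CARD('m)+2) * d = e/4" using e(1) by (simp_all add: d_def field_simps add_nonneg_pos)
  have R: "R > 1" using e by (simp add: R_def)
  define N where "N = hbox k R d d1"
  \<comment> \<open>Radial retraction onto the closed unit disc: it picks the comparison point in
    \<open>K1\<close>, \<open>K2\<close> or \<open>K3\<close>.\<close>
  define pr where "pr zt = (if cmod zt <= 1 then zt else sgn zt)" for zt :: complex
  have pr: "cmod (pr zt) <= 1" "1 <= cmod zt ==> cmod (pr zt) = 1" "cmod zt < R ==> cmod (zt-pr zt) <= e/4" for zt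
  proof -
   show "cmod (pr zt) <= 1" "1 <= cmod zt ==> cmod (pr zt) = 1" by (auto simp: pr_def norm_sgn)
   assume "cmod zt < R"
   show "cmod (zt-pr zt) <= e/4"
   proof (cases "cmod zt <= 1")
    case False
    have "zt-sgn zt = (cmod zt-1) *R sgn zt" 
    proof -
     have "zt ~= 0" using False by auto
     then have "cmod zt *R sgn zt = zt" by (simp add: sgn_div_norm)
     then show ?thesis by (simp add: scaleR_diff_left)
    qed
    then have "cmod (zt-sgn zt) = cmod zt-1" using False by (auto simp: norm_sgn)
    then show ?thesis using False \<open>cmod zt < R\<close> by (simp add: pr_def R_def)
   qed (insert e, simp add: pr_def)
  qed
  have near: "t : ball (c (pr (fst t $ k)) y) e" if t: "t : N" and y: "\<bar>Im (snd t)-y\<bar> <= d" for t y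
  proof -
   have tt: "cmod (fst t $ k) < R" "!!i. i ~= k ==> cmod (fst t $ i) <= d" "\<bar>Re (snd t)\<bar> <= d" using t by (auto simp: N_def hbox_def less_imp_le)
   have "norm (fst t-axis k (pr (fst t $ k))) <= (\<Sum>i\<in>UNIV. cmod ((fst t-axis k (pr (fst t $ k))) $ i))"
    by (rule norm_vec_le_sum)
   also have "... <= (\<Sum>i\<in>UNIV. (if i = k then e/4 else 0)+d)"
    by (rule sum_mono) (insert tt pr(3) d, auto simp: axis_def intro: add_increasing2)
   also have "... = e/4+CARD('m) * d" by (simp add: sum.distrib)
   finally have 1: "norm (fst t-axis k (pr (fst t $ k))) <= e/4+CARD('m) * d" .
   have 2: "cmod (snd t-Complex 0 y) <= d+d"
    using cmod_le[of "snd t-Complex 0 y"] tt(3) y by simp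
   have "t-c (pr (fst t $ k)) y = (fst t-axis k (pr (fst t $ k)),snd t-Complex 0 y)" by (simp add: c_def prod_eq_iff)
   then have "norm (t-c (pr (fst t $ k)) y) <= (e/4+CARD('m) * d)+(d+d)"
    using norm_Pair_le_add[of "fst t-axis k (pr (fst t $ k))" "snd t-Complex 0 y"] 1 2 by simp
   also have "... = e/4+(real CARD('m)+2) * d" by (simp add: algebra_simps)
   also have "... < e" using d(2) e by simp
   finally show ?thesis by (simp add: dist_norm norm_minus_commute)
  qed
  have inK: "c zt 0 : K1" if "cmod zt = 1" for zt using that by (auto simp: K1_def intro!: image_eqI[where x="(zt,0)"])
  have inK2: "c zt y : K2" if "cmod zt <= 1" "-d1 <= y" "y <= -d1/2" for zt y using that by (auto simp: K2_def intro!: image_eqI[where x="(zt,y)"])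
  have inK3: "c zt y : K3" if "cmod zt <= 1" "-d1 <= y" "y <= 0" for zt y using that by (auto simp: K3_def intro!: image_eqI[where x="(zt,y)"])
  have NDom: "t : Dom" if t: "t : N" for t
  proof -
   have tI: "- d1 < Im (snd t)" "Im (snd t) < d" using t by (auto simp: N_def hbox_def)
   have "t : ball (c (pr (fst t $ k)) (min (Im (snd t)) 0)) e" by (rule near[OF t]) (use tI d in auto)
   moreover have "c (pr (fst t $ k)) (min (Im (snd t)) 0) : K3" by (rule inK3[OF pr(1)]) (use tI d1 in auto)
   moreover have "ball x e <= ball x e3" for x :: "'m cn" using e(4) by (rule subset_ball)
   ultimately show ?thesis using E3 by blast
  qed
  have N1: "Re (rh t) < 0" if t: "t : N" and "\<bar>Im (snd t)\<bar> <= d" "1 <= cmod (fst t $ k)" for t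
  proof -
   have "t : ball (c (pr (fst t $ k)) 0) e" by (rule near[OF t]) (use that in auto)
   then have "t : ball (c (pr (fst t $ k)) 0) e1" using e(2) by auto
   then have "t : O1" using E1 inK[OF pr(2)[OF that(3)]] by blast
   then show ?thesis by (simp add: O1_def)
  qed
  have hat: "hat k R d d1 (%t. sx (t,cj t))"
  proof
   show "1 < R" "0 < d" "0 < d1" using R d d1 by auto
   show "bsm False (hbox k R d d1) (%t. sx (t,cj t))"
    by (rule bsm_diag[OF hol_imp_bsm[OF real_cx_hol[OF cxsx]]]) (use NDom N_def in auto)
   fix t assume "t : hbox k R d d1"
   then have t: "t : N" by (simp add: N_def)
   show "Im (sx (t,cj t)) = 0" using rh_real[OF NDom[OF t]] by (simp add: rh_def)
   show "0 < Re (fd (%t. sx (t,cj t)) t (0,\<i>))"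
    using rh_y[OF NDom[OF t]] unfolding rh_def[abs_def] by simp
   have tI: "- d1 < Im (snd t)" "Im (snd t) < d" using t by (auto simp: N_def hbox_def)
   show "Re (sx (t,cj t)) < 0" if "1 <= cmod (fst t $ k)"
   proof (cases "- d <= Im (snd t)")
    case True
    then show ?thesis using N1[OF t _ that] tI by (simp add: rh_def)
   next
    case False
    define y where "y = - Im (snd t)"
    have y: "y > 0" using False d by (simp add: y_def)
    have sN: "t+ta *R (0,\<i>) : N" if "0 <= ta" "ta <= y" for ta
     using t that d(1) tI by (auto simp: N_def hbox_def y_def)
    have "Re (rh t)+y/2 <= Re (rh (t+y *R (0,\<i>)))" by (rule mono) (use y NDom[OF sN] in auto)
    moreover have "Re (rh (t+y *R (0,\<i>))) < 0"
     by (rule N1[OF sN]) (insert y that d, auto simp: y_def)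
    ultimately show ?thesis using y by (simp add: rh_def)
   qed
   show "Re (sx (t,cj t)) < 0" if "Im (snd t) <= - d1/2"
   proof -
    have "t : ball (c (pr (fst t $ k)) (Im (snd t))) e" by (rule near[OF t]) (use d in auto)
    then have "t : ball (c (pr (fst t $ k)) (Im (snd t))) e2" using e(3) by auto
    then have "t : O1" using E2 inK2[OF pr(1)] tI that by (meson UN_I less_imp_le subsetD)
    then show ?thesis by (simp add: O1_def rh_def)
   qed
  qed
  have oN: "open (hbox k R d d1)" using hat.open_N[OF hat] by (simp add: hat.N_def[OF hat])
  have BN: "B t : ball 0 s" if "t : hbox k R d d1" for t using DomS NDom that by (simp add: N_def)
  have hBN: "hol (hbox k R d d1) B" using hol_subset[OF hB oN] by simp
  have hXi: "hol (hbox k R d d1) (%t. Xi0 (B t))" by (rule hol_compose[OF h0 hBN BN])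
  have cxN: "real_cx (hbox k R d d1) sx"
   unfolding sx_def by (rule real_cx_scale, rule real_cx_pullback[OF cx hBN BN])
  have B0: "B 0 = 0" using W(2) g(2) by (simp add: B_def ga_def prod_eq_iff vec_eq_iff)
  have sg0: "sg ~= 0" using sga by auto
  have Xiprop: "ALL t:hbox k R d d1. Xi0 (B t) : V0 & (Xi0 (B t) : M \<longleftrightarrow> sx (t,cj t) = 0)"
   using XiV XiM BN sg0 by (auto simp del: split_paired_All simp: sx_def)
  \<comment> \<open>Inverting \<open>B\<close> means recovering the disc parameter from the
    \<open>k\<close>-th coordinate. This is solvable near \<open>0\<close> because
    \<open>deriv W 0\<close> and \<open>w0 $ k\<close> are nonzero; the remaining coordinates are
    then explicit.\<close>
  define G where "G q = of_real ep * W (snd q) * w0 $ k-fst (Ps0 (fst q)) $ k" for q :: "'m cn \<times> complex"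
  have hG: "hol (V1 \<times> UNIV) G"
  proof -
   have oo: "open (V1 \<times> (UNIV :: complex set))" using V1(1) by (intro open_Times open_UNIV)
   have "hol (V1 \<times> UNIV) (%q. W (snd q))"
    by (rule hol_compose_1[OF W(1) open_UNIV]) (use oo in auto)
   moreover have "hol (V1 \<times> UNIV) (%q :: 'm cn \<times> complex. Ps0 (fst q))"
    by (rule hol_compose[OF hPs]) (insert oo, auto intro!: hol_fst hol_id simp: mem_Times_iff)
   ultimately show ?thesis unfolding G_def by (intro hol_diff hol_mult hol_const hol_nth hol_fst) (use oo in auto)
  qed
  have G0: "G (p,0) = 0" using W(2) Psp by (simp add: G_def)
  have "ldv G (p,0) (0,1) = deriv (%zt. (of_real ep * w0 $ k) * W zt-fst (Ps0 p) $ k) 0"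
   unfolding ldv_def by (simp add: G_def mult_ac cs.zero_right)
  also have "... = (of_real ep * w0 $ k) * deriv W 0"
  proof (rule DERIV_imp_deriv)
   have "(W has_field_derivative deriv W 0) (at 0)" using holomorphic_derivI[OF W(1) open_UNIV] by simp
   then show "((%zt. (of_real ep * w0 $ k) * W zt-fst (Ps0 p) $ k) has_field_derivative (of_real ep * w0 $ k) * deriv W 0) (at 0)"
    by (auto intro!: derivative_eq_intros)
  qed
  finally have dG: "ldv G (p,0) (0,1) ~= 0" using ep(1) k W(3) by simp
  have pS: "(p,0) : V1 \<times> (UNIV :: complex set)" using V1 by simp
  obtain U e' \<omega> where U: "open U" "p : U" "0 < e'" "e' <= 1" "hol U \<omega>" "\<omega> p = 0"
   and \<omega>U: "ALL u:U. \<omega> u : ball 0 e'"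
   and sol: "ALL u:U. ALL y:ball 0 e'. (u,y) : V1 \<times> UNIV & (G (u,y) = 0 \<longleftrightarrow> y = \<omega> u)"
   using hol_implicit_function[OF hG pS G0 dG zero_less_one] by blast
  have UV: "U <= V1" and G\<omega>: "!!x. x : U ==> G (x,\<omega> x) = 0" using sol \<omega>U by (blast, blast)
  define Ps where "Ps x = ((\<chi> i. if i = k then \<omega> x else fst (Ps0 x) $ i-of_real ep * W (\<omega> x) * w0 $ i),
   of_real sg * (snd (Ps0 x)-ga (\<omega> x)))" for x
  have hPsU: "hol U Ps"
  proof -
   have hP: "hol U Ps0" by (rule hol_subset[OF hPs U(1) UV])
   have hW: "hol U (%x. W (\<omega> x))" "hol U (%x. g (\<omega> x))"
    by (rule hol_compose_1[OF W(1) open_UNIV U(5)], simp) (rule hol_compose_1[OF g(1) open_UNIV U(5)], simp)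
   have hc: "hol U (%x. if i = k then \<omega> x else fst (Ps0 x) $ i-of_real ep * W (\<omega> x) * w0 $ i)" for i
   proof (cases "i = k")
    case False
    have "hol U (%x. fst (Ps0 x) $ i-of_real ep * W (\<omega> x) * w0 $ i)"
     by (intro hol_diff hol_mult hol_const hol_nth hol_fst hP hW U(1))
    with False show ?thesis by simp
   qed (use U(5) in simp)
   have hv: "hol U (%x. \<chi> i. if i = k then \<omega> x else fst (Ps0 x) $ i-of_real ep * W (\<omega> x) * w0 $ i)"
    by (rule hol_vec[OF U(1)]) (use hc in simp)
   show ?thesis unfolding Ps_def ga_def
    by (intro hol_Pair hv hol_mult hol_const hol_diff hol_snd hP hW U(1))
  qed
  have BPs: "B (Ps x) = Ps0 x" if "x : U" for x
  proof -
   have "of_real ep * W (\<omega> x) * w0 $ k = fst (Ps0 x) $ k" using G\<omega>[OF that] by (simp add: G_def)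
   moreover have "of_real sg * (of_real sg * y) = y" for y :: complex
   proof -
    have "complex_of_real sg * of_real sg = 1" using sg2 by (metis of_real_1 of_real_mult)
    then show ?thesis by (simp add: mult.assoc[symmetric])
   qed
   ultimately show ?thesis by (simp only: B_def Ps_def prod_eq_iff vec_eq_iff fst_conv snd_conv vec_lambda_beta) (simp add: B_def Ps_def prod_eq_iff vec_eq_iff)
  qed
  have Ps0p: "Ps p = 0" using W(2) g(2) Psp U(6) by (simp add: Ps_def ga_def prod_eq_iff vec_eq_iff)
  have 0: "0 : hbox k R d d1" using R d d1 by (simp add: hbox_def)
  show thesis
  proof (rule that[OF hat cxN hXi _ Xiprop, of "U Int Ps -` hbox k R d d1" Ps])
   show "Xi0 (B 0) = p" by (simp add: B0 Xi0)
   show "open (U Int Ps -` hbox k R d d1)"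
    by (rule continuous_open_preimage[OF hol_continuous_on[OF hPsU] U(1) oN])
   then show "hol (U Int Ps -` hbox k R d d1) Ps" by (rule hol_subset[OF hPsU]) simp
   show "p : U Int Ps -` hbox k R d d1" using U(2) 0 Ps0p by simp
   show "Ps p = 0" by (rule Ps0p)
   show "ALL x:U Int Ps -` hbox k R d d1. Ps x : hbox k R d d1 & Xi0 (B (Ps x)) = x"
    using inv UV BPs by (metis IntE vimageE subsetD)
  qed
 qed
qed

subsection \<open>Nested Cauchy estimates and continuation across a line\<close>

lemma ldv_cauchy:
 fixes f :: "'a::cvec => complex"
 assumes f: "hol S f" and et: "et > 0" and S: "!!zt. cmod zt <= et ==> x+cs zt v : S"
  and B: "!!zt. cmod zt = et ==> cmod (f (x+cs zt v)) <= B"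
 shows "cmod (ldv f x v) <= B/et"
proof -
 have o: "open {zt. x+cs zt v : S}" by (rule open_line[OF hol_open[OF f]])
 have h: "(%zt. f (x+cs zt v)) holomorphic_on {zt. x+cs zt v : S}"
  using hol_line[OF f] hol_iff_holomorphic_on[OF o] by blast
 have "cmod ((deriv ^^ 1) (%zt. f (x+cs zt v)) 0) <= fact 1 * B/et^1"
 proof (rule Cauchy_inequality)
  show "(%zt. f (x+cs zt v)) holomorphic_on ball 0 et"
   by (rule holomorphic_on_subset[OF h]) (use S in auto)
  show "continuous_on (cball 0 et) (%zt. f (x+cs zt v))"
   by (rule continuous_on_subset[OF holomorphic_on_imp_continuous_on[OF h]]) (use S in auto)
 qed (use et B in auto)
 then show ?thesis by (simp add: ldv_def)
qed

lemma power_le_exp_fact: "x >= 0 ==> x^n <= exp x * fact n" for x :: real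
proof -
 assume x: "x >= 0"
 have "(\<Sum>i\<in>{n}. x^i /\<^sub>R fact i) <= (\<Sum>i. x^i /\<^sub>R fact i)"
  by (rule sum_le_suminf[OF summable_exp_generic]) (use x in auto)
 then show ?thesis by (simp add: exp_def field_simps)
qed

text \<open>With \<open>n\<close> derivatives to take, the available radius \<open>dl\<close> is
  divided into \<open>n+1\<close> equal steps, one Cauchy estimate per step. The resulting
  \<open>(n+1)^n\<close> is absorbed by \<open>exp (n+1)\<close> and \<open>fact n\<close>. Room is
  required only along the displacements in \<open>V\<close>, since in the application only the
  \<open>chi\<close>-directions are free.\<close>

lemma nested_cauchy:
 fixes c :: "'i list => 'a::cvec => complex" and e :: "'j::finite => 'a" and CB C dl :: real
 assumes hol: "!!is. hol E (c is)"
  and b: "!!i j u. u : E ==> cmod (b i j u) <= CB" and CB: "CB >= 0"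
  and rec: "!!i is u. u : E ==> c (i # is) u = (\<Sum>j\<in>UNIV. b i j u * ldv (c is) u (e j))"
  and c0: "!!u. u : E ==> cmod (c [] u) <= C"
  and V: "!!h h'. h : V ==> h' : V ==> h+h' : V" "0 : V" "!!zt j. cs zt (e j) : V" "!!j. norm (e j) <= 1"
  and dl: "dl > 0" "!!h. h : V ==> norm h < dl ==> u+h : E"
 shows "cmod (c is u) <= C * exp 1*(exp 1*(CARD('j) * CB)/dl)^length is * fact (length is)"
proof -
 define A where "A = CARD('j) * CB"
 have A: "A >= 0" using CB by (simp add: A_def)
 \<comment> \<open>Induction on the list: a Cauchy circle of radius \<open>et\<close> uses up one of
   the \<open>length is+1\<close> portions of room.\<close>
 have step: "cmod (c is u) <= C * (A/et)^length is"
  if et: "et > 0" and E: "!!h. h : V ==> norm h < real (length is+1) * et ==> u+h : E" for u "is" and et :: real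
  using E
 proof (induction "is" arbitrary: u)
  case Nil
  then have "u : E" using Nil[of 0] V(2) et by simp
  then show ?case using c0 by simp
 next
  case (Cons i "is")
  have uE: "u : E" using Cons.prems[of 0] V(2) et by simp
  have shift: "u+cs zt (e j)+h : E" if "cmod zt <= et" "h : V" "norm h < real (length is+1) * et" for zt j h
  proof -
   have "cmod zt * norm (e j) <= et * 1" using that(1) V(4) et by (intro mult_mono) auto
   then have "norm (cs zt (e j)+h) < real (length (i # is)+1) * et"
    using norm_triangle_ineq[of "cs zt (e j)" h] that(3) by (simp add: norm_cs algebra_simps)
   then have "u+(cs zt (e j)+h) : E" using Cons.prems V(1,3) that(2) by blast
   then show ?thesis by (simp add: add.assoc)
  qed
  have "cmod (ldv (c is) u (e j)) <= C * (A/et)^length is/et" for j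
  proof (rule ldv_cauchy[OF hol et])
   show "u+cs zt (e j) : E" if "cmod zt <= et" for zt
    using shift[OF that V(2)] et by simp
   show "cmod (c is (u+cs zt (e j))) <= C * (A/et)^length is" if "cmod zt = et" for zt
    by (rule Cons.IH) (use shift that in auto)
  qed
  then have "cmod (c (i # is) u) <= (\<Sum>j\<in>(UNIV :: 'j set). CB * (C * (A/et)^length is/et))"
   unfolding rec[OF uE]
  proof (intro order_trans[OF norm_sum] sum_mono)
   fix j assume *: "!!j. cmod (ldv (c is) u (e j)) <= C * (A/et)^length is/et"
   show "cmod (b i j u * ldv (c is) u (e j)) <= CB * (C * (A/et)^length is/et)"
    unfolding norm_mult by (intro mult_mono * b[OF uE] CB norm_ge_zero)
  qed
  then show ?case by (simp add: A_def mult_ac)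
 qed
 define n where "n = length is"
 have "u : E" using dl(2)[of 0] V(2) dl(1) by simp
 then have C: "C >= 0" using c0 norm_ge_zero order_trans by blast
 have n1: "real (n+1) > 0" by simp
 have eq: "real (length is+1)*(dl/real (n+1)) = dl" using n1 unfolding n_def by (simp add: field_simps del: of_nat_add)
 have "cmod (c is u) <= C * (A/(dl/real (n+1)))^n"
  unfolding n_def by (rule step) (insert dl eq n1, auto simp: n_def)
 also have "... = C * (A/dl)^n * (real (n+1))^n" by (simp add: power_divide power_mult_distrib)
 also have "... <= C * (A/dl)^n * (exp 1 * exp 1^n * fact n)"
 proof -
  have "exp (real (n+1)) = exp 1 * exp 1^n" by (simp add: exp_add exp_of_nat_mult[symmetric])
  then have "real (n+1)^n <= exp 1 * exp 1^n * fact n"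
   using power_le_exp_fact[of "real (n+1)" n] by simp
  moreover have "C * (A/dl)^n >= 0" using C A dl by simp
  ultimately show ?thesis by (rule mult_left_mono)
 qed
 finally show ?thesis by (simp add: A_def n_def power_mult_distrib power_divide mult_ac)
qed

text \<open>On the arc the multiplier has modulus \<open>2 * s * abs (Im x)\<close>, since there
  \<open>x^2-s^2\<close> equals \<open>x * (x-cnj x)\<close>; so its \<open>k\<close>-th power
  cancels the blow-up allowed by \<open>int\<close>, also at the corners. On the diameter it is at
  most \<open>s^2\<close>, and on the concentric half-size half disc at least
  \<open>3/4 * s^2\<close>, which permits dividing it out.\<close>

lemma halfdisc_bound:
 fixes f :: "complex => complex" and s A :: real
 assumes s: "s > 0" and f: "f holomorphic_on {x. cmod x < s & Im x < 0}"
  and c: "continuous_on {x. cmod x <= s & Im x <= 0} f"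
  and A: "A >= 0"
  and re: "!!x. cmod x <= s ==> Im x = 0 ==> cmod (f x) <= A"
  and int: "!!x. cmod x <= s ==> Im x < 0 ==> cmod (f x) * (abs (Im x))^k <= A"
  and x: "cmod x <= s/2" "Im x <= 0"
 shows "cmod (f x) <= A * (4/3*(1+2/s))^k"
proof (cases "Im x = 0")
 case True
 have "A * 1 <= A * (4/3*(1+2/s))^k"
  using s A by (intro mult_left_mono one_le_power) (auto simp: field_simps)
 then show ?thesis using re[of x] True x s by simp
next
 case False
 define D where "D = {x. cmod x < s & Im x < 0}"
 have oD: "open D" unfolding D_def by (intro open_Collect_conj open_Collect_less continuous_intros)
 have clD: "closure D <= {x. cmod x <= s & Im x <= 0}"
  by (rule closure_minimal) (auto simp: D_def intro!: closed_Collect_conj closed_Collect_le continuous_intros)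
 \<comment> \<open>One number dominating both \<open>s^2\<close> from the diameter and
   \<open>2 * s\<close> from the arc.\<close>
 define L where "L = s^2+2 * s"
 have L: "L > 0" using s by (simp add: L_def add_pos_pos)
 define g where "g x = f x * (x^2-(of_real s)^2)^k" for x
 have "cmod (g x) <= A * L^k"
 proof (rule maximum_modulus_frontier[where S=D and f=g])
  show "g holomorphic_on interior D" unfolding interior_open[OF oD] g_def
   using f by (auto intro!: holomorphic_intros simp: D_def)
  show "continuous_on (closure D) g" unfolding g_def
   by (intro continuous_intros continuous_on_subset[OF c clD])
  show "bounded D" by (rule bounded_subset[OF bounded_ball[of 0 s]]) (auto simp: D_def)
  show "x : D" using x False s by (auto simp: D_def)
  fix y assume "y : frontier D"
  then have y: "cmod y <= s" "Im y <= 0" "cmod y = s | Im y = 0"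
   using clD interior_open[OF oD] by (auto simp: frontier_def D_def)
  show "cmod (g y) <= A * L^k"
  proof (cases "Im y = 0")
   case True
   have "cmod (y^2-(of_real s)^2) <= L"
   proof -
    have "y^2-(of_real s)^2 = of_real ((Re y)^2-s^2)" using True by (simp add: complex_eq_iff power2_eq_square)
    moreover have "(Re y)^2 <= s^2" using y(1) True s abs_le_square_iff[of "Re y" s] by (simp add: cmod_def)
    ultimately have "cmod (y^2-(of_real s)^2) = \<bar>(Re y)^2-s^2\<bar>" "(Re y)^2 <= s^2" by (simp_all only: norm_of_real)
    then show ?thesis using s zero_le_power2[of "Re y"] unfolding L_def by linarith
   qed
   then have "cmod (y^2-(of_real s)^2)^k <= L^k" by (rule power_mono) simp
   then show ?thesis unfolding g_def norm_mult norm_power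
    by (intro mult_mono re y True A) auto
  next
   case False
   then have ys: "cmod y = s" and yn: "Im y < 0" using y by auto
   have "(of_real s)^2 = y * cnj y" using ys complex_norm_square[of y] by simp
   then have "y^2-(of_real s)^2 = y * (y-cnj y)" by (simp add: power2_eq_square right_diff_distrib)
   then have "cmod (y^2-(of_real s)^2) = s * (2 * (abs (Im y)))"
    by (simp add: norm_mult ys complex_diff_cnj)
   then have "cmod (g y) = (cmod (f y) * (abs (Im y))^k)*(2 * s)^k"
    by (simp add: g_def norm_mult norm_power power_mult_distrib mult_ac)
   also have "... <= A * L^k"
    using s int[of y] y yn A by (intro mult_mono power_mono) (auto simp: L_def)
   finally show ?thesis .
  qed
 qed
 moreover have "cmod (x^2-(of_real s)^2) >= 3/4 * s^2"
 proof -
  have "(cmod x)^2 <= (s/2)^2" using x by (intro power_mono) auto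
  then have "cmod (x^2) <= s^2/4" by (simp add: norm_power power_divide)
  moreover have "cmod ((of_real s)^2 :: complex) = s^2" by (simp add: norm_power)
  ultimately show ?thesis using norm_triangle_ineq3[of "x^2" "(of_real s)^2"] by simp
 qed
 then have "(3/4 * s^2)^k <= cmod (x^2-(of_real s)^2)^k" by (intro power_mono) auto
 then have "cmod (f x)*(3/4 * s^2)^k <= cmod (g x)" by (simp add: g_def norm_mult norm_power mult_left_mono)
 ultimately have "cmod (f x)*(3/4 * s^2)^k <= A * L^k" by linarith
 then have "cmod (f x) <= A * L^k/(3/4 * s^2)^k" using s by (simp add: pos_le_divide_eq)
 also have "... = A * (L/(3/4 * s^2))^k" by (simp add: power_divide)
 also have "L/(3/4 * s^2) = 4/3*(1+2/s)" using s by (simp add: L_def field_simps power2_eq_square)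
 finally show ?thesis .
qed

text \<open>If \<open>c bs\<close> is the partial derivative along the list \<open>bs\<close>, then
  \<open>tl_sum c a k bs\<close> is the \<open>k\<close>-fold derivative of \<open>c bs\<close> in
  direction \<open>-a\<close>; over \<open>fact k\<close> it is the Taylor term for the step from
  \<open>a\<close> to \<open>0\<close>. Lists replace multi-indices so that recursions
  match.\<close>

fun tl_sum :: "('i::finite list => complex) => ('i => complex) => nat => 'i list => complex" where
 "tl_sum c a 0 bs = c bs"
| "tl_sum c a (Suc k) bs = (\<Sum>i\<in>UNIV. - a i * tl_sum c a k (i # bs))"

lemma fact_add_le: "fact (k+l) <= (2^(k+l)*(fact k * fact l) :: real)"
proof -
 have "fact k * fact l * ((k+l) choose k) = fact (k+l)"
  using binomial_fact_lemma[of k "k+l"] by simp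
 then have "real (fact k * fact l * ((k+l) choose k)) = real (fact (k+l))" by (rule arg_cong)
 then have "fact k * fact l * real ((k+l) choose k) = (fact (k+l) :: real)" by simp
 moreover have "fact k * fact l * real ((k+l) choose k) <= fact k * fact l * 2^(k+l)"
 proof (rule mult_left_mono)
  show "real ((k+l) choose k) <= 2^(k+l)"
   using binomial_le_pow2[of "k+l" k] by (metis of_nat_le_iff of_nat_numeral of_nat_power)
 qed simp
 ultimately show ?thesis by (simp only: mult_ac)
qed

lemma tl_sum_bound:
 fixes c :: "'i::finite list => complex" and C K ep :: real
 assumes c: "!!bs. cmod (c bs) <= C * K^length bs * fact (length bs)" and a: "!!i. cmod (a i) <= ep"
  and K: "K >= 0"
 shows "cmod (tl_sum c a k bs/fact k) <= C * (2 * K)^length bs * fact (length bs)*(CARD('i) * ep * (2 * K))^k"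
proof -
 have C: "C >= 0" using order_trans[OF norm_ge_zero c[of "[]"]] by simp
 have ep: "ep >= 0" using a norm_ge_zero order_trans by blast
 have "cmod (tl_sum c a k bs) <= (CARD('i) * ep)^k * (C * K^(k+length bs) * fact (k+length bs))"
 proof (induction k arbitrary: bs)
  case 0 then show ?case using c by simp
 next
  case (Suc k)
  have "cmod (tl_sum c a (Suc k) bs) <= (\<Sum>i\<in>(UNIV :: 'i set). ep * ((CARD('i) * ep)^k * (C * K^(k+length (i # bs)) * fact (k+length (i # bs)))))"
   unfolding tl_sum.simps
  proof (intro order_trans[OF norm_sum] sum_mono)
   fix i
   show "cmod (- a i * tl_sum c a k (i # bs)) <= ep * ((CARD('i) * ep)^k * (C * K^(k+length (i # bs)) * fact (k+length (i # bs))))"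
    unfolding norm_mult norm_minus_cancel by (intro mult_mono a Suc.IH ep norm_ge_zero)
  qed
  then show ?case by (simp add: mult_ac del: fact_Suc)
 qed
 also have "... <= (CARD('i) * ep)^k * (C * K^(k+length bs)*(2^(k+length bs)*(fact k * fact (length bs))))"
  using C ep K by (intro mult_left_mono fact_add_le) auto
 finally show ?thesis
  by (simp add: norm_divide power_mult_distrib power_add pos_divide_le_eq mult_ac)
qed

text \<open>Below the real axis the Taylor terms form a series dominated by a geometric one of ratio
  \<open>1/2\<close>, holomorphic inside and continuous up to the axis. There its sum equals
  \<open>H\<close>, so the two halves paste to one holomorphic function. The factors
  \<open>2\<close> on \<open>K\<close> come from splitting \<open>fact (k+l)\<close>.\<close>

lemma slice_extension:
 fixes c :: "'i::finite list => complex => complex" and H :: "complex => complex" and s B C K ep :: real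
 assumes H: "H holomorphic_on {x. cmod x < s & Im x > 0}" "continuous_on {x. cmod x < s & Im x >= 0} H"
  and HB: "!!x. cmod x < s ==> Im x >= 0 ==> cmod (H x) <= B"
  and ch: "!!is. c is holomorphic_on {x. cmod x < s & Im x < 0}" "!!is. continuous_on {x. cmod x < s & Im x <= 0} (c is)"
  and ah: "!!i. a i holomorphic_on {x. cmod x < s & Im x < 0}" "!!i. continuous_on {x. cmod x < s & Im x <= 0} (a i)"
  and cB: "!!is x. cmod x < s ==> Im x <= 0 ==> cmod (c is x) <= C * K^length is * fact (length is)"
  and aB: "!!i x. cmod x < s ==> Im x <= 0 ==> cmod (a i x) <= ep"
  and K: "K >= 0" and ep: "0 <= ep" "CARD('i) * ep * (2 * K) <= 1/2"
  and eq: "!!x. cmod x < s ==> Im x = 0 ==> (%k. tl_sum (%is. c is x) (%i. a i x) k bs/fact k) sums H x"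
 obtains E where "E holomorphic_on ball 0 s" "!!x. cmod x < s ==> Im x >= 0 ==> E x = H x"
  "!!x. cmod x < s ==> cmod (E x) <= max B (2 * C * (2 * K)^length bs * fact (length bs))"
proof -
 define L where "L = {x. cmod x < s & Im x <= 0}"
 define Lo where "Lo = {x. cmod x < s & Im x < 0}"
 have oLo: "open Lo" unfolding Lo_def by (intro open_Collect_conj open_Collect_less continuous_intros)
 define t where "t k x = tl_sum (%is. c is x) (%i. a i x) k bs/fact k" for k x
 have tl_h: "(%x. tl_sum (%is. c is x) (%i. a i x) k bs) holomorphic_on Lo" for k bs
  by (induction k arbitrary: bs) (auto intro!: holomorphic_intros ch ah simp: Lo_def)
 have tl_c: "continuous_on L (%x. tl_sum (%is. c is x) (%i. a i x) k bs)" for k bs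
  by (induction k arbitrary: bs) (auto intro!: continuous_intros ch ah simp: L_def)
 define Q where "Q = C * (2 * K)^length bs * fact (length bs)"
 have tB: "cmod (t k x) <= Q * (1/2)^k" if "x : L" for k x
 proof -
  have x: "cmod x < s" "Im x <= 0" using that by (auto simp: L_def)
  have "C >= 0" using order_trans[OF norm_ge_zero cB[OF x, of "[]"]] by simp
  then have Q: "Q >= 0" using K by (simp add: Q_def)
  have "cmod (t k x) <= Q * (CARD('i) * ep * (2 * K))^k"
   unfolding t_def Q_def by (rule tl_sum_bound[OF cB[OF x] aB[OF x] K])
  also have "... <= Q * (1/2)^k" using ep K Q by (intro mult_left_mono power_mono) auto
  finally show ?thesis .
 qed
 have sm: "summable (%k. Q * (1/2)^k :: real)" by (intro summable_mult summable_geometric) simp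
 define S where "S x = (\<Sum>k. t k x)" for x
 have u: "uniform_limit L (%n x. \<Sum>k<n. t k x) S sequentially"
  unfolding S_def by (rule Weierstrass_m_test[OF tB sm])
 have Sc: "continuous_on L S"
  by (rule uniform_limit_theorem[OF _ u]) (auto intro!: always_eventually continuous_intros tl_c simp: t_def)
 have Sh: "S holomorphic_on Lo"
 proof (rule holomorphic_uniform_sequence[OF oLo])
  show "(%x. \<Sum>k<n. t k x) holomorphic_on Lo" for n unfolding t_def by (intro holomorphic_intros tl_h) auto
  fix x assume "x : Lo"
  then obtain d where "d > 0" "cball x d <= Lo" using oLo open_contains_cball by blast
  moreover have "Lo <= L" by (auto simp: L_def Lo_def)
  ultimately show "EX d>0. cball x d <= Lo & uniform_limit (cball x d) (%n x. \<Sum>k<n. t k x) S sequentially"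
   using uniform_limit_on_subset[OF u] by blast
 qed
 have SB: "cmod (S x) <= 2 * Q" if "x : L" for x
 proof -
  have "cmod (S x) <= (\<Sum>k. Q * (1/2)^k)" unfolding S_def by (rule norm_suminf_le[OF tB[OF that] sm])
  also have "... = 2 * Q" using suminf_geometric[of "1/2 :: real"] by (subst suminf_mult) (auto intro: summable_geometric)
  finally show ?thesis .
 qed
 define E where "E x = (if 0 <= Im x then H x else S x)" for x
 have ES: "E x = S x" if "x : L" for x
  using eq[of x] that by (auto simp: E_def S_def t_def L_def sums_iff)
 have "E holomorphic_on ball 0 s"
 proof (rule holomorphic_on_paste_across_line[of _ \<i> _ 0])
  have "ball 0 s Int {z. \<i> \<bullet> z < 0} = Lo" by (auto simp: Lo_def inner_complex_def)
  then show "E holomorphic_on (ball 0 s Int {z. \<i> \<bullet> z < 0})"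
   using holomorphic_transform[OF Sh, of E] ES by (simp add: Lo_def L_def)
  have "ball 0 s Int {z. 0 < \<i> \<bullet> z} = {x. cmod x < s & Im x > 0}" by (auto simp: inner_complex_def)
  then show "E holomorphic_on (ball 0 s Int {z. 0 < \<i> \<bullet> z})"
   using holomorphic_transform[OF H(1), of E] by (simp add: E_def)
  have "continuous_on ({x. cmod x < s & Im x >= 0} Un L) E"
  proof (rule continuous_on_Un_local)
   have "closedin (top_of_set ({x. cmod x < s & Im x >= 0} Un L)) (({x. cmod x < s & Im x >= 0} Un L) Int {x. Im x >= 0})"
    by (intro closedin_closed_Int closed_Collect_le continuous_intros)
   moreover have "({x. cmod x < s & Im x >= 0} Un L) Int {x. Im x >= 0} = {x. cmod x < s & Im x >= 0}" by (auto simp: L_def)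
   ultimately show "closedin (top_of_set ({x. cmod x < s & Im x >= 0} Un L)) {x. cmod x < s & Im x >= 0}" by simp
   have "closedin (top_of_set ({x. cmod x < s & Im x >= 0} Un L)) (({x. cmod x < s & Im x >= 0} Un L) Int {x. Im x <= 0})"
    by (intro closedin_closed_Int closed_Collect_le continuous_intros)
   moreover have "({x. cmod x < s & Im x >= 0} Un L) Int {x. Im x <= 0} = L" by (auto simp: L_def)
   ultimately show "closedin (top_of_set ({x. cmod x < s & Im x >= 0} Un L)) L" by simp
   show "continuous_on {x. cmod x < s & Im x >= 0} E" by (rule continuous_on_eq[OF H(2)]) (auto simp: E_def)
   show "continuous_on L E" by (rule continuous_on_eq[OF Sc]) (auto simp: ES)
  qed
  moreover have "{x. cmod x < s & Im x >= 0} Un L = ball 0 s" by (auto simp: L_def)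
  ultimately show "continuous_on (ball 0 s) E" by simp
 qed auto
 then show thesis
 proof (rule that)
  show "E x = H x" if "cmod x < s" "Im x >= 0" for x using that by (simp add: E_def)
  show "cmod (E x) <= max B (2 * C * (2 * K)^length bs * fact (length bs))" if "cmod x < s" for x
  proof (cases "Im x >= 0")
   case True then show ?thesis using HB[OF that True] by (simp add: E_def max.coboundedI1)
  next
   case False
   then have "x : L" using that by (simp add: L_def)
   then show ?thesis using SB[of x] ES[of x] by (simp add: Q_def mult_ac)
  qed
 qed
qed

text \<open>The Taylor coefficients of the slices at \<open>z0\<close> are those of
  \<open>G\<close>, hence holomorphic in \<open>w\<close>. The common bound \<open>B\<close> makes
  the expansions converge uniformly on the smaller disc, so the sum is jointly holomorphic although
  nothing is assumed about \<open>g\<close> in \<open>w\<close> away from \<open>z0\<close>.\<close>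

lemma hartogs_slices:
 fixes G :: "'a::cvec \<times> complex => complex"
 assumes G: "hol (A \<times> ball z0 e) G" and A: "open A" and e: "e > 0" and r: "r > 0"
  and g: "!!w. w : A ==> (%z. g (w,z)) holomorphic_on ball z0 r"
  and B: "!!w z. w : A ==> z : ball z0 r ==> cmod (g (w,z)) <= B"
  and eq: "!!w z. w : A ==> z : ball z0 e ==> z : ball z0 r ==> g (w,z) = G (w,z)"
 shows "hol (A \<times> ball z0 (r/4)) g"
proof -
 have it: "hol (A \<times> ball z0 e) (%q. (deriv ^^ j) (%z. G (fst q,z)) (snd q))" for j
 proof (induction j)
  case 0 then show ?case using G by simp
 next
  case (Suc j)
  define F where "F q = (deriv ^^ j) (%z. G (fst q,z)) (snd q)" for q
  have "ldv F q (0,1) = (deriv ^^ Suc j) (%z. G (fst q,z)) (snd q)" for q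
  proof -
   have "ldv F q (0,1) = deriv (%zt. (deriv ^^ j) (%z. G (fst q,z)) (snd q+zt)) 0"
    by (simp add: ldv_def F_def cs.zero_right)
   also have "... = deriv ((deriv ^^ j) (%z. G (fst q,z))) (snd q)"
    using deriv_shift_0[of "(deriv ^^ j) (%z. G (fst q,z))" "snd q"] by (simp add: o_def)
   finally show ?thesis by simp
  qed
  then show ?case using hol_ldv[of "A \<times> ball z0 e" F "(0,1)"] Suc F_def[abs_def] by simp
 qed
 define b where "b j w = (deriv ^^ j) (%z. G (w,z)) z0/fact j" for j w
 have hb: "hol A (b j)" for j
 proof -
  have "hol A (%w. (w,z0))" using A by (intro hol_Pair) auto
  from hol_compose[OF it[of j] this] have "hol A (%w. (deriv ^^ j) (%z. G (w,z)) z0)" using e by simp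
  then show ?thesis unfolding b_def divide_inverse using A by (intro hol_mult hol_const)
 qed
 define p where "p J q = (\<Sum>j\<le>J. b j (fst q)*(snd q-z0)^j)" for J :: nat and q
 have close: "cmod (g q-p J q) <= 2 * B * (1/2)^Suc J" if q: "q : A \<times> ball z0 (r/4)" for q J
 proof -
  have w: "fst q : A" and z: "cmod (snd q-z0) < r/4" using q by (auto simp: mem_Times_iff dist_norm norm_minus_commute)
  define f where "f zt = g (fst q,z0+zt)" for zt
  have hf: "f holomorphic_on ball 0 r" unfolding f_def
  proof (rule holomorphic_on_compose_gen[OF _ g[OF w], of "%zt. z0+zt" "ball 0 r", unfolded o_def])
   show "(%zt. z0+zt) holomorphic_on ball 0 r" by (intro holomorphic_intros)
  qed (auto simp: dist_norm)
  have fB: "cmod (f zt) <= B" if "cmod zt <= r/2" for zt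
   unfolding f_def by (rule B[OF w]) (insert that r, simp add: dist_norm)
  have B0: "B >= 0" using fB[of 0] r norm_ge_zero order_trans by (metis less_eq_real_def half_gt_zero norm_zero)
  have bj: "(deriv ^^ j) f 0/fact j = b j (fst q)" for j
  proof -
   have "(deriv ^^ j) f 0 = (deriv ^^ j) (%z. g (fst q,z)) z0"
    unfolding f_def using higher_deriv_shift_0[where n=j and f="%z. g (fst q,z)" and z=z0] by (simp add: o_def add.commute)
   also have "... = (deriv ^^ j) (%z. G (fst q,z)) z0"
   proof (rule higher_deriv_transform_within_open)
    show "(%z. g (fst q,z)) holomorphic_on ball z0 (min e r)" by (rule holomorphic_on_subset[OF g[OF w]]) auto
    have "(%z. g (fst q,z)) holomorphic_on ball z0 (min e r)" by (rule holomorphic_on_subset[OF g[OF w]]) auto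
    then show "(%z. G (fst q,z)) holomorphic_on ball z0 (min e r)"
     by (rule holomorphic_transform) (use eq[OF w] in auto)
   qed (use e r eq[OF w] in auto)
   finally show ?thesis by (simp add: b_def)
  qed
  have "cmod (f (snd q-z0)-(\<Sum>j\<le>J. (deriv ^^ j) f 0/fact j * (snd q-z0)^j)) <= 2 * B * (cmod (snd q-z0)/(r/2))^Suc J"
   by (rule taylor_truncation(2)[OF hf]) (use r z fB in auto)
  also have "... <= 2 * B * (1/2)^Suc J"
  proof (intro mult_left_mono power_mono)
   show "cmod (snd q-z0)/(r/2) <= 1/2" using z r by (simp add: field_simps)
  qed (use B0 r in auto)
  finally show ?thesis unfolding bj p_def f_def by simp
 qed
 have oT: "open (A \<times> ball z0 (r/4))" using A by (intro open_Times) auto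
 have hp: "hol (A \<times> ball z0 (r/4)) (p J)" for J unfolding p_def
 proof (intro hol_sum oT hol_mult hol_power hol_diff hol_snd hol_id hol_const)
  show "hol (A \<times> ball z0 (r/4)) (%q. b j (fst q))" for j
   by (rule hol_compose[OF hb hol_fst[OF hol_id[OF oT]]]) auto
 qed
 have u: "uniform_limit (A \<times> ball z0 (r/4)) p g sequentially"
 proof (rule uniform_limitI)
  fix ep :: real assume ep: "ep > 0"
  have "(%J. 2 * B * (1/2)^Suc J) \<longlonglongrightarrow> 2 * B * 0"
   by (intro tendsto_mult tendsto_const LIMSEQ_Suc[OF LIMSEQ_power_zero]) simp
  then have "\<forall>\<^sub>F J in sequentially. 2 * B * (1/2)^Suc J < ep" using ep order_tendstoD(2)[of _ "2 * B * 0"] by simp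
  then show "\<forall>\<^sub>F J in sequentially. ALL q:A \<times> ball z0 (r/4). dist (p J q) (g q) < ep"
  proof (rule eventually_mono)
   fix J assume *: "2 * B * (1/2)^Suc J < ep"
   show "ALL q:A \<times> ball z0 (r/4). dist (p J q) (g q) < ep"
   proof
    fix q assume "q : A \<times> ball z0 (r/4)"
    from close[OF this, of J] * show "dist (p J q) (g q) < ep" by (simp only: dist_norm norm_minus_commute)
   qed
  qed
 qed
 show ?thesis
 proof (rule hol_uniform_limit[where F=sequentially and f=p])
  show "EX T. x : T & T <= A \<times> ball z0 (r/4) & open T & (\<forall>\<^sub>F n in sequentially. hol T (p n)) & uniform_limit T p g sequentially"
   if "x : A \<times> ball z0 (r/4)" for x using that oT hp u by (intro exI[of _ "A \<times> ball z0 (r/4)"]) auto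
 qed simp
qed

fun itd :: "('i => 'a::cvec) => ('a => complex) => 'i list => 'a => complex" where
 "itd e f [] = f"
| "itd e f (i # is) = (%x. ldv (itd e f is) x (e i))"

lemma hol_itd: "hol S f ==> hol S (itd e f is)"
 by (induction "is") (auto intro: hol_ldv)

definition luc :: "'a::cvec set => ('n => 'a => complex) => ('a => complex) => 'n filter => bool" where
 "luc S f g F \<longleftrightarrow> (ALL x:S. EX r>0. ball x r <= S & uniform_limit (ball x r) f g F)"

text \<open>Cauchy's estimate on discs of radius \<open>et\<close> transfers the uniform smallness
  on a ball to the derivative on the half-size ball. It justifies termwise differentiation.\<close>

lemma luc_ldv:
 assumes l: "luc S f g F" and f: "!!n. hol S (f n)" and g: "hol S g"
 shows "luc S (%n x. ldv (f n) x v) (%x. ldv g x v) F"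
 unfolding luc_def
proof
 fix x assume "x : S"
 then obtain r where r: "r > 0" "ball x r <= S" "uniform_limit (ball x r) f g F" using l by (auto simp: luc_def)
 define et where "et = r/(4*(norm v+1))"
 have et: "et > 0" using r by (simp add: et_def add_nonneg_pos)
 have etv: "et * norm v < r/2"
 proof -
  have "et * (norm v+1) = r/4" 
  proof -
   have "norm v+1 ~= 0" using norm_ge_zero[of v] by linarith
   then show ?thesis unfolding et_def by (simp add: divide_simps)
  qed
  then show ?thesis using et r by (simp add: distrib_left)
 qed
 have "uniform_limit (ball x (r/2)) (%n x. ldv (f n) x v) (%x. ldv g x v) F"
 proof (rule uniform_limitI)
  fix ep :: real assume ep: "ep > 0"
  then have "\<forall>\<^sub>F n in F. ALL y:ball x r. dist (f n y) (g y) < ep * et/2"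
   using uniform_limitD[OF r(3), of "ep * et/2"] et by simp
  then show "\<forall>\<^sub>F n in F. ALL y:ball x (r/2). dist (ldv (f n) y v) (ldv g y v) < ep"
  proof (rule eventually_mono)
   fix n assume n: "ALL y:ball x r. dist (f n y) (g y) < ep * et/2"
   show "ALL y:ball x (r/2). dist (ldv (f n) y v) (ldv g y v) < ep"
   proof
    fix y assume y: "y : ball x (r/2)"
    have yS: "y : S" using y r by auto
    have near: "y+cs zt v : ball x r" if "cmod zt <= et" for zt
    proof -
     have "norm (cs zt v) <= et * norm v" using that by (simp add: norm_cs mult_right_mono)
     then have "norm (cs zt v) < r/2" using etv by linarith
     moreover have "norm (y-x) < r/2" using y by (simp add: dist_norm norm_minus_commute)
     ultimately have "norm ((y-x)+cs zt v) < r" by (intro norm_triangle_lt) simp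
     moreover have "(y-x)+cs zt v = (y+cs zt v)-x" by simp
     ultimately show ?thesis by (simp add: dist_norm norm_minus_commute)
    qed
    have d: "hol S (%y. f n y-g y)" by (rule hol_diff[OF f g])
    have "cmod (ldv (%y. f n y-g y) y v) <= (ep * et/2)/et"
     by (rule ldv_cauchy[OF d et]) (insert near r n, auto simp: dist_norm intro!: less_imp_le)
    moreover have "ldv (%y. f n y-g y) y v = ldv (f n) y v-ldv g y v"
     by (rule ldv_eqI[OF _ hol_imp_ghol[OF d] yS]) (intro has_derivative_diff hol_derivL[OF f yS] hol_derivL[OF g yS])
    ultimately show "dist (ldv (f n) y v) (ldv g y v) < ep" using ep et by (simp add: dist_norm)
   qed
  qed
 qed
 moreover have "ball x (r/2) <= S" using r by auto
 ultimately show "EX r>0. ball x r <= S & uniform_limit (ball x r) (%n x. ldv (f n) x v) (%x. ldv g x v) F"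
  using r(1) by (intro exI[of _ "r/2"]) auto
qed

lemma luc_itd:
 assumes "luc S f g F" "!!n. hol S (f n)" "hol S g"
 shows "luc S (%n. itd e (f n) is) (itd e g is) F"
proof (induction "is")
 case Nil then show ?case using assms(1) by simp
next
 case (Cons i "is")
 from luc_ldv[OF this hol_itd[OF assms(2)] hol_itd[OF assms(3)], of "e i"] show ?case by simp
qed

lemma luc_tendsto: "luc S f g F ==> x : S ==> ((%n. f n x) \<longlongrightarrow> g x) F"
 unfolding luc_def by (metis centre_in_ball tendsto_uniform_limitI)

lemma ldv_cong_open:
 assumes "open S" "x : S" "!!y. y : S ==> f y = g y" shows "ldv f x v = ldv g x v"
proof -
 have "\<forall>\<^sub>F zt in nhds 0. zt : {zt. x+cs zt v : S}"
  by (rule eventually_nhds_in_open[OF open_line[OF assms(1)]]) (insert assms(2), simp add: cs.zero_left)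
 then have "\<forall>\<^sub>F zt in nhds 0. f (x+cs zt v) = g (x+cs zt v)"
  by (rule eventually_mono) (use assms(3) in simp)
 then show ?thesis unfolding ldv_def by (rule deriv_cong_ev) simp
qed

lemma DERIV_line:
 assumes f: "hol S f" and x: "x+cs xi v : S"
 shows "((%zt. f (x+cs zt v)) has_field_derivative ldv f (x+cs xi v) v) (at xi)"
proof -
 have o: "open {zt. x+cs zt v : S}" by (rule open_line[OF hol_open[OF f]])
 have h: "(%zt. f (x+cs zt v)) holomorphic_on {zt. x+cs zt v : S}"
  using hol_line[OF f] hol_iff_holomorphic_on[OF o] by blast
 have "ldv f (x+cs xi v) v = deriv (%zt. f (x+cs zt v)) xi"
  using deriv_shift_0[of "%zt. f (x+cs zt v)" xi] by (simp add: ldv_def o_def cs.add_left add.assoc)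
 then show ?thesis using holomorphic_derivI[OF h o] x by simp
qed

section \<open>Derivatives of the defining series of the target\<close>

definition pdisc2 :: "real => ((complex^'m::finite) \<times> 'm cn) set" where
 "pdisc2 r = {l. ALL i. cmod (l $ i) < r} \<times> polydisc r"

lemma open_pdisc2: "open (pdisc2 r :: ((complex^'m::finite) \<times> 'm cn) set)"
proof -
 have eq: "pdisc2 r = (\<Inter>i\<in>UNIV. {x :: (complex^'m) \<times> 'm cn. cmod (fst x $ i) < r}) Int (\<Inter>i\<in>UNIV. {x. cmod (fst (snd x) $ i) < r}) Int {x. cmod (snd (snd x)) < r}"
  by (auto simp: pdisc2_def polydisc_def)
 show ?thesis unfolding eq
  by (intro open_Int open_INT open_Collect_less continuous_intros ballI) auto
qed

text \<open>The partial derivative of the monomial \<open>mpow l bt\<close> along the axes listed in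
  \<open>bs\<close>, as falling factorials. Truncated subtraction in the exponent is harmless
  because the product contains a zero factor when an axis is listed too often.\<close>

definition qf :: "'m::finite list => ('m => nat) => complex^'m => complex" where
 "qf bs bt l = (\<Prod>i\<in>UNIV. (\<Prod>j<count_list bs i. of_nat (bt i)-of_nat j)*(l $ i)^(bt i-count_list bs i))"

lemma qf_Nil: "qf [] bt l = mpow l bt"
 by (simp add: qf_def mpow_def)

lemma qf_deriv: "((%zt. qf bs bt (l+cs zt (axis i 1))) has_field_derivative qf (i # bs) bt l) (at 0)"
proof -
 define t where "t bs p x = (\<Prod>j<count_list bs p. of_nat (bt p)-of_nat j) * x^(bt p-count_list bs p)" for bs p and x :: complex
 define Q where "Q = (\<Prod>p\<in>UNIV-{i}. t bs p (l $ p))"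
 have split: "qf bs' bt l' = t bs' i (l' $ i)*(\<Prod>p\<in>UNIV-{i}. t bs' p (l' $ p))" for bs' l'
  unfolding qf_def t_def[symmetric] by (rule prod.remove) auto
 have eq: "qf bs bt (l+cs zt (axis i 1)) = t bs i (l $ i+zt) * Q" for zt
  unfolding split Q_def by (simp add: axis_def)
 have eq': "qf (i # bs) bt l = t (i # bs) i (l $ i) * Q"
  unfolding split Q_def t_def by simp
 define k where "k = count_list bs i"
 define c where "c = (\<Prod>j<k. of_nat (bt i)-of_nat j :: complex)"
 have "((%zt. t bs i (l $ i+zt)) has_field_derivative c * (of_nat (bt i-k)*(l $ i)^(bt i-k-1))) (at 0)"
  unfolding t_def k_def[symmetric] c_def[symmetric] by (auto intro!: derivative_eq_intros)
 moreover have "c * (of_nat (bt i-k)*(l $ i)^(bt i-k-1)) = t (i # bs) i (l $ i)"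
 proof (cases "k <= bt i")
  case True
  then show ?thesis by (simp add: t_def k_def[symmetric] c_def of_nat_diff mult_ac)
 next
  case False
  then have "c = 0" unfolding c_def by (intro prod_zero) (auto intro!: bexI[of _ "bt i"])
  then show ?thesis by (simp add: t_def k_def[symmetric] c_def)
 qed
 ultimately show ?thesis unfolding eq eq' by (auto intro: DERIV_cmult_right)
qed

lemma qf_zero: "qf bs bt 0 = (if bt = count_list bs then (\<Prod>i\<in>UNIV. fact (count_list bs i)) else 0)"
proof (cases "bt = count_list bs")
 case True
 have "(\<Prod>j<k. of_nat k-of_nat j) = (fact k :: complex)" for k
 proof -
  have "(\<Prod>j<k. of_nat k-of_nat j :: complex) = of_nat (\<Prod>j<k. k-j)"
   unfolding of_nat_prod by (rule prod.cong) (auto simp: of_nat_diff)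
  also have "... = fact k" by (simp add: fact_prod_rev atLeast0LessThan)
  finally show ?thesis .
 qed
 then show ?thesis using True by (simp add: qf_def)
next
 case False
 then obtain i where i: "bt i ~= count_list bs i" by auto
 have "(\<Prod>j<count_list bs i. of_nat (bt i)-of_nat j)*(0 :: complex)^(bt i-count_list bs i) = 0"
 proof (cases "bt i < count_list bs i")
  case True
  then have "(\<Prod>j<count_list bs i. of_nat (bt i)-of_nat j :: complex) = 0"
   by (intro prod_zero) (auto intro!: bexI[of _ "bt i"])
  then show ?thesis by simp
 next
  case False then show ?thesis using i by simp
 qed
 then have "qf bs bt 0 = 0" unfolding qf_def by (intro prod_zero) (auto intro!: bexI[of _ i])
 then show ?thesis using False by simp
qed

abbreviation (input) "el i \<equiv> (axis i 1,0)"

lemma tl_sum_DERIV: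
 assumes "!!bs. ((%xi. c bs xi) has_field_derivative (\<Sum>i\<in>UNIV. - a i * c (i # bs) xi)) (at xi)"
 shows "((%xi. tl_sum (%bs. c bs xi) a k bs) has_field_derivative tl_sum (%bs. c bs xi) a (Suc k) bs) (at xi)"
proof (induction k arbitrary: bs)
 case 0 then show ?case using assms by simp
next
 case (Suc k)
 show ?case unfolding tl_sum.simps(2)[of _ a k bs] tl_sum.simps(2)[of _ a "Suc k" bs]
  by (intro DERIV_sum DERIV_cmult Suc.IH)
qed

text \<open>The one-variable Taylor series at \<open>0\<close> of a function along a line, evaluated
  at \<open>1\<close>; the hypothesis says that differentiation along the line prepends one index
  with weight \<open>- a i\<close>.\<close>

lemma tl_sum_taylor:
 fixes c :: "'i::finite list => complex => complex"
 assumes c: "!!bs xi. xi : ball 0 r ==> (c bs has_field_derivative (\<Sum>i\<in>UNIV. - a i * c (i # bs) xi)) (at xi)" and r: "r > 1"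
 shows "(%k. tl_sum (%bs. c bs 0) a k bs/fact k) sums c bs 1"
proof -
 have hd: "ALL xi:ball 0 r. (deriv ^^ k) (c bs) xi = tl_sum (%bs. c bs xi) a k bs" for k
 proof (induction k)
  case (Suc k)
  show ?case
  proof
   fix xi :: complex assume xi: "xi : ball 0 r"
   have "\<forall>\<^sub>F et in nhds xi. et : ball 0 r" by (rule eventually_nhds_in_open) (use xi in auto)
   then have ev: "\<forall>\<^sub>F et in nhds xi. (deriv ^^ k) (c bs) et = tl_sum (%bs. c bs et) a k bs"
    by (rule eventually_mono) (use Suc in blast)
   have "(deriv ^^ Suc k) (c bs) xi = deriv (%et. tl_sum (%bs. c bs et) a k bs) xi"
    using deriv_cong_ev[OF ev refl] by simp
   then show "(deriv ^^ Suc k) (c bs) xi = tl_sum (%bs. c bs xi) a (Suc k) bs"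
    using DERIV_imp_deriv[OF tl_sum_DERIV[OF c[OF xi]]] by simp
  qed
 qed simp
 have "c bs holomorphic_on ball 0 r" unfolding holomorphic_on_open[OF open_ball] using c by blast
 from holomorphic_power_series[OF this, of 1] r
 have "(%n. (deriv ^^ n) (c bs) 0/fact n * (1-0)^n) sums c bs 1" by simp
 moreover have "0 : ball (0 :: complex) r" using r by simp
 ultimately show ?thesis using hd by (simp cong: sums_cong)
qed

lemma ldv_axis_sum:
 fixes f :: "(complex^'m::finite) \<times> 'm cn => complex"
 assumes "hol S f" "x : S"
 shows "ldv f x (v,0) = (\<Sum>i\<in>UNIV. v $ i * ldv f x (el i))"
proof -
 have "(v,0) = (\<Sum>i\<in>UNIV. cs (v $ i) (axis i 1,0 :: 'm cn))"
  by (simp add: prod_eq_iff fst_sum snd_sum vec_eq_iff axis_def cs.zero_right if_distrib cong: if_cong)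
 then have "ldv f x (v,0) = (\<Sum>i\<in>UNIV. ldv f x (cs (v $ i) (axis i 1,0)))"
  using linear_sum[OF ldv_linear[OF assms]] by simp
 then show ?thesis by (simp only: ldv_cs[OF hol_imp_ghol[OF assms(1)] assms(2)])
qed

text \<open>Normal convergence at radius \<open>r\<close> gives a summable majorant, so the double
  series is holomorphic and may be differentiated term by term. At first argument \<open>0\<close>
  only the monomial with the right exponents survives, which is how the single functions
  \<open>th bt\<close> are isolated.\<close>

lemma theta_package:
 fixes th :: "('m::finite => nat) => 'm cn => complex"
 assumes r: "0 < r" "r < R" and hth: "!!bt. hol (polydisc R) (th bt)"
  and nor: "(%bt. r^mlen bt * (SUP t\<in>cpolydisc r. cmod (th bt t))) summable_on UNIV"
 obtains dT :: "'m list => (complex^'m) \<times> 'm cn => complex" and C K :: real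
  where "K >= 0" "!!bs. hol (pdisc2 r) (dT bs)" "!!i bs x. dT (i # bs) x = ldv (dT bs) x (el i)"
  "!!bs x. x : pdisc2 (r/2) ==> cmod (dT bs x) <= C * K^length bs * fact (length bs)"
  "!!l t. dT [] (l,t) = (\<Sum>\<^sub>\<infinity>bt. mpow l bt * th bt t)"
  "!!bs t. t : polydisc r ==> dT bs (0,t) = (\<Prod>i\<in>UNIV. fact (count_list bs i)) * th (count_list bs) t"
  "!!bs a t. t : polydisc r ==> (!!i. cmod (a $ i) < r/4) ==>
   (%k. tl_sum (%bs. dT bs (a,t)) (%i. a $ i) k bs/fact k) sums dT bs (0,t)"
proof -
 define T where "T x = (\<Sum>\<^sub>\<infinity>bt. mpow (fst x) bt * th bt (snd x))" for x
 define f where "f J x = (\<Sum>bt\<in>J. mpow (fst x) bt * th bt (snd x))" for J x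
 define D :: "((complex^'m) \<times> 'm cn) set" where "D = pdisc2 r"
 have oD: "open D" by (simp add: D_def open_pdisc2)
 define m where "m bt = r^mlen bt * (SUP t\<in>cpolydisc r. cmod (th bt t))" for bt
 have sub: "cpolydisc r <= (polydisc R :: 'm cn set)" using r by (auto simp: cpolydisc_def polydisc_def intro: le_less_trans)
 have comp: "compact (cpolydisc r :: 'm cn set)"
 proof -
  have "norm t <= real CARD('m) * r+r" if "t : cpolydisc r" for t :: "'m cn"
  proof -
   have "norm (fst t) <= (\<Sum>i\<in>(UNIV :: 'm set). r)"
    using norm_vec_le_sum[of "fst t"] sum_mono[of UNIV "%i. cmod (fst t $ i)" "%_. r"] that by (auto simp: cpolydisc_def)
   moreover have "cmod (snd t) <= r" using that by (auto simp: cpolydisc_def)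
   ultimately show ?thesis using norm_Pair_le_add[of "fst t" "snd t"] by simp
  qed
  then have "bounded (cpolydisc r :: 'm cn set)" unfolding bounded_iff by blast
  moreover have "closed {t :: 'm cn. (ALL i. cmod (fst t $ i) <= r) & cmod (snd t) <= r}"
   by (intro closed_Collect_conj closed_Collect_all closed_Collect_le continuous_intros)
  ultimately show ?thesis by (simp add: compact_eq_bounded_closed cpolydisc_def)
 qed
 have thB: "cmod (th bt t) <= (SUP t\<in>cpolydisc r. cmod (th bt t))" if "t : cpolydisc r" for bt t
 proof (rule cSUP_upper[OF that])
  have "continuous_on (cpolydisc r) (%t. cmod (th bt t))"
   by (intro continuous_on_norm continuous_on_subset[OF hol_continuous_on[OF hth] sub])
  then show "bdd_above ((%t. cmod (th bt t)) ` cpolydisc r)"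
   by (intro bounded_imp_bdd_above compact_imp_bounded compact_continuous_image comp)
 qed
 have tB: "cmod (mpow (fst x) bt * th bt (snd x)) <= m bt" if "x : D" for bt x
 proof -
  have x: "!!i. cmod (fst x $ i) <= r" "snd x : cpolydisc r"
   using that by (auto simp: D_def pdisc2_def polydisc_def cpolydisc_def less_imp_le)
  have "cmod (mpow (fst x) bt) <= (\<Prod>i\<in>UNIV. r^bt i)"
   unfolding mpow_def prod_norm[symmetric] by (rule prod_mono) (auto simp: norm_power intro!: power_mono x)
  also have "... = r^mlen bt" by (simp add: mlen_def power_sum)
  finally show ?thesis unfolding m_def norm_mult using thB[OF x(2)] r by (intro mult_mono) auto
 qed
 have ms: "m summable_on UNIV" using nor by (simp add: m_def[abs_def])
 have u: "uniform_limit D f T (finite_subsets_at_top UNIV)"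
  using Weierstrass_m_test_general[of UNIV D "%bt x. mpow (fst x) bt * th bt (snd x)" m] tB ms
  by (simp add: f_def[abs_def] T_def[abs_def])
 have hf: "hol D (f J)" for J unfolding f_def mpow_def
 proof (intro hol_sum oD hol_mult hol_prod hol_power hol_nth hol_fst hol_id)
  show "hol D (%x. th bt (snd x))" for bt
   by (rule hol_compose[OF hth hol_snd[OF hol_id[OF oD]]]) (insert r, auto simp: D_def pdisc2_def polydisc_def intro: less_trans[OF _ r(2)])
 qed
 have hT: "hol D T"
  by (rule hol_uniform_limit[where F="finite_subsets_at_top UNIV" and f=f]) (use oD hf u in auto)
 have l: "luc D f T (finite_subsets_at_top UNIV)" unfolding luc_def
 proof
  fix x assume "x : D"
  then obtain e where "e > 0" "ball x e <= D" using oD open_contains_ball by blast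
  then show "EX e>0. ball x e <= D & uniform_limit (ball x e) f T (finite_subsets_at_top UNIV)"
   using uniform_limit_on_subset[OF u] by blast
 qed
 define dT where "dT = itd el T"
 have hdT: "hol D (dT bs)" for bs unfolding dT_def by (rule hol_itd[OF hT])
 have dT_Cons: "dT (i # bs) x = ldv (dT bs) x (el i)" for i bs x by (simp add: dT_def)
 have TB: "cmod (T x) <= (\<Sum>\<^sub>\<infinity>bt. m bt)" if "x : D" for x
 proof -
  have "(%bt. mpow (fst x) bt * th bt (snd x)) summable_on UNIV"
   by (rule abs_summable_summable, rule summable_on_comparison_test[OF ms]) (use tB[OF that] in auto)
  then show ?thesis unfolding T_def
   by (rule norm_infsum_le[OF has_sum_infsum has_sum_infsum[OF ms]]) (rule tB[OF that])
 qed
 \<comment> \<open>Plain derivatives fit the recursion of \<open>nested_cauchy\<close> with the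
   identity matrix as coefficients.\<close>
 have bnd: "cmod (dT bs x) <= (\<Sum>\<^sub>\<infinity>bt. m bt) * exp 1*(exp 1*(real CARD('m)*1)/(r/2))^length bs * fact (length bs)"
  if x: "x : pdisc2 (r/2)" for bs x
 proof (rule nested_cauchy[where E=D and b="%i j _. if j = i then 1 else 0" and e="el" and V=UNIV])
  show "x+h : D" if "norm h < r/2" for h
  proof -
   have "cmod (fst h $ i) < r/2" "cmod (fst (snd h) $ i) < r/2" "cmod (snd (snd h)) < r/2" for i
    using that norm_fst_le[of "fst h" "snd h"] norm_snd_le[of "snd h" "fst h"] norm_fst_le[of "fst (snd h)" "snd (snd h)"]
     norm_snd_le[of "snd (snd h)" "fst (snd h)"] Finite_Cartesian_Product.norm_nth_le[of "fst h" i] Finite_Cartesian_Product.norm_nth_le[of "fst (snd h)" i]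
    by simp_all
   moreover have "cmod (fst x $ i) < r/2" "cmod (fst (snd x) $ i) < r/2" "cmod (snd (snd x)) < r/2" for i
    using x by (auto simp: pdisc2_def polydisc_def)
   moreover have "cmod (p+q) < r" if "cmod p < r/2" "cmod q < r/2" for p q
    by (rule norm_triangle_lt) (use that in simp)
   ultimately have "cmod (fst x $ i+fst h $ i) < r" "cmod (fst (snd x) $ i+fst (snd h) $ i) < r"
    "cmod (snd (snd x)+snd (snd h)) < r" for i by blast+
   then show ?thesis unfolding D_def pdisc2_def polydisc_def by (simp add: mem_Times_iff)
  qed
  show "dT (i # is) u = (\<Sum>j\<in>UNIV. (if j = i then 1 else 0) * ldv (dT is) u (el j))" for i "is" u
   by (simp add: dT_Cons if_distrib[of "%c. c * _"] cong: if_cong)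
 qed (insert hdT TB r, auto simp: dT_def norm_Pair norm_axis_1)
 have fin: "itd el (f J) bs x = (\<Sum>bt\<in>J. qf bs bt (fst x) * th bt (snd x))" if "x : D" for J bs x
  using that
 proof (induction bs arbitrary: x)
  case Nil then show ?case by (simp add: f_def qf_Nil)
 next
  case (Cons i bs)
  have "itd el (f J) (i # bs) x = ldv (%x. \<Sum>bt\<in>J. qf bs bt (fst x) * th bt (snd x)) x (el i)"
   using ldv_cong_open[OF oD Cons.prems Cons.IH] by simp
  also have "... = deriv (%zt. \<Sum>bt\<in>J. qf bs bt (fst x+cs zt (axis i 1)) * th bt (snd x)) 0"
   by (simp add: ldv_def cs.zero_right)
  also have "... = (\<Sum>bt\<in>J. qf (i # bs) bt (fst x) * th bt (snd x))"
   by (intro DERIV_imp_deriv DERIV_sum DERIV_cmult_right qf_deriv)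
  finally show ?case .
 qed
 have zero: "dT bs (0,t) = (\<Prod>i\<in>UNIV. fact (count_list bs i)) * th (count_list bs) t" if t: "t : polydisc r" for bs t
 proof -
  have x: "(0,t) : D" using t r by (simp add: D_def pdisc2_def)
  have lim: "((%J. itd el (f J) bs (0,t)) \<longlongrightarrow> dT bs (0,t)) (finite_subsets_at_top UNIV)"
   unfolding dT_def by (rule luc_tendsto[OF luc_itd[OF l hf hT] x])
  have "\<forall>\<^sub>F J in finite_subsets_at_top UNIV. itd el (f J) bs (0,t) = (\<Prod>i\<in>UNIV. fact (count_list bs i)) * th (count_list bs) t"
   unfolding eventually_finite_subsets_at_top
  proof (intro exI[of _ "{count_list bs}"] conjI allI impI)
   fix J assume J: "finite J & {count_list bs} <= J & J <= UNIV"
   have "itd el (f J) bs (0,t) = (\<Sum>bt\<in>J. (if bt = count_list bs then (\<Prod>i\<in>UNIV. fact (count_list bs i)) * th bt t else 0))"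
    unfolding fin[OF x] by (intro sum.cong) (auto simp: qf_zero)
   also have "... = (\<Prod>i\<in>UNIV. fact (count_list bs i)) * th (count_list bs) t" using J by simp
   finally show "itd el (f J) bs (0,t) = (\<Prod>i\<in>UNIV. fact (count_list bs i)) * th (count_list bs) t" .
  qed auto
  from tendsto_unique[OF _ lim tendsto_eventually[OF this]] show ?thesis by simp
 qed
 have taylor: "(%k. tl_sum (%bs. dT bs (a,t)) (%i. a $ i) k bs/fact k) sums dT bs (0,t)"
  if t: "t : polydisc r" and a: "!!i. cmod (a $ i) < r/4" for bs t and a :: "complex^'m"
 proof -
  \<comment> \<open>The segment from \<open>a\<close> to \<open>0\<close> is parametrised by
    \<open>xi\<close> from \<open>0\<close> to \<open>1\<close>. For \<open>xi\<close> in the disc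
    of radius \<open>2\<close> the factor \<open>1-xi\<close> is at most \<open>3\<close>, so
    coordinates below \<open>r/4\<close> remain in the polydisc.\<close>
  define c where "c bs xi = dT bs ((a,t)+cs xi (- a,0))" for bs xi
  have inD: "(a,t)+cs xi (- a,0) : D" if xi: "xi : ball 0 2" for xi
  proof -
   have "cmod (a $ i-xi * a $ i) < r" for i
   proof -
    have "cmod (1-xi) <= 3" using norm_triangle_ineq4[of 1 xi] xi by simp
    then have "cmod ((1-xi) * a $ i) <= 3*(r/4)" unfolding norm_mult using a[of i] by (intro mult_mono) auto
    then show ?thesis using r by (simp add: left_diff_distrib)
   qed
   then show ?thesis using t by (simp add: D_def pdisc2_def cs.zero_right)
  qed
  have "(c bs has_field_derivative (\<Sum>i\<in>UNIV. - (a $ i) * c (i # bs) xi)) (at xi)" if xi: "xi : ball 0 2" for bs xi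
   using DERIV_line[OF hdT inD[OF xi], of bs] ldv_axis_sum[OF hdT inD[OF xi], of bs "- a"]
   by (simp add: c_def[abs_def] dT_Cons)
  from tl_sum_taylor[where c=c and a="%i. a $ i" and r=2 and bs=bs, OF this] show ?thesis by (simp add: c_def cs.zero_left cs.zero_right)
 qed
 show thesis
  by (rule that[of "exp 1*(CARD('m)*1)/(r/2)" dT "(\<Sum>\<^sub>\<infinity>bt. m bt) * exp 1"])
   (insert r hdT dT_Cons bnd zero taylor, auto simp: D_def dT_def T_def)
qed

subsection \<open>Coordinates along the conjugate Segre varieties\<close>

lemma hol_lipschitz:
 fixes f :: "'a::cvec => complex"
 assumes f: "hol S f" and x0: "x0 : S"
 obtains r L where "r > 0" "L >= 0" "ball x0 r <= S" "!!x y. x : ball x0 r ==> y : ball x0 r ==> cmod (f x-f y) <= L * norm (x-y)"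
proof -
 obtain e where e: "e > 0" "cball x0 e <= S" using hol_open[OF f] x0 open_contains_cball by blast
 have "continuous_on (cball x0 e) f" by (rule continuous_on_subset[OF hol_continuous_on[OF f] e(2)])
 from continuous_on_compact_bound[OF compact_cball this]
 obtain B where B: "B >= 0" "!!x. x : cball x0 e ==> cmod (f x) <= B" by blast
 define L where "L = 4 * B/e"
 have d: "cmod (ldv f x v) <= L * norm v" if x: "x : ball x0 (e/2)" for x v
 proof (cases "v = 0")
  case True
  then show ?thesis using ldv_linear[OF f, of x] x e by (auto simp: linear_0 subset_iff)
 next
  case False
  have "cmod (ldv f x v) <= B/(e/(4 * norm v))"
  proof (rule ldv_cauchy[OF f])
   have in': "x+cs zt v : cball x0 e" if "cmod zt <= e/(4 * norm v)" for zt
   proof -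
    have "norm (cs zt v) <= e/4" using that False by (simp add: norm_cs field_simps)
    moreover have "dist x0 (x+cs zt v) <= dist x0 x+norm (cs zt v)"
     using dist_triangle[of x0 "x+cs zt v" x] by (simp add: dist_norm)
    ultimately show ?thesis using x e by simp
   qed
   show "x+cs zt v : S" if "cmod zt <= e/(4 * norm v)" for zt using in'[OF that] e by blast
   show "cmod (f (x+cs zt v)) <= B" if "cmod zt = e/(4 * norm v)" for zt using in' that B by simp
  qed (use e False in auto)
  then show ?thesis by (simp add: L_def mult_ac)
 qed
 have sub: "ball x0 (e/2) <= S" using e by (auto simp: subset_iff)
 have "cmod (f x-f y) <= L * norm (x-y)" if "x : ball x0 (e/2)" "y : ball x0 (e/2)" for x y
 proof (rule differentiable_bound[OF convex_ball])
  show "(f has_derivative ldv f z) (at z within ball x0 (e/2))" if "z : ball x0 (e/2)" for z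
   using hol_derivL[OF f] sub that by (blast intro: has_derivative_at_withinI)
  show "onorm (ldv f z) <= L" if "z : ball x0 (e/2)" for z
   by (rule onorm_le) (rule d[OF that])
 qed (use that in auto)
 then show thesis using that[of "e/2" L] e sub B by (simp add: L_def)
qed

definition cjv :: "complex^'m::finite => complex^'m" where
 "cjv w = (\<chi> i. cnj (w $ i))"

lemma cj_Pair: "cj (w,z) = (cjv w,cnj z)"
 by (simp add: cj_def cjv_def)

lemma cjv_simps [simp]: "cjv 0 = 0" "cjv (cjv w) = w" "cjv w $ i = cnj (w $ i)"
 by (simp_all add: cjv_def vec_eq_iff)

lemma bounded_linear_cjv: "bounded_linear (cjv :: complex^'m::finite => _)"
proof -
 have "bounded_linear (%w :: complex^'m. fst (cj (w,0)))"
  by (rule bounded_linear_compose[OF bounded_linear_fst bounded_linear_compose[OF bounded_linear_cj]])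
   (intro bounded_linear_Pair bounded_linear_ident bounded_linear_zero)
 then show ?thesis by (simp add: cj_Pair)
qed

lemma norm_cjv [simp]: "norm (cjv w) = norm w"
 using norm_cj[of "(w,0)"] by (simp add: cj_Pair norm_Pair)

text \<open>Points of the complexified hypersurface are pairs of \<open>(w,z)\<close> and
  \<open>(chi,y)\<close> annihilating \<open>sx\<close>; \<open>(w,(chi,z))\<close> are coordinates
  on it. The function \<open>X\<close> is the mean of \<open>z\<close> and \<open>y\<close>, hence
  \<open>y = 2 * X u-z\<close>. On the real points it equals \<open>Re z\<close>.\<close>

definition qh :: "((complex^'m) \<times> 'm cn => complex) => (complex^'m::finite) \<times> 'm cn => 'm cn" where
 "qh X u = (fst (snd u),2 * X u-snd (snd u))"

text \<open>With \<open>chi\<close> frozen at \<open>cjv w\<close>, the variable \<open>x\<close> is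
  a holomorphic coordinate on the slice and \<open>Z w\<close> is its inverse chart: real
  \<open>x\<close> gives points of \<open>M\<close>, positive imaginary part gives the positive
  side, quantitatively by \<open>sgnZ\<close>, and reflection becomes \<open>x\<close> to
  \<open>cnj x\<close>. By \<open>lip\<close> a shift of \<open>chi\<close> changes the sign
  function of the reflected point at most linearly. The smaller radius \<open>s2\<close> serves the
  inverse direction \<open>ZX\<close>.\<close>

locale leaf0 =
 fixes S :: "'m::finite cn set" and sx :: "'m cn \<times> 'm cn => complex" and r s s2 c L :: real
  and X :: "(complex^'m) \<times> 'm cn => complex" and Z :: "complex^'m => complex => complex"
 assumes r: "r > 0" and s: "s > 0" and c: "c > 0" and s2: "s2 > 0" "s2 <= s" and L: "L >= 0"
  and hX: "hol (ball 0 r) X" and X0: "X 0 = 0" and qN: "!!u. u : ball 0 r ==> cj (qh X u) : S"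
  and lip: "!!w a b z. (w,(a,z)) : ball 0 r ==> (w,(b,z)) : ball 0 r ==>
   \<bar>Re (sx (cj (qh X (w,(a,z))),qh X (w,(a,z))))-Re (sx (cj (qh X (w,(b,z))),qh X (w,(b,z))))\<bar> <= L * norm (a-b)"
  and hZ: "!!w. norm w < s ==> Z w holomorphic_on ball 0 s"
  and XZ: "!!w x. norm w < s ==> cmod x < s ==> (w,(cjv w,Z w x)) : ball 0 (r/2) & (w,Z w x) : S & X (w,(cjv w,Z w x)) = x &
   cj (qh X (w,(cjv w,Z w x))) = (w,Z w (cnj x))"
  and sgnZ: "!!w x. norm w < s ==> cmod x < s ==> Im x >= 0 ==> Re (sx ((w,Z w x),cj (w,Z w x))) >= c * Im x"
  and ZM: "!!w x. norm w < s ==> cmod x < s ==> Im x = 0 ==> sx ((w,Z w x),cj (w,Z w x)) = 0"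
  and ZX: "!!w z. norm w < s2 ==> cmod z < s2 ==> (w,(cjv w,z)) : ball 0 r & cmod (X (w,(cjv w,z))) < s & Z w (X (w,(cjv w,z))) = z &
   (sx ((w,z),cj (w,z)) = 0 --> Im (X (w,(cjv w,z))) = 0)"
  and Zcont: "!!dl. dl > 0 ==> EX s'>0. ALL w x. norm w < s' --> cmod x < s' --> (w,(cjv w,Z w x)) : ball 0 dl"

text \<open>Two implicit functions: first \<open>z\<close> in terms of \<open>(w,chi,x)\<close>,
  where \<open>x\<close> is the mean of \<open>z\<close> and its partner coordinate, then
  \<open>x\<close> in terms of \<open>(w,chi,z)\<close>. Using the mean makes the reflection act by
  plain conjugation of \<open>x\<close>.\<close>

lemma leaf_coords:
 fixes sx :: "'m::finite cn \<times> 'm cn => complex"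
 assumes cx: "real_cx S sx" and S0: "0 : S" and sx0: "sx (0,0) = 0" and oS: "open S"
  and pos: "Re (ldv sx (0,0) ((0,\<i>),(0,- \<i>))) > 0"
 obtains r s s2 c L X Z where "leaf0 S sx r s s2 c L X Z"
proof -
 define T where "T = S \<times> {ta. cj ta : S}"
 have hsx: "hol T sx" unfolding T_def by (rule real_cx_hol[OF cx])
 have T0: "(0,0) : T" using S0 by (simp add: T_def)
 have oT: "open T" by (rule hol_open[OF hsx])
 define A where "A q = ldv sx q ((0,1),0)" for q
 define B where "B q = ldv sx q (0,(0,1))" for q
 have AB: "ldv sx q ((0,z),(0,y)) = z * A q+y * B q" if "q : T" for q z y
  unfolding A_def B_def by (rule ldv_Pair_snd[OF hsx that])
 have cAB: "continuous_on T A" "continuous_on T B"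
  unfolding A_def B_def by (intro hol_continuous_on hol_ldv hsx)+
 define a where "a = A (0,0)"
 have fdreal: "Im (ldv sx (0,0) (v,cj v)) = 0" for v
 proof -
  have "((%t. Im (sx (t,cj t))) has_derivative (%v. Im (ldv sx (0,cj 0) (v,cj v)))) (at 0)"
   by (rule bounded_linear.has_derivative[OF bounded_linear_Im fd_diag[OF cx S0]])
  moreover have "((%t. Im (sx (t,cj t))) has_derivative (%v. 0)) (at 0)"
   by (rule has_derivative_transform_within_open[OF has_derivative_const oS S0, of 0]) (simp add: real_cx_real[OF cx])
  ultimately have "(%v. Im (ldv sx (0,cj 0) (v,cj v))) = (%v. 0)" by (rule has_derivative_unique)
  from fun_cong[OF this, of v] show ?thesis by simp
 qed
 have b: "B (0,0) = cnj a"
  using fdreal[of "(0,1)"] fdreal[of "(0,\<i>)"] AB[OF T0] by (simp add: cj_Pair a_def complex_eq_iff)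
 have ima: "Im a < 0" using pos AB[OF T0] b by (simp add: a_def[symmetric])
 define G where "G p = sx ((fst (fst p),snd p),(fst (snd (fst p)),2 * snd (snd (fst p))-snd p))" for p :: "((complex^'m) \<times> 'm cn) \<times> complex"
 define m where "m p = ((fst (fst p),snd p),(fst (snd (fst p)),2 * snd (snd (fst p))-snd p))" for p :: "((complex^'m) \<times> 'm cn) \<times> complex"
 have hm: "hol UNIV m" unfolding m_def by (intro hol_Pair hol_diff hol_mult hol_const hol_fst hol_snd hol_id open_UNIV)
 define SG where "SG = m -` T"
 have oSG: "open SG" unfolding SG_def using open_vimage[OF oT hol_continuous_on[OF hm]] .
 have hG: "hol SG G" unfolding G_def using hol_compose[OF hsx hol_subset[OF hm oSG]] by (simp add: SG_def m_def)
 have m0: "m (0,0) = (0,0)" by (simp add: m_def zero_prod_def)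
 have SG0: "(0,0) : SG" using T0 by (simp add: SG_def m0)
 have G0: "G (0,0) = 0" using sx0 by (simp add: G_def zero_prod_def)
 have "ldv G (0,0) (0,1) = ldv sx (0,0) ((0,1),(0,- 1))"
  by (simp add: ldv_def G_def zero_prod_def cs.zero_right)
 also have "... = a-cnj a" using AB[OF T0] b by (simp add: a_def)
 finally have dG: "ldv G (0,0) (0,1) ~= 0" using ima by (simp add: complex_eq_iff)
 obtain U1 e1 Zf where U1: "open U1" "0 : U1" "0 < e1" "e1 <= 1" "hol U1 Zf" "Zf 0 = 0"
  and ZfU: "ALL u:U1. Zf u : ball 0 e1"
  and sol1: "ALL u:U1. ALL y:ball 0 e1. (u,y) : SG & (G (u,y) = 0 \<longleftrightarrow> y = Zf u)"
  using hol_implicit_function[OF hG SG0 G0 dG zero_less_one] by blast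
 define ex :: "(complex^'m) \<times> 'm cn" where "ex = (0,(0,1))"
 define zt where "zt = ldv Zf 0 ex"
 \<comment> \<open>Differentiating the equation satisfied by \<open>Zf\<close> in \<open>x\<close>
   gives \<open>zt * a+(2-zt) * cnj a = 0\<close>.\<close>
 have zt: "zt * (a-cnj a) = - 2 * cnj a"
 proof -
  define g where "g x = ((0 :: complex^'m,Zf (cs x ex)),(0 :: complex^'m,2 * x-Zf (cs x ex)))" for x
  have "((%x. Zf (0+cs x ex)) has_field_derivative zt) (at 0)"
   using DERIV_line[OF U1(5), of 0 0 ex] U1(2) by (simp add: zt_def cs.zero_left)
  then have d: "((%x. Zf (cs x ex)) has_derivative (%h. zt * h)) (at 0)" by (simp add: has_field_derivative_def)
  have "(g has_derivative (%h. ((0,zt * h),(0,2 * h-zt * h)))) (at 0)"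
   unfolding g_def by (intro has_derivative_Pair has_derivative_const d has_derivative_diff has_derivative_mult_right has_derivative_ident)
  moreover have g0: "g 0 = (0,0)" using U1(6) by (simp add: g_def cs.zero_left) (simp add: zero_prod_def)
  then have "(sx has_derivative ldv sx (0,0)) (at (g 0))" using hol_derivL[OF hsx T0] by simp
  ultimately have "((%x. sx (g x)) has_derivative (%h. ldv sx (0,0) ((0,zt * h),(0,2 * h-zt * h)))) (at 0)"
   by (rule has_derivative_compose)
  moreover have "((%x. sx (g x)) has_derivative (%h. 0)) (at 0)"
  proof (rule has_derivative_transform_within_open[where f="%_. 0" and s="{x. cs x ex : U1}"])
   show "((%_. 0 :: complex) has_derivative (%h. 0)) (at 0)" by simp
   have "open ((%x. cs x ex) -` U1)"
    by (rule open_vimage[OF U1(1)]) (intro continuous_intros cs.continuous_on)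
   then show "open {x. cs x ex : U1}" by (simp add: vimage_def)
   show "0 : {x. cs x ex : U1}" using U1(2) by (simp add: cs.zero_left)
   show "0 = sx (g x)" if "x : {x. cs x ex : U1}" for x
   proof -
    have "cs x ex : U1" using that by simp
    then have "G (cs x ex,Zf (cs x ex)) = 0" using sol1 ZfU by blast
    then show ?thesis by (simp add: G_def g_def ex_def cs.zero_right)
   qed
  qed
  ultimately have "(%h. ldv sx (0,0) ((0,zt * h),(0,2 * h-zt * h))) = (%h. 0)" by (rule has_derivative_unique)
  from fun_cong[OF this, of 1] have "zt * a+(2-zt) * cnj a = 0" using AB[OF T0] b by (simp add: a_def)
  then show ?thesis by (simp add: algebra_simps add_eq_0_iff)
 qed
 have a0: "a ~= 0" using ima by auto
 have zt0: "zt ~= 0" using zt a0 by auto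
 \<comment> \<open>The derivative of the defining function when \<open>x\<close> moves in the
   imaginary direction. It is positive as \<open>Im a < 0\<close>, which fixes the side of
   \<open>M\<close>; half of it becomes the constant \<open>c\<close>.\<close>
 have dir: "\<i> * zt * a+cnj (\<i> * zt) * cnj a = of_real (- 2*(cmod a)^2/Im a)"
 proof -
  have aa: "a-cnj a = 2 * \<i> * of_real (Im a)" by (simp add: complex_eq_iff)
  have m0: "complex_of_real (Im a) ~= 0" using ima by simp
  have "\<i> * zt * of_real (Im a) = (zt * (2 * \<i> * of_real (Im a)))/2" by simp
  then have eq: "\<i> * zt * of_real (Im a) = - cnj a" unfolding zt[unfolded aa] by simp
  have "\<i> * zt = (\<i> * zt * of_real (Im a))/of_real (Im a)" using m0 by simp
  then have "\<i> * zt = - cnj a/of_real (Im a)" by (simp only: eq)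
  then have "\<i> * zt * a = of_real (- (cmod a)\<^sup>2 / Im a)" using complex_norm_square[of a] by (simp add: mult.commute)
  moreover have "cnj (\<i> * zt) * cnj a = cnj (\<i> * zt * a)" by simp
  ultimately show ?thesis by (simp only: complex_cnj_complex_of_real) (simp flip: of_real_add)
 qed
 define G2 where "G2 p = Zf (fst (fst p),(fst (snd (fst p)),snd p))-snd (snd (fst p))" for p :: "((complex^'m) \<times> 'm cn) \<times> complex"
 define m2 where "m2 p = (fst (fst p),(fst (snd (fst p)),snd p))" for p :: "((complex^'m) \<times> 'm cn) \<times> complex"
 have hm2: "hol UNIV m2" unfolding m2_def by (intro hol_Pair hol_fst hol_snd hol_id open_UNIV)
 define S2 where "S2 = m2 -` U1"
 have oS2: "open S2" unfolding S2_def using open_vimage[OF U1(1) hol_continuous_on[OF hm2]] .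
 have hG2: "hol S2 G2"
 proof -
  have "hol S2 (%p. Zf (m2 p))" by (rule hol_compose[OF U1(5) hol_subset[OF hm2 oS2]]) (auto simp: S2_def)
  then show ?thesis unfolding G2_def m2_def by (intro hol_diff hol_snd hol_fst hol_id oS2)
 qed
 have m20: "m2 (0,0) = 0" by (simp add: m2_def zero_prod_def)
 have S20: "(0,0) : S2" using U1(2) by (simp add: S2_def m20)
 have G20: "G2 (0,0) = 0" using U1(6) m20 by (simp add: G2_def m2_def)
 have "ldv G2 (0,0) (0,1) = zt"
  unfolding zt_def ldv_def G2_def ex_def by (simp add: zero_prod_def cs.zero_right)
 then have dG2: "ldv G2 (0,0) (0,1) ~= 0" using zt0 by simp
 obtain U2 e2 X where U2: "open U2" "0 : U2" "0 < e2" "e2 <= 1" "hol U2 X" "X 0 = 0"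
  and XU: "ALL u:U2. X u : ball 0 e2"
  and sol2: "ALL u:U2. ALL y:ball 0 e2. (u,y) : S2 & (G2 (u,y) = 0 \<longleftrightarrow> y = X u)"
  using hol_implicit_function[OF hG2 S20 G20 dG2 zero_less_one] by blast
 obtain r1 L1 where r1: "r1 > 0" "L1 >= 0" "ball (0,0) r1 <= T"
  and L1: "!!x y. x : ball (0,0) r1 ==> y : ball (0,0) r1 ==> cmod (sx x-sx y) <= L1 * norm (x-y)"
  using hol_lipschitz[OF hsx T0] by blast
 obtain r2 L2 where r2: "r2 > 0" "L2 >= 0" "ball 0 r2 <= U2"
  and L2: "!!x y. x : ball 0 r2 ==> y : ball 0 r2 ==> cmod (X x-X y) <= L2 * norm (x-y)"
  using hol_lipschitz[OF U2(5,2)] by blast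
 define r where "r = min r2 (r1/(4+4 * L2))"
 have r: "r > 0" "r <= r2" "(2+2 * L2) * r <= r1/2"
 proof -
  show "r > 0" "r <= r2" using r1 r2 by (auto simp: r_def intro!: divide_pos_pos add_pos_nonneg)
  have "(2+2 * L2) * r <= (2+2 * L2)*(r1/(4+4 * L2))" using r2(2) by (intro mult_left_mono) (auto simp: r_def)
  also have "... = r1/2" using r2(2) by (simp add: field_simps add_pos_nonneg add_nonneg_eq_0_iff)
  finally show "(2+2 * L2) * r <= r1/2" .
 qed
 have hX: "hol (ball 0 r) X" by (rule hol_subset[OF U2(5)]) (use r r2 in auto)
 have qn: "norm (qh X u) < r1/2" if u: "u : ball 0 r" for u
 proof -
  have nu: "norm u < r" using u by simp
  have "u : ball 0 r2" "0 : ball 0 r2" using u r r2 by auto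
  from L2[OF this] have "cmod (X u) <= L2 * norm u" using U2(6) by simp
  moreover have "norm (fst (snd u)) <= norm u" "cmod (snd (snd u)) <= norm u"
   using norm_snd_le[of "snd u" "fst u"] norm_fst_le[of "fst (snd u)" "snd (snd u)"] norm_snd_le[of "snd (snd u)" "fst (snd u)"] by auto
  moreover have "cmod (2 * X u-snd (snd u)) <= 2 * cmod (X u)+cmod (snd (snd u))"
   using norm_triangle_ineq4[of "2 * X u" "snd (snd u)"] by (simp add: norm_mult)
  ultimately have "norm (qh X u) <= (2+2 * L2) * norm u"
   using norm_Pair_le_add[of "fst (snd u)" "2 * X u-snd (snd u)"] unfolding qh_def by (simp add: algebra_simps)
  also have "... < (2+2 * L2) * r" using nu r2(2) by (intro mult_strict_left_mono) auto
  finally show ?thesis using r(3) by linarith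
 qed
 have qball: "(cj (qh X u),qh X u) : ball (0,0) r1" if u: "u : ball 0 r" for u
  unfolding zero_prod_def[symmetric] mem_ball_0
  using norm_Pair_le_add[of "cj (qh X u)" "qh X u"] qn[OF u] by simp
 have qS: "cj (qh X u) : S" if u: "u : ball 0 r" for u using qball[OF u] r1(3) by (auto simp: T_def)
 define L where "L = L1*(2*(1+2 * L2))"
 have L: "L >= 0" using r1 r2 by (simp add: L_def)
 have lip: "\<bar>Re (sx (cj (qh X (w,(a,z))),qh X (w,(a,z))))-Re (sx (cj (qh X (w,(b,z))),qh X (w,(b,z))))\<bar> <= L * norm (a-b)"
  if u: "(w,(a,z)) : ball 0 r" and u': "(w,(b,z)) : ball 0 r" for w a b z
 proof -
  define q where "q = qh X (w,(a,z))"
  define q' where "q' = qh X (w,(b,z))"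
  have "(w,(a,z)) : ball 0 r2" "(w,(b,z)) : ball 0 r2" using u u' r(2) by auto
  from L2[OF this] have "cmod (X (w,(a,z))-X (w,(b,z))) <= L2 * norm (a-b)" by (simp add: norm_Pair)
  moreover have "q-q' = (a-b,2*(X (w,(a,z))-X (w,(b,z))))" by (simp add: q_def q'_def qh_def algebra_simps)
  then have "norm (q-q') <= norm (a-b)+2 * cmod (X (w,(a,z))-X (w,(b,z)))"
   using norm_Pair_le_add[of "a-b" "2*(X (w,(a,z))-X (w,(b,z)))"] by (simp only: norm_mult norm_numeral)
  ultimately have n: "norm (q-q') <= (1+2 * L2) * norm (a-b)" by (simp add: algebra_simps)
  have "cmod (sx (cj q,q)-sx (cj q',q')) <= L1 * norm ((cj q,q)-(cj q',q'))"
   unfolding q_def q'_def by (rule L1[OF qball[OF u] qball[OF u']])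
  also have "... <= L1*(norm (q-q')+norm (q-q'))"
  proof -
   have "cj q-cj q' = cj (q-q')" by (simp add: linear_diff[OF bounded_linear.linear[OF bounded_linear_cj]])
   then show ?thesis using norm_Pair_le_add[of "cj q-cj q'" "q-q'"] r1(2) by (intro mult_left_mono) auto
  qed
  also have "... <= L1*(2*((1+2 * L2) * norm (a-b)))" using n r1(2) by (intro mult_left_mono) auto
  finally have "cmod (sx (cj q,q)-sx (cj q',q')) <= L * norm (a-b)" by (simp only: L_def mult.assoc)
  then show ?thesis using abs_Re_le_cmod[of "sx (cj q,q)-sx (cj q',q')"] by (simp add: q_def q'_def)
 qed
 define us where "us p = (fst p,(cjv (fst p),snd p))" for p :: "'m cn"
 define Zs where "Zs p = Zf (us p)" for p
 have usl: "bounded_linear us" unfolding us_def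
  by (intro bounded_linear_Pair bounded_linear_fst bounded_linear_snd bounded_linear_compose[OF bounded_linear_cjv])
 have us0: "us 0 = 0" by (simp add: us_def zero_prod_def)
 have cus: "isCont us 0" by (rule linear_continuous_at[OF usl])
 have cZs: "isCont Zs 0" unfolding Zs_def
  by (rule isCont_o2[OF cus]) (insert hol_continuous_on[OF U1(5)] U1 us0, simp add: continuous_on_eq_continuous_at)
 have Zs0: "Zs 0 = 0" by (simp add: Zs_def us0 U1(6))
 have small: "EX d>0. ALL p. norm p < d --> f p : W" if A: "isCont f 0" "open W" "f 0 : W" for f :: "'m cn => 'b::real_normed_vector" and W
 proof -
  obtain Y where Y: "open Y" "0 : Y" "ALL x:Y. f x : W"
   using A(1)[unfolded continuous_at_open, rule_format, of W] A(2,3) by auto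
  obtain d where "d > 0" "ball 0 d <= Y" using Y(1,2) open_contains_ball by blast
  then show ?thesis using Y(3) mem_ball_0 subsetD by metis
 qed
 define Zd where "Zd p = ldv Zf (us p) ex" for p
 define tt where "tt p = (fst p,Zs p)" for p :: "'m cn"
 define Dn where "Dn p = Re (\<i> * Zd p * A (tt p,cj (tt p))+cnj (\<i> * Zd p) * B (tt p,cj (tt p)))" for p
 have tt0: "tt 0 = 0" using Zs0 by (simp add: tt_def) (simp add: zero_prod_def)
 have ctt: "isCont tt 0" unfolding tt_def by (intro continuous_intros cZs)
 have ctc: "isCont (%p. (tt p,cj (tt p))) 0"
  by (intro continuous_Pair ctt isCont_o2[OF ctt linear_continuous_at[OF bounded_linear_cj]])
 have cAtt: "isCont (%p. A (tt p,cj (tt p))) 0" "isCont (%p. B (tt p,cj (tt p))) 0"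
  using cAB T0 oT by (intro isCont_o2[OF ctc]; simp add: tt0 continuous_on_eq_continuous_at)+
 have cZd: "isCont Zd 0" unfolding Zd_def
  by (rule isCont_o2[OF cus]) (insert hol_continuous_on[OF hol_ldv[OF U1(5)]] U1 us0, simp add: continuous_on_eq_continuous_at)
 have cDn: "isCont Dn 0" unfolding Dn_def
  by (intro bounded_linear.continuous[OF bounded_linear_Re] bounded_linear.continuous[OF bounded_linear_cnj]
    continuous_add continuous_mult continuous_const cAtt cZd)
 define c where "c = Dn 0/2"
 have "Dn 0 = - 2*(cmod a)^2/Im a"
  using dir b by (simp add: Dn_def tt0 Zd_def us0 zt_def[symmetric] a_def[symmetric])
 moreover have "- 2*(cmod a)^2/Im a > 0" using ima a0 by (intro divide_neg_neg) auto
 ultimately have c: "c > 0" "Dn 0 > c" unfolding c_def by linarith+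
 obtain d1 where d1: "d1 > 0" "!!p. norm p < d1 ==> us p : U1" using small[OF cus U1(1)] U1(2) us0 by auto
 define vv where "vv p = (fst p,(cjv (fst p),Zs p))" for p :: "'m cn"
 have cvv: "isCont vv 0" unfolding vv_def
  by (intro continuous_intros cZs isCont_o2[OF _ linear_continuous_at[OF bounded_linear_cjv]])
 have vv0: "vv 0 = 0" using Zs0 by (simp add: vv_def) (simp add: zero_prod_def)
 obtain d2 where d2: "d2 > 0" "!!p. norm p < d2 ==> vv p : ball 0 (r/2)" using small[OF cvv open_ball, of 0 "r/2"] r vv0 by auto
 obtain d3 where d3: "d3 > 0" "!!p. norm p < d3 ==> tt p : S" using small[OF ctt oS] S0 tt0 by auto
 have "isCont (%p. 2 * snd p-Zs p) 0" by (intro continuous_intros cZs)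
 from small[OF this open_ball, of 0 e1] Zs0 U1(3)
 obtain d4 where d4: "d4 > 0" "!!p. norm p < d4 ==> 2 * snd p-Zs p : ball 0 e1" by auto
 obtain d5 where d5: "d5 > 0" "!!p. norm p < d5 ==> Dn p : {c<..}" using small[OF cDn open_greaterThan, of c] c by auto
 define s where "s = min (min d1 d2) (min (min d3 d4) (min d5 e2))/2"
 have s: "s > 0" "2 * s <= d1" "2 * s <= d2" "2 * s <= d3" "2 * s <= d4" "2 * s <= d5" "2 * s <= e2"
  using d1 d2 d3 d4 d5 U2(3) by (auto simp: s_def)
 have nsm: "norm (w,x) < 2 * s" if "norm w < s" "cmod x < s" for w :: "complex^'m" and x
  using norm_Pair_le_add[of w x] that by linarith
 define Z where "Z w x = Zs (w,x)" for w x
 have Zeq: "G (us (w,x),Z w x) = 0" if "norm w < s" "cmod x < s" for w x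
 proof -
  have "us (w,x) : U1" using d1(2) nsm[OF that] s by simp
  then show ?thesis using sol1 ZfU unfolding Z_def Zs_def by blast
 qed
 \<comment> \<open>Conjugating the equation exchanges \<open>z\<close> with its partner
   \<open>2 * x-z\<close>, and uniqueness in the implicit function theorem identifies the
   solution.\<close>
 have Zrefl: "Z w (cnj x) = cnj (2 * x-Z w x)" if w: "norm w < s" and x: "cmod x < s" for w x
 proof -
  have "us (w,x) : U1" "us (w,cnj x) : U1" using d1(2) nsm[OF w, of x] nsm[OF w, of "cnj x"] x s by simp_all
  then have in': "(us (w,x),Z w x) : SG" using sol1 ZfU unfolding Z_def Zs_def by blast
  define y where "y = cnj (2 * x-Z w x)"
  have "2 * x-Z w x : ball 0 e1" using d4(2)[of "(w,x)"] nsm[OF w x] s by (simp add: Z_def)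
  then have y: "y : ball 0 e1" unfolding y_def by (simp only: mem_ball_0 complex_mod_cnj)
  have T1: "((w,Z w x),(cjv w,2 * x-Z w x)) : T" using in' by (simp add: SG_def m_def us_def)
  have e: "sx ((w,Z w x),(cjv w,2 * x-Z w x)) = 0" using Zeq[OF w x] by (simp add: G_def us_def)
  have "sx (cj (cjv w,2 * x-Z w x),cj (w,Z w x)) = cnj (sx ((w,Z w x),(cjv w,2 * x-Z w x)))"
   by (rule real_cx_sym[OF cx]) (insert T1, auto simp: T_def)
  then have "G (us (w,cnj x),y) = 0" using e by (simp add: G_def us_def y_def cj_Pair)
  then have "y = Z w (cnj x)" using sol1 y \<open>us (w, cnj x) \<in> U1\<close> unfolding Z_def Zs_def by blast
  then show ?thesis by (simp add: y_def)
 qed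
 have ZM: "sx ((w,Z w x),cj (w,Z w x)) = 0" if w: "norm w < s" and x: "cmod x < s" and i: "Im x = 0" for w x
 proof -
  have "cnj x = x" using i by (simp add: complex_eq_iff)
  then have "2 * x-Z w x = cnj (Z w x)" using Zrefl[OF w x] by (metis complex_cnj_cnj)
  then show ?thesis using Zeq[OF w x] by (simp add: G_def us_def cj_Pair)
 qed
 have vin: "(w,(cjv w,Z w x)) : ball 0 (r/2)" if "norm w < s" "cmod x < s" for w x
  using d2(2)[of "(w,x)"] nsm[OF that] s by (simp add: vv_def Z_def)
 have XZ: "X (w,(cjv w,Z w x)) = x" if w: "norm w < s" and x: "cmod x < s" for w x
 proof -
  have "(w,(cjv w,Z w x)) : U2" using vin[OF w x] r r2 by (auto simp: subset_iff)
  moreover have "x : ball 0 e2" using x s by simp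
  moreover have "G2 ((w,(cjv w,Z w x)),x) = 0" by (simp add: G2_def Z_def Zs_def us_def)
  ultimately show ?thesis using sol2 by metis
 qed
 have ttS: "(w,Z w x) : S" if "norm w < s" "cmod x < s" for w x
  using d3(2)[of "(w,x)"] nsm[OF that] s by (simp add: tt_def Z_def)
 have DZ: "(Z w has_field_derivative Zd (w,x)) (at x)" if w: "norm w < s" and x: "cmod x < s" for w x
 proof -
  have eq: "us (w,y) = us (w,0)+cs y ex" for y by (simp add: us_def ex_def cs.zero_right)
  have "us (w,x) : U1" using d1(2) nsm[OF w x] s by simp
  then show ?thesis using DERIV_line[OF U1(5), of "us (w,0)" x ex]
   unfolding Z_def[abs_def] Zs_def Zd_def eq[symmetric] by simp
 qed
 \<comment> \<open>On the real axis the function vanishes by \<open>ZM\<close>; its derivative along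
   the vertical segment stays above \<open>c\<close>.\<close>
 have sgn: "Re (sx ((w,Z w x),cj (w,Z w x))) >= c * Im x" if w: "norm w < s" and x: "cmod x < s" and i: "Im x >= 0" for w x
 proof -
  define pt where "pt ta = Complex (Re x) ta" for ta
  have pts: "cmod (pt ta) < s" if "0 <= ta" "ta <= Im x" for ta
  proof -
   have "cmod (pt ta) <= cmod x" unfolding pt_def cmod_def using that by (simp add: power_mono)
   then show ?thesis using x by simp
  qed
  define g where "g ta = Re (sx ((w,Z w (pt ta)),cj (w,Z w (pt ta))))-c * ta" for ta
  have "g 0 <= g (Im x)"
  proof (rule DERIV_nonneg_imp_nondecreasing[OF i])
   fix ta assume ta: "0 <= ta" "ta <= Im x"
   note pp = pts[OF ta]
   define D where "D = Zd (w,pt ta)"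
   have ptd: "(pt has_vector_derivative \<i>) (at ta)"
   proof -
    have "pt = (%ta. of_real (Re x) + of_real ta * \<i>)" by (auto simp: pt_def complex_eq_iff)
    then show ?thesis by (auto intro!: derivative_eq_intros)
   qed
   have "((Z w \<circ> pt) has_vector_derivative \<i> * D) (at ta)"
    by (rule field_vector_diff_chain_at[OF ptd]) (insert DZ[OF w pp], simp add: D_def)
   then have "((%ta. (w,Z w (pt ta))) has_vector_derivative (0,\<i> * D)) (at ta)"
    unfolding o_def by (intro has_vector_derivative_Pair has_vector_derivative_const)
   then have "((%ta. (w,Z w (pt ta))) has_derivative (%h. h *R (0,\<i> * D))) (at ta)" by (simp add: has_vector_derivative_def)
   from has_derivative_compose[OF this fd_diag[OF cx ttS[OF w pp]]]
   have "((%ta. sx ((w,Z w (pt ta)),cj (w,Z w (pt ta)))) has_derivative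
    (%h. ldv sx ((w,Z w (pt ta)),cj (w,Z w (pt ta))) (h *R (0,\<i> * D),cj (h *R (0,\<i> * D))))) (at ta)" .
   then have "((%ta. sx ((w,Z w (pt ta)),cj (w,Z w (pt ta)))) has_vector_derivative
    ldv sx ((w,Z w (pt ta)),cj (w,Z w (pt ta))) ((0,\<i> * D),cj (0,\<i> * D))) (at ta)"
   proof -
    have TT: "((w,Z w (pt ta)),cj (w,Z w (pt ta))) : T" using ttS[OF w pp] by (simp add: T_def)
    have "ldv sx ((w,Z w (pt ta)),cj (w,Z w (pt ta))) (h *R v,cj (h *R v)) = h *R ldv sx ((w,Z w (pt ta)),cj (w,Z w (pt ta))) (v,cj v)" for h v
     using linear_scale[OF ldv_linear[OF hsx TT], of h "(v,cj v)"] by (simp only: scaleR_Pair linear_scale[OF bounded_linear.linear[OF bounded_linear_cj]])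
    then show ?thesis using \<open>((\<lambda>ta. sx ((w, Z w (pt ta)), cj (w, Z w (pt ta)))) has_derivative _) (at ta)\<close>
     unfolding has_vector_derivative_def by (simp only:)
   qed
   moreover have "ldv sx ((w,Z w (pt ta)),cj (w,Z w (pt ta))) ((0,\<i> * D),cj (0,\<i> * D))
    = \<i> * D * A ((w,Z w (pt ta)),cj (w,Z w (pt ta)))+cnj (\<i> * D) * B ((w,Z w (pt ta)),cj (w,Z w (pt ta)))"
    unfolding cj_Pair cjv_simps(1) by (rule AB) (insert ttS[OF w pp], simp add: T_def cj_Pair[symmetric])
   ultimately have "((%ta. Re (sx ((w,Z w (pt ta)),cj (w,Z w (pt ta))))) has_vector_derivative Dn (w,pt ta)) (at ta)"
    unfolding Dn_def tt_def fst_conv D_def[symmetric] Z_def[symmetric]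
    by (simp only: bounded_linear.has_vector_derivative[OF bounded_linear_Re])
   then have "(g has_real_derivative Dn (w,pt ta)-c * 1) (at ta)"
    unfolding has_real_derivative_iff_has_vector_derivative[symmetric] g_def[abs_def]
    by (intro DERIV_diff DERIV_cmult DERIV_ident)
   moreover have "Dn (w,pt ta) > c" using d5(2) nsm[OF w pp] s by simp
   ultimately show "EX D. (g has_real_derivative D) (at ta) & 0 <= D" by (intro exI conjI) auto
  qed
  moreover have "pt (Im x) = x" by (simp add: pt_def)
  moreover have "sx ((w,Z w (pt 0)),cj (w,Z w (pt 0))) = 0" by (rule ZM[OF w pts]) (insert i, auto simp: pt_def)
  ultimately show ?thesis by (simp add: g_def)
 qed
 have cXu: "isCont (%p. X (us p)) 0"
  by (rule isCont_o2[OF cus]) (insert hol_continuous_on[OF U2(5)] U2 us0, simp add: continuous_on_eq_continuous_at)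
 obtain d6 where d6: "d6 > 0" "!!p. norm p < d6 ==> X (us p) : ball 0 s" using small[OF cXu open_ball, of 0 s] us0 U2(6) s by auto
 obtain d7 where d7: "d7 > 0" "!!p. norm p < d7 ==> us p : ball 0 r" using small[OF cus open_ball, of 0 r] us0 r by auto
 define s2 where "s2 = min (min s e1) (min d6 d7/2)"
 have s2: "s2 > 0" "s2 <= s" "s2 <= e1" "2 * s2 <= d6" "2 * s2 <= d7" using s d6 d7 U1(3) by (auto simp: s2_def)
 have inv: "(w,(cjv w,z)) : ball 0 r & cmod (X (w,(cjv w,z))) < s & Z w (X (w,(cjv w,z))) = z &
   (sx ((w,z),cj (w,z)) = 0 --> Im (X (w,(cjv w,z))) = 0)" if w: "norm w < s2" and z: "cmod z < s2" for w z
 proof -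
  have n: "norm (w,z) < 2 * s2" using norm_Pair_le_add[of w z] w z by linarith
  define u where "u = (w,(cjv w,z))"
  have us: "us (w,z) = u" by (simp add: us_def u_def)
  have ur: "u : ball 0 r" using d7(2)[of "(w,z)"] n s2 us by simp
  then have uU2: "u : U2" using r(2) r2(3) subset_ball by blast
  have Xs: "cmod (X u) < s" using d6(2)[of "(w,z)"] n s2 us by simp
  have "G2 (u,X u) = 0" using sol2 XU uU2 by blast
  then have ZX: "Z w (X u) = z" by (simp add: G2_def u_def Z_def Zs_def us_def)
  have "Im (X u) = 0" if M: "sx ((w,z),cj (w,z)) = 0"
  proof -
   have rz: "cmod (of_real (Re z)) < s2" using abs_Re_le_cmod[of z] z by simp
   have usU: "us (w,of_real (Re z)) : U1" by (rule d1(2)) (use nsm[of w "of_real (Re z)"] w rz s2 s in simp)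
   have "2 * of_real (Re z)-z = cnj z" by (simp add: complex_eq_iff)
   then have "G (us (w,of_real (Re z)),z) = 0" using M by (simp add: G_def us_def cj_Pair)
   moreover have "z : ball 0 e1" using z s2 by simp
   ultimately have "z = Zf (us (w,of_real (Re z)))" using sol1 usU by blast
   then have "G2 (u,of_real (Re z)) = 0" by (simp add: G2_def u_def us_def)
   moreover have "of_real (Re z) : ball (0 :: complex) e2" using rz s2 s by simp
   ultimately have "of_real (Re z) = X u" using sol2 uU2 by blast
   then show ?thesis by (metis Im_complex_of_real)
  qed
  then show ?thesis using ur Xs ZX by (simp add: u_def)
 qed
 have cont0: "EX s'>0. ALL w x. norm w < s' --> cmod x < s' --> (w,(cjv w,Z w x)) : ball 0 dl" if dl: "dl > 0" for dl
 proof -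
  obtain d8 where d8: "d8 > 0" "!!p. norm p < d8 ==> vv p : ball 0 dl" using small[OF cvv open_ball, of 0 dl] dl vv0 by auto
  have "(w,(cjv w,Z w x)) : ball 0 dl" if "norm w < d8/2" "cmod x < d8/2" for w x
  proof -
   have "norm (w,x) < d8" using norm_Pair_le_add[of w x] that by linarith
   from d8(2)[OF this] show ?thesis by (simp add: vv_def Z_def)
  qed
  then show ?thesis using d8(1) by (intro exI[of _ "d8/2"]) auto
 qed
 have ZH: "Z w holomorphic_on ball 0 s" if "norm w < s" for w
  unfolding holomorphic_on_open[OF open_ball]
 proof
  fix x :: complex assume "x : ball 0 s"
  then show "EX f'. (Z w has_field_derivative f') (at x)" using DZ[OF that, of x] by (intro exI[of _ "Zd (w,x)"]) simp
 qed
 have XX: "(w,(cjv w,Z w x)) : ball 0 (r/2) & (w,Z w x) : S & X (w,(cjv w,Z w x)) = x &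
   cj (qh X (w,(cjv w,Z w x))) = (w,Z w (cnj x))" if "norm w < s" "cmod x < s" for w x
  using vin[OF that] ttS[OF that] XZ[OF that] Zrefl[OF that] by (simp add: qh_def cj_Pair)
 show thesis
  by (rule that[of r s s2 c L X Z], intro leaf0.intro)
   (fact r(1) s(1) c(1) s2(1,2) L hX U2(6) qS lip ZH XX sgn ZM inv cont0)+
qed

subsection \<open>Continuation of the reflected functions\<close>

text \<open>A fixed choice of derivatives within \<open>S\<close>, needed because at boundary points
  the derivative may not be unique; the choice makes all derivatives smooth up to the
  boundary.\<close>

definition bd :: "'a::cvec set => ('a => complex) => 'a => 'a => complex" where
 "bd S g = (SOME g'. hasder True S g g' & (ALL v. bsm True S (g' v)))"

lemma bd:
 assumes "bsm True S g"
 shows "x : S ==> (g has_derivative (%v. bd S g v x)) (at x within S)"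
  and "x : S ==> clin (%v. bd S g v x)" and "bsm True S (bd S g v)"
proof -
 have "EX g'. hasder True S g g' & (ALL v. bsm True S (g' v))" using assms by (rule bsmE) blast
 from someI_ex[OF this] have *: "hasder True S g (bd S g) & (ALL v. bsm True S (bd S g v))" unfolding bd_def .
 then show "x : S ==> (g has_derivative (%v. bd S g v x)) (at x within S)"
  "x : S ==> clin (%v. bd S g v x)" "bsm True S (bd S g v)" by (auto simp: hasder_def)
qed

lemma bsm_imp_hol:
 fixes g :: "'a::cvec => complex"
 assumes "bsm True S g" "open T" "T <= S" shows "hol T g"
 unfolding hol_def
proof (intro conjI ballI assms(2))
 fix x assume "x : T"
 then have x: "x : S" "at x within T = at x" using assms(3) at_within_open[OF _ assms(2)] by blast+
 have "(g has_derivative (%v. bd S g v x)) (at x within T)"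
  using has_derivative_subset[OF bd(1)[OF assms(1) x(1)] assms(3)] .
 then show "EX L. (g has_derivative L) (at x) & clin L" using bd(2)[OF assms(1) x(1)] x(2) by metis
qed

lemma bd_eq_ldv:
 assumes "bsm True S g" "open T" "T <= S" "x : T" shows "bd S g v x = ldv g x v"
proof -
 have x: "x : S" using assms by blast
 have "(g has_derivative (%v. bd S g v x)) (at x within T)"
  using has_derivative_subset[OF bd(1)[OF assms(1) x] assms(3)] .
 then have "(g has_derivative (%v. bd S g v x)) (at x)" unfolding at_within_open[OF assms(4,2)] .
 from ldv_eqI[OF this hol_imp_ghol[OF bsm_imp_hol[OF assms(1-3)]] assms(4)] show ?thesis by simp
qed

lemma clin_cn_sum:
 fixes L :: "'m::finite cn => complex"
 assumes "linear L" "clin L"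
 shows "L x = (\<Sum>i\<in>UNIV. fst x $ i * L (axis i 1,0))+snd x * L (0,1)"
proof -
 have "x = (\<Sum>i\<in>UNIV. cs (fst x $ i) (axis i 1,0))+cs (snd x) (0,1)"
  by (simp add: prod_eq_iff fst_sum snd_sum vec_eq_iff axis_def cs.zero_right if_distrib cong: if_cong)
 then have "L x = (\<Sum>i\<in>UNIV. L (cs (fst x $ i) (axis i 1,0)))+L (cs (snd x) (0,1))"
  unfolding linear_sum[OF assms(1), symmetric] linear_add[OF assms(1), symmetric] by (rule arg_cong)
 also have "... = (\<Sum>i\<in>UNIV. fst x $ i * L (axis i 1,0))+snd x * L (0,1)"
  by (simp only: clinD[OF assms(2)] cs_complex_def)
 finally show ?thesis .
qed

lemma bsm_compose_cn:
 fixes q :: "'a::cvec => 'm::finite cn"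
 assumes q: "hol T q" and A: "A <= T" and qB: "!!x. x : A ==> q x : B" and g: "bsm True B g"
 shows "bsm True A (%x. g (q x))"
proof (rule bsm_compose[where I="UNIV :: 'm option set" and T=B and q=q
  and l="%i u. case i of None => snd u | Some i => vec_nth (fst u) i" and e="%i. case i of None => (0,1) | Some i => (axis i 1,0)"
  and q'="%v y. frechet_derivative q (at y) v"])
 fix L :: "'m cn => complex" and u assume "linear L" "True ==> clin L"
 then have "L u = (\<Sum>i\<in>UNIV. fst u $ i * L (axis i 1,0))+snd u * L (0,1)" by (intro clin_cn_sum) auto
 then show "L u = (\<Sum>i\<in>UNIV. (case i of None => snd u | Some i => fst u $ i) * L (case i of None => (0,1) | Some i => (axis i 1,0)))"
  by (simp add: UNIV_option_conv sum.reindex)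
next
 fix y assume y: "y : A"
 then have yT: "y : T" using A by blast
 show "(q has_derivative (%v. frechet_derivative q (at y) v)) (at y within A)"
  using has_derivative_at_withinI[OF hol_deriv(1)[OF q yT]] .
 show "clin (%v. frechet_derivative q (at y) v)" using hol_deriv(2)[OF q yT] .
 show "q y : B" by (rule qB[OF y])
next
 fix v and i :: "'m option"
 have comp: "bsm True A (%y. l (frechet_derivative q (at y) v))" if l: "bounded_linear l" "clin l" for l :: "'m cn => complex"
 proof -
  have h: "hol T (%y. l (q y))" by (rule hol_linear_compose[OF l q])
  have "ldv (%y. l (q y)) y v = l (frechet_derivative q (at y) v)" if "y : A" for y
   by (rule ldv_eqI[OF bounded_linear.has_derivative[OF l(1) hol_deriv(1)[OF q]] hol_imp_ghol[OF h]]) (use that A in auto)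
  then show ?thesis by (rule bsm_cong[OF bsm_subset[OF hol_imp_bsm[OF hol_ldv[OF h]] A]])
 qed
 show "bsm True A (%y. case i of None => snd (frechet_derivative q (at y) v) | Some i => fst (frechet_derivative q (at y) v) $ i)"
 proof (cases i)
  case None
  then show ?thesis using comp[OF bounded_linear_snd] by (simp add: clin_def)
 next
  case (Some j)
  have "bounded_linear (%u :: 'm cn. fst u $ j)"
   by (rule bounded_linear_compose[OF bounded_linear_vec_nth bounded_linear_fst])
  from comp[OF this] Some show ?thesis by (simp add: clin_def)
 qed
qed (use g in auto)

lemma has_derivative_vecI:
 fixes f :: "'a::real_normed_vector => complex^'m::finite"
 assumes "!!i. ((%x. f x $ i) has_derivative (%v. f' v $ i)) F"
 shows "(f has_derivative f') F"
proof -
 have "((%x. \<Sum>i\<in>UNIV. axis i (f x $ i)) has_derivative (%v. \<Sum>i\<in>UNIV. axis i (f' v $ i))) F"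
  by (intro has_derivative_sum bounded_linear.has_derivative[OF bounded_linear_axis] assms)
 then show ?thesis by (simp flip: vec_eq_sum_axis)
qed

lemma axis_sum_cs: "(\<Sum>j\<in>UNIV. cs (x $ j) (axis j 1)) = (x :: complex^'m::finite)"
 by (simp add: vec_eq_iff axis_def if_distrib cong: if_cong)

text \<open>A real point in the coordinates of the complexified hypersurface. The map is only real
  linear, so a derivative along it mixes holomorphic and conjugate directions.\<close>

definition rp :: "'m::finite cn => (complex^'m) \<times> 'm cn" where
 "rp t = (fst t,(cjv (fst t),snd t))"

lemma bounded_linear_rp: "bounded_linear rp"
 unfolding rp_def
 by (intro bounded_linear_Pair bounded_linear_fst bounded_linear_snd bounded_linear_compose[OF bounded_linear_cjv])

lemma rp_0 [simp]: "rp 0 = 0"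
 by (simp add: rp_def zero_prod_def)

lemma norm_le_rp: "norm t <= norm (rp t)"
proof -
 have "norm t = sqrt ((norm (fst t))^2+(norm (snd t))^2)" by (metis norm_Pair prod.collapse)
 also have "... <= norm (rp t)" by (simp add: rp_def norm_Pair)
 finally show ?thesis .
qed

abbreviation (input) "ej j \<equiv> (0,(axis j 1,0))"

text \<open>Here \<open>f\<close> is \<open>h\<close> read in charts, \<open>F\<close> its one-sided
  extension, and \<open>f_eq\<close> the equation of \<open>M'\<close>. Injectivity of the
  differential of \<open>h\<close> on tangent vectors is \<open>nondeg\<close>, the facts on
  \<open>dT\<close> are those of \<open>theta_package\<close>, and \<open>f_small\<close> places the
  values where the Taylor step to \<open>0\<close> converges.\<close>

locale leaf = hat k R d d1 "%t. sx (t,cj t)" + leaf0 "hat.N k R d d1" sx r s s2 c L X Z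
 for k :: "'m::finite" and R d d1 :: real and sx :: "'m cn \<times> 'm cn => complex" and r s s2 c L X Z +
 fixes f F :: "'m cn => 'm cn" and dT :: "'m list => (complex^'m) \<times> 'm cn => complex" and rT CT KT :: real
 assumes f_crf: "!!i. crf (%t. fst (f t) $ i)" "crf (%t. snd (f t))"
  and F_bsm: "!!i. bsm True K (%t. fst (F t) $ i)" "bsm True K (%t. snd (F t))"
  and F_f: "!!t. t : M ==> F t = f t" and f0: "f 0 = 0" and M0: "0 : M"
  and f_eq: "!!t. t : M ==> norm t < s2 ==> cnj (snd (f t)) = dT [] (cjv (fst (f t)),f t)"
  and nondeg: "!!v. fd (%t. sx (t,cj t)) 0 v = 0 ==> (!!i. fd (%t. fst (f t) $ i) 0 v = 0) ==> fd (%t. snd (f t)) 0 v = 0 ==> v = 0"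
  and rT: "rT > 0" and KT: "KT >= 0" and dT_hol: "!!bs. hol (pdisc2 rT) (dT bs)" and dT_Cons: "!!i bs x. dT (i # bs) x = ldv (dT bs) x (axis i 1,0)"
  and dT_bound: "!!bs x. x : pdisc2 (rT/2) ==> cmod (dT bs x) <= CT * KT^length bs * fact (length bs)"
  and dT_taylor: "!!bs a t. t : polydisc rT ==> (!!i. cmod (vec_nth a i) < rT/4) ==>
   (%k. tl_sum (%bs. dT bs (a,t)) (vec_nth a) k bs/fact k) sums dT bs (0,t)"
  and f_small: "!!t. t : M ==> norm t < s2 ==> (cjv (fst (f t)),f t) : pdisc2 (rT/4)"
begin

abbreviation (input) "rh t \<equiv> sx (t,cj t)"

text \<open>On \<open>KK\<close> the reflected point \<open>cj (qh X u)\<close> lies in the domain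
  of \<open>F\<close>. The functions \<open>aw\<close> and \<open>az\<close> are the components of
  the reflected map, holomorphic in \<open>u\<close> because of the two conjugations.\<close>

definition "KK dl = {u : ball 0 dl. Re (sx (cj (qh X u),qh X u)) >= 0}"
definition "PP dl = {u : ball 0 dl. Re (sx (cj (qh X u),qh X u)) > 0}"
definition "aw i u = cnj (fst (F (cj (qh X u))) $ i)"
definition "az u = cnj (snd (F (cj (qh X u))))"

lemma hqh: "hol (ball 0 r) (qh X)"
 unfolding qh_def by (intro hol_Pair hol_diff hol_mult hol_const hol_fst hol_snd hol_id hX open_ball)

lemma KK_K: "u : KK r ==> cj (qh X u) : K"
 using qN by (simp add: KK_def K_def)

lemma PP_KK: "PP dl <= KK dl"
 by (auto simp: PP_def KK_def)

lemma open_PP: "dl <= r ==> open (PP dl)"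
proof -
 assume dl: "dl <= r"
 have "continuous_on (ball 0 r) (%u. Re (sx (cj (qh X u),cj (cj (qh X u)))))"
  by (intro continuous_intros continuous_on_compose2[OF cont_rho] continuous_on_compose2[OF linear_continuous_on[OF bounded_linear_cj]] hol_continuous_on[OF hqh])
   (insert qN, auto simp del: split_paired_All split_paired_Ex)
 moreover have "ball (0 :: (complex^'m) \<times> 'm cn) dl <= ball 0 r" using dl by (rule subset_ball)
 ultimately have "continuous_on (ball 0 dl) (%u. Re (sx (cj (qh X u),qh X u)))"
  unfolding cj_cj by (rule continuous_on_subset)
 then have "open (ball 0 dl Int (%u. Re (sx (cj (qh X u),qh X u))) -` {0<..})"
  by (rule continuous_open_preimage) auto
 then show ?thesis by (simp add: PP_def vimage_def Int_def)
qed

lemma bsm_reflect: "bsm True K g ==> bsm True (KK r) (%u. cnj (g (cj (qh X u))))"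
proof -
 assume g: "bsm True K g"
 have "bsm True {x. cj x : K} (%x. cnj (g (cj x)))"
  by (rule bsm_conjugate[OF bounded_linear_cj cj_cs g])
 moreover have "KK r <= ball 0 r" by (auto simp: KK_def simp del: split_paired_All)
 moreover have "qh X u : {x. cj x : K}" if "u : KK r" for u using KK_K[OF that] by simp
 ultimately show ?thesis using bsm_compose_cn[OF hqh, of "KK r" "{x. cj x : K}" "%x. cnj (g (cj x))"] by blast
qed

lemma bsm_aw: "bsm True (KK r) (aw i)"
 unfolding aw_def[abs_def] by (rule bsm_reflect[OF F_bsm(1)])

lemma bsm_az: "bsm True (KK r) az"
 unfolding az_def[abs_def] by (rule bsm_reflect[OF F_bsm(2)])

lemma rp_qh:
 assumes t: "t : M" "norm (rp t) < s2"
 shows "rp t : KK r" "cj (qh X (rp t)) = t" "Im (X (rp t)) = 0" "cmod (X (rp t)) < s"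
proof -
 obtain w z where tw: "t = (w,z)" by (cases t)
 have n: "norm t < s2" using norm_le_rp[of t] t by linarith
 then have w: "norm w < s2" and z: "cmod z < s2" using norm_fst_le[of w z] norm_snd_le[of z w] by (auto simp: tw)
 have "sx ((w,z),cj (w,z)) = 0" using t(1) by (simp add: M_def tw)
 with ZX[OF w z] have *: "(w,(cjv w,z)) : ball 0 r" "cmod (X (w,(cjv w,z))) < s" "Z w (X (w,(cjv w,z))) = z" "Im (X (w,(cjv w,z))) = 0" by auto
 have rpt: "rp t = (w,(cjv w,z))" by (simp add: rp_def tw)
 show "Im (X (rp t)) = 0" "cmod (X (rp t)) < s" using * rpt by auto
 have "cnj (X (rp t)) = X (rp t)" using * rpt by (simp add: complex_eq_iff)
 then show q: "cj (qh X (rp t)) = t" using XZ[of w "X (rp t)"] w s2 * rpt by (simp add: tw)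
 then have "qh X (rp t) = cj t" by (metis cj_cj)
 then show "rp t : KK r" using q * rpt t(1) by (simp add: KK_def M_def)
qed

lemma aw_rp: "t : M ==> norm (rp t) < s2 ==> aw i (rp t) = cnj (fst (f t) $ i)"
 and az_rp: "t : M ==> norm (rp t) < s2 ==> az (rp t) = cnj (snd (f t))"
 using rp_qh(2) F_f by (simp_all add: aw_def az_def)

definition "f' t v = ((\<chi> i. fd (%t. fst (f t) $ i) t v),fd (%t. snd (f t)) t v)"

lemma f_bsm: "bsm False N (%t. fst (f t) $ i)" "bsm False N (%t. snd (f t))"
 using f_crf by (auto simp: crf_def)

lemma f_deriv: "t : N ==> (f has_derivative f' t) (at t)"
proof -
 assume t: "t : N"
 have "((%t. fst (f t)) has_derivative (%v. fst (f' t v))) (at t)"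
  by (rule has_derivative_vecI) (insert bsm_open(1)[OF open_N f_bsm(1) t], simp add: f'_def)
 moreover have "((%t. snd (f t)) has_derivative (%v. snd (f' t v))) (at t)"
  using bsm_open(1)[OF open_N f_bsm(2) t] by (simp add: f'_def)
 ultimately have "((%t. (fst (f t),snd (f t))) has_derivative (%v. (fst (f' t v),snd (f' t v)))) (at t)"
  by (rule has_derivative_Pair)
 then show ?thesis by simp
qed

lemma f'_cs:
 assumes t: "t : M" and v: "fd (%t. rh t) t v = 0" "fd (%t. rh t) t (cs \<i> v) = 0"
 shows "f' t (cs \<i> v) = cs \<i> (f' t v)"
proof -
 have tN: "t : N" using t by (simp add: M_def)
 have c: "fd g t (cs \<i> v) = \<i> * fd g t v" if "crf g" for g
 proof -
  have "wb v g t * wb ez (%t. rh t) t = wb ez g t * wb v (%t. rh t) t" using that t unfolding crf_def by blast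
  moreover have "wb v (%t. rh t) t = 0" using v by (simp add: wb_def)
  ultimately have "wb v g t = 0" using wb_ez_rho[OF tN] by simp
  then have "fd g t v+\<i> * fd g t (cs \<i> v) = 0" by (simp add: wb_def)
  then have "\<i> * (fd g t v+\<i> * fd g t (cs \<i> v)) = 0" by simp
  then show ?thesis by (simp add: algebra_simps)
 qed
 show ?thesis using c[OF f_crf(1)] c[OF f_crf(2)] by (simp add: f'_def prod_eq_iff vec_eq_iff)
qed

text \<open>Solving the complex linear equation for the last coordinate is possible because
  \<open>wb ez\<close> of the defining function is nonzero. So every \<open>w\<close> lifts to a
  complex tangent vector, and the \<open>chi\<close>-directions can be reached one at a
  time.\<close>

lemma complex_tangent:
 assumes t: "t : N"
 obtains v where "fst v = w" "fd (%t. rh t) t v = 0" "fd (%t. rh t) t (cs \<i> v) = 0"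
proof -
 define W where "W v = wb v (%t. rh t) t" for v
 note lin = lin_rho[OF t]
 have W: "W ez ~= 0" unfolding W_def by (rule wb_ez_rho[OF t])
 define z where "z = cnj (- W (w,0)/W ez)"
 define v where "v = (w,0)+cs z ez"
 have "W v = W (w,0)+W (cs z ez)"
  using lin by (simp add: W_def v_def wb_def linear_add cs_add_right algebra_simps add_divide_distrib)
 also have "W (cs z ez) = cnj z * W ez" unfolding W_def
  using wb_form_cs[OF lin, of z ez] by (simp add: wb_def)
 finally have "W v = 0" using W by (simp add: z_def)
 then have "fd (%t. rh t) t v+\<i> * fd (%t. rh t) t (cs \<i> v) = 0" by (simp add: W_def wb_def)
 moreover have "fst v = w" by (simp add: v_def ez_def cs.zero_right)
 ultimately show thesis using fd_rho_real[OF t, of v] fd_rho_real[OF t, of "cs \<i> v"]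
  by (intro that[of v]) (auto simp: complex_eq_iff)
qed

text \<open>The identity on \<open>M\<close> is differentiated along the tangent vectors
  \<open>v\<close> and \<open>cs \<i> v\<close>. Adding \<open>\<i>\<close> times the second result
  to the first cancels the holomorphic contributions on both sides and leaves the
  \<open>chi\<close>-derivative on the left, the derivative in the conjugate argument on the
  right.\<close>

lemma antilinear_part:
 assumes g: "bsm True (KK dl) g" and dl: "dl <= r" "dl <= s2" and G: "hol D G"
  and eq: "!!t. t : M ==> rp t : ball 0 dl ==> (cj (f t),f t) : D & g (rp t) = G (cj (f t),f t)"
  and t: "t : M" "rp t : ball 0 dl"
  and v: "fd (%t. rh t) t v = 0" "fd (%t. rh t) t (cs \<i> v) = 0"
 shows "bd (KK dl) g (0,(cjv (fst v),0)) (rp t) = ldv G (cj (f t),f t) (cj (f' t v),0)"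
proof -
 have tN: "t : N" using t by (simp add: M_def)
 define p where "p = (cj (f t),f t)"
 have p: "p : D" using eq[OF t] by (simp add: p_def)
 have rpK: "rp t : KK dl" if "t : M" "rp t : ball 0 dl" for t
 proof -
  have "norm (rp t) < s2" using that dl by simp
  from rp_qh(1)[OF that(1) this] that(2) show ?thesis by (simp add: KK_def)
 qed
 have E: "bd (KK dl) g (rp v) (rp t) = ldv G p (cj (f' t v),f' t v)" if v: "fd (%t. rh t) t v = 0" for v
 proof -
  obtain ga e where ga: "e > 0" "!!s. s : {-e<..<e} ==> ga s : M" "ga 0 = t" "(ga has_vector_derivative v) (at (0::real))"
   using tangent_curve[OF t(1) v] by blast
  have gad: "(ga has_derivative (%h. h *R v)) (at 0)" using ga(4) by (simp add: has_vector_derivative_def)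
  then have rd: "((%s. rp (ga s)) has_derivative (%h. rp (h *R v))) (at 0)"
   by (rule bounded_linear.has_derivative[OF bounded_linear_rp])
  have "isCont (%s. rp (ga s)) 0" by (rule has_derivative_continuous[OF rd])
  then obtain Y where Y: "open Y" "0 : Y" "ALL s:Y. rp (ga s) : ball 0 dl"
   using continuous_at_open[of 0 "%s. rp (ga s)"] t(2) ga(3) by (metis open_ball)
  define J where "J = Y Int {-e<..<e}"
  have J: "open J" "0 : J" using Y ga(1) by (auto simp: J_def)
  have JK: "(%s. rp (ga s)) ` J <= KK dl" using rpK Y(3) ga(2) unfolding J_def by blast
  have gd: "(g has_derivative (%v. bd (KK dl) g v (rp t))) (at (rp (ga 0)) within (%s. rp (ga s)) ` J)"
   using has_derivative_subset[OF bd(1)[OF g rpK[OF t]] JK] ga(3) by simp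
  have "((%s. g (rp (ga s))) has_derivative (%h. bd (KK dl) g (rp (h *R v)) (rp t))) (at 0 within J)"
   by (rule has_derivative_in_compose[OF has_derivative_at_withinI[OF rd] gd])
  then have 1: "((%s. g (rp (ga s))) has_derivative (%h. bd (KK dl) g (rp (h *R v)) (rp t))) (at 0)"
   unfolding at_within_open[OF J(2,1)] .
  have fd: "((%s. f (ga s)) has_derivative (%h. f' t (h *R v))) (at 0)"
   by (rule has_derivative_compose[OF gad]) (use f_deriv[OF tN] ga(3) in simp)
  then have "((%s. (cj (f (ga s)),f (ga s))) has_derivative (%h. (cj (f' t (h *R v)),f' t (h *R v)))) (at 0)"
   by (intro has_derivative_Pair bounded_linear.has_derivative[OF bounded_linear_cj])
  from has_derivative_compose[OF this, of G "ldv G p"] hol_derivL[OF G p] ga(3)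
  have "((%s. G (cj (f (ga s)),f (ga s))) has_derivative (%h. ldv G p (cj (f' t (h *R v)),f' t (h *R v)))) (at 0)"
   by (simp add: p_def)
  then have 2: "((%s. g (rp (ga s))) has_derivative (%h. ldv G p (cj (f' t (h *R v)),f' t (h *R v)))) (at 0)"
   by (rule has_derivative_transform_within_open[OF _ J]) (insert eq Y(3) ga(2), auto simp: J_def simp del: split_paired_All)
  from fun_cong[OF has_derivative_unique[OF 1 2], of 1] show ?thesis by simp
 qed
 have cl: "clin (%v. bd (KK dl) g v (rp t))" by (rule bd(2)[OF g rpK[OF t]])
 have li: "linear (%v. bd (KK dl) g v (rp t))" using bd(1)[OF g rpK[OF t]] has_derivative_linear by blast
 have cl2: "ldv G p (cs c v) = c * ldv G p v" for c v by (rule ldv_cs[OF hol_imp_ghol[OF G] p])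
 have li2: "linear (ldv G p)" by (rule ldv_linear[OF G p])
 have "bd (KK dl) g (cs 2 (0,(cjv (fst v),0))) (rp t) = bd (KK dl) g (rp v+cs \<i> (rp (cs \<i> v))) (rp t)"
  by (rule arg_cong[where f="%v. bd (KK dl) g v (rp t)"])
   (simp add: rp_def prod_eq_iff vec_eq_iff cs.zero_right)
 also have "... = bd (KK dl) g (rp v) (rp t)+\<i> * bd (KK dl) g (rp (cs \<i> v)) (rp t)"
  using clinD[OF cl, of \<i> "rp (cs \<i> v)"] by (simp add: linear_add[OF li])
 also have "... = ldv G p (cj (f' t v),f' t v)+\<i> * ldv G p (cj (cs \<i> (f' t v)),cs \<i> (f' t v))"
  using E[OF v(1)] E[OF v(2)] f'_cs[OF t(1) v] by simp
 also have "... = ldv G p ((cj (f' t v),f' t v)+cs \<i> (cj (cs \<i> (f' t v)),cs \<i> (f' t v)))"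
  by (simp only: linear_add[OF li2] cl2)
 also have "... = ldv G p (cs 2 (cj (f' t v),0))"
  by (rule arg_cong[where f="ldv G p"]) (simp add: prod_eq_iff vec_eq_iff cs.zero_right)
 finally have "2 * bd (KK dl) g (0,(cjv (fst v),0)) (rp t) = 2 * ldv G p (cj (f' t v),0)"
  unfolding cl2 using clinD[OF cl, of 2 "(0,(cjv (fst v),0))"] by simp
 then show ?thesis by (simp add: p_def)
qed

end

lemma ldv_bounded_linear:
 fixes G :: "'a::cvec => complex"
 assumes "bounded_linear G" "clin G" shows "ldv G p v = G v"
 by (rule ldv_eqI[OF bounded_linear_imp_has_derivative[OF assms(1)] hol_imp_ghol[OF hol_linear[OF assms open_UNIV]]]) simp

lemma bd_leaf_sum:
 fixes g :: "(complex^'m::finite) \<times> 'm cn => complex"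
 assumes g: "bsm True S g" and u: "u : S"
 shows "bd S g (0,(x,0)) u = (\<Sum>j\<in>UNIV. x $ j * bd S g (ej j) u)"
proof -
 have li: "linear (%v. bd S g v u)" using bd(1)[OF g u] has_derivative_linear by blast
 have "(0,(x,0)) = (\<Sum>j\<in>UNIV. cs (x $ j) (ej j :: (complex^'m) \<times> 'm cn))"
  by (simp add: prod_eq_iff fst_sum snd_sum axis_sum_cs cs.zero_right)
 then have "bd S g (0,(x,0)) u = (\<Sum>j\<in>UNIV. bd S g (cs (x $ j) (ej j)) u)"
  using linear_sum[OF li] by simp
 then show ?thesis by (simp only: clinD[OF bd(2)[OF g u]] cs_complex_def)
qed

lemma cont_near:
 fixes g :: "'a::real_normed_vector => 'b::metric_space"
 assumes "continuous_on S g" "0 : S" "e > 0"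
 obtains dl where "dl > 0" "!!u. u : S ==> norm u < dl ==> dist (g u) (g 0) < e"
 using assms unfolding continuous_on_iff by (metis dist_0_norm dist_commute)

context leaf
begin

definition "dl0 = min r s2"

lemma dl0: "dl0 > 0" "dl0 <= r" "dl0 <= s2"
 using r s2 by (auto simp: dl0_def)

lemma rp_KK: "t : M ==> rp t : ball 0 dl ==> dl <= dl0 ==> rp t : KK dl"
 using rp_qh(1)[of t] dl0 by (simp add: KK_def)

lemma KK_sub: "dl <= dl' ==> KK dl <= KK dl'"
 unfolding KK_def using subset_ball[of dl dl' 0] by blast

lemmas bsm_aw0 = bsm_subset[OF bsm_aw KK_sub[OF dl0(2)]]

text \<open>The Jacobian of the reflected map in \<open>chi\<close>. By Cramer's rule
  \<open>Bm i j u\<close> is the entry in row \<open>j\<close>, column \<open>i\<close> of its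
  inverse, meaningful where the determinant is nonzero.\<close>

definition "Am u = (\<chi> i j. bd (KK dl0) (aw i) (ej j) u)"
definition "Bm i j u = det (\<chi> p q. if q = j then axis i 1 $ p else Am u $ p $ q)/det (Am u)"

primrec cc :: "real => 'm list => (complex^'m) \<times> 'm cn => complex" where
 "cc dl [] = az"
| "cc dl (i # is) = (%u. \<Sum>j\<in>UNIV. Bm i j u * bd (KK dl) (cc dl is) (ej j) u)"

lemma rp_small: "rp t : ball 0 dl0 ==> norm (rp t) < s2" "rp t : ball 0 dl0 ==> norm t < s2"
 using norm_le_rp[of t] dl0 by auto

lemma aw_anti:
 assumes t: "t : M" "rp t : ball 0 dl0" and v: "fd (%t. sx (t,cj t)) t v = 0" "fd (%t. sx (t,cj t)) t (cs \<i> v) = 0"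
 shows "bd (KK dl0) (aw i) (0,(cjv (fst v),0)) (rp t) = cnj (fst (f' t v) $ i)"
proof -
 define G where "G q = fst (fst q) $ i" for q :: "'m cn \<times> 'm cn"
 have G: "bounded_linear G" "clin G" unfolding G_def
  by (rule bounded_linear_compose[OF bounded_linear_vec_nth bounded_linear_compose[OF bounded_linear_fst bounded_linear_fst]])
   (simp add: clin_def)
 have "bd (KK dl0) (aw i) (0,(cjv (fst v),0)) (rp t) = ldv G (cj (f t),f t) (cj (f' t v),0)"
 proof (rule antilinear_part[OF bsm_aw0 dl0(2,3) hol_linear[OF G open_UNIV] _ t v])
  fix t assume t: "t : M" "rp t : ball 0 dl0"
  show "(cj (f t),f t) : UNIV & aw i (rp t) = G (cj (f t),f t)"
   using aw_rp[OF t(1) rp_small(1)[OF t(2)]] by (simp add: G_def)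
 qed
 then show ?thesis by (simp add: ldv_bounded_linear[OF G] G_def)
qed

lemma az_anti:
 assumes t: "t : M" "rp t : ball 0 dl0" and v: "fd (%t. sx (t,cj t)) t v = 0" "fd (%t. sx (t,cj t)) t (cs \<i> v) = 0"
 shows "bd (KK dl0) az (0,(cjv (fst v),0)) (rp t) = cnj (snd (f' t v))"
proof -
 define G where "G q = snd (fst q)" for q :: "'m cn \<times> 'm cn"
 have G: "bounded_linear G" "clin G" unfolding G_def
  by (rule bounded_linear_compose[OF bounded_linear_snd bounded_linear_fst]) (simp add: clin_def)
 have "bd (KK dl0) az (0,(cjv (fst v),0)) (rp t) = ldv G (cj (f t),f t) (cj (f' t v),0)"
 proof (rule antilinear_part[OF bsm_subset[OF bsm_az KK_sub[OF dl0(2)]] dl0(2,3) hol_linear[OF G open_UNIV] _ t v])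
  fix t assume t: "t : M" "rp t : ball 0 dl0"
  show "(cj (f t),f t) : UNIV & az (rp t) = G (cj (f t),f t)"
   using az_rp[OF t(1) rp_small(1)[OF t(2)]] by (simp add: G_def)
 qed
 then show ?thesis by (simp add: ldv_bounded_linear[OF G] G_def)
qed

lemma f_pdisc: "t : M ==> norm t < s2 ==> (cjv (fst (f t)),f t) : pdisc2 rT" "t : M ==> norm t < s2 ==> (cjv (fst (f t)),f t) : pdisc2 (rT/2)"
proof -
 assume "t : M" "norm t < s2"
 from f_small[OF this] have *: "ALL i. cmod (fst (f t) $ i) < rT/4" "cmod (snd (f t)) < rT/4"
  by (auto simp: pdisc2_def polydisc_def)
 have **: "x < rT/4 ==> x < rT" "x < rT/4 ==> x < rT/2" for x using rT by linarith+
 show "(cjv (fst (f t)),f t) : pdisc2 rT" "(cjv (fst (f t)),f t) : pdisc2 (rT/2)"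
  using * ** by (auto simp: pdisc2_def polydisc_def)
qed

lemma dT_anti:
 assumes g: "bsm True (KK dl) g" and dl: "dl <= dl0"
  and eq: "!!t. t : M ==> rp t : ball 0 dl ==> g (rp t) = dT is (cjv (fst (f t)),f t)"
  and t: "t : M" "rp t : ball 0 dl" and v: "fd (%t. sx (t,cj t)) t v = 0" "fd (%t. sx (t,cj t)) t (cs \<i> v) = 0"
 shows "bd (KK dl) g (0,(cjv (fst v),0)) (rp t) = ldv (dT is) (cjv (fst (f t)),f t) (cjv (fst (f' t v)),0)"
proof -
 define m where "m q = (fst (fst q),snd q)" for q :: "'m cn \<times> 'm cn"
 have hm: "hol UNIV m" unfolding m_def by (intro hol_Pair hol_fst hol_snd hol_id open_UNIV)
 define D where "D = m -` pdisc2 rT"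
 have oD: "open D" unfolding D_def using open_vimage[OF open_pdisc2 hol_continuous_on[OF hm]] .
 have hG: "hol D (%q. dT is (m q))" by (rule hol_compose[OF dT_hol hol_subset[OF hm oD]]) (auto simp: D_def)
 have cjf: "fst (cj y) = cjv (fst y)" for y :: "'m cn" by (simp add: vec_eq_iff)
 have "bd (KK dl) g (0,(cjv (fst v),0)) (rp t) = ldv (%q. dT is (m q)) (cj (f t),f t) (cj (f' t v),0)"
 proof (rule antilinear_part[OF g _ _ hG _ t v])
  show "dl <= r" "dl <= s2" using dl dl0 by auto
  fix t assume t: "t : M" "rp t : ball 0 dl"
  have "rp t : ball 0 dl0" using t(2) dl by simp
  then have "norm t < s2" by (rule rp_small)
  then show "(cj (f t),f t) : D & g (rp t) = dT is (m (cj (f t),f t))"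
   using eq[OF t] f_pdisc(1)[OF t(1)] by (simp add: D_def m_def cjf)
 qed
 then show ?thesis by (simp add: ldv_def m_def cjf)
qed

lemma KK0: "0 : KK dl0"
 using rp_KK[OF M0, of dl0] dl0 by simp

text \<open>A kernel vector yields a complex tangent vector whose image has vanishing
  \<open>w\<close>-part. The differentiated equation of \<open>M'\<close> then makes the
  \<open>z\<close>-part vanish too, against injectivity of the differential.\<close>

lemma det_A0: "det (Am 0) ~= 0"
proof
 assume "det (Am 0) = 0"
 then have "~ (EX B. B ** Am 0 = mat 1)" using invertible_det_nz[of "Am 0"] invertible_left_inverse[of "Am 0"] by auto
 then obtain x where x: "Am 0 *v x = 0" "x ~= 0" unfolding matrix_left_invertible_ker by blast
 have N0: "0 : N" using M0 by (simp add: M_def)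
 obtain v where v: "fst v = cjv x" "fd (%t. sx (t,cj t)) 0 v = 0" "fd (%t. sx (t,cj t)) 0 (cs \<i> v) = 0"
  using complex_tangent[OF N0] by blast
 have rp0: "rp 0 : ball 0 dl0" using dl0 by simp
 have "cnj (fst (f' 0 v) $ i) = 0" for i
 proof -
  have "cnj (fst (f' 0 v) $ i) = bd (KK dl0) (aw i) (0,(x,0)) 0"
   using aw_anti[OF M0 rp0 v(2,3), of i] v(1) by simp
  also have "... = (Am 0 *v x) $ i"
   by (rule trans[OF bd_leaf_sum[OF bsm_aw0 KK0]]) (simp add: Am_def matrix_vector_mult_def mult.commute)
  finally show ?thesis using x by simp
 qed
 then have fw: "fst (f' 0 v) = 0" by (simp add: vec_eq_iff)
 have bz: "bsm True (KK dl0) az" by (rule bsm_subset[OF bsm_az KK_sub[OF dl0(2)]])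
 have eq: "az (rp t) = dT [] (cjv (fst (f t)),f t)" if "t : M" "rp t : ball 0 dl0" for t
  using az_rp[OF that(1)] f_eq[OF that(1)] rp_small[OF that(2)] by simp
 have "cnj (snd (f' 0 v)) = ldv (dT []) (cjv (fst (f 0)),f 0) (cjv (fst (f' 0 v)),0)"
  using az_anti[OF M0 rp0 v(2,3)] dT_anti[OF bz order_refl eq M0 rp0 v(2,3)] by simp
 also have "... = 0"
 proof -
  have e: "(cjv (fst (f' 0 v)),0 :: 'm cn) = 0" by (simp add: fw prod_eq_iff)
  show ?thesis unfolding e by (rule linear_0[OF ldv_linear[OF dT_hol f_pdisc(1)[OF M0]]]) (use s2 in simp)
 qed
 finally have "snd (f' 0 v) = 0" by simp
 then have "v = 0" using fw v(2) by (intro nondeg) (auto simp: f'_def vec_eq_iff)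
 then have "cjv x = 0" using v(1) by simp
 then have "x = 0" using cjv_simps(1,2) by metis
 then show False using x by simp
qed

lemma Bm_inverse: "det (Am u) ~= 0 ==> (\<Sum>j\<in>UNIV. Am u $ p $ j * Bm i j u) = axis i 1 $ p"
proof -
 assume "det (Am u) ~= 0"
 from cramer[OF this, of "\<chi> j. Bm i j u" "axis i 1"] have "Am u *v (\<chi> j. Bm i j u) = axis i 1"
  by (simp add: Bm_def)
 from arg_cong[OF this, of "%x. x $ p"] show ?thesis by (simp add: matrix_vector_mult_def)
qed

lemma bsm_Am: "bsm True (KK dl0) (%u. Am u $ p $ q)"
 by (simp add: Am_def bd(3)[OF bsm_aw0])

lemma bsm_det: "(!!p q. bsm True S (%u. A u $ p $ q)) ==> bsm True S (%u. det (A u :: complex^'m^'m))"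
 unfolding det_def by (intro bsm_sum bsm_mult bsm_prod bsm_const)

lemma good_radius:
 obtains dl CB CA where "0 < dl" "dl <= dl0" "CB >= 0" "CA >= 0" "!!i j. bsm True (KK dl) (Bm i j)"
  "!!u. u : KK dl ==> det (Am u) ~= 0" "!!u i j. u : KK dl ==> cmod (Bm i j u) <= CB"
  "!!u. u : KK dl ==> cmod (az u) <= CA"
proof -
 have "continuous_on (KK dl0) (%u. det (Am u))" by (rule bsm_continuous_on[OF bsm_det[OF bsm_Am]])
 from cont_near[OF this KK0, of "cmod (det (Am 0))"] det_A0
 obtain d1 where d1: "d1 > 0" "!!u. u : KK dl0 ==> norm u < d1 ==> dist (det (Am u)) (det (Am 0)) < cmod (det (Am 0))" by auto
 define dl1 where "dl1 = min d1 dl0"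
 have dl1: "dl1 > 0" "dl1 <= dl0" using d1 dl0 by (auto simp: dl1_def)
 have nz: "det (Am u) ~= 0" if "u : KK dl1" for u
 proof
  assume "det (Am u) = 0"
  moreover have "u : KK dl0" "norm u < d1" using that KK_sub[OF dl1(2)] by (auto simp: KK_def dl1_def simp del: split_paired_All)
  ultimately show False using d1(2)[of u] by (simp add: dist_norm)
 qed
 have bA: "bsm True (KK dl1) (%u. Am u $ p $ q)" for p q by (rule bsm_subset[OF bsm_Am KK_sub[OF dl1(2)]])
 have bB: "bsm True (KK dl1) (Bm i j)" for i j
 proof -
  have "bsm True (KK dl1) (%u. (\<chi> p q. if q = j then axis i 1 $ p else Am u $ p $ q) $ p $ q)" for p q
   using bA[of p q] by (cases "q = j") auto
  from bsm_det[OF this] have "bsm True (KK dl1) (%u. det (\<chi> p q. if q = j then axis i 1 $ p else Am u $ p $ q))" .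
  then show ?thesis unfolding Bm_def[abs_def] by (rule bsm_divide[OF _ bsm_det[OF bA] nz])
 qed
 have bz: "bsm True (KK dl1) az" using dl1 dl0 by (intro bsm_subset[OF bsm_az KK_sub]) auto
 define S where "S u = (\<Sum>i\<in>UNIV. \<Sum>j\<in>UNIV. cmod (Bm i j u))+cmod (az u)" for u
 have 0: "0 : KK dl1" using KK0 dl1 by (simp add: KK_def)
 have "continuous_on (KK dl1) S" unfolding S_def
  by (intro continuous_intros bsm_continuous_on[OF bB] bsm_continuous_on[OF bz])
 from cont_near[OF this 0, of 1] obtain d2 where d2: "d2 > 0" "!!u. u : KK dl1 ==> norm u < d2 ==> dist (S u) (S 0) < 1" by auto
 define dl where "dl = min d2 dl1"
 have dl: "dl > 0" "dl <= dl1" using d2 dl1 by (auto simp: dl_def)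
 note sub = KK_sub[OF dl(2)]
 have SB: "S u <= S 0+1" if "u : KK dl" for u
 proof -
  have "u : KK dl1" "norm u < d2" using that sub by (auto simp: KK_def dl_def simp del: split_paired_All)
  then show ?thesis using d2(2)[of u] by (simp add: dist_real_def)
 qed
 have Spos: "S u >= 0" for u unfolding S_def by (intro add_nonneg_nonneg sum_nonneg) auto
 have le: "cmod (Bm i j u) <= S u" "cmod (az u) <= S u" for i j u
 proof -
  have "cmod (Bm i j u) <= (\<Sum>j\<in>UNIV. cmod (Bm i j u))" by (rule member_le_sum) auto
  also have "... <= (\<Sum>i\<in>UNIV. \<Sum>j\<in>UNIV. cmod (Bm i j u))" by (rule member_le_sum) (auto intro: sum_nonneg)
  finally show "cmod (Bm i j u) <= S u" by (simp add: S_def add_increasing2)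
  show "cmod (az u) <= S u" by (simp add: S_def sum_nonneg)
 qed
 show thesis
 proof (rule that[of dl "S 0+1" "S 0+1"])
  show "0 < dl" "dl <= dl0" using dl dl1 by auto
  show "0 <= S 0+1" using Spos[of 0] by simp
  then show "0 <= S 0+1" .
  show "bsm True (KK dl) (Bm i j)" for i j by (rule bsm_subset[OF bB sub])
  show "det (Am u) ~= 0" if "u : KK dl" for u using nz that sub by blast
  show "cmod (Bm i j u) <= S 0+1" "cmod (az u) <= S 0+1" if "u : KK dl" for u i j
   using le SB[OF that] order_trans by blast+
 qed
qed

lemma cc_bsm: "(!!i j. bsm True (KK dl) (Bm i j)) ==> dl <= r ==> bsm True (KK dl) (cc dl is)"
proof (induction "is")
 case Nil then show ?case using bsm_subset[OF bsm_az KK_sub] by simp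
next
 case (Cons i "is")
 have "bsm True (KK dl) (%u. \<Sum>j\<in>UNIV. Bm i j u * bd (KK dl) (cc dl is) (ej j) u)"
  by (intro bsm_sum bsm_mult Cons.prems(1) bd(3)[OF Cons.IH[OF Cons.prems]])
 then show ?case by simp
qed

text \<open>By induction on the list: differentiating the identity for \<open>is\<close> in
  \<open>chi\<close> with \<open>dT_anti\<close> gives the Jacobian applied to the next derivatives,
  and \<open>Bm\<close> undoes it.\<close>

lemma cc_M:
 fixes dl :: real
 assumes B: "!!i j. bsm True (KK dl) (Bm i j)" and nz: "!!u. u : KK dl ==> det (Am u) ~= 0" and dl: "dl <= dl0"
  and t: "t : M" "rp t : ball 0 dl"
 shows "cc dl is (rp t) = dT is (cjv (fst (f t)),f t)"
 using t
proof (induction "is" arbitrary: t)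
 case Nil
 then have "rp t : ball 0 dl0" using dl by simp
 from az_rp[OF Nil(1) rp_small(1)[OF this]] f_eq[OF Nil(1) rp_small(2)[OF this]] show ?case by simp
next
 case (Cons i "is")
 note t = Cons.prems
 have t0: "rp t : ball 0 dl0" using t(2) dl by simp
 have tN: "t : N" using t by (simp add: M_def)
 have rK: "rp t : KK dl" by (rule rp_KK[OF t dl])
 have dlr: "dl <= r" using dl dl0 by simp
 define p where "p = (cjv (fst (f t)),f t)"
 have pD: "p : pdisc2 rT" using f_pdisc(1)[OF t(1) rp_small(2)[OF t0]] by (simp add: p_def)
 have key: "bd (KK dl) (cc dl is) (ej j) (rp t) = (\<Sum>q\<in>UNIV. Am (rp t) $ q $ j * dT (q # is) p)" for j
 proof -
  obtain v where v: "fst v = cjv (axis j 1)" "fd (%t. sx (t,cj t)) t v = 0" "fd (%t. sx (t,cj t)) t (cs \<i> v) = 0"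
   using complex_tangent[OF tN] by blast
  have cv: "cjv (fst v) = axis j 1" by (simp add: v(1))
  have "bd (KK dl) (cc dl is) (ej j) (rp t) = ldv (dT is) p (cjv (fst (f' t v)),0)"
   using dT_anti[OF cc_bsm[OF B dlr] dl Cons.IH t v(2,3)] unfolding cv p_def .
  also have "... = (\<Sum>q\<in>UNIV. cnj (fst (f' t v) $ q) * dT (q # is) p)"
   by (rule trans[OF ldv_axis_sum[OF dT_hol pD]]) (simp add: dT_Cons)
  also have "... = (\<Sum>q\<in>UNIV. Am (rp t) $ q $ j * dT (q # is) p)"
   using aw_anti[OF t(1) t0 v(2,3)] by (simp add: cv Am_def)
  finally show ?thesis .
 qed
 have "cc dl (i # is) (rp t) = (\<Sum>j\<in>UNIV. \<Sum>q\<in>UNIV. Bm i j (rp t)*(Am (rp t) $ q $ j * dT (q # is) p))"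
  by (simp add: key sum_distrib_left)
 also have "... = (\<Sum>q\<in>UNIV. \<Sum>j\<in>UNIV. Bm i j (rp t)*(Am (rp t) $ q $ j * dT (q # is) p))" by (rule sum.swap)
 also have "... = (\<Sum>q\<in>UNIV. (\<Sum>j\<in>UNIV. Am (rp t) $ q $ j * Bm i j (rp t)) * dT (q # is) p)"
  by (simp add: sum_distrib_right sum_distrib_left mult_ac)
 also have "... = dT (i # is) p"
  by (simp add: Bm_inverse[OF nz[OF rK]] axis_def if_distrib[of "%c. c * _"] cong: if_cong)
 finally show ?case by (simp add: p_def)
qed

definition "uu w x = (w,(cjv w,Z w x))"

lemma sgn_uu:
 assumes "norm w < s" "cmod x < s" "Im x <= 0"
 shows "Re (sx (cj (qh X (uu w x)),qh X (uu w x))) >= c * (abs (Im x))" and "uu w x : ball 0 r"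
proof -
 have q: "cj (qh X (uu w x)) = (w,Z w (cnj x))" using XZ[OF assms(1,2)] by (simp add: uu_def)
 then have "qh X (uu w x) = cj (w,Z w (cnj x))" by (metis cj_cj)
 then show "Re (sx (cj (qh X (uu w x)),qh X (uu w x))) >= c * (abs (Im x))"
  using sgnZ[of w "cnj x"] q assms by simp
 have "uu w x : ball 0 (r/2)" using XZ[OF assms(1,2)] by (simp add: uu_def)
 then show "uu w x : ball 0 r" using r by simp
qed

lemma uu_KK: "norm w < s ==> cmod x < s ==> Im x <= 0 ==> uu w x : ball 0 dl ==> uu w x : KK dl"
proof -
 assume a: "norm w < s" "cmod x < s" "Im x <= 0" and b: "uu w x : ball 0 dl"
 have "0 <= c * (abs (Im x))" using c by simp
 with sgn_uu(1)[OF a] have "0 <= Re (sx (cj (qh X (uu w x)),qh X (uu w x)))" by linarith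
 with b show ?thesis by (simp add: KK_def)
qed

lemma uu_PP: "norm w < s ==> cmod x < s ==> Im x < 0 ==> uu w x : ball 0 dl ==> uu w x : PP dl"
proof -
 assume a: "norm w < s" "cmod x < s" "Im x < 0" and b: "uu w x : ball 0 dl"
 have "0 < c * (abs (Im x))" using c a(3) by (intro mult_pos_pos) auto
 with sgn_uu(1)[OF a(1,2)] a(3) have "0 < Re (sx (cj (qh X (uu w x)),qh X (uu w x)))" by linarith
 with b show ?thesis by (simp add: PP_def)
qed

lemma hol_uu: "norm w < s ==> hol (ball 0 s) (uu w)"
 unfolding uu_def[abs_def] using hZ[of w] by (intro hol_Pair hol_const) (auto simp: hol_iff_holomorphic_on)

lemma uu_rp: "norm w < s ==> cmod x < s ==> Im x = 0 ==> (w,Z w x) : M & rp (w,Z w x) = uu w x"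
 using XZ[of w x] ZM[of w x] by (simp add: M_def rp_def uu_def)

text \<open>At depth \<open>abs (Im x)\<close> the sign function is at least
  \<open>c * abs (Im x)\<close>, and by \<open>lip\<close> it stays positive under shifts of
  \<open>chi\<close> of proportional size. Nested Cauchy estimates with that radius give the bound
  with a loss of one factor \<open>abs (Im x)\<close> per derivative.\<close>

lemma cc_interior:
 fixes dl CB CA :: real
 assumes B: "!!i j. bsm True (KK dl) (Bm i j)" and dl: "dl > 0" "dl <= dl0" and CB: "CB >= 0" "!!u i j. u : KK dl ==> cmod (Bm i j u) <= CB"
  and CA: "!!u. u : KK dl ==> cmod (az u) <= CA"
  and w: "norm w < s" and x: "cmod x < s" "Im x < 0" "(abs (Im x)) <= 1" and u: "uu w x : ball 0 (dl/2)"
 shows "cmod (cc dl is (uu w x)) * (abs (Im x))^length is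
  <= CA * exp 1*(exp 1*(CARD('m) * CB)/min (c/(L+1)) (dl/2))^length is * fact (length is)"
proof -
 \<comment> \<open>The first entry gives \<open>ka * L < c\<close>; the second, together with
   \<open>abs (Im x) <= 1\<close>, keeps shifted points in the ball of radius
   \<open>dl\<close>.\<close>
 define ka where "ka = min (c/(L+1)) (dl/2)"
 have ka: "ka > 0" "ka <= dl/2" "ka * L < c"
 proof -
  show "ka > 0" using c L dl by (auto simp: ka_def)
  show "ka <= dl/2" unfolding ka_def by (rule min.cobounded2)
  have "ka <= c/(L+1)" by (simp add: ka_def)
  then have "ka * (L+1) <= c" using L by (simp add: pos_le_divide_eq)
  then show "ka * L < c" using \<open>ka > 0\<close> by (simp add: distrib_left)
 qed
 have dlr: "dl <= r" using dl dl0 by simp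
 note bs = cc_bsm[OF B dlr]
 have "cmod (cc dl is (uu w x)) <= CA * exp 1*(exp 1*(CARD('m) * CB)/(ka * (abs (Im x))))^length is * fact (length is)"
 proof (rule nested_cauchy[where E="PP dl" and b=Bm and e="%j. ej j" and V="{h. EX a. h = (0,(a,0))}"])
  show "hol (PP dl) (cc dl is)" for "is" by (rule bsm_imp_hol[OF bs open_PP[OF dlr] PP_KK])
  show "cmod (Bm i j u) <= CB" "cmod (cc dl [] u) <= CA" if "u : PP dl" for i j u
   using CB(2)[of u] CA[of u] that PP_KK by auto
  show "cc dl (i # is) u = (\<Sum>j\<in>UNIV. Bm i j u * ldv (cc dl is) u (ej j))" if "u : PP dl" for i "is" u
   using bd_eq_ldv[OF bs open_PP[OF dlr] PP_KK that] by simp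
  show "norm (ej j :: (complex^'m) \<times> 'm cn) <= 1" for j by (simp add: norm_Pair norm_axis_1)
  show "0 < ka * (abs (Im x))" using ka x by (intro mult_pos_pos) auto
  fix h :: "(complex^'m) \<times> 'm cn" assume "h : {h. EX a. h = (0,(a,0))}" and n: "norm h < ka * (abs (Im x))"
  then obtain a where h: "h = (0,(a,0))" by blast
  have na: "norm a < ka * (abs (Im x))" using n by (simp add: h norm_Pair)
  have "ka * (abs (Im x)) <= ka * 1" using ka x by (intro mult_left_mono) auto
  then have "norm h < dl/2" using n ka by linarith
  then have in': "uu w x+h : ball 0 dl" using u norm_triangle_ineq[of "uu w x" h] by simp
  have uh: "uu w x+h = (w,(cjv w+a,Z w x))" by (simp add: uu_def h)
  define g where "g u = Re (sx (cj (qh X u),qh X u))" for u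
  have "\<bar>g (w,(cjv w+a,Z w x))-g (w,(cjv w,Z w x))\<bar> <= L * norm (cjv w+a-cjv w)"
   unfolding g_def by (rule lip) (insert in' uh dlr sgn_uu(2)[OF w x(1)] x, auto simp: uu_def)
  moreover have "g (w,(cjv w,Z w x)) >= c * (abs (Im x))" using sgn_uu(1)[OF w x(1)] x by (simp add: g_def uu_def)
  moreover have "L * norm a <= L * (ka * (abs (Im x)))" using na L by (intro mult_left_mono) auto
  moreover have "L * (ka * (abs (Im x))) < c * (abs (Im x))" using ka(3) x by (simp add: mult_ac)
  ultimately have "g (uu w x+h) > 0" unfolding uh by simp
  then show "uu w x+h : PP dl" using in' by (simp add: PP_def g_def)
 qed (insert CB cs.zero_right, auto simp: zero_prod_def)
 then have "cmod (cc dl is (uu w x)) * (abs (Im x))^length is <=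
   (CA * exp 1*(exp 1*(CARD('m) * CB)/(ka * (abs (Im x))))^length is * fact (length is)) * (abs (Im x))^length is"
  by (rule mult_right_mono) simp
 also have "... = CA * exp 1*(exp 1*(CARD('m) * CB)/ka)^length is * fact (length is)"
 proof -
  define y where "y = (abs (Im x))"
  define A where "A = exp 1*(CARD('m) * CB)"
  have "(A/(ka * y))^length is * y^length is = (A/ka)^length is"
   unfolding power_mult_distrib[symmetric] using x by (simp add: y_def)
  then show ?thesis unfolding y_def[symmetric] A_def[symmetric] by (simp only: mult_ac)
 qed
 finally show ?thesis by (simp add: ka_def)
qed

end

context leaf
begin

lemma CT: "CT >= 0"
proof -
 have "(0,0) : pdisc2 (rT/2)" using rT by (simp add: pdisc2_def polydisc_def)
 from order_trans[OF norm_ge_zero dT_bound[OF this, of "[]"]] show ?thesis by simp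
qed

text \<open>On the real axis \<open>cc\<close> equals \<open>dT\<close>, bounded by
  \<open>dT_bound\<close> without loss; below it \<open>cc_interior\<close> applies.
  \<open>halfdisc_bound\<close> merges both into one estimate up to the axis, at the price of a
  larger geometric constant.\<close>

lemma slice_bound:
 fixes dl CB CA :: real
 assumes B: "!!i j. bsm True (KK dl) (Bm i j)" and nz: "!!u. u : KK dl ==> det (Am u) ~= 0"
  and dl: "dl > 0" "dl <= dl0" and CB: "CB >= 0" "!!u i j. u : KK dl ==> cmod (Bm i j u) <= CB"
  and CA: "CA >= 0" "!!u. u : KK dl ==> cmod (az u) <= CA"
 obtains s' C K where "s' > 0" "s' <= s" "C >= 0" "K >= 0" "!!w x. norm w < s' ==> cmod x < s' ==> uu w x : ball 0 dl"
  "!!is w x. norm w < s' ==> cmod x < s' ==> Im x <= 0 ==> cmod (cc dl is (uu w x)) <= C * K^length is * fact (length is)"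
proof -
 obtain s'' where s'': "s'' > 0" "!!w x. norm w < s'' ==> cmod x < s'' ==> uu w x : ball 0 (dl/2)"
  using Zcont[of "dl/2"] dl unfolding uu_def by (metis half_gt_zero)
 define s1 where "s1 = min (min s'' s) 1/2"
 have s1: "s1 > 0" "s1 < s''" "s1 < s" "s1 <= 1" using s'' s by (auto simp: s1_def)
 define K1 where "K1 = exp 1*(CARD('m) * CB)/min (c/(L+1)) (dl/2)"
 have K1: "K1 >= 0" using CB c L dl by (simp add: K1_def)
 define K0 where "K0 = max KT K1"
 have K0: "K0 >= 0" using K1 by (simp add: K0_def)
 define C where "C = max CT (CA * exp 1)"
 have C: "C >= 0" using CT by (simp add: C_def)
 define K where "K = K0*(4/3*(1+2/s1))"
 have K: "K >= 0" using K0 s1 by (simp add: K_def)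
 have dlr: "dl <= r" using dl dl0 by simp
 note bs = cc_bsm[OF B dlr]
 have in2: "uu w x : ball 0 (dl/2)" "uu w x : ball 0 dl" if "norm w < s1" "cmod x <= s1" for w x
  using s''(2)[of w x] that s1 dl by auto
 have bound: "cmod (cc dl is (uu w x)) <= C * K^length is * fact (length is)"
  if w: "norm w < s1" and x: "cmod x <= s1/2" "Im x <= 0" for "is" w x
 proof -
  define A where "A = C * K0^length is * fact (length is)"
  have ws: "norm w < s" using w s1 by simp
  have hu: "hol (ball 0 s) (uu w)" by (rule hol_uu[OF ws])
  have "cmod (cc dl is (uu w x)) <= A * (4/3*(1+2/s1))^length is"
  proof (rule halfdisc_bound[where f="%x. cc dl is (uu w x)" and k="length is" and A=A, OF s1(1)])
   have o: "open {x. cmod x < s1 & Im x < 0}" by (intro open_Collect_conj open_Collect_less continuous_intros)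
   have "hol {x. cmod x < s1 & Im x < 0} (%x. cc dl is (uu w x))"
    by (rule hol_compose[OF bsm_imp_hol[OF bs open_PP[OF dlr] PP_KK] hol_subset[OF hu o]])
     (use s1 in2(2)[OF w] uu_PP[OF ws] in auto)
   then show "(%x. cc dl is (uu w x)) holomorphic_on {x. cmod x < s1 & Im x < 0}" by (simp add: hol_iff_holomorphic_on o)
   show "continuous_on {x. cmod x <= s1 & Im x <= 0} (%x. cc dl is (uu w x))"
    by (rule continuous_on_compose2[OF bsm_continuous_on[OF bs] continuous_on_subset[OF hol_continuous_on[OF hu]]])
     (insert s1 in2(2)[OF w] uu_KK[OF ws], auto simp del: split_paired_All split_paired_Ex)
   show "0 <= A" using C K0 by (simp add: A_def)
   show "cmod (cc dl is (uu w x)) <= A" if x: "cmod x <= s1" "Im x = 0" for x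
   proof -
    have xs: "cmod x < s" using x s1 by simp
    define t where "t = (w,Z w x)"
    have t: "t : M" "rp t = uu w x" using uu_rp[OF ws xs x(2)] by (auto simp: t_def)
    have rb: "rp t : ball 0 dl" using in2(2)[OF w x(1)] t by simp
    have r0: "rp t : ball 0 dl0" using rb dl by simp
    have "cc dl is (uu w x) = dT is (cjv (fst (f t)),f t)" using cc_M[OF B nz dl(2) t(1) rb] t(2) by simp
    then have "cmod (cc dl is (uu w x)) <= CT * KT^length is * fact (length is)"
     using dT_bound[OF f_pdisc(2)[OF t(1) rp_small(2)[OF r0]]] by simp
    also have "... <= A" unfolding A_def using CT KT C by (intro mult_mono power_mono) (auto simp: C_def K0_def)
    finally show ?thesis .
   qed
   show "cmod (cc dl is (uu w x)) * (abs (Im x))^length is <= A" if x: "cmod x <= s1" "Im x < 0" for x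
   proof -
    have xs: "cmod x < s" "(abs (Im x)) <= 1" using x s1 abs_Im_le_cmod[of x] by auto
    have "cmod (cc dl is (uu w x)) * (abs (Im x))^length is <= CA * exp 1 * K1^length is * fact (length is)"
     unfolding K1_def by (rule cc_interior[OF B dl CB CA(2) ws xs(1) x(2) xs(2) in2(1)[OF w x(1)]])
    also have "... <= A" unfolding A_def using CA K1 C by (intro mult_mono power_mono) (auto simp: C_def K0_def)
    finally show ?thesis .
   qed
  qed (use x in auto)
  then show ?thesis unfolding A_def K_def power_mult_distrib by (simp only: mult_ac)
 qed
 show thesis
 proof (rule that[of "s1/2" C K])
  show "uu w x : ball 0 dl" if "norm w < s1/2" "cmod x < s1/2" for w x using in2(2)[of w x] that s1 by simp
  show "cmod (cc dl is (uu w x)) <= C * K^length is * fact (length is)"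
   if "norm w < s1/2" "cmod x < s1/2" "Im x <= 0" for "is" w x using bound[of w x "is"] that s1 by simp
 qed (use s1 C K in auto)
qed

lemma F_hol: "hol P F"
proof -
 have 1: "hol P (%t. fst (F t) $ i)" for i by (rule bsm_imp_hol[OF F_bsm(1) open_P]) (auto simp: P_def K_def simp del: split_paired_All)
 have 2: "hol P (%t. snd (F t))" by (rule bsm_imp_hol[OF F_bsm(2) open_P]) (auto simp: P_def K_def simp del: split_paired_All)
 have "hol P (%t. (fst (F t),snd (F t)))" by (intro hol_Pair hol_vec[OF open_P 1] 2)
 then show ?thesis by simp
qed

lemma F_cont: "continuous_on K F"
proof -
 have "continuous_on K (%t. \<Sum>i\<in>UNIV. axis i (fst (F t) $ i))"
  by (intro continuous_on_sum bounded_linear.continuous_on[OF bounded_linear_axis] bsm_continuous_on[OF F_bsm(1)])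
 then have "continuous_on K (%t. fst (F t))" by (simp flip: vec_eq_sum_axis)
 then have "continuous_on K (%t. (fst (F t),snd (F t)))" by (intro continuous_on_Pair bsm_continuous_on[OF F_bsm(2)])
 then show ?thesis by simp
qed

text \<open>For each list, the slices above \<open>M\<close> carry \<open>dT bs (0,F)\<close>, those
  below its Taylor expansion through \<open>cc\<close> and \<open>aw\<close>. The pasted functions
  depend on \<open>w\<close> without known regularity, which is restored by the Hartogs argument
  from a region above \<open>M\<close> where the formula is jointly holomorphic.\<close>

lemma reflected_function_extends:
 obtains ep C K' where "ep > 0" "C >= 0" "K' >= 0"
  "!!bs. EX ph. hol (ball 0 ep) ph & (ALL t:M Int ball 0 ep. ph t = dT bs (0,f t)) &
   (ALL t:ball 0 ep. cmod (ph t) <= C * K'^length bs * fact (length bs))"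
proof -
 obtain dl CB CA where dl: "0 < dl" "dl <= dl0" and CB: "CB >= 0" and CA: "CA >= 0" and B: "!!i j. bsm True (KK dl) (Bm i j)"
  and nz: "!!u. u : KK dl ==> det (Am u) ~= 0" and CB': "!!u i j. u : KK dl ==> cmod (Bm i j u) <= CB"
  and CA': "!!u. u : KK dl ==> cmod (az u) <= CA"
  using good_radius by blast
 obtain s' Cm Km where s': "s' > 0" "s' <= s" and Cm: "Cm >= 0" and Km: "Km >= 0"
  and indl: "!!w x. norm w < s' ==> cmod x < s' ==> uu w x : ball 0 dl"
  and ccB: "!!is w x. norm w < s' ==> cmod x < s' ==> Im x <= 0 ==> cmod (cc dl is (uu w x)) <= Cm * Km^length is * fact (length is)"
  using slice_bound[OF B nz dl CB CB' CA CA'] by blast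
 have dlr: "dl <= r" using dl dl0 by simp
 note bs = cc_bsm[OF B dlr]
 have bsa: "bsm True (KK dl) (aw i)" for i by (rule bsm_subset[OF bsm_aw KK_sub[OF dlr]])
 \<comment> \<open>The bound for the components \<open>aw\<close> that makes the Taylor ratio at
   most \<open>1/2\<close>. It holds near the origin because \<open>f 0 = 0\<close>.\<close>
 define ep where "ep = 1/(4*(Km+1))/CARD('m)"
 have ep: "ep > 0" "CARD('m) * ep * (2 * Km) <= 1/2"
 proof -
  show "ep > 0" using Km by (simp add: ep_def)
  have "CARD('m) * ep = 1/(4*(Km+1))" by (simp add: ep_def)
  then show "CARD('m) * ep * (2 * Km) <= 1/2" using Km by (simp add: divide_le_eq)
 qed
 have K0: "0 : KK dl" using KK0 dl by (simp add: KK_def)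
 have aw0: "aw i 0 = 0" for i using aw_rp[OF M0, of i] f0 s2 by simp
 have "continuous_on (KK dl) (%u. \<Sum>i\<in>UNIV. cmod (aw i u))" by (intro continuous_intros bsm_continuous_on[OF bsa])
 from cont_near[OF this K0 ep(1)] obtain da where da: "da > 0"
  "!!u. u : KK dl ==> norm u < da ==> dist (\<Sum>i\<in>UNIV. cmod (aw i u)) (\<Sum>i\<in>UNIV. cmod (aw i 0)) < ep" by blast
 have awB: "cmod (aw i u) <= ep" if "u : KK dl" "norm u < da" for i u
 proof -
  have "cmod (aw i u) <= (\<Sum>i\<in>UNIV. cmod (aw i u))" by (rule member_le_sum) auto
  then show ?thesis using da(2)[OF that] aw0 by (simp add: dist_real_def)
 qed
 have "0 : K" using M0 by (simp add: K_def M_def)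
 from cont_near[OF F_cont this, of "rT/2"] rT obtain df where df: "df > 0"
  "!!t. t : K ==> norm t < df ==> dist (F t) (F 0) < rT/2" by auto
 have F0: "F 0 = 0" using F_f[OF M0] f0 by simp
 have FP: "(0,F t) : pdisc2 (rT/2)" if "t : K" "norm t < df" for t
 proof -
  have "norm (F t) < rT/2" using df(2)[OF that] F0 by simp
  then have "cmod (fst (F t) $ i) < rT/2" "cmod (snd (F t)) < rT/2" for i
   using norm_fst_le[of "fst (F t)" "snd (F t)"] norm_snd_le[of "snd (F t)" "fst (F t)"] Finite_Cartesian_Product.norm_nth_le[of "fst (F t)" i] by auto
  then show ?thesis using rT by (simp add: pdisc2_def polydisc_def)
 qed
 have sub: "pdisc2 (rT/2) <= (pdisc2 rT :: ((complex^'m) \<times> 'm cn) set)"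
 proof -
  have "x < rT/2 ==> x < rT" for x using rT by simp
  then show ?thesis by (auto simp: pdisc2_def polydisc_def)
 qed
 have "EX s'>0. ALL w x. norm w < s' --> cmod x < s' --> uu w x : ball 0 (min da df)"
  unfolding uu_def by (rule Zcont) (use da df in simp)
 then obtain sb where sb': "sb > 0" "ALL w x. norm w < sb --> cmod x < sb --> uu w x : ball 0 (min da df)"
  by (elim exE conjE)
 have sb: "sb > 0" "norm w < sb ==> cmod x < sb ==> uu w x : ball 0 (min da df)" for w x
  by (rule sb'(1)) (rule sb'(2)[rule_format])
 define s3 where "s3 = min s' sb"
 have s3: "s3 > 0" "s3 <= s'" "s3 <= sb" "s3 <= s" using s' sb by (auto simp: s3_def)
 define Cf where "Cf = CT+2 * Cm"
 define Kf where "Kf = max KT (2 * Km)"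
 have Cf: "Cf >= 0" "Kf >= 0" using CT Cm KT by (auto simp: Cf_def Kf_def)
 have up: "(w,Z w x) : K" "norm (w,Z w x) < df" "0 < Im x ==> (w,Z w x) : P"
  if w: "norm w < s3" and x: "cmod x < s3" "Im x >= 0" for w x
 proof -
  have ws: "norm w < s" "cmod x < s" using w x s3 by auto
  have N: "(w,Z w x) : N" using XZ[OF ws] by simp
  have ge: "Re (sx ((w,Z w x),cj (w,Z w x))) >= c * Im x" by (rule sgnZ[OF ws x(2)])
  have "c * Im x >= 0" using c x by simp
  then show "(w,Z w x) : K" using ge N by (simp add: K_def)
  show "(w,Z w x) : P" if "0 < Im x"
  proof -
   have "c * Im x > 0" using c that by simp
   then show ?thesis using ge N by (simp add: P_def)
  qed
  have "norm (uu w x) < df" using sb(2)[of w x] w x s3 by simp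
  moreover have "norm (w,Z w x) <= norm (uu w x)" using norm_le_rp[of "(w,Z w x)"] by (simp add: rp_def uu_def)
  ultimately show "norm (w,Z w x) < df" by simp
 qed
 have slice: "EX E. E holomorphic_on ball 0 s3 & (ALL x. cmod x < s3 --> Im x >= 0 --> E x = dT bs (0,F (w,Z w x))) &
   (ALL x. cmod x < s3 --> cmod (E x) <= Cf * Kf^length bs * fact (length bs))" if w: "norm w < s3" for w bs
 proof -
  have ws: "norm w < s" "norm w < s'" using w s3 by auto
  have hu: "hol (ball 0 s) (uu w)" by (rule hol_uu[OF ws(1)])
  define H where "H x = dT bs (0,F (w,Z w x))" for x
  define Up where "Up = {x. cmod x < s3 & Im x > 0}"
  define Lo where "Lo = {x. cmod x < s3 & Im x < 0}"
  have oU: "open Up" "open Lo" unfolding Up_def Lo_def by (intro open_Collect_conj open_Collect_less continuous_intros)+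
  have hZs: "hol (ball 0 s) (%x. (w,Z w x))" using hZ[OF ws(1)] by (intro hol_Pair hol_const) (auto simp: hol_iff_holomorphic_on)
  have inK: "uu w x : KK dl" if "cmod x < s3" "Im x <= 0" for x
   by (rule uu_KK[OF ws(1)]) (use that s3 indl[OF ws(2), of x] in auto)
  have inP: "uu w x : PP dl" if "cmod x < s3" "Im x < 0" for x
   by (rule uu_PP[OF ws(1)]) (use that s3 indl[OF ws(2), of x] in auto)
  have hh: "(%x. g (uu w x)) holomorphic_on Lo" if g: "bsm True (KK dl) g" for g
  proof -
   have "hol Lo (%x. g (uu w x))"
    by (rule hol_compose[OF bsm_imp_hol[OF g open_PP[OF dlr] PP_KK] hol_subset[OF hu oU(2)]]) (insert inP s3, auto simp: Lo_def)
   then show ?thesis using oU by (simp add: hol_iff_holomorphic_on)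
  qed
  have hc: "continuous_on {x. cmod x < s3 & Im x <= 0} (%x. g (uu w x))" if g: "bsm True (KK dl) g" for g
   by (rule continuous_on_compose2[OF bsm_continuous_on[OF g] continuous_on_subset[OF hol_continuous_on[OF hu]]])
    (insert inK s3, auto simp del: split_paired_All split_paired_Ex)
  obtain E where E: "E holomorphic_on ball 0 s3" "!!x. cmod x < s3 ==> Im x >= 0 ==> E x = H x"
   "!!x. cmod x < s3 ==> cmod (E x) <= max (CT * KT^length bs * fact (length bs)) (2 * Cm * (2 * Km)^length bs * fact (length bs))"
  proof (rule slice_extension[where H=H and s=s3 and B="CT * KT^length bs * fact (length bs)" and C=Cm and K=Km and ep=ep and bs=bs
     and c="%is x. cc dl is (uu w x)" and a="%i x. aw i (uu w x)"])
   have "hol Up H" unfolding H_def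
   proof (rule hol_compose[OF dT_hol])
    have "hol Up (%x. F (w,Z w x))"
     by (rule hol_compose[OF F_hol hol_subset[OF hZs oU(1)]]) (insert up(3)[OF w] s3, auto simp: Up_def)
    then show "hol Up (%x. (0,F (w,Z w x)))" by (intro hol_Pair hol_const oU)
    show "(0,F (w,Z w x)) : pdisc2 rT" if "x : Up" for x
     using FP[OF up(1,2)[OF w]] sub that by (auto simp: Up_def)
   qed
   then show "H holomorphic_on {x. cmod x < s3 & 0 < Im x}" using oU by (simp add: hol_iff_holomorphic_on Up_def)
   have cF: "continuous_on {x. cmod x < s3 & 0 <= Im x} (%x. F (w,Z w x))"
    by (rule continuous_on_compose2[OF F_cont continuous_on_subset[OF hol_continuous_on[OF hZs]]])
     (use up(1)[OF w] s3 in auto)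
   show "continuous_on {x. cmod x < s3 & 0 <= Im x} H" unfolding H_def
    by (rule continuous_on_compose2[OF hol_continuous_on[OF dT_hol] continuous_on_Pair[OF continuous_on_const cF]])
     (use FP[OF up(1,2)[OF w]] sub in auto)
   show "cmod (H x) <= CT * KT^length bs * fact (length bs)" if "cmod x < s3" "0 <= Im x" for x
    unfolding H_def by (rule dT_bound[OF FP[OF up(1,2)[OF w that]]])
   show "(%x. cc dl is (uu w x)) holomorphic_on {x. cmod x < s3 & Im x < 0}" for "is" using hh[OF bs] by (simp add: Lo_def)
   show "continuous_on {x. cmod x < s3 & Im x <= 0} (%x. cc dl is (uu w x))" for "is" by (rule hc[OF bs])
   show "(%x. aw i (uu w x)) holomorphic_on {x. cmod x < s3 & Im x < 0}" for i using hh[OF bsa] by (simp add: Lo_def)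
   show "continuous_on {x. cmod x < s3 & Im x <= 0} (%x. aw i (uu w x))" for i by (rule hc[OF bsa])
   show "cmod (cc dl is (uu w x)) <= Cm * Km^length is * fact (length is)" if "cmod x < s3" "Im x <= 0" for "is" x
    by (rule ccB[OF ws(2)]) (use that s3 in auto)
   show "cmod (aw i (uu w x)) <= ep" if "cmod x < s3" "Im x <= 0" for i x
    using awB[OF inK[OF that]] sb(2)[of w x] w that s3 by simp
   show "0 <= Km" "0 <= ep" "CARD('m) * ep * (2 * Km) <= 1/2" using Km ep by auto
   show "(%k. tl_sum (%is. cc dl is (uu w x)) (%i. aw i (uu w x)) k bs/fact k) sums H x" if x: "cmod x < s3" "Im x = 0" for x
   proof -
    have xs: "cmod x < s" "cmod x < s'" using x s3 by auto
    define t where "t = (w,Z w x)"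
    have t: "t : M" "rp t = uu w x" using uu_rp[OF ws(1) xs(1) x(2)] by (auto simp: t_def)
    have rb: "rp t : ball 0 dl" using indl[OF ws(2) xs(2)] t by simp
    have r0: "rp t : ball 0 dl0" using rb dl by simp
    note nt = rp_small[OF r0]
    have cce: "cc dl is (uu w x) = dT is (cjv (fst (f t)),f t)" for "is" using cc_M[OF B nz dl(2) t(1) rb] t(2) by simp
    have awe: "aw i (uu w x) = cjv (fst (f t)) $ i" for i using aw_rp[OF t(1) nt(1)] t(2) by simp
    have "F t = f t" by (rule F_f[OF t(1)])
    then have He: "H x = dT bs (0,f t)" by (simp add: H_def t_def)
    have "f t : polydisc rT" using f_pdisc(1)[OF t(1) nt(2)] by (simp add: pdisc2_def)
    moreover have "cmod (cjv (fst (f t)) $ i) < rT/4" for i using f_small[OF t(1) nt(2)] by (simp add: pdisc2_def)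
    ultimately show ?thesis unfolding cce awe He by (rule dT_taylor)
   qed
  qed blast
  have le: "max (CT * KT^length bs * fact (length bs)) (2 * Cm * (2 * Km)^length bs * fact (length bs)) <= Cf * Kf^length bs * fact (length bs)"
   using CT Cm KT Km Cf by (intro max.boundedI mult_mono power_mono) (auto simp: Cf_def Kf_def)
  show ?thesis using E le order_trans unfolding H_def by blast
 qed
 \<comment> \<open>A choice for each \<open>w\<close> separately, so nothing is known yet about the
   dependence on \<open>w\<close>.\<close>
 define E where "E w bs = (SOME E. E holomorphic_on ball 0 s3 & (ALL x. cmod x < s3 --> Im x >= 0 --> E x = dT bs (0,F (w,Z w x))) &
   (ALL x. cmod x < s3 --> cmod (E x) <= Cf * Kf^length bs * fact (length bs)))" for w bs
 have E: "E w bs holomorphic_on ball 0 s3" "!!x. cmod x < s3 ==> Im x >= 0 ==> E w bs x = dT bs (0,F (w,Z w x))"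
  "!!x. cmod x < s3 ==> cmod (E w bs x) <= Cf * Kf^length bs * fact (length bs)" if "norm w < s3" for w bs
  using someI_ex[OF slice[OF that, of bs]] unfolding E_def[symmetric] by blast+
 \<comment> \<open>The slice coordinate \<open>x\<close> of a point. It is holomorphic in
   \<open>z\<close> for fixed \<open>w\<close>, but involves \<open>cjv w\<close>.\<close>
 define Y where "Y t = X (rp t)" for t
 have rpb: "continuous_on UNIV rp" by (rule linear_continuous_on[OF bounded_linear_rp])
 have oR: "open {t. rp t : ball 0 r}" using open_vimage[OF open_ball rpb, of 0 r] by (simp add: vimage_def)
 have cY: "continuous_on {t. rp t : ball 0 r} Y" unfolding Y_def
  by (rule continuous_on_compose2[OF hol_continuous_on[OF hX] continuous_on_subset[OF rpb]]) auto
 have Y0: "Y 0 = 0" by (simp add: Y_def X0)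
 have R0: "0 : {t. rp t : ball 0 r}" using r by simp
 from cont_near[OF cY R0 s3(1)] obtain dY where dY: "dY > 0" "!!t. rp t : ball 0 r ==> norm t < dY ==> cmod (Y t) < s3"
  unfolding Y0 by (auto simp del: split_paired_All)
 define s4 where "s4 = min (min s2 s3) (dY/2)"
 have s4: "s4 > 0" "s4 <= s2" "s4 <= s3" using s2 s3 dY by (auto simp: s4_def)
 have inv: "rp (w,z) : ball 0 r" "cmod (Y (w,z)) < s3" "Z w (Y (w,z)) = z" "sx ((w,z),cj (w,z)) = 0 ==> Im (Y (w,z)) = 0"
  if w: "norm w < s4" and z: "cmod z < s4" for w z
 proof -
  have *: "norm w < s2" "cmod z < s2" using w z s4 by auto
  note zx = ZX[OF *]
  show 1: "rp (w,z) : ball 0 r" using zx by (simp add: rp_def)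
  have "norm (w,z) < dY" using norm_Pair_le_add[of w z] w z by (simp add: s4_def)
  then show "cmod (Y (w,z)) < s3" by (rule dY(2)[OF 1])
  show "Z w (Y (w,z)) = z" "sx ((w,z),cj (w,z)) = 0 ==> Im (Y (w,z)) = 0" using zx by (auto simp: Y_def rp_def)
 qed
 have "EX s'>0. ALL w x. norm w < s' --> cmod x < s' --> (w,(cjv w,Z w x)) : ball 0 (s4/8)"
  by (rule Zcont) (use s4 in simp)
 then obtain s5 where s5: "s5 > 0" "ALL w x. norm w < s5 --> cmod x < s5 --> (w,(cjv w,Z w x)) : ball 0 (s4/8)"
  by (elim exE conjE)
 \<comment> \<open>A base point strictly above the real axis, chosen so close that \<open>z0\<close>
   has modulus below \<open>s4/8\<close>.\<close>
 define x0 where "x0 = Complex 0 (min s5 s/2)"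
 have x0: "Im x0 > 0" "cmod x0 < s5" "cmod x0 < s" using s5 s by (auto simp: x0_def cmod_def)
 define z0 where "z0 = Z 0 x0"
 have z0: "cmod z0 < s4/8"
 proof -
  have "norm (0 :: complex^'m,(cjv 0,Z 0 x0)) < s4/8" using s5(2)[rule_format, of 0 x0] s5(1) x0 by simp
  then show ?thesis by (simp add: z0_def norm_Pair)
 qed
 have Yz0: "Y (0,z0) = x0" using XZ[of 0 x0] x0 s by (simp add: Y_def rp_def z0_def)
 define W where "W = {t. rp t : ball 0 r} Int Y -` {x. Im x > 0}"
 have oW: "open W" unfolding W_def
  by (rule continuous_open_preimage[OF cY oR]) (intro open_Collect_less continuous_intros)
 have "(0,z0) : W" using inv(1)[of 0 z0] s4 z0 Yz0 x0 by (simp add: W_def)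
 then obtain et where et: "et > 0" "ball (0,z0) et <= W" using oW open_contains_ball by blast
 define e where "e = min (et/2) s4"
 have e: "e > 0" "e <= s4" using et s4 by (auto simp: e_def)
 have inW: "(w,z) : W" if "w : ball 0 e" "z : ball z0 e" for w z
 proof -
  have "norm w < et/2" "cmod (z-z0) < et/2" using that by (auto simp: e_def dist_norm norm_minus_commute)
  then have "norm ((w,z)-(0,z0)) < et" using norm_Pair_le_add[of w "z-z0"] by simp
  then have "(w,z) : ball (0,z0) et" unfolding mem_ball dist_commute[of "(0,z0)"] by (simp only: dist_norm)
  then show ?thesis using et by blast
 qed
 define e' where "e' = min e (s4/8)"
 have e': "e' > 0" "e' <= e" using e s4 by (auto simp: e'_def)
 have zs: "cmod z < s4" if "z : ball z0 (s4/2)" for z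
  using that z0 s4(1) norm_triangle_ineq[of z0 "z-z0"] by (simp add: dist_norm norm_minus_commute)
 define g where "g bs t = E (fst t) bs (Y t)" for bs t
 have inP: "(w,z) : P" "norm (w,z) < df" "g bs (w,z) = dT bs (0,F (w,z))"
  if w: "w : ball 0 e" and z: "z : ball z0 e'" for w z bs
 proof -
  have ze: "z : ball z0 e" "cmod z < s4" using z e' zs[of z] s4 by (auto simp: e'_def)
  have w4: "norm w < s4" using w e by simp
  note i = inv[OF w4 ze(2)]
  have "Im (Y (w,z)) > 0" using inW[OF w ze(1)] by (simp add: W_def)
  with up[of w "Y (w,z)"] i w4 s4 show "(w,z) : P" "norm (w,z) < df" by auto
  show "g bs (w,z) = dT bs (0,F (w,z))"
   using E(2)[of w "Y (w,z)" bs] i w4 s4 \<open>Im (Y (w, z)) > 0\<close> by (simp add: g_def)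
 qed
 \<comment> \<open>The slices exist on the disc of radius \<open>s4/2\<close> about
   \<open>z0\<close>; a quarter of it, \<open>s4/8\<close>, still contains the origin.\<close>
 have hg: "hol (ball 0 e \<times> ball z0 (s4/2/4)) (g bs)" for bs
 proof (rule hartogs_slices[where e=e' and G="%t. dT bs (0,F t)" and B="Cf * Kf^length bs * fact (length bs)"])
  have oo: "open (ball (0 :: complex^'m) e \<times> ball z0 e')" by (intro open_Times open_ball)
  have sP: "ball 0 e \<times> ball z0 e' <= P" using inP(1) by blast
  have "hol (ball 0 e \<times> ball z0 e') (%t. (0 :: complex^'m,F t))"
   by (intro hol_Pair hol_const oo hol_subset[OF F_hol oo sP])
  then show "hol (ball 0 e \<times> ball z0 e') (%t. dT bs (0,F t))"
  proof (rule hol_compose[OF dT_hol])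
   fix t assume t: "t : ball (0 :: complex^'m) e \<times> ball z0 e'"
   then have "t : K" "norm t < df" using inP(1,2)[of "fst t" "snd t"] by (auto simp: mem_Times_iff P_def K_def)
   then show "(0,F t) : pdisc2 rT" using FP sub by blast
  qed
  fix w :: "complex^'m" assume "w : ball 0 e"
  then have w: "norm w < s4" "norm w < s3" using e s4 by auto
  show "(%z. g bs (w,z)) holomorphic_on ball z0 (s4/2)"
  proof -
   have "hol (ball z0 (s4/2)) (%z. Y (w,z))" unfolding Y_def
    by (rule hol_compose[OF hX]) (insert inv(1)[OF w(1) zs], auto simp: rp_def intro!: hol_Pair)
   then have hY: "(%z. Y (w,z)) holomorphic_on ball z0 (s4/2)" by (simp add: hol_iff_holomorphic_on)
   have "(E w bs \<circ> (%z. Y (w,z))) holomorphic_on ball z0 (s4/2)"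
    by (rule holomorphic_on_compose_gen[OF hY E(1)[OF w(2)]]) (use inv(2)[OF w(1) zs] in auto)
   then show ?thesis by (simp add: g_def o_def)
  qed
  show "cmod (g bs (w,z)) <= Cf * Kf^length bs * fact (length bs)" if "z : ball z0 (s4/2)" for z
   using E(3)[OF w(2), of "Y (w,z)" bs] inv(2)[OF w(1) zs[OF that]] by (simp add: g_def)
  show "g bs (w,z) = dT bs (0,F (w,z))" if "z : ball z0 e'" for z
   by (rule inP(3)[OF \<open>w \<in> ball 0 e\<close> that])
 qed (use e' s4 in auto)
 define ep1 where "ep1 = min e (s4/8-cmod z0)"
 have ep1: "ep1 > 0" using e z0 by (simp add: ep1_def)
 have inB: "fst t : ball 0 e" "snd t : ball z0 (s4/2/4)" "norm (fst t) < s4" "cmod (snd t) < s4" if "t : ball 0 ep1" for t :: "'m cn"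
 proof -
  have n: "norm (fst t) < ep1" "cmod (snd t) < ep1"
   using that norm_fst_le[of "fst t" "snd t"] norm_snd_le[of "snd t" "fst t"] by auto
  then show "fst t : ball 0 e" "norm (fst t) < s4" "cmod (snd t) < s4" using e by (auto simp: ep1_def)
  show "snd t : ball z0 (s4/2/4)" using n norm_triangle_ineq4[of z0 "snd t"] by (simp add: ep1_def dist_norm)
 qed
 show thesis
 proof (rule that[of ep1 Cf Kf])
  fix bs
  show "EX ph. hol (ball 0 ep1) ph & (ALL t:M Int ball 0 ep1. ph t = dT bs (0,f t)) &
   (ALL t:ball 0 ep1. cmod (ph t) <= Cf * Kf^length bs * fact (length bs))"
  proof (intro exI[of _ "g bs"] conjI ballI)
   show "hol (ball 0 ep1) (g bs)" by (rule hol_subset[OF hg]) (insert inB(1,2), auto simp: mem_Times_iff simp del: split_paired_All)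
   fix t :: "'m cn" assume "t : ball 0 ep1"
   then have t: "norm (fst t) < s4" "cmod (snd t) < s4" "norm (fst t) < s3" using inB[of t] s4 by auto
   show "cmod (g bs t) <= Cf * Kf^length bs * fact (length bs)"
    using E(3)[OF t(3), of "Y t" bs] inv(2)[OF t(1,2)] by (simp add: g_def)
  next
   fix t :: "'m cn" assume t': "t : M Int ball 0 ep1"
   then have t: "norm (fst t) < s4" "cmod (snd t) < s4" "norm (fst t) < s3" using inB[of t] s4 by auto
   have "sx ((fst t,snd t),cj (fst t,snd t)) = 0" using t' by (simp add: M_def)
   with inv[OF t(1,2)] have "Im (Y t) = 0" "cmod (Y t) < s3" "Z (fst t) (Y t) = snd t" by auto
   then have "g bs t = dT bs (0,F t)" using E(2)[OF t(3), of "Y t" bs] by (simp add: g_def)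
   then show "g bs t = dT bs (0,f t)" using F_f t' by simp
  qed
 qed (use ep1 Cf in auto)
qed

end

section \<open>Real coordinates, multi-indices and the passage to charts\<close>

lemma linear_cn_real_sum:
 fixes L :: "'m::finite cn => complex"
 assumes "linear L"
 shows "L x = (\<Sum>i\<in>UNIV. of_real (Re (fst x $ i)) * L (axis i 1,0) + of_real (Im (fst x $ i)) * L (axis i \<i>,0))
  + (of_real (Re (snd x)) * L (0,1) + of_real (Im (snd x)) * L (0,\<i>))"
proof -
 have "x = (\<Sum>i\<in>UNIV. Re (fst x $ i) *R (axis i 1,0)+Im (fst x $ i) *R (axis i \<i>,0))+(Re (snd x) *R (0,1)+Im (snd x) *R (0,\<i>))"
  by (simp add: prod_eq_iff fst_sum snd_sum vec_eq_iff axis_def if_distrib sum.distrib complex_eq_iff cong: if_cong)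
 then have "L x = L ((\<Sum>i\<in>UNIV. Re (fst x $ i) *R (axis i 1,0)+Im (fst x $ i) *R (axis i \<i>,0))+(Re (snd x) *R (0,1)+Im (snd x) *R (0,\<i>)))"
  by (rule arg_cong)
 then show ?thesis
  by (simp only: linear_add[OF assms] linear_sum[OF assms] linear_scale[OF assms] scaleR_conv_of_real)
qed

lemma bsm_Re_Im: "bsm False S f ==> bsm False S (%x. of_real (Re (f x)))" "bsm False S f ==> bsm False S (%x. of_real (Im (f x)))"
proof -
 assume f: "bsm False S f"
 have "bsm False S (%x. (1/2)*(f x+cnj (f x)))" "bsm False S (%x. (- \<i>/2)*(f x-cnj (f x)))"
  by (intro bsm_mult bsm_const bsm_add bsm_diff f bsm_cnj)+
 moreover have "(1/2)*(z+cnj z) = of_real (Re z)" "(- \<i>/2)*(z-cnj z) = of_real (Im z)" for z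
  by (simp_all add: complex_eq_iff)
 ultimately show "bsm False S (%x. of_real (Re (f x)))" "bsm False S (%x. of_real (Im (f x)))" by simp_all
qed

lemma has_derivative_cnI:
 fixes q :: "'a::real_normed_vector => 'm::finite cn"
 assumes "!!i. ((%t. fst (q t) $ i) has_derivative (%v. fst (q' v) $ i)) (at x within S)" "((%t. snd (q t)) has_derivative (%v. snd (q' v))) (at x within S)"
 shows "(q has_derivative q') (at x within S)"
proof -
 have "((%t. (fst (q t),snd (q t))) has_derivative (%v. (fst (q' v),snd (q' v)))) (at x within S)"
  by (rule has_derivative_Pair[OF has_derivative_vecI assms(2)]) (rule assms(1))
 then show ?thesis by simp
qed

lemma bsm_compose_components:
 fixes q :: "'a::cvec => 'm::finite cn"
 assumes A: "open A" and q: "!!i. bsm False A (%t. fst (q t) $ i)" "bsm False A (%t. snd (q t))"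
  and qB: "!!x. x : A ==> q x : B" and g: "bsm False B g"
 shows "bsm False A (%x. g (q x))"
proof -
 define q' where "q' v y = ((\<chi> i. fd (%t. fst (q t) $ i) y v),fd (%t. snd (q t)) y v)" for v y
 define l :: "'m option \<times> bool => 'm cn => complex" where "l j u = (case j of (None,b) => of_real (if b then Re (snd u) else Im (snd u)) | (Some i,b) => of_real (if b then Re (vec_nth (fst u) i) else Im (vec_nth (fst u) i)))"
  for j u
 define e :: "'m option \<times> bool => 'm cn" where "e j = (case j of (None,b) => (0,if b then 1 else \<i>) | (Some i,b) => (axis i (if b then 1 else \<i>),0))" for j
 show ?thesis
 proof (rule bsm_compose[where I="UNIV :: ('m option \<times> bool) set" and T=B and q=q and l=l and e=e and q'=q'])
  fix L :: "'m cn => complex" and u assume "linear L"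
  have "(\<Sum>j\<in>UNIV. l j u * L (e j)) = (\<Sum>o'\<in>UNIV. \<Sum>b\<in>UNIV. l (o',b) u * L (e (o',b)))"
   by (simp add: sum.cartesian_product flip: UNIV_Times_UNIV)
  also have "... = L u" unfolding linear_cn_real_sum[OF \<open>linear L\<close>, of u]
   by (simp add: UNIV_bool UNIV_option_conv sum.reindex l_def e_def add_ac)
  finally show "L u = (\<Sum>j\<in>UNIV. l j u * L (e j))" by simp
 next
  fix y assume y: "y : A"
  show "(q has_derivative (%v. q' v y)) (at y within A)"
   by (rule has_derivative_at_withinI, rule has_derivative_cnI)
    (insert bsm_open(1)[OF A q(1) y] bsm_open(1)[OF A q(2) y], simp_all add: q'_def)
  show "q y : B" by (rule qB[OF y])
 next
  fix v and j :: "'m option \<times> bool"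
  show "bsm False A (%y. l j (q' v y))"
  proof (cases j)
   case (Pair o' b)
   then show ?thesis
    by (cases o'; cases b) (auto simp: l_def q'_def intro!: bsm_Re_Im bsm_open(2)[OF A] q)
  qed
 qed (use g in auto)
qed

lemma smooth_on_has_derivative:
 assumes "smooth_on U f" "x : U" shows "(f has_derivative frechet_derivative f (at x)) (at x)"
proof -
 have "Ck (Suc 0) U f" using assms(1) unfolding smooth_on_def by blast
 then show ?thesis using assms(2) by (simp add: frechet_derivative_works[symmetric])
qed

lemma fact_sum_le: "finite A ==> fact (\<Sum>i\<in>A. bt i) <= ((2^card A)^(\<Sum>i\<in>A. bt i)*(\<Prod>i\<in>A. fact (bt i)) :: real)"
proof (induction A rule: finite_induct)
 case (insert a A)
 define S where "S = (\<Sum>i\<in>A. bt i)"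
 define p where "p = (\<Prod>i\<in>A. fact (bt i) :: real)"
 have p: "p >= 0" by (auto simp: p_def intro: prod_nonneg)
 have "fact (bt a+S) <= (2^(bt a+S)*(fact (bt a) * fact S) :: real)" by (rule fact_add_le)
 also have "... <= 2^(bt a+S)*(fact (bt a)*((2^card A)^S * p))"
  using insert.IH by (intro mult_left_mono) (auto simp: S_def p_def)
 also have "... <= 2^(bt a+S)*(fact (bt a)*((2^card A)^(bt a+S) * p))"
  using p by (intro mult_left_mono mult_right_mono power_increasing) auto
 also have "... = (2^Suc (card A))^(bt a+S)*(fact (bt a) * p)"
  by (simp add: power_mult_distrib)
 finally show ?case using insert.hyps by (simp add: S_def p_def)
qed simp

text \<open>The estimates run over lists of directions; any list with the prescribed counts
  represents the multi-index.\<close>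

lemma list_with_count:
 fixes bt :: "'m::finite => nat"
 obtains bs where "count_list bs = bt" "length bs = mlen bt"
proof -
 have rep: "count_list (replicate n a) i = (if i = a then n else 0)" for n and a i :: 'm
  by (induction n) auto
 have "EX bs. (ALL i. count_list bs i = (if i : A then bt i else 0)) & length bs = (\<Sum>i\<in>A. bt i)" if "finite A" for A
  using that
 proof (induction A rule: finite_induct)
  case (insert a A)
  then obtain bs where "ALL i. count_list bs i = (if i : A then bt i else 0)" "length bs = (\<Sum>i\<in>A. bt i)" by blast
  then show ?case using insert.hyps
   by (intro exI[of _ "replicate (bt a) a @ bs"]) (auto simp: count_list_append rep)
 qed (auto intro: exI[of _ "[]"])
 from this[of UNIV] that show thesis by (auto simp: mlen_def fun_eq_iff)
qed

lemma has_derivative_hol_comp: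
 fixes G :: "'m::finite cn => 'm cn"
 assumes "holo_map S G" "x : S"
 obtains G' where "(G has_derivative G') (at x)" "clin G'" "!!v i. fst (G' v) $ i = ldv (%x. fst (G x) $ i) x v"
  "!!v. snd (G' v) = ldv (%x. snd (G x)) x v"
proof -
 have h: "hol S (%x. fst (G x) $ i)" "hol S (%x. snd (G x))" for i
  using assms(1) by (auto simp: holo_map_def holo_fun_iff_hol)
 define G' where "G' v = ((\<chi> i. ldv (%x. fst (G x) $ i) x v),ldv (%x. snd (G x)) x v)" for v
 have "(G has_derivative G') (at x)"
  by (rule has_derivative_cnI) (insert hol_derivL[OF h(1) assms(2)] hol_derivL[OF h(2) assms(2)], simp_all add: G'_def)
 moreover have "clin G'" unfolding clin_def
  using ldv_cs[OF hol_imp_ghol[OF h(1)] assms(2)] ldv_cs[OF hol_imp_ghol[OF h(2)] assms(2)]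
  by (simp add: G'_def prod_eq_iff vec_eq_iff)
 ultimately show thesis by (rule that) (simp_all add: G'_def)
qed

text \<open>Every \<open>u\<close> differs from a complex tangent vector by a multiple of
  \<open>ez\<close>, so the equation on complex tangent vectors determines \<open>wb u\<close> from
  \<open>wb ez\<close>.\<close>

lemma (in hat) crfI:
 assumes g: "bsm False N g"
  and lin: "!!t v. t : M ==> fd rh t v = 0 ==> fd rh t (cs \<i> v) = 0 ==> fd g t (cs \<i> v) = \<i> * fd g t v"
 shows "crf g"
 unfolding crf_def
proof (intro conjI ballI allI g)
 fix t u assume t: "t : M"
 then have tN: "t : N" by (simp add: M_def)
 note nz = wb_ez_rho[OF tN]
 define z where "z = cnj (wb u rh t/wb ez rh t)"
 define v where "v = u-cs z ez"
 have wbv: "wb v f t = wb u f t-cnj z * wb ez f t" if f: "bsm False N f" for f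
 proof -
  have "linear (frechet_derivative f (at t))" by (rule fd_linear[OF open_N f tN])
  then have "wb v f t = wb u f t-wb (cs z ez) f t"
   by (simp add: wb_def v_def linear_diff cs.diff_right algebra_simps diff_divide_distrib)
  then show ?thesis using wb_cs[OF open_N f tN] by simp
 qed
 have "wb v rh t = 0" using wbv[OF rho_bsm'] nz by (simp add: z_def)
 then have "fd rh t v+\<i> * fd rh t (cs \<i> v) = 0" by (simp add: wb_def)
 then have "fd rh t v = 0" "fd rh t (cs \<i> v) = 0"
  using fd_rho_real[OF tN, of v] fd_rho_real[OF tN, of "cs \<i> v"] by (auto simp: complex_eq_iff)
 from lin[OF t this] have "wb v g t = 0" by (simp add: wb_def)
 then have "wb u g t = cnj z * wb ez g t" using wbv[OF g] by simp
 then show "wb u g t * wb ez rh t = wb ez g t * wb u rh t" using nz by (simp add: z_def)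
qed

theorem theorem1p8:
  fixes M M' :: "'m::finite cn set"
    and h :: "'m cn \<Rightarrow> 'm cn"
    and p :: "'m cn"
    and \<Phi> :: "'m cn \<Rightarrow> 'm cn" and V' :: "'m cn set"
    and \<Theta> :: "('m \<Rightarrow> nat) \<Rightarrow> 'm cn \<Rightarrow> complex" and r' :: real
  assumes M_hyp: "real_analytic_hypersurface M" and M_conn: "connected M"
    and M'_hyp: "real_analytic_hypersurface M'" and M'_conn: "connected M'"
    and h_CR: "CR_diffeo M M' h"
    and pM: "p \<in> M"
    and minimal: "minimal_at M p"
    \<comment> \<open>holomorphic coordinates t' = \<Phi>(x) = (w',z') vanishing at p' = h p\<close>
    and coords: "biholo V' \<Phi>" and pV': "h p \<in> V'" and Phi0: "\<Phi> (h p) = 0"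
    \<comment> \<open>the power series \<Theta>' = sum over beta of (conj w')^beta \<Theta>'_beta(t'): vanishes at 0 and
        converges normally in the polydisc of radius 4r'\<close>
    and r'_pos: "r' > 0"
    and Theta_holo: "\<And>\<beta>. holo_fun (polydisc (4 * r')) (\<Theta> \<beta>)"
    and Theta_normal: "\<And>\<rho>. 0 < \<rho> \<Longrightarrow> \<rho> < 4 * r' \<Longrightarrow>
          (\<lambda>\<beta>. \<rho> ^ mlen \<beta> * (SUP t\<in>cpolydisc \<rho>. cmod (\<Theta> \<beta> t))) summable_on UNIV"
    and Theta_zero: "\<Theta> (\<lambda>_. 0) 0 = 0"
    \<comment> \<open>M' is given near p' by conj z' = \<Theta>'(conj w', t')\<close>
    and coords_small: "\<Phi> ` V' \<subseteq> polydisc r'"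
    and M'_eq: "\<And>x. x \<in> V' \<Longrightarrow>
          (x \<in> M' \<longleftrightarrow> cnj (snd (\<Phi> x)) =
             (\<Sum>\<^sub>\<infinity>\<beta>. mpow (\<chi> i. cnj (fst (\<Phi> x) $ i)) \<beta> * \<Theta> \<beta> (\<Phi> x)))"
  shows "\<exists>U C. open U \<and> p \<in> U \<and> C > 0 \<and> (\<forall>t\<in>M \<inter> U. h t \<in> V') \<and>
           (\<forall>\<beta>. \<exists>\<phi>. holo_fun U \<phi> \<and>
                 (\<forall>t\<in>M \<inter> U. \<phi> t = \<Theta> \<beta> (\<Phi> (h t))) \<and>
                 (\<forall>t\<in>U. cmod (\<phi> t) \<le> C ^ (mlen \<beta> + 1)))"
proof -
 have bij: "bij_betw h M M'" and CR: "CR_map M h" and smi: "smooth_on_set M' (inv_into M h)"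
  using h_CR by (auto simp: CR_diffeo_def)
 have hpM': "h p : M'" using bij pM by (auto simp: bij_betw_def)
 obtain W H where WH: "open W" "p : W" "smooth_on W H" "ALL x:M Int W. H x = h x"
  using CR pM unfolding CR_map_def smooth_on_set_def by blast
 obtain W2 G where WG: "open W2" "h p : W2" "smooth_on W2 G" "ALL y:M' Int W2. G y = inv_into M h y"
  using smi hpM' unfolding smooth_on_set_def by blast
 have oV': "open V'" and h\<Phi>: "holo_map V' \<Phi>" and inj\<Phi>: "inj_on \<Phi> V'" and h\<Phi>i: "holo_map (\<Phi> ` V') (inv_into V' \<Phi>)"
  using coords by (auto simp: biholo_def)
 have HD: "x : W ==> (H has_derivative frechet_derivative H (at x)) (at x)" for x
  by (rule smooth_on_has_derivative[OF WH(3)])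
 have cH: "continuous_on W H" using HD has_derivative_continuous by (blast intro: continuous_at_imp_continuous_on)
 \<comment> \<open>Small enough that \<open>H\<close>, the coordinates of the target and the smooth
   extension \<open>G\<close> of the inverse map are all available on the chart.\<close>
 define V0 where "V0 = W Int H -` (V' Int W2)"
 have oV0: "open V0" unfolding V0_def by (rule continuous_open_preimage[OF cH WH(1)]) (intro open_Int oV' WG(1))
 have Hp: "H p = h p" using WH(2,4) pM by blast
 have pV0: "p : V0" using WH(2) pV' WG(2) Hp by (simp add: V0_def)
 show ?thesis
 proof (rule disc_chart[OF M_hyp pM oV0 pV0 minimal])
  fix k :: 'm and R d d1 and Xi :: "'m cn => 'm cn" and sx and V1 :: "'m cn set" and Ps :: "'m cn => 'm cn"
  assume hat: "hat k R d d1 (%t. sx (t,cj t))" and cx: "real_cx (hbox k R d d1) sx" and hXi: "hol (hbox k R d d1) Xi" and Xi0: "Xi 0 = p"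
   and XiM: "ALL t:hbox k R d d1. Xi t : V0 & (Xi t : M \<longleftrightarrow> sx (t,cj t) = 0)"
   and V1: "open V1" "p : V1" and hPs: "hol V1 Ps" and Psp: "Ps p = 0" and inv: "ALL x:V1. Ps x : hbox k R d d1 & Xi (Ps x) = x"
  interpret ht: hat k R d d1 "%t. sx (t,cj t)" by (rule hat)
  note NN = ht.N_def[symmetric]
  note cx = cx[unfolded NN] and hXi = hXi[unfolded NN] and XiM = XiM[unfolded NN] and inv = inv[unfolded NN]
  define f where "f t = \<Phi> (H (Xi t))" for t
  have XiW: "Xi t : W" "H (Xi t) : V'" "H (Xi t) : W2" if "t : ht.N" for t
   using XiM that by (auto simp: V0_def simp del: split_paired_All)
  have M_in: "t : ht.N" "Xi t : M" "H (Xi t) = h (Xi t)" if "t : ht.M" for t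
  proof -
   show N: "t : ht.N" using that by (simp add: ht.M_def)
   show m: "Xi t : M" using XiM N that by (simp add: ht.M_def)
   show "H (Xi t) = h (Xi t)" using WH(4) m XiW(1)[OF N] by blast
  qed
  have N0: "0 : ht.N" using inv V1(2) Psp by metis
  have "sx (0,cj 0) = 0" using XiM N0 Xi0 pM by metis
  then have M0: "0 : ht.M" using N0 by (simp add: ht.M_def)
  have f0: "f 0 = 0" by (simp add: f_def Xi0 Hp Phi0)
  have h\<Phi>c: "hol V' (%x. fst (\<Phi> x) $ i)" "hol V' (%x. snd (\<Phi> x))" for i
   using h\<Phi> by (auto simp: holo_map_def holo_fun_iff_hol)
  have bl: "bounded_linear (%x :: 'm cn. fst x $ i)" for i
   by (rule bounded_linear_compose[OF bounded_linear_vec_nth bounded_linear_fst])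
  have bXi: "bsm False ht.N (%t. fst (Xi t) $ i)" "bsm False ht.N (%t. snd (Xi t))" for i
   by (intro hol_imp_bsm hol_nth hol_fst hol_snd hXi)+
  have bHXi: "bsm False ht.N (%t. fst (H (Xi t)) $ i)" "bsm False ht.N (%t. snd (H (Xi t)))" for i
   by (rule bsm_compose_components[OF ht.open_N bXi XiW(1) smooth_on_imp_bsm[OF WH(3) bl]], assumption,
     rule bsm_compose_components[OF ht.open_N bXi XiW(1) smooth_on_imp_bsm[OF WH(3) bounded_linear_snd]], assumption)
  have bf: "bsm False ht.N (%t. fst (f t) $ i)" "bsm False ht.N (%t. snd (f t))" for i
   unfolding f_def
   by (rule bsm_compose_components[OF ht.open_N bHXi XiW(2) hol_imp_bsm[OF h\<Phi>c(1)]], assumption,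
     rule bsm_compose_components[OF ht.open_N bHXi XiW(2) hol_imp_bsm[OF h\<Phi>c(2)]], assumption)
  \<comment> \<open>Complex tangent vectors of the model are carried by \<open>Xi\<close> to vectors
    that are tangent to \<open>M\<close> together with their multiple by \<open>\<i>\<close>, as
    curves in \<open>M\<close> show. There the CR condition applies to \<open>H\<close>, while
    \<open>Xi\<close> and \<open>\<Phi>\<close> have complex linear derivatives.\<close>
  have chain: "fd (%t. fst (f t) $ i) t (cs \<i> v) = \<i> * fd (%t. fst (f t) $ i) t v & fd (%t. snd (f t)) t (cs \<i> v) = \<i> * fd (%t. snd (f t)) t v"
   if t: "t : ht.M" and v: "fd (%t. sx (t,cj t)) t v = 0" "fd (%t. sx (t,cj t)) t (cs \<i> v) = 0" for t v i
  proof -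
   note m = M_in[OF t]
   define Xi' where "Xi' = frechet_derivative Xi (at t)"
   have Xi': "(Xi has_derivative Xi') (at t)" "clin Xi'" unfolding Xi'_def using hol_deriv[OF hXi m(1)] by auto
   define H' where "H' = frechet_derivative H (at (Xi t))"
   have H': "(H has_derivative H') (at (Xi t))" unfolding H'_def by (rule HD[OF XiW(1)[OF m(1)]])
   obtain \<Phi>' where \<Phi>': "(\<Phi> has_derivative \<Phi>') (at (H (Xi t)))" "clin \<Phi>'"
    using has_derivative_hol_comp[OF h\<Phi> XiW(2)[OF m(1)]] by metis
   have fD: "(f has_derivative (%v. \<Phi>' (H' (Xi' v)))) (at t)" unfolding f_def
    by (rule has_derivative_compose[where f="%t. H (Xi t)" and g=\<Phi>, OF has_derivative_compose[where f=Xi and g=H, OF Xi'(1) H'] \<Phi>'(1)])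
   have fdi: "fd (%t. fst (f t) $ i) t w = fst (\<Phi>' (H' (Xi' w))) $ i" "fd (%t. snd (f t)) t w = snd (\<Phi>' (H' (Xi' w)))" for w
    using frechet_derivative_at[OF bounded_linear.has_derivative[OF bl fD]] frechet_derivative_at[OF has_derivative_snd[OF fD]] by metis+
   have tang: "Xi' w : tangent_space M (Xi t)" if w: "fd (%t. sx (t,cj t)) t w = 0" for w
   proof -
    obtain ga e where ga: "e > 0" "!!s. s : {-e<..<e} ==> ga s : ht.M" "ga 0 = t" "(ga has_vector_derivative w) (at (0::real))"
     using ht.tangent_curve[OF t w] by blast
    have "((%s. Xi (ga s)) has_derivative (%h. Xi' (h *R w))) (at 0)"
     by (rule has_derivative_compose[where f=ga and g=Xi]) (insert ga(3,4) Xi'(1), simp_all add: has_vector_derivative_def)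
    then have "((%s. Xi (ga s)) has_vector_derivative Xi' w) (at 0)"
     by (simp add: has_vector_derivative_def linear_scale[OF has_derivative_linear[OF Xi'(1)]])
    moreover have "ALL s:{-e<..<e}. Xi (ga s) : M" using ga(2) M_in(2) by blast
    ultimately show ?thesis unfolding tangent_space_def mem_Collect_eq using ga(1,3)
     by (intro exI[of _ "%s. Xi (ga s)"] exI[of _ e] conjI) simp_all
   qed
   have Jc: "Jc x = cs \<i> x" for x :: "'m cn" by (simp add: Jc_def cmul_eq_cs)
   have t1: "Xi' v : tangent_space M (Xi t)" by (rule tang[OF v(1)])
   have t2: "Jc (Xi' v) : tangent_space M (Xi t)" using tang[OF v(2)] by (simp add: Jc clinD[OF Xi'(2)])
   have "ALL v. v : tangent_space M (Xi t) & Jc v : tangent_space M (Xi t) -->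
     frechet_derivative H (at (Xi t)) (Jc v) = Jc (frechet_derivative H (at (Xi t)) v)"
    using CR m(2) WH(1,3,4) XiW(1)[OF m(1)] unfolding CR_map_def by blast
   then have "H' (cs \<i> (Xi' v)) = cs \<i> (H' (Xi' v))" using t1 t2 unfolding H'_def Jc by blast
   then show ?thesis by (simp add: fdi clinD[OF Xi'(2)] clinD[OF \<Phi>'(2)])
  qed
  have crf: "ht.crf (%t. fst (f t) $ i)" "ht.crf (%t. snd (f t))" for i
   by (rule ht.crfI[OF bf(1)], use chain in blast) (rule ht.crfI[OF bf(2)], use chain in blast)
  have "EX F. bsm True ht.K F & (ALL t:ht.M. F t = fst (f t) $ i)" for i
   by (rule ht.CR_extension[OF crf(1)[of i]]) blast
  then have "ALL i. EX F. bsm True ht.K F & (ALL t:ht.M. F t = fst (f t) $ i)" by (rule allI)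
  from choice[OF this] obtain Fw where Fw': "ALL i. bsm True ht.K (Fw i) & (ALL t:ht.M. Fw i t = fst (f t) $ i)" by (elim exE)
  have Fw: "bsm True ht.K (Fw i)" "t : ht.M ==> Fw i t = fst (f t) $ i" for i t using Fw' by blast+
  obtain Fz where Fz: "bsm True ht.K Fz" "!!t. t : ht.M ==> Fz t = snd (f t)"
   by (rule ht.CR_extension[OF crf(2)]) blast
  define F where "F t = ((\<chi> i. Fw i t),Fz t)" for t
  have F: "bsm True ht.K (%t. fst (F t) $ i)" "bsm True ht.K (%t. snd (F t))" for i using Fw(1) Fz(1) by (simp_all add: F_def)
  have Ff: "F t = f t" if "t : ht.M" for t using Fw(2)[OF that] Fz(2)[OF that] by (simp add: F_def prod_eq_iff vec_eq_iff)
  \<comment> \<open>Radius \<open>2 * r'\<close> is below the radius of convergence and makes the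
    derivative bounds hold on polydiscs of radius \<open>r'\<close>.\<close>
  have r2: "0 < 2 * r'" "2 * r' < 4 * r'" using r'_pos by auto
  have hTh: "hol (polydisc (4 * r')) (\<Theta> bt)" for bt using Theta_holo by (simp add: holo_fun_iff_hol)
  obtain dT :: "'m list => (complex^'m) \<times> 'm cn => complex" and CT KT :: real
   where KT: "KT >= 0" and dT_hol: "!!bs. hol (pdisc2 (2 * r')) (dT bs)" and dT_Cons: "!!i bs x. dT (i # bs) x = ldv (dT bs) x (axis i 1,0)"
   and dT_bound: "!!bs x. x : pdisc2 (2 * r'/2) ==> cmod (dT bs x) <= CT * KT^length bs * fact (length bs)"
   and dT_Nil: "!!l t. dT [] (l,t) = (\<Sum>\<^sub>\<infinity>bt. mpow l bt * \<Theta> bt t)"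
   and dT_zero: "!!bs t. t : polydisc (2 * r') ==> dT bs (0,t) = (\<Prod>i\<in>UNIV. fact (count_list bs i)) * \<Theta> (count_list bs) t"
   and dT_taylor: "!!bs a t. t : polydisc (2 * r') ==> (!!i. cmod (vec_nth a i) < 2 * r'/4) ==>
   (%k. tl_sum (%bs. dT bs (a,t)) (vec_nth a) k bs/fact k) sums dT bs (0,t)"
   by (rule theta_package[OF r2 hTh Theta_normal[OF r2]]) blast
  have f_eq: "cnj (snd (f t)) = dT [] (cjv (fst (f t)),f t)" if "t : ht.M" for t
  proof -
   note m = M_in[OF that]
   have "h (Xi t) : M'" using bij m(2) by (auto simp: bij_betw_def)
   then have "H (Xi t) : M'" by (simp add: m(3))
   then show ?thesis using M'_eq[OF XiW(2)[OF m(1)]] by (simp add: f_def dT_Nil cjv_def)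
  qed
  \<comment> \<open>Along a curve in \<open>M\<close> with velocity \<open>v\<close>, applying the
    inverse coordinates and then \<open>G\<close> to \<open>f\<close> gives back \<open>Xi\<close>
    of the curve. A vanishing derivative of \<open>f\<close> thus makes the derivative of
    \<open>Xi\<close> along \<open>v\<close> vanish.\<close>
  have nondeg: "v = 0" if v: "fd (%t. sx (t,cj t)) 0 v = 0" and fv: "!!i. fd (%t. fst (f t) $ i) 0 v = 0" "fd (%t. snd (f t)) 0 v = 0" for v
  proof -
   obtain ga e where ga: "e > 0" "!!s. s : {-e<..<e} ==> ga s : ht.M" "ga 0 = 0" "(ga has_vector_derivative v) (at (0::real))"
    using ht.tangent_curve[OF M0 v] by blast
   have gad: "(ga has_derivative (%h. h *R v)) (at 0)" using ga(4) by (simp add: has_vector_derivative_def)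
   define f' where "f' v = ((\<chi> i. fd (%t. fst (f t) $ i) 0 v),fd (%t. snd (f t)) 0 v)" for v
   have f': "(f has_derivative f') (at 0)"
    by (rule has_derivative_cnI) (insert bsm_open(1)[OF ht.open_N bf(1) N0] bsm_open(1)[OF ht.open_N bf(2) N0], simp_all add: f'_def)
   have "f' v = 0" using fv by (simp add: f'_def prod_eq_iff vec_eq_iff)
   then have "f' (h *R v) = 0" for h using linear_scale[OF has_derivative_linear[OF f']] by simp
   moreover have "((%s. f (ga s)) has_derivative (%h. f' (h *R v))) (at 0)"
    by (rule has_derivative_compose[where f=ga and g=f]) (use gad ga(3) f' in simp_all)
   ultimately have fd0: "((%s. f (ga s)) has_derivative (%h. 0)) (at 0)" by simp
   have "f 0 : \<Phi> ` V'" using XiW(2)[OF N0] by (simp add: f_def)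
   from has_derivative_hol_comp[OF h\<Phi>i this] obtain I' where I': "(inv_into V' \<Phi> has_derivative I') (at (f 0))" by metis
   have if0: "inv_into V' \<Phi> (f t) = H (Xi t)" if "t : ht.N" for t
    unfolding f_def by (rule inv_into_f_f[OF inj\<Phi> XiW(2)[OF that]])
   have "((%s. inv_into V' \<Phi> (f (ga s))) has_derivative (%h. I' 0)) (at 0)"
    by (rule has_derivative_compose[where f="%s. f (ga s)" and g="inv_into V' \<Phi>", OF fd0]) (use I' ga(3) in simp)
   then have id0: "((%s. inv_into V' \<Phi> (f (ga s))) has_derivative (%h. 0)) (at 0)"
    using linear_0[OF has_derivative_linear[OF I']] by simp
   have GD: "(G has_derivative frechet_derivative G (at (h p))) (at (h p))" by (rule smooth_on_has_derivative[OF WG(3,2)])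
   have "((%s. G (inv_into V' \<Phi> (f (ga s)))) has_derivative (%h'. frechet_derivative G (at (h p)) 0)) (at 0)"
    by (rule has_derivative_compose[where f="%s. inv_into V' \<Phi> (f (ga s))" and g=G, OF id0]) (use GD ga(3) if0[OF N0] Xi0 Hp in simp)
   then have "((%s. G (inv_into V' \<Phi> (f (ga s)))) has_derivative (%h'. 0)) (at 0)"
    using linear_0[OF has_derivative_linear[OF GD]] by simp
   then have Xiga0: "((%s. Xi (ga s)) has_derivative (%h'. 0)) (at 0)"
   proof (rule has_derivative_transform_within_open)
    show "open {-e<..<e}" "0 : {-e<..<e}" using ga(1) by auto
    fix s assume "s : {-e<..<e}"
    then have "ga s : ht.M" by (rule ga(2))
    note m = M_in[OF this]
    have "h (Xi (ga s)) : M' Int W2" using bij m XiW(3)[OF m(1)] by (auto simp: bij_betw_def)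
    then have "G (h (Xi (ga s))) = inv_into M h (h (Xi (ga s)))" using WG(4) by blast
    also have "... = Xi (ga s)" using bij m(2) by (simp add: bij_betw_def)
    finally show "G (inv_into V' \<Phi> (f (ga s))) = Xi (ga s)" using if0[OF m(1)] m(3) by simp
   qed
   define Xi' where "Xi' = frechet_derivative Xi (at 0)"
   have Xi': "(Xi has_derivative Xi') (at 0)" unfolding Xi'_def by (rule hol_deriv(1)[OF hXi N0])
   have "((%s. Xi (ga s)) has_derivative (%h. Xi' (h *R v))) (at 0)"
    by (rule has_derivative_compose[where f=ga and g=Xi, OF gad]) (use ga(3) Xi' in simp)
   from fun_cong[OF has_derivative_unique[OF this Xiga0], of 1] have Xiv: "Xi' v = 0" by simp
   define Ps' where "Ps' = frechet_derivative Ps (at p)"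
   have Ps': "(Ps has_derivative Ps') (at p)" unfolding Ps'_def by (rule hol_deriv(1)[OF hPs V1(2)])
   have "((%x. Xi (Ps x)) has_derivative (%v. Xi' (Ps' v))) (at p)"
    by (rule has_derivative_compose[where f=Ps and g=Xi, OF Ps']) (use Psp Xi' in simp)
   moreover have "((%x. Xi (Ps x)) has_derivative (%v. v)) (at p)"
    by (rule has_derivative_transform_within_open[OF has_derivative_ident V1]) (use inv in metis)
   ultimately have "(%v. Xi' (Ps' v)) = (%v. v)" by (rule has_derivative_unique)
   \<comment> \<open>\<open>Ps\<close> is a local right inverse of \<open>Xi\<close>; equal
     dimensions turn surjectivity of the differential into injectivity.\<close>
   then have "surj Xi'" by (metis surj_def)
   then have "inj Xi'" by (intro linear_surjective_imp_injective[OF has_derivative_linear[OF Xi']]) simp_all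
   then show "v = 0" using Xiv linear_0[OF has_derivative_linear[OF Xi']] by (metis injD)
  qed
  have pos: "Re (ldv sx (0,0) ((0,\<i>),(0,- \<i>))) > 0"
  proof -
   have "fd (%t. sx (t,cj t)) 0 (0,\<i>) = ldv sx (0,0) ((0,\<i>),(0,- \<i>))"
    using fun_cong[OF frechet_derivative_at[OF fd_diag[OF cx N0]], of "(0,\<i>)"] by (simp add: cj_Pair)
   then show ?thesis using ht.rho_y'[OF N0] by (simp add: ht.ey_def)
  qed
  have sx0: "sx (0,0) = 0" using M0 by (simp add: ht.M_def)
  show ?thesis
  proof (rule leaf_coords[OF cx N0 sx0 ht.open_N pos])
   fix r s s2 c L X and Z :: "complex^'m => complex => complex"
   assume l0: "leaf0 ht.N sx r s s2 c L X Z"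
   interpret l0: leaf0 ht.N sx r s s2 c L X Z by (rule l0)
   have cf: "continuous_on ht.N f"
   proof -
    have "continuous_on ht.N (%t. \<Sum>i\<in>UNIV. axis i (fst (f t) $ i))"
     by (intro continuous_on_sum bounded_linear.continuous_on[OF bounded_linear_axis] bsm_continuous_on[OF bf(1)])
    then have "continuous_on ht.N (%t. fst (f t))" by (simp flip: vec_eq_sum_axis)
    then have "continuous_on ht.N (%t. (fst (f t),snd (f t)))" by (intro continuous_on_Pair bsm_continuous_on[OF bf(2)])
    then show ?thesis by simp
   qed
   have r4: "2 * r'/4 > 0" using r'_pos by simp
   obtain ef where ef: "ef > 0" "!!t. t : ht.N ==> norm t < ef ==> dist (f t) (f 0) < 2 * r'/4"
    by (rule cont_near[OF cf N0 r4]) blast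
   define s2' where "s2' = min s2 ef"
   have s2': "s2' > 0" "s2' <= s" "s2' <= s2" "s2' <= ef" using l0.s2 ef by (auto simp: s2'_def)
   have f_small: "(cjv (fst (f t)),f t) : pdisc2 (2 * r'/4)" if "t : ht.M" "norm t < s2'" for t
   proof -
    have "norm (f t) < 2 * r'/4" using ef(2)[OF M_in(1)[OF that(1)]] that(2) s2' f0 by simp
    then have "cmod (fst (f t) $ i) < 2 * r'/4" "cmod (snd (f t)) < 2 * r'/4" for i
     using norm_fst_le[of "fst (f t)" "snd (f t)"] norm_snd_le[of "snd (f t)" "fst (f t)"] Finite_Cartesian_Product.norm_nth_le[of "fst (f t)" i] by auto
    then show ?thesis by (simp add: pdisc2_def polydisc_def)
   qed
   have ZX': "(w,(cjv w,z)) : ball 0 r & cmod (X (w,(cjv w,z))) < s & Z w (X (w,(cjv w,z))) = z &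
     (sx ((w,z),cj (w,z)) = 0 --> Im (X (w,(cjv w,z))) = 0)" if "norm w < s2'" "cmod z < s2'" for w z
    by (rule l0.ZX) (use that s2' in auto)
   have f_eq': "cnj (snd (f t)) = dT [] (cjv (fst (f t)),f t)" if "t : ht.M" "norm t < s2'" for t
    by (rule f_eq[OF that(1)])
   have L0: "leaf0 ht.N sx r s s2' c L X Z"
    by (intro leaf0.intro) (fact l0.r l0.s l0.c s2'(1,2) l0.L l0.hX l0.X0 l0.qN l0.lip l0.hZ l0.XZ l0.sgnZ l0.ZM ZX' l0.Zcont)+
   have "leaf k R d d1 sx r s s2' c L X Z f F dT (2 * r') CT KT"
    by (intro leaf.intro[OF hat L0] leaf_axioms.intro)
     (fact crf F Ff f0 M0 f_eq' nondeg r2(1) KT dT_hol dT_Cons dT_bound dT_taylor f_small)+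
   then interpret lf: leaf k R d d1 sx r s s2' c L X Z f F dT "2 * r'" CT KT .
   obtain ep C K' where ep: "ep > 0" and C: "C >= 0" and K': "K' >= 0"
    and ext: "!!bs. EX ph. hol (ball 0 ep) ph & (ALL t:ht.M Int ball 0 ep. ph t = dT bs (0,f t)) &
     (ALL t:ball 0 ep. cmod (ph t) <= C * K'^length bs * fact (length bs))"
    by (rule lf.reflected_function_extends) blast
   define U where "U = V1 Int Ps -` ball 0 ep"
   have oU: "open U" unfolding U_def by (rule continuous_open_preimage[OF hol_continuous_on[OF hPs] V1(1) open_ball])
   have pU: "p : U" using V1(2) Psp ep by (simp add: U_def)
   \<comment> \<open>\<open>dT bs (0,.)\<close> is the coefficient times the product of factorials
     of the multi-index, while the bound carries the factorial of its length. The quotient of the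
     two is at most \<open>(2^CARD('m))^mlen bt\<close>, which is absorbed here.\<close>
   define C' where "C' = C+K' * 2^CARD('m)+1"
   have C': "C' >= 1" "C <= C'" "K' * 2^CARD('m) <= C'" using C K' by (auto simp: C'_def)
   have MU: "Ps t : ht.M" "f (Ps t) = \<Phi> (h t)" "h t : V'" if "t : M Int U" for t
   proof -
    have Pst: "Ps t : ht.N" "Xi (Ps t) = t" using inv that by (auto simp: U_def simp del: split_paired_All)
    then have "sx (Ps t,cj (Ps t)) = 0" using XiM that by (metis IntD1)
    then show m: "Ps t : ht.M" using Pst(1) by (simp add: ht.M_def)
    show "f (Ps t) = \<Phi> (h t)" using M_in(3)[OF m] by (simp add: f_def Pst)
    show "h t : V'" using M_in(3)[OF m] XiW(2)[OF Pst(1)] by (simp add: Pst)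
   qed
   have extbt: "EX ph. holo_fun U ph & (ALL t:M Int U. ph t = \<Theta> bt (\<Phi> (h t))) & (ALL t:U. cmod (ph t) <= C'^(mlen bt+1))" for bt
   proof -
    obtain bs :: "'m list" where bs: "count_list bs = bt" "length bs = mlen bt" by (rule list_with_count)
    obtain ph where ph: "hol (ball 0 ep) ph" "ALL t:ht.M Int ball 0 ep. ph t = dT bs (0,f t)"
     "ALL t:ball 0 ep. cmod (ph t) <= C * K'^length bs * fact (length bs)" using ext by blast
    define pf where "pf = (\<Prod>i\<in>UNIV. fact (bt i) :: real)"
    have pf: "pf > 0" by (auto simp: pf_def intro: prod_pos)
    have pfc: "(\<Prod>i\<in>UNIV. fact (bt i)) = complex_of_real pf" by (simp add: pf_def)
    show ?thesis
    proof (intro exI[of _ "%t. ph (Ps t) * inverse (of_real pf)"] conjI ballI)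
     have "hol U (%t. ph (Ps t))"
      by (rule hol_compose[OF ph(1) hol_subset[OF hPs oU]]) (auto simp: U_def simp del: split_paired_All)
     then show "holo_fun U (%t. ph (Ps t) * inverse (of_real pf))"
      unfolding holo_fun_iff_hol by (intro hol_mult hol_const oU)
     fix t assume t: "t : M Int U"
     have "\<Phi> (h t) : polydisc r'" using coords_small MU(3)[OF t] by blast
     then have "\<Phi> (h t) : polydisc (2 * r')"
     proof -
      have "x < r' ==> x < 2 * r'" for x using r'_pos by linarith
      then show "\<Phi> (h t) : polydisc r' ==> \<Phi> (h t) : polydisc (2 * r')" by (auto simp: polydisc_def)
     qed
     then have "dT bs (0,\<Phi> (h t)) = complex_of_real pf * \<Theta> bt (\<Phi> (h t))" using dT_zero[of "\<Phi> (h t)" bs] bs(1) pfc by simp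
     moreover have "ph (Ps t) = dT bs (0,\<Phi> (h t))" using ph(2) MU(1,2)[OF t] t by (auto simp: U_def)
     ultimately show "ph (Ps t) * inverse (of_real pf) = \<Theta> bt (\<Phi> (h t))" using pf by simp
    next
     fix t assume "t : U"
     then have "cmod (ph (Ps t)) <= C * K'^mlen bt * fact (mlen bt)" using ph(3) bs(2) by (auto simp: U_def)
     also have "... <= C * K'^mlen bt * ((2^CARD('m))^mlen bt * pf)"
      using fact_sum_le[of "UNIV :: 'm set" bt] C K' by (intro mult_left_mono) (auto simp: mlen_def pf_def)
     also have "... = C * (K' * 2^CARD('m))^mlen bt * pf" by (simp add: power_mult_distrib mult_ac)
     also have "... <= C' * C'^mlen bt * pf"
      using C C' K' pf by (intro mult_right_mono mult_mono power_mono) auto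
     finally have "cmod (ph (Ps t))/pf <= C' * C'^mlen bt" using pf by (simp add: pos_divide_le_eq)
     then show "cmod (ph (Ps t) * inverse (of_real pf)) <= C'^(mlen bt+1)"
      using pf by (simp add: norm_mult norm_inverse divide_inverse)
    qed
   qed
   show ?thesis
    by (intro exI[of _ U] exI[of _ C'] conjI allI extbt oU pU) (use C' MU(3) in auto)
  qed
 qed
qed

end
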